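(* Let $d\ge 2$, let $G$ be a finite reflection group on $\mathbb{R}^d$ with positive root system $R_+$ and nonnegative multiplicity function $\kappa$, and let $h_\kappa(x)=\prod_{v\in R_+}|\langle x,v\rangle|^{\kappa_v}$. Let $f\in W_2^1(\mathbb{S}^{d-1},h_\kappa^2)$ be invariant under $G$ and assume $\int_{\mathbb{S}^{d-1}} f(x)h_\kappa^2(x)\,d\sigma=0$ and $\|f\|_{L^2(\mathbb{S}^{d-1},h_\kappa^2)}=1$. Then $$\min_{1\le i\le d}\ \frac{1}{\omega_d^\kappa}\int_{\mathbb{S}^{d-1}}(1-x_i)|f(x)|^2h_\kappa^2(x)\,d\sigma\ \cdot\ \|\nabla_0 f\|_{L^2(\mathbb{S}^{d-1},h_\kappa^2)}^2\ \ge\ C_{\kappa,d},$$ where $$C_{\kappa,d}=2\lambda_\kappa\left(1-\frac{\sqrt{2\lambda_\kappa}}{\sqrt{(\lambda_\kappa+\frac12)^2+2\lambda_\kappa}}\right).$$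
   Context: Functions are real-valued. For nonzero $v\in\mathbb{R}^d$ the reflection along $v$ is $x\sigma_v:=x-2\langle x,v\rangle v/\|v\|^2$. $G$ is a finite reflection group on $\mathbb{R}^d$ with a fixed positive root system $R_+$, so $G$ is the subgroup of the orthogonal group generated by $\{\sigma_v:v\in R_+\}$. The multiplicity function $v\mapsto\kappa_v\ge 0$ on $R_+$ satisfies $\kappa_u=\kappa_v$ whenever $\sigma_u$ is conjugate to $\sigma_v$ in $G$. "Invariant under $G$" means $f(x\sigma_v)=f(x)$ for all $v\in R_+$. Put $\gamma_\kappa=\sum_{v\in R_+}\kappa_v$ and $\lambda_\kappa=\gamma_\kappa+\frac{d-2}{2}$. $d\sigma$ is the surface measure on the unit sphere $\mathbb{S}^{d-1}$ and $\omega_d^\kappa=\int_{\mathbb{S}^{d-1}}h_\kappa^2\,d\sigma$. The norm is normalized: $\|f\|_{L^2(\mathbb{S}^{d-1},h_\kappa^2)}=\left(\frac{1}{\omega_d^\kappa}\int_{\mathbb{S}^{d-1}}|f|^2h_\kappa^2\,d\sigma\right)^{1/2}$; for a vector-valued function, $|\cdot|$ is the Euclidean norm. $\nabla_0$ is the spherical gradient: $\nabla_0 f(\xi)$ is the gradient at $\xi\in\mathbb{S}^{d-1}$ of $x\mapsto f(x/\|x\|)$. The $h$-spherical gradient is $\nabla_{h,0}f(\xi)=\nabla_0f(\xi)+\sum_{v\in R_+}\kappa_v\frac{f(\xi)-f(\xi\sigma_v)}{\langle\xi,v\rangle}v$, and $W_2^1(\mathbb{S}^{d-1},h_\kappa^2)=\{f\in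 L^2(\mathbb{S}^{d-1},h_\kappa^2):\nabla_{h,0}f\in L^2(\mathbb{S}^{d-1},h_\kappa^2)\}$, with derivatives in the weak sense away from the hyperplanes $\langle x,v\rangle=0$, $v\in R_+$. (For $G$-invariant $f$, $\nabla_{h,0}f=\nabla_0f$.) *)

theory Defs
  imports "HOL-Analysis.Analysis"
begin

section \<open>Finite reflection groups\<close>

definition reflect :: "real^'d \<Rightarrow> real^'d \<Rightarrow> real^'d" where
  "reflect v x = x - (2 * (x \<bullet> v) / (norm v)\<^sup>2) *\<^sub>R v"

definition root_system :: "(real^'d) set \<Rightarrow> bool" where
  "root_system R \<longleftrightarrow>
     finite R \<and> 0 \<notin> R \<and>
     (\<forall>u\<in>R. \<forall>v\<in>R. reflect v u \<in> R) \<and>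
     (\<forall>v\<in>R. \<forall>c. c *\<^sub>R v \<in> R \<longrightarrow> c = 1 \<or> c = - 1)"

definition positive_root_system :: "(real^'d) set \<Rightarrow> bool" where
  "positive_root_system Rp \<longleftrightarrow>
     (\<exists>R w. root_system R \<and> (\<forall>v\<in>R. v \<bullet> w \<noteq> 0) \<and> Rp = {v \<in> R. v \<bullet> w > 0})"

text \<open>Reflections are involutions, so the monoid they generate is the group they generate.\<close>

inductive_set reflection_group :: "(real^'d) set \<Rightarrow> (real^'d \<Rightarrow> real^'d) set"
  for Rp :: "(real^'d) set" where
  one: "id \<in> reflection_group Rp"
| mult: "g \<in> reflection_group Rp \<Longrightarrow> v \<in> Rp \<Longrightarrow> reflect v \<circ> g \<in> reflection_group Rp"

definition multiplicity_function :: "(real^'d) set \<Rightarrow> (real^'d \<Rightarrow> real) \<Rightarrow> bool" where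
  "multiplicity_function Rp \<kappa> \<longleftrightarrow>
     (\<forall>v\<in>Rp. \<kappa> v \<ge> 0) \<and>
     (\<forall>u\<in>Rp. \<forall>v\<in>Rp.
        (\<exists>g\<in>reflection_group Rp. reflect u = g \<circ> reflect v \<circ> inv g) \<longrightarrow> \<kappa> u = \<kappa> v)"

definition gamma_k :: "(real^'d) set \<Rightarrow> (real^'d \<Rightarrow> real) \<Rightarrow> real" where
  "gamma_k Rp \<kappa> = (\<Sum>v\<in>Rp. \<kappa> v)"

definition lambda_k :: "(real^'d) set \<Rightarrow> (real^'d \<Rightarrow> real) \<Rightarrow> real" where
  "lambda_k Rp \<kappa> = gamma_k Rp \<kappa> + (real CARD('d) - 2) / 2"

text \<open>As \<^term>\<open>0 powr 0 = (0::real)\<close>, a factor with \<open>\<kappa> v = 0\<close> takes the value \<open>0\<close> instead of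
  \<open>1\<close> on the hyperplane orthogonal to \<open>v\<close>. This is a null set for the surface measure when
  the dimension is at least two.\<close>

definition h_weight :: "(real^'d) set \<Rightarrow> (real^'d \<Rightarrow> real) \<Rightarrow> real^'d \<Rightarrow> real" where
  "h_weight Rp \<kappa> x = (\<Prod>v\<in>Rp. \<bar>x \<bullet> v\<bar> powr \<kappa> v)"


section \<open>Weighted \<open>L\<^sup>2\<close> on the unit sphere\<close>

text \<open>Surface measure in polar coordinates: the measure of a Borel set \<open>A\<close> of the sphere is
  \<open>d\<close> times the Lebesgue measure of the cone \<open>{r a | a \<in> A, 0 < r < 1}\<close>. The space of this
  measure is the sphere itself.\<close>

definition surface_measure :: "(real^'d) measure" where
  "surface_measure =
     scale_measure (of_nat CARD('d))
       (distr (restrict_space lborel (ball 0 1 - {0})) (restrict_space borel (sphere 0 1))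
          (\<lambda>x. x /\<^sub>R norm x))"

lemma space_surface_measure: "space (surface_measure :: (real^'d) measure) = sphere 0 1"
  by (simp add: surface_measure_def space_scale_measure space_restrict_space)

lemma sets_surface_measure:
  "sets (surface_measure :: (real^'d) measure) = sets (restrict_space borel (sphere 0 1))"
  by (simp add: surface_measure_def)

lemma emeasure_surface_measure:
  assumes "A \<in> sets borel" "A \<subseteq> sphere 0 1"
  shows "emeasure (surface_measure :: (real^'d) measure) A =
    of_nat CARD('d) * emeasure lborel {x \<in> ball 0 1 - {0}. x /\<^sub>R norm x \<in> A}"
proof -
  have A: "A \<in> sets (restrict_space borel (sphere 0 1))"
    using assms by (auto simp: sets_restrict_space_iff)
  have m: "(\<lambda>x::real^'d. x /\<^sub>R norm x) \<in>
      measurable (restrict_space lborel (ball 0 1 - {0})) (restrict_space borel (sphere 0 1))"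
  proof (rule measurable_restrict_space2)
    show "(\<lambda>x::real^'d. x /\<^sub>R norm x) \<in>
        space (restrict_space lborel (ball 0 1 - {0})) \<rightarrow> sphere 0 1"
      by (simp add: space_restrict_space)
    show "(\<lambda>x::real^'d. x /\<^sub>R norm x) \<in> borel_measurable (restrict_space lborel (ball 0 1 - {0}))"
      by (rule measurable_restrict_space1) measurable
  qed
  have eq: "(\<lambda>x::real^'d. x /\<^sub>R norm x) -` A \<inter> space (restrict_space lborel (ball 0 1 - {0})) =
      {x \<in> ball 0 1 - {0}. x /\<^sub>R norm x \<in> A}"
    by (auto simp: space_restrict_space)
  have "emeasure (restrict_space lborel (ball 0 1 - {0})) {x \<in> ball 0 1 - {0::real^'d}. x /\<^sub>R norm x \<in> A}
      = emeasure lborel {x \<in> ball 0 1 - {0}. x /\<^sub>R norm x \<in> A}"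
    by (rule emeasure_restrict_space) auto
  then show ?thesis
    unfolding surface_measure_def emeasure_scale_measure emeasure_distr[OF m A] eq by simp
qed

definition omega_k :: "(real^'d) set \<Rightarrow> (real^'d \<Rightarrow> real) \<Rightarrow> real" where
  "omega_k Rp \<kappa> = (LINT \<xi>|surface_measure. (h_weight Rp \<kappa> \<xi>)\<^sup>2)"

definition L2_h :: "(real^'d) set \<Rightarrow> (real^'d \<Rightarrow> real) \<Rightarrow> (real^'d \<Rightarrow> 'b::euclidean_space) set" where
  "L2_h Rp \<kappa> = {f. f \<in> borel_measurable surface_measure \<and>
     integrable surface_measure (\<lambda>\<xi>. (norm (f \<xi>))\<^sup>2 * (h_weight Rp \<kappa> \<xi>)\<^sup>2)}"

definition norm_h ::
  "(real^'d) set \<Rightarrow> (real^'d \<Rightarrow> real) \<Rightarrow> (real^'d \<Rightarrow> 'b::euclidean_space) \<Rightarrow> real" where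
  "norm_h Rp \<kappa> f =
     sqrt (1 / omega_k Rp \<kappa> * (LINT \<xi>|surface_measure. (norm (f \<xi>))\<^sup>2 * (h_weight Rp \<kappa> \<xi>)\<^sup>2))"


section \<open>Weak gradients\<close>

definition partial_deriv :: "'d \<Rightarrow> (real^'d \<Rightarrow> real) \<Rightarrow> real^'d \<Rightarrow> real" where
  "partial_deriv i \<phi> x = frechet_derivative \<phi> (at x) (axis i 1)"

primrec k_smooth :: "nat \<Rightarrow> (real^'d \<Rightarrow> real) \<Rightarrow> bool" where
  "k_smooth 0 \<phi> \<longleftrightarrow> continuous_on UNIV \<phi>"
| "k_smooth (Suc k) \<phi> \<longleftrightarrow>
     (\<forall>x. \<phi> differentiable (at x)) \<and> (\<forall>i. k_smooth k (partial_deriv i \<phi>))"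

definition test_functions :: "(real^'d) set \<Rightarrow> (real^'d \<Rightarrow> real) set" where
  "test_functions \<Omega> = {\<phi>. (\<forall>k. k_smooth k \<phi>) \<and>
     compact (closure {x. \<phi> x \<noteq> 0}) \<and> closure {x. \<phi> x \<noteq> 0} \<subseteq> \<Omega>}"

definition weak_gradient_on ::
  "(real^'d) set \<Rightarrow> (real^'d \<Rightarrow> real) \<Rightarrow> (real^'d \<Rightarrow> real^'d) \<Rightarrow> bool" where
  "weak_gradient_on \<Omega> F G \<longleftrightarrow>
     (\<forall>K. compact K \<and> K \<subseteq> \<Omega> \<longrightarrow> set_integrable lborel K F \<and> set_integrable lborel K G) \<and>
     (\<forall>\<phi>\<in>test_functions \<Omega>. \<forall>i.
        (LINT x|lborel. F x * partial_deriv i \<phi> x) = - (LINT x|lborel. G x $ i * \<phi> x))"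

definition off_hyperplanes :: "(real^'d) set \<Rightarrow> (real^'d) set" where
  "off_hyperplanes Rp = {x. x \<noteq> 0 \<and> (\<forall>v\<in>Rp. x \<bullet> v \<noteq> 0)}"

text \<open>The spherical gradient of \<open>f\<close> is the restriction to the sphere of the gradient of
  \<open>x \<mapsto> f (x / \<parallel>x\<parallel>)\<close>. A weak gradient is determined only almost everywhere in
  the surrounding space, so restricting it to the sphere needs a choice of representative. As
  \<open>x \<mapsto> f (x / \<parallel>x\<parallel>)\<close> is homogeneous of degree \<open>0\<close>, its gradient is
  homogeneous of degree \<open>-1\<close>, that is, of the form \<open>x \<mapsto> g (x / \<parallel>x\<parallel>) / \<parallel>x\<parallel>\<close>
  with \<open>g\<close> the restriction in question.\<close>

definition has_weak_sph_gradient ::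
  "(real^'d) set \<Rightarrow> (real^'d \<Rightarrow> real) \<Rightarrow> (real^'d \<Rightarrow> real^'d) \<Rightarrow> bool" where
  "has_weak_sph_gradient Rp f g \<longleftrightarrow>
     g \<in> borel_measurable surface_measure \<and>
     weak_gradient_on (off_hyperplanes Rp)
       (\<lambda>x. f (x /\<^sub>R norm x)) (\<lambda>x. g (x /\<^sub>R norm x) /\<^sub>R norm x)"

text \<open>The choice is immaterial: weak gradients are unique up to null sets of the surface
  measure.\<close>

definition sph_gradient :: "(real^'d) set \<Rightarrow> (real^'d \<Rightarrow> real) \<Rightarrow> real^'d \<Rightarrow> real^'d" where
  "sph_gradient Rp f = (SOME g. has_weak_sph_gradient Rp f g)"

definition h_sph_gradient ::
  "(real^'d) set \<Rightarrow> (real^'d \<Rightarrow> real) \<Rightarrow> (real^'d \<Rightarrow> real) \<Rightarrow> real^'d \<Rightarrow> real^'d" where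
  "h_sph_gradient Rp \<kappa> f \<xi> =
     sph_gradient Rp f \<xi> + (\<Sum>v\<in>Rp. (\<kappa> v * ((f \<xi> - f (reflect v \<xi>)) / (\<xi> \<bullet> v))) *\<^sub>R v)"

definition sobolev_h :: "(real^'d) set \<Rightarrow> (real^'d \<Rightarrow> real) \<Rightarrow> (real^'d \<Rightarrow> real) set" where
  "sobolev_h Rp \<kappa> = {f. f \<in> L2_h Rp \<kappa> \<and>
     (\<exists>g. has_weak_sph_gradient Rp f g) \<and> h_sph_gradient Rp \<kappa> f \<in> L2_h Rp \<kappa>}"

text \<open>Elements of \<open>L\<^sup>2\<close> are classes modulo null sets, hence invariance almost everywhere.\<close>

definition G_invariant :: "(real^'d) set \<Rightarrow> (real^'d \<Rightarrow> real) \<Rightarrow> bool" where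
  "G_invariant Rp f \<longleftrightarrow> (\<forall>v\<in>Rp. AE \<xi> in surface_measure. f (reflect v \<xi>) = f \<xi>)"

definition C_const :: "(real^'d) set \<Rightarrow> (real^'d \<Rightarrow> real) \<Rightarrow> real" where
  "C_const Rp \<kappa> = (let l = lambda_k Rp \<kappa> in
     2 * l * (1 - sqrt (2 * l) / sqrt ((l + 1 / 2)\<^sup>2 + 2 * l)))"

end

theory Submission
  imports Defs "HOL-Real_Asymp.Real_Asymp"
begin

text \<open>Let \<open>l\<close> be \<open>\<lambda>\<^sub>\<kappa>\<close>, and let \<open>D\<close> and \<open>m\<close> be the normalized integrals of \<open>\<bar>\<nabla>\<^sub>0 f\<bar>\<^sup>2\<close> and of
  \<open>x\<^sub>i \<bar>f\<bar>\<^sup>2\<close> against \<open>h\<^sup>2\<close>. Two inequalities suffice: \<open>2 l \<le> D\<close> and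
  \<open>(l + 1/2)\<^sup>2 m\<^sup>2 \<le> D (1 - m\<^sup>2)\<close>; minimizing \<open>(1 - m) D\<close> under both gives the constant.

  For the first one, \<open>h\<^sup>2 exp (- \<bar>x\<bar>\<^sup>2 / 2)\<close> is log-concave with curvature at least \<open>1\<close> on each Weyl
  chamber, so the Prekopa-Leindler inequality yields a Poincare inequality with constant \<open>1\<close> there.
  By invariance an \<open>f\<close> of mean zero has mean zero on each chamber, and applying the inequality to
  \<open>\<bar>x\<bar>\<^sup>2 f (x / \<bar>x\<bar>)\<close> and integrating out the radius gives \<open>2 l \<le> D\<close>.

  For the second one, reflecting shows that \<open>\<langle>x, p\<rangle> f\<^sup>2\<close> has integral zero if \<open>p\<close> is a root. If \<open>p\<close> is
  orthogonal to all roots, then \<open>h\<close> is invariant under translation by \<open>p\<close>, and integration by parts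
  gives \<open>(2 l + 1) \<integral> \<langle>x, p\<rangle> f\<^sup>2 h\<^sup>2 = 2 \<integral> f \<langle>\<nabla>\<^sub>0 f, p\<rangle> h\<^sup>2\<close>. As the gradient is tangential, only the
  component of \<open>p\<close> orthogonal to \<open>x\<close>, of norm \<open>sqrt (\<bar>p\<bar>\<^sup>2 - \<langle>x, p\<rangle>\<^sup>2)\<close>, matters, and the
  Cauchy-Schwarz inequality applies.\<close>

section \<open>The Prekopa-Leindler inequality\<close>

text \<open>Nothing is known about \<open>f\<close> at the reflecting hyperplanes: its gradient is
  weak, is taken off the hyperplanes, and is square integrable only against a weight that may
  degenerate there. This shapes both inequalities. The Poincare inequality is proved on compact
  convex pieces inside an open chamber, where mollifications converge, and passes to the chamber by
  exhaustion, so no boundary condition and no eigenfunction expansion enters. Integration by parts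
  is done only along flows that respect the hyperplanes: dilations, which preserve cones, and
  translations orthogonal to all roots. A cutoff that is constant along such a flow is never
  differentiated and may be as rough as an indicator or a sign. Tangentiality of the gradient is not
  built into its definition; it is derived from the dilations in the form F (G \<bullet> x) = 0
  almost everywhere, which is all that the estimates use. As for the exponent 2 in |x|^2 f: a power
  a yields D \<ge> 2 l + 2 a - a^2, because the radial derivative costs a^2 and the Gaussian moments
  gain 2 l + 2 a. For a = 2 this is 2 l.\<close>

lemma emeasure_halve_translate:
  fixes A :: "real set"
  assumes [measurable]: "A \<in> sets borel"
  shows "emeasure lborel ((\<lambda>x. (x + t) / 2) ` A) = emeasure lborel A / 2"
    and "(\<lambda>x. (x + t) / 2) ` A \<in> sets borel"
proof -
  have eq: "(\<lambda>x. (x + t) / 2) ` A = (\<lambda>y. - t + 2 * y) -` A"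
    by (auto simp: field_simps image_iff intro!: bexI[of _ "- t + 2 * _"])
  show m: "(\<lambda>x. (x + t) / 2) ` A \<in> sets borel"
    unfolding eq using measurable_sets[of "\<lambda>y::real. - t + 2 * y" borel borel A] by simp
  have "emeasure lborel A = emeasure (density (distr lborel borel (\<lambda>x. - t + 2 * x)) (\<lambda>_. ennreal \<bar>2\<bar>)) A"
    using lborel_real_affine[of 2 "- t"] by simp
  also have "\<dots> = ennreal 2 * emeasure (distr lborel borel (\<lambda>x. - t + 2 * x)) A"
    by (subst emeasure_density_const) simp_all
  also have "\<dots> = 2 * emeasure lborel ((\<lambda>y. - t + 2 * y) -` A)"
    by (subst emeasure_distr) simp_all
  finally show "emeasure lborel ((\<lambda>x. (x + t) / 2) ` A) = emeasure lborel A / 2"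
    unfolding eq by (simp add: mult.commute[of 2] ennreal_mult_divide_eq)
qed

text \<open>Averaging \<open>A\<close> with a point \<open>b\<close> near the infimum of
  \<open>B\<close>, and \<open>B\<close> with a point \<open>a\<close> near the supremum of
  \<open>A\<close>, gives two subsets of \<open>C\<close> of half the measures of \<open>A\<close>
  and \<open>B\<close>. One lies to the left of (sup A + b) / 2, the other to the right of (a + inf
  B) / 2, so they overlap in an interval of length at most e / 2. Choosing near-extremal points
  makes compactness unnecessary.\<close>

lemma Brunn_Minkowski_midpoint_bounded:
  fixes A B C :: "real set"
  assumes [measurable]: "A \<in> sets borel" "B \<in> sets borel" "C \<in> sets borel"
    and ne: "A \<noteq> {}" "B \<noteq> {}" and bd: "bounded A" "bounded B"
    and mid: "\<And>a b. a \<in> A \<Longrightarrow> b \<in> B \<Longrightarrow> (a + b) / 2 \<in> C"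
  shows "emeasure lborel A + emeasure lborel B \<le> 2 * emeasure lborel C"
proof (rule ennreal_le_epsilon)
  fix e :: real assume e: "0 < e"
  define \<alpha> \<beta> where "\<alpha> = Sup A" and "\<beta> = Inf B"
  have bA: "bdd_above A" and bB: "bdd_below B"
    using bd bounded_imp_bdd_above bounded_imp_bdd_below by auto
  obtain a where a: "a \<in> A" "\<alpha> - e/2 < a"
    using less_cSupD[of A "\<alpha> - e/2"] ne e by (auto simp: \<alpha>_def)
  obtain b where b: "b \<in> B" "b < \<beta> + e/2"
    using cInf_lessD[of B "\<beta> + e/2"] ne e by (auto simp: \<beta>_def)
  let ?X = "(\<lambda>x. (x + b) / 2) ` A" and ?Y = "(\<lambda>x. (x + a) / 2) ` B"
  have [measurable]: "?X \<in> sets borel" "?Y \<in> sets borel"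
    by (auto intro: emeasure_halve_translate)
  have sub: "?X \<union> ?Y \<subseteq> C"
    using mid a b by (auto simp: add.commute[of _ a])
  have int: "?X \<inter> ?Y \<subseteq> {(a + \<beta>) / 2 .. (\<alpha> + b) / 2}"
    using cSup_upper[OF _ bA] cInf_lower[OF _ bB] unfolding \<alpha>_def \<beta>_def by fastforce
  have "emeasure lborel (?X \<inter> ?Y) \<le> emeasure lborel {(a + \<beta>) / 2 .. (\<alpha> + b) / 2}"
    by (rule emeasure_mono[OF int]) simp
  also have "\<dots> \<le> ennreal (e / 2)"
    using a b e by (auto simp: emeasure_lborel_Icc_eq field_simps intro!: ennreal_leI)
  finally have i: "emeasure lborel (?X \<inter> ?Y) \<le> ennreal (e / 2)" .
  have "emeasure lborel ?X + emeasure lborel ?Y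
      = emeasure lborel (?X \<union> ?Y) + emeasure lborel (?X \<inter> ?Y)"
    by (rule emeasure_Un_Int) simp_all
  also have "\<dots> \<le> emeasure lborel C + ennreal (e / 2)"
    using i emeasure_mono[OF sub, of lborel] by (intro add_mono) auto
  finally have "2 * (emeasure lborel ?X + emeasure lborel ?Y) \<le> 2 * (emeasure lborel C + ennreal (e / 2))"
    by (rule mult_left_mono) simp
  moreover have "2 * (x / 2) = x" for x :: ennreal
    by (simp add: ennreal_times_divide mult.commute[of 2] ennreal_mult_divide_eq)
  moreover have "2 * ennreal (e / 2) = ennreal e"
    using e by (metis ennreal_mult'' ennreal_numeral field_sum_of_halves mult_2 le_less zero_le_numeral half_gt_zero)
  ultimately show "emeasure lborel A + emeasure lborel B \<le> 2 * emeasure lborel C + ennreal e"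
    by (simp add: emeasure_halve_translate distrib_left)
qed

lemma Brunn_Minkowski_midpoint:
  fixes A B C :: "real set"
  assumes [measurable]: "A \<in> sets borel" "B \<in> sets borel" "C \<in> sets borel"
    and ne: "A \<noteq> {}" "B \<noteq> {}"
    and mid: "\<And>a b. a \<in> A \<Longrightarrow> b \<in> B \<Longrightarrow> (a + b) / 2 \<in> C"
  shows "emeasure lborel A + emeasure lborel B \<le> 2 * emeasure lborel C"
proof -
  have lim: "(\<lambda>n. emeasure lborel (S \<inter> {- real n .. real n})) \<longlonglongrightarrow> emeasure lborel S"
    if [measurable]: "S \<in> sets borel" for S
  proof -
    have "(\<lambda>n. emeasure lborel (S \<inter> {- real n .. real n})) \<longlonglongrightarrow> emeasure lborel (\<Union>n. S \<inter> {- real n .. real n})"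
      by (rule Lim_emeasure_incseq) (auto simp: incseq_def)
    also have "(\<Union>n. S \<inter> {- real n .. real n}) = S"
    proof -
      have "\<exists>n. x \<in> {- real n .. real n}" for x
        using real_arch_simple[of "\<bar>x\<bar>"] by (auto simp: abs_le_iff minus_le_iff)
      then show ?thesis by auto
    qed
    finally show ?thesis .
  qed
  \<comment> \<open>The bounded case requires nonempty sets, so only truncations large enough to
    contain these two points are used.\<close>
  obtain a b where ab: "a \<in> A" "b \<in> B" using ne by auto
  obtain N where N: "real N \<ge> max \<bar>a\<bar> \<bar>b\<bar>" using real_arch_simple by blast
  show ?thesis
  proof (rule LIMSEQ_le_const2)
    show "(\<lambda>n. emeasure lborel (A \<inter> {- real n .. real n}) + emeasure lborel (B \<inter> {- real n .. real n}))
        \<longlonglongrightarrow> emeasure lborel A + emeasure lborel B"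
      by (intro tendsto_add lim) simp_all
    show "\<exists>N. \<forall>n\<ge>N. emeasure lborel (A \<inter> {- real n .. real n}) + emeasure lborel (B \<inter> {- real n .. real n})
        \<le> 2 * emeasure lborel C"
    proof (intro exI allI impI)
      fix n assume n: "N \<le> n"
      then have "real N \<le> real n" by simp
      then have "a \<in> {- real n .. real n}" "b \<in> {- real n .. real n}"
        using N by (auto simp: abs_le_iff)
      with ab show "emeasure lborel (A \<inter> {- real n .. real n}) + emeasure lborel (B \<inter> {- real n .. real n})
        \<le> 2 * emeasure lborel C"
        by (intro Brunn_Minkowski_midpoint_bounded mid) (auto intro: bounded_subset[of "{- real n .. real n}"])
    qed
  qed
qed

text \<open>Tonelli applied to the region under the graph: a value v is the length of {s | 0 < s <
  v}, and this remains true for an infinite v. The levels are real numbers so that Lebesgue measure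
  can be used for them.\<close>

lemma nn_integral_layer_cake:
  assumes [measurable]: "f \<in> borel_measurable M" and "sigma_finite_measure M"
  shows "(\<integral>\<^sup>+x. f x \<partial>M) = (\<integral>\<^sup>+s. indicator {0<..} s * emeasure M {x \<in> space M. ennreal s < f x} \<partial>lborel)"
proof -
  interpret sigma_finite_measure M by fact
  interpret pair_sigma_finite M lborel ..
  have v: "v = (\<integral>\<^sup>+s. indicator {s. 0 < s \<and> ennreal s < v} s \<partial>lborel)" for v :: ennreal
  proof (cases v)
    case (real r)
    have eq: "{s. 0 < s \<and> ennreal s < v} = {0<..<r}"
      using real by (auto simp: ennreal_less_iff)
    show ?thesis unfolding eq using real by simp
  next
    case top
    have eq: "{s::real. 0 < s \<and> ennreal s < v} = {0<..}"
      using top by auto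
    have "emeasure lborel {0::real<..} = \<infinity>"
    proof (rule ccontr)
      assume "emeasure lborel {0::real<..} \<noteq> \<infinity>"
      then obtain r where r: "emeasure lborel {0::real<..} = ennreal r" "0 \<le> r"
        by (cases "emeasure lborel {0::real<..}") auto
      have "emeasure lborel {0::real<..<r+1} \<le> emeasure lborel {0::real<..}"
        by (rule emeasure_mono) auto
      then show False using r by (simp add: ennreal_le_iff)
    qed
    then show ?thesis unfolding eq using top by simp
  qed
  have "(\<integral>\<^sup>+x. f x \<partial>M) = (\<integral>\<^sup>+x. \<integral>\<^sup>+s. indicator {s. 0 < s \<and> ennreal s < f x} s \<partial>lborel \<partial>M)"
    by (subst v[symmetric]) rule
  also have "\<dots> = (\<integral>\<^sup>+x. \<integral>\<^sup>+s. indicator {p \<in> space (M \<Otimes>\<^sub>M lborel). 0 < snd p \<and> ennreal (snd p) < f (fst p)} (x, s) \<partial>lborel \<partial>M)"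
    by (intro nn_integral_cong) (auto simp: indicator_def space_pair_measure)
  also have "\<dots> = (\<integral>\<^sup>+s. \<integral>\<^sup>+x. indicator {p \<in> space (M \<Otimes>\<^sub>M lborel). 0 < snd p \<and> ennreal (snd p) < f (fst p)} (x, s) \<partial>M \<partial>lborel)"
    by (rule Fubini'[symmetric]) measurable
  also have "\<dots> = (\<integral>\<^sup>+s. \<integral>\<^sup>+x. indicator {0<..} s * indicator {x \<in> space M. ennreal s < f x} x \<partial>M \<partial>lborel)"
    by (intro nn_integral_cong) (auto simp: indicator_def space_pair_measure)
  also have "\<dots> = (\<integral>\<^sup>+s. indicator {0<..} s * emeasure M {x \<in> space M. ennreal s < f x} \<partial>lborel)"
    by (intro nn_integral_cong) (simp add: nn_integral_cmult)
  finally show ?thesis .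
qed

text \<open>The heights are measured relative to the suprema \<open>a\<close> and \<open>b\<close>.
  The superlevel sets of \<open>f\<close> at a s and of \<open>g\<close> at b s are then both
  nonempty for 0 < s < 1 and both empty for s \<ge> 1, so Brunn-Minkowski applies at every level
  that counts. The midpoints lie in the superlevel set of \<open>h\<close> at the geometric mean
  height c s. Integrating over s compares a sum with 2 Z; the product form follows from the
  inequality of arithmetic and geometric means.\<close>

lemma Prekopa_Leindler_bounded_1:
  fixes f g h :: "real \<Rightarrow> ennreal"
  assumes [measurable]: "f \<in> borel_measurable borel" "g \<in> borel_measurable borel" "h \<in> borel_measurable borel"
    and mid: "\<And>x y. f x * g y \<le> (h ((x + y) / 2))\<^sup>2"
    and bd: "(SUP x. f x) < \<infinity>" "(SUP x. g x) < \<infinity>"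
  shows "(\<integral>\<^sup>+x. f x \<partial>lborel) * (\<integral>\<^sup>+x. g x \<partial>lborel) \<le> (\<integral>\<^sup>+x. h x \<partial>lborel)\<^sup>2"
proof (cases "(SUP x. f x) = 0 \<or> (SUP x. g x) = 0")
  case True
  then have "(\<forall>x. f x = 0) \<or> (\<forall>x. g x = 0)"
    by (metis SUP_upper UNIV_I bot.extremum_uniqueI bot_ennreal)
  then show ?thesis by auto
next
  case False
  then obtain a b where a: "(SUP x. f x) = ennreal a" "0 < a" and b: "(SUP x. g x) = ennreal b" "0 < b"
    using bd by (cases "SUP x. f x"; cases "SUP x. g x") (auto simp: less_le)
  define c where "c = sqrt (a * b)"
  have c: "0 < c" "c\<^sup>2 = a * b" using a b by (auto simp: c_def)
  define L where "L u k s = emeasure lborel {x. ennreal (k * s) < u x}" for u :: "real \<Rightarrow> ennreal" and k s :: real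
  have scale: "(\<integral>\<^sup>+x. u x \<partial>lborel) = ennreal k * (\<integral>\<^sup>+s. indicator {0<..} s * L u k s \<partial>lborel)"
    if [measurable]: "u \<in> borel_measurable borel" and k: "0 < k" for u :: "real \<Rightarrow> ennreal" and k
  proof -
    have [measurable]: "(\<lambda>s. emeasure lborel {x. ennreal s < u x}) \<in> borel_measurable borel"
    proof -
      have "(\<lambda>s. emeasure lborel (Pair s -` {p \<in> space (borel \<Otimes>\<^sub>M lborel). ennreal (fst p) < u (snd p)})) \<in> borel_measurable borel"
        by (rule lborel.measurable_emeasure_Pair) measurable
      then show ?thesis by (simp add: space_pair_measure vimage_def)
    qed
    have "(\<integral>\<^sup>+x. u x \<partial>lborel) = (\<integral>\<^sup>+s. indicator {0<..} s * emeasure lborel {x. ennreal s < u x} \<partial>lborel)"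
      using nn_integral_layer_cake[of u lborel] by (simp add: sigma_finite_lborel)
    also have "\<dots> = ennreal k * (\<integral>\<^sup>+s. indicator {0<..} (0 + k * s) * emeasure lborel {x. ennreal (0 + k * s) < u x} \<partial>lborel)"
      using k by (subst nn_integral_real_affine[where c=k and t=0]) auto
    also have "(\<lambda>s. indicator {0<..} (0 + k * s) :: ennreal) = indicator {0<..}"
      using k by (auto simp: indicator_def fun_eq_iff zero_less_mult_iff)
    finally show ?thesis by (simp add: L_def)
  qed
  have step: "indicator {0<..} s * L f a s + indicator {0<..} s * L g b s \<le> 2 * (indicator {0<..} s * L h c s)" for s
  proof (cases "0 < s \<and> s < 1")
    case True
    have "ennreal (a * s) < (SUP x. f x)" "ennreal (b * s) < (SUP x. g x)"
      using True a b by (auto simp: ennreal_less_iff)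
    then have ne: "{x. ennreal (a * s) < f x} \<noteq> {}" "{x. ennreal (b * s) < g x} \<noteq> {}"
      by (auto simp: less_SUP_iff)
    have "L f a s + L g b s \<le> 2 * L h c s"
      unfolding L_def
    proof (rule Brunn_Minkowski_midpoint[OF _ _ _ ne])
      fix x y assume x: "x \<in> {x. ennreal (a * s) < f x}" and y: "y \<in> {x. ennreal (b * s) < g x}"
      have "(ennreal (c * s))\<^sup>2 = ennreal (a * s) * ennreal (b * s)"
        using c a b True by (simp add: ennreal_power ennreal_mult[symmetric] power_mult_distrib) (simp add: power2_eq_square mult_ac)
      also have "\<dots> < f x * g y"
      proof -
        have "ennreal (a * s) * ennreal (b * s) < f x * ennreal (b * s)"
          using x b True by (intro ennreal_mult_strict_right_mono) auto
        also have "\<dots> \<le> f x * g y"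
          using y by (intro mult_left_mono) auto
        finally show ?thesis .
      qed
      also have "\<dots> \<le> (h ((x + y) / 2))\<^sup>2" by (rule mid)
      finally show "(x + y) / 2 \<in> {x. ennreal (c * s) < h x}"
        by (metis (mono_tags) mem_Collect_eq not_less power_mono zero_le)
    qed measurable
    then show ?thesis using True by simp
  next
    case False
    \<comment> \<open>Above its supremum a function has no superlevel set. Without the normalization
      one of the two sets could be empty and the other not, and Brunn-Minkowski would say
      nothing.\<close>
    have "L f a s = 0 \<and> L g b s = 0" if "1 \<le> s"
    proof -
      have "f x \<le> ennreal (a * s)" for x
      proof -
        have "f x \<le> ennreal a" using a(1) by (metis SUP_upper UNIV_I)
        also have "\<dots> \<le> ennreal (a * s)" using that a by (intro ennreal_leI) simp
        finally show ?thesis .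
      qed
      moreover have "g x \<le> ennreal (b * s)" for x
      proof -
        have "g x \<le> ennreal b" using b(1) by (metis SUP_upper UNIV_I)
        also have "\<dots> \<le> ennreal (b * s)" using that b by (intro ennreal_leI) simp
        finally show ?thesis .
      qed
      ultimately show ?thesis unfolding L_def by (auto simp: not_less[symmetric])
    qed
    then show ?thesis using False by (auto simp: indicator_def)
  qed
  have [measurable]: "(\<lambda>s. L u k s) \<in> borel_measurable borel" if [measurable]: "u \<in> borel_measurable borel" for u k
  proof -
    have "(\<lambda>s. emeasure lborel (Pair s -` {p \<in> space (borel \<Otimes>\<^sub>M lborel). ennreal (k * fst p) < u (snd p)})) \<in> borel_measurable borel"
      by (rule lborel.measurable_emeasure_Pair) measurable
    then show ?thesis by (simp add: space_pair_measure vimage_def L_def)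
  qed
  define X Y Z where "X = (\<integral>\<^sup>+s. indicator {0<..} s * L f a s \<partial>lborel)"
    and "Y = (\<integral>\<^sup>+s. indicator {0<..} s * L g b s \<partial>lborel)"
    and "Z = (\<integral>\<^sup>+s. indicator {0<..} s * L h c s \<partial>lborel)"
  have "X + Y = (\<integral>\<^sup>+s. indicator {0<..} s * L f a s + indicator {0<..} s * L g b s \<partial>lborel)"
    unfolding X_def Y_def by (rule nn_integral_add[symmetric]) measurable
  also have "\<dots> \<le> (\<integral>\<^sup>+s. 2 * (indicator {0<..} s * L h c s) \<partial>lborel)"
    by (rule nn_integral_mono) (rule step)
  also have "\<dots> = 2 * Z"
    unfolding Z_def by (rule nn_integral_cmult) measurable
  finally have XYZ: "X + Y \<le> 2 * Z" .
  \<comment> \<open>From X + Y \<le> 2 Z and 4 X Y = (X + Y)^2 - (X - Y)^2.\<close>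
  have "X * Y \<le> Z\<^sup>2"
  proof (cases "Z = \<infinity>")
    case False
    then obtain z where z: "Z = ennreal z" "0 \<le> z" by (cases Z) auto
    have "2 * Z < \<infinity>" using z by (simp add: ennreal_mult_less_top)
    with XYZ have lt: "X + Y < \<infinity>" by (rule le_less_trans)
    then obtain x y where xy: "X = ennreal x" "0 \<le> x" "Y = ennreal y" "0 \<le> y"
      by (cases X; cases Y) auto
    have "2 * Z = ennreal (2 * z)" using z by (simp add: ennreal_mult)
    then have "x + y \<le> 2 * z"
      using XYZ xy z by (simp flip: ennreal_plus)
    then have "(x + y)\<^sup>2 \<le> (2 * z)\<^sup>2" using xy by (intro power_mono) auto
    moreover have "0 \<le> (x - y)\<^sup>2" by simp
    ultimately have "x * y \<le> z\<^sup>2" by (simp add: power2_eq_square algebra_simps)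
    then show ?thesis using xy z by (simp add: ennreal_power ennreal_mult[symmetric] ennreal_leI)
  qed simp
  then have "ennreal (c\<^sup>2) * (X * Y) \<le> ennreal (c\<^sup>2) * Z\<^sup>2" by (rule mult_left_mono) simp
  moreover have "ennreal (c\<^sup>2) = ennreal a * ennreal b" "ennreal (c\<^sup>2) = (ennreal c)\<^sup>2"
    using c a b by (simp_all add: ennreal_mult ennreal_power)
  moreover have "(ennreal a * X) * (ennreal b * Y) = (ennreal a * ennreal b) * (X * Y)"
    by (simp only: mult_ac)
  ultimately have "(ennreal a * X) * (ennreal b * Y) \<le> (ennreal c * Z)\<^sup>2"
    by (simp add: power_mult_distrib)
  then show ?thesis
    using a b c by (simp add: scale[of f a] scale[of g b] scale[of h c] X_def Y_def Z_def)
qed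

text \<open>Cutting \<open>f\<close> and \<open>g\<close> off at integer heights preserves the
  hypothesis with the same \<open>h\<close>, and monotone convergence removes the cutoffs.\<close>

lemma Prekopa_Leindler_1:
  fixes f g h :: "real \<Rightarrow> ennreal"
  assumes [measurable]: "f \<in> borel_measurable borel" "g \<in> borel_measurable borel" "h \<in> borel_measurable borel"
    and mid: "\<And>x y. f x * g y \<le> (h ((x + y) / 2))\<^sup>2"
  shows "(\<integral>\<^sup>+x. f x \<partial>lborel) * (\<integral>\<^sup>+x. g x \<partial>lborel) \<le> (\<integral>\<^sup>+x. h x \<partial>lborel)\<^sup>2"
proof -
  have lim: "(SUP n::nat. \<integral>\<^sup>+x. min (u x) (of_nat n) \<partial>lborel) = (\<integral>\<^sup>+x. u x \<partial>lborel)"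
    if [measurable]: "u \<in> borel_measurable borel" for u :: "real \<Rightarrow> ennreal"
  proof -
    have "(SUP n::nat. min (u x) (of_nat n)) = u x" for x
    proof (rule antisym)
      show "u x \<le> (SUP n::nat. min (u x) (of_nat n))"
      proof (cases "u x")
        case (real r)
        obtain n where "r \<le> real n" using real_arch_simple by blast
        then have "u x \<le> of_nat n"
          using real by (simp add: ennreal_of_nat_eq_real_of_nat ennreal_leI)
        then show ?thesis by (intro SUP_upper2[of n]) auto
      next
        case top
        then show ?thesis by (simp add: ennreal_SUP_of_nat_eq_top)
      qed
    qed (auto intro: SUP_least)
    moreover have "(\<integral>\<^sup>+x. (SUP n::nat. min (u x) (of_nat n)) \<partial>lborel) = (SUP n::nat. \<integral>\<^sup>+x. min (u x) (of_nat n) \<partial>lborel)"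
      by (rule nn_integral_monotone_convergence_SUP) (auto simp: incseq_def le_fun_def intro: min.coboundedI2)
    ultimately show ?thesis by simp
  qed
  have "(\<integral>\<^sup>+x. min (f x) (of_nat n) \<partial>lborel) * (\<integral>\<^sup>+x. min (g x) (of_nat m) \<partial>lborel) \<le> (\<integral>\<^sup>+x. h x \<partial>lborel)\<^sup>2" for n m :: nat
  proof (rule Prekopa_Leindler_bounded_1)
    fix x y
    show "min (f x) (of_nat n) * min (g y) (of_nat m) \<le> (h ((x + y) / 2))\<^sup>2"
      by (rule order_trans[OF mult_mono mid]) auto
  next
    have "(SUP x. min (f x) (of_nat n)) \<le> of_nat n" by (rule SUP_least) auto
    then show "(SUP x. min (f x) (of_nat n)) < \<infinity>" by (rule le_less_trans) (simp add: ennreal_of_nat_eq_real_of_nat)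
    have "(SUP x. min (g x) (of_nat m)) \<le> of_nat m" by (rule SUP_least) auto
    then show "(SUP x. min (g x) (of_nat m)) < \<infinity>" by (rule le_less_trans) (simp add: ennreal_of_nat_eq_real_of_nat)
  qed measurable
  then have "(SUP n::nat. \<integral>\<^sup>+x. min (f x) (of_nat n) \<partial>lborel) * (SUP n::nat. \<integral>\<^sup>+x. min (g x) (of_nat n) \<partial>lborel)
      \<le> (\<integral>\<^sup>+x. h x \<partial>lborel)\<^sup>2"
    by (simp add: SUP_mult_left_ennreal SUP_mult_right_ennreal SUP_le_iff)
  then show ?thesis by (simp add: lim)
qed

text \<open>Induction on the number of coordinates. For fixed values of the coordinates in
  \<open>I\<close>, the one-dimensional inequality along the new coordinate says that the fibre
  integrals of \<open>f\<close>, \<open>g\<close> and \<open>h\<close> satisfy the hypothesis of the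
  inequality over \<open>I\<close>. The points are extensional functions because the product measure
  lives on these.\<close>

lemma Prekopa_Leindler_PiM:
  fixes f g h :: "('i \<Rightarrow> real) \<Rightarrow> ennreal"
  assumes "finite I"
    and "f \<in> borel_measurable (\<Pi>\<^sub>M i\<in>I. lborel)" "g \<in> borel_measurable (\<Pi>\<^sub>M i\<in>I. lborel)"
      "h \<in> borel_measurable (\<Pi>\<^sub>M i\<in>I. lborel)"
    and "\<And>x y. x \<in> extensional I \<Longrightarrow> y \<in> extensional I \<Longrightarrow> f x * g y \<le> (h (\<lambda>i\<in>I. (x i + y i) / 2))\<^sup>2"
  shows "(\<integral>\<^sup>+x. f x \<partial>(\<Pi>\<^sub>M i\<in>I. lborel)) * (\<integral>\<^sup>+x. g x \<partial>(\<Pi>\<^sub>M i\<in>I. lborel)) \<le> (\<integral>\<^sup>+x. h x \<partial>(\<Pi>\<^sub>M i\<in>I. lborel))\<^sup>2"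
  using assms
proof (induction I arbitrary: f g h rule: finite_induct)
  case empty
  interpret product_sigma_finite "\<lambda>_. lborel :: real measure" ..
  show ?case
    using empty(4)[of "\<lambda>_. undefined" "\<lambda>_. undefined"]
    by (simp add: nn_integral_empty restrict_def)
next
  case (insert i I)
  interpret P: product_sigma_finite "\<lambda>_. lborel :: real measure" ..
  have [measurable]: "f \<in> borel_measurable (\<Pi>\<^sub>M i\<in>insert i I. lborel)" "g \<in> borel_measurable (\<Pi>\<^sub>M i\<in>insert i I. lborel)"
      "h \<in> borel_measurable (\<Pi>\<^sub>M i\<in>insert i I. lborel)"
    using insert by auto
  have [measurable]: "(\<lambda>p. u ((fst p)(i := snd p))) \<in> borel_measurable ((\<Pi>\<^sub>M i\<in>I. lborel) \<Otimes>\<^sub>M lborel)"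
    if [measurable]: "u \<in> borel_measurable (\<Pi>\<^sub>M i\<in>insert i I. lborel)" for u :: "('i \<Rightarrow> real) \<Rightarrow> ennreal"
    by measurable
  have mI: "(\<lambda>x. \<integral>\<^sup>+y. u (x(i := y)) \<partial>lborel) \<in> borel_measurable (\<Pi>\<^sub>M i\<in>I. lborel)"
    if [measurable]: "u \<in> borel_measurable (\<Pi>\<^sub>M i\<in>insert i I. lborel)" for u :: "('i \<Rightarrow> real) \<Rightarrow> ennreal"
    by (rule lborel.borel_measurable_nn_integral) (simp add: split_beta' that)
  have m1: "(\<lambda>y. u (x(i := y))) \<in> borel_measurable borel"
    if [measurable]: "u \<in> borel_measurable (\<Pi>\<^sub>M i\<in>insert i I. lborel)" and x: "x \<in> extensional I" for u :: "('i \<Rightarrow> real) \<Rightarrow> ennreal" and x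
  proof -
    have [measurable]: "x \<in> space (\<Pi>\<^sub>M i\<in>I. lborel)" using x by (simp add: space_PiM PiE_def)
    have "(\<lambda>y. u (x(i := y))) \<in> borel_measurable lborel" by measurable
    then show ?thesis by simp
  qed
  have "(\<integral>\<^sup>+x. \<integral>\<^sup>+y. f (x(i := y)) \<partial>lborel \<partial>(\<Pi>\<^sub>M i\<in>I. lborel)) * (\<integral>\<^sup>+x. \<integral>\<^sup>+y. g (x(i := y)) \<partial>lborel \<partial>(\<Pi>\<^sub>M i\<in>I. lborel))
    \<le> (\<integral>\<^sup>+x. \<integral>\<^sup>+y. h (x(i := y)) \<partial>lborel \<partial>(\<Pi>\<^sub>M i\<in>I. lborel))\<^sup>2"
  proof (rule insert.IH)
    fix x y :: "'i \<Rightarrow> real" assume x: "x \<in> extensional I" and y: "y \<in> extensional I"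
    show "(\<integral>\<^sup>+ s. f (x(i := s)) \<partial>lborel) * (\<integral>\<^sup>+ s. g (y(i := s)) \<partial>lborel)
       \<le> (\<integral>\<^sup>+ s. h ((\<lambda>i\<in>I. (x i + y i) / 2)(i := s)) \<partial>lborel)\<^sup>2"
    proof (rule Prekopa_Leindler_1)
      fix s t
      have eq: "(\<lambda>j\<in>insert i I. ((x(i := s)) j + (y(i := t)) j) / 2) = (\<lambda>i\<in>I. (x i + y i) / 2)(i := (s + t) / 2)"
        using insert(2) by (auto simp: fun_eq_iff)
      have "x(i := s) \<in> extensional (insert i I)" "y(i := t) \<in> extensional (insert i I)"
        using x y by (auto simp: extensional_def)
      from insert(7)[OF this]
      show "f (x(i := s)) * g (y(i := t)) \<le> (h ((\<lambda>i\<in>I. (x i + y i) / 2)(i := (s + t) / 2)))\<^sup>2"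
        unfolding eq .
    qed (use x y in \<open>auto intro!: m1\<close>)
  qed (rule mI; measurable)+
  then show ?case
    using insert(1,2) by (simp add: P.product_nn_integral_insert)
qed

text \<open>The hypothesis is the geometric mean condition at the midpoint, squared so that no roots
  of \<open>ennreal\<close> values occur. The proof reads Lebesgue measure as a product measure over
  the basis.\<close>

theorem Prekopa_Leindler_midpoint:
  fixes f g h :: "'a::euclidean_space \<Rightarrow> ennreal"
  assumes [measurable]: "f \<in> borel_measurable borel" "g \<in> borel_measurable borel" "h \<in> borel_measurable borel"
    and mid: "\<And>x y. f x * g y \<le> (h ((1/2) *\<^sub>R (x + y)))\<^sup>2"
  shows "(\<integral>\<^sup>+x. f x \<partial>lborel) * (\<integral>\<^sup>+x. g x \<partial>lborel) \<le> (\<integral>\<^sup>+x. h x \<partial>lborel)\<^sup>2"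
proof -
  have [measurable]: "(\<lambda>f. \<Sum>b\<in>Basis. f b *\<^sub>R b) \<in> (\<Pi>\<^sub>M b\<in>(Basis :: 'a set). lborel) \<rightarrow>\<^sub>M borel"
    by measurable
  have eq: "(\<integral>\<^sup>+x. u x \<partial>lborel) = (\<integral>\<^sup>+x. u (\<Sum>b\<in>Basis. x b *\<^sub>R b) \<partial>(\<Pi>\<^sub>M b\<in>(Basis :: 'a set). lborel))"
    if [measurable]: "u \<in> borel_measurable borel" for u :: "'a \<Rightarrow> ennreal"
    by (subst lborel_eq, subst nn_integral_distr) simp_all
  have mid': "(1/2) *\<^sub>R ((\<Sum>b\<in>Basis. x b *\<^sub>R b) + (\<Sum>b\<in>Basis. y b *\<^sub>R b)) = (\<Sum>b\<in>(Basis :: 'a set). (\<lambda>i\<in>Basis. (x i + y i) / 2) b *\<^sub>R b)"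
    for x y :: "'a \<Rightarrow> real"
    by (simp add: sum.distrib[symmetric] scaleR_sum_right scaleR_add_left[symmetric] del: scaleR_add_left)
  show ?thesis
    unfolding eq[OF assms(1)] eq[OF assms(2)] eq[OF assms(3)]
  proof (rule Prekopa_Leindler_PiM)
    fix x y :: "'a \<Rightarrow> real"
    show "f (\<Sum>b\<in>Basis. x b *\<^sub>R b) * g (\<Sum>b\<in>Basis. y b *\<^sub>R b)
       \<le> (h (\<Sum>b\<in>Basis. (\<lambda>i\<in>Basis. (x i + y i) / 2) b *\<^sub>R b))\<^sup>2"
      unfolding mid'[symmetric] by (rule mid)
  qed simp_all
qed

section \<open>Smooth bump functions\<close>

text \<open>The derivatives of the flat function \<open>s \<mapsto> exp (-1/s)\<close>, extended by \<open>0\<close> to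
  \<open>s \<le> 0\<close>, are \<open>P\<^sub>k(1/s) exp (-1/s)\<close> for polynomials \<open>P\<^sub>k\<close>.\<close>

fun flat_poly :: "nat \<Rightarrow> real poly" where
  "flat_poly 0 = 1"
| "flat_poly (Suc k) = [:0, 0, 1:] * (flat_poly k - pderiv (flat_poly k))"

definition flat :: "nat \<Rightarrow> real \<Rightarrow> real" where
  "flat k s = (if s \<le> 0 then 0 else poly (flat_poly k) (1 / s) * exp (- (1 / s)))"

lemma tendsto_poly_exp_neg: "((\<lambda>u. poly p u * exp (- u)) \<longlongrightarrow> (0::real)) at_top"
proof -
  have "(\<lambda>u. poly p u * exp (- u)) = (\<lambda>u. \<Sum>i\<le>degree p. coeff p i * (u ^ i / exp u))"
    by (simp add: fun_eq_iff poly_altdef sum_distrib_right exp_minus divide_inverse sum_distrib_left mult_ac)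
  moreover have "((\<lambda>u. \<Sum>i\<le>degree p. coeff p i * (u ^ i / exp u)) \<longlongrightarrow> (\<Sum>i\<le>degree p. coeff p i * 0)) at_top"
    by (intro tendsto_intros tendsto_power_div_exp_0)
  ultimately show ?thesis by simp
qed

text \<open>For s > 0 the derivative of P(1/s) exp(-1/s) is (1/s^2) (P - P')(1/s) exp(-1/s), which
  is the recursion of \<open>flat_poly\<close>. At s = 0 the right difference quotient is u P(u)
  exp(-u) with u = 1/s, and it tends to 0 as u grows.\<close>

lemma flat_has_derivative: "(flat k has_real_derivative flat (Suc k) s) (at s)"
proof -
  consider "s < 0" | "s > 0" | "s = 0" by linarith
  then show ?thesis
  proof cases
    case 1
    have "((\<lambda>_. 0::real) has_real_derivative 0) (at s)" by simp
    then have "(flat k has_real_derivative 0) (at s)"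
      by (rule DERIV_cong_ev[THEN iffD1, rotated -1])
         (use 1 eventually_nhds_in_open[of "{..<0}" s] in \<open>auto simp: flat_def elim!: eventually_mono\<close>)
    then show ?thesis using 1 by (simp add: flat_def)
  next
    case 2
    have "((\<lambda>s. poly (flat_poly k) (1 / s) * exp (- (1 / s))) has_real_derivative
       (poly (pderiv (flat_poly k)) (1 / s) * (- 1 / s\<^sup>2)) * exp (- (1 / s)) + poly (flat_poly k) (1 / s) * (exp (- (1 / s)) * (1 / s\<^sup>2))) (at s)"
      using 2 by (auto intro!: derivative_eq_intros poly_DERIV[THEN DERIV_chain2] simp: power2_eq_square)
    also have "(poly (pderiv (flat_poly k)) (1 / s) * (- 1 / s\<^sup>2)) * exp (- (1 / s)) + poly (flat_poly k) (1 / s) * (exp (- (1 / s)) * (1 / s\<^sup>2))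
      = flat (Suc k) s"
      using 2 by (simp add: flat_def power2_eq_square field_simps)
    finally show ?thesis
      by (rule DERIV_cong_ev[THEN iffD1, rotated -1])
         (use 2 eventually_nhds_in_open[of "{0<..}" s] in \<open>auto simp: flat_def elim!: eventually_mono\<close>)
  next
    case 3
    have "((\<lambda>h. flat k h / h) \<longlongrightarrow> 0) (at_right 0)"
    proof -
      have "((\<lambda>u. poly ([:0, 1:] * flat_poly k) u * exp (- u)) \<longlongrightarrow> 0) at_top"
        by (rule tendsto_poly_exp_neg)
      then have "((\<lambda>h. poly ([:0, 1:] * flat_poly k) (inverse h) * exp (- inverse h)) \<longlongrightarrow> 0) (at_right 0)"
        by (rule filterlim_compose[OF _ filterlim_inverse_at_top_right])
      then show ?thesis
        by (rule Lim_transform_eventually)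
           (use eventually_at_right_less[of "0::real"] in eventually_elim, simp add: flat_def inverse_eq_divide)
    qed
    moreover have "((\<lambda>h. flat k h / h) \<longlongrightarrow> 0) (at_left 0)"
      by (rule Lim_transform_eventually[OF tendsto_const])
         (auto simp: eventually_at_filter flat_def)
    ultimately have "((\<lambda>h. flat k h / h) \<longlongrightarrow> 0) (at 0)"
      by (simp add: filterlim_at_split)
    then show ?thesis using 3 by (simp add: DERIV_def flat_def)
  qed
qed

lemma flat_pos: "0 < s \<Longrightarrow> 0 < flat 0 s" and flat_nonneg: "0 \<le> flat 0 s" and flat_zero: "s \<le> 0 \<Longrightarrow> flat k s = 0"
  by (simp_all add: flat_def)

lemma continuous_on_flat: "continuous_on UNIV (flat k)"
  by (rule DERIV_continuous_on, rule flat_has_derivative[THEN has_field_derivative_at_within])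

section \<open>Closure properties of \<open>k_smooth\<close>\<close>

lemma k_smooth_SucD: "k_smooth (Suc k) \<phi> \<Longrightarrow> k_smooth k \<phi>"
proof (induction k arbitrary: \<phi>)
  case 0
  then show ?case
    by (auto simp: continuous_on_eq_continuous_at intro!: differentiable_imp_continuous_within)
qed auto

lemma partial_deriv_eq: "(f has_derivative f') (at x) \<Longrightarrow> partial_deriv i f x = f' (axis i 1)"
  unfolding partial_deriv_def using frechet_derivative_at by metis

lemma k_smooth_const: "k_smooth k (\<lambda>x :: real^'d. c)"
proof (induction k arbitrary: c)
  case (Suc k)
  have "partial_deriv i (\<lambda>x :: real^'d. c) = (\<lambda>x. 0)" for i and c :: real
    by (auto simp: fun_eq_iff intro!: partial_deriv_eq[THEN trans] derivative_intros)
  then show ?case using Suc by simp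
qed simp

lemma k_smooth_add: "k_smooth k f \<Longrightarrow> k_smooth k g \<Longrightarrow> k_smooth k (\<lambda>x. f x + g x)"
proof (induction k arbitrary: f g)
  case (Suc k)
  have "partial_deriv i (\<lambda>x. f x + g x) = (\<lambda>x. partial_deriv i f x + partial_deriv i g x)" for i
  proof
    fix x
    have "f differentiable (at x)" "g differentiable (at x)" using Suc.prems by auto
    then have "((\<lambda>x. f x + g x) has_derivative (\<lambda>h. frechet_derivative f (at x) h + frechet_derivative g (at x) h)) (at x)"
      by (intro has_derivative_add) (auto simp: frechet_derivative_works[symmetric])
    from partial_deriv_eq[OF this, of i]
    show "partial_deriv i (\<lambda>x. f x + g x) x = partial_deriv i f x + partial_deriv i g x"
      by (simp add: partial_deriv_def)
  qed
  then show ?case using Suc by simp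
qed (auto intro: continuous_intros)

lemma k_smooth_mult: "k_smooth k f \<Longrightarrow> k_smooth k g \<Longrightarrow> k_smooth k (\<lambda>x. f x * g x)"
proof (induction k arbitrary: f g)
  case (Suc k)
  have "partial_deriv i (\<lambda>x. f x * g x) = (\<lambda>x. f x * partial_deriv i g x + partial_deriv i f x * g x)" for i
  proof
    fix x
    have "f differentiable (at x)" "g differentiable (at x)" using Suc.prems by auto
    then have "((\<lambda>x. f x * g x) has_derivative (\<lambda>h. f x * frechet_derivative g (at x) h + frechet_derivative f (at x) h * g x)) (at x)"
      by (intro has_derivative_mult) (auto simp: frechet_derivative_works[symmetric])
    from partial_deriv_eq[OF this, of i]
    show "partial_deriv i (\<lambda>x. f x * g x) x = f x * partial_deriv i g x + partial_deriv i f x * g x"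
      by (simp add: partial_deriv_def)
  qed
  moreover have "k_smooth k f" "k_smooth k g" using Suc.prems k_smooth_SucD by auto
  ultimately show ?case using Suc by (auto intro!: k_smooth_add)
qed (auto intro: continuous_intros)

lemma k_smooth_linear:
  fixes a :: "real^'d"
  shows "k_smooth k (\<lambda>x. c + x \<bullet> a)"
proof (cases k)
  case (Suc m)
  have d: "((\<lambda>x. c + x \<bullet> a) has_derivative (\<lambda>h. h \<bullet> a)) (at x)" for x
    by (auto intro!: derivative_eq_intros)
  then have "partial_deriv i (\<lambda>x. c + x \<bullet> a) = (\<lambda>_. axis i 1 \<bullet> a)" for i
    by (auto simp: fun_eq_iff intro: partial_deriv_eq)
  then show ?thesis using d Suc by (auto simp: k_smooth_const differentiable_def)
qed (auto intro!: continuous_intros)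

text \<open>Differentiating raises the index of \<open>flat\<close> by one, so the induction on the
  order of smoothness has to range over all indices \<open>j\<close>.\<close>

lemma k_smooth_flat_compose:
  fixes q :: "real^'d \<Rightarrow> real"
  assumes "\<And>k. k_smooth k q" shows "k_smooth k (\<lambda>x. flat j (q x))"
proof (induction k arbitrary: j)
  case 0
  have "continuous_on UNIV q" using assms[of 0] by simp
  then show ?case using continuous_on_compose2[OF continuous_on_flat] by auto
next
  case (Suc k)
  have d: "((\<lambda>x. flat j (q x)) has_derivative (\<lambda>h. flat (Suc j) (q x) * frechet_derivative q (at x) h)) (at x)" for x
  proof -
    have "q differentiable (at x)" using assms[of 1] by auto
    then have "(q has_derivative frechet_derivative q (at x)) (at x)" by (simp add: frechet_derivative_works[symmetric])
    from has_derivative_compose[OF this, of "flat j"] flat_has_derivative[of j "q x"]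
    show ?thesis by (simp add: has_field_derivative_def)
  qed
  have "partial_deriv i (\<lambda>x. flat j (q x)) = (\<lambda>x. flat (Suc j) (q x) * partial_deriv i q x)" for i
    using partial_deriv_eq[OF d, of i] by (simp add: fun_eq_iff partial_deriv_def)
  moreover have "k_smooth k (partial_deriv i q)" for i using assms[of "Suc k"] by simp
  ultimately show ?case using d Suc by (auto simp: differentiable_def intro!: k_smooth_mult)
qed

lemma k_smooth_sum: "finite I \<Longrightarrow> (\<And>i. i \<in> I \<Longrightarrow> k_smooth k (f i)) \<Longrightarrow> k_smooth k (\<lambda>x. \<Sum>i\<in>I. f i x)"
  by (induction I rule: finite_induct) (auto intro: k_smooth_const k_smooth_add)

lemma k_smooth_dist_square:
  fixes x :: "real^'d"
  shows "k_smooth k (\<lambda>y. c - (x - y) \<bullet> (x - y))"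
proof -
  \<comment> \<open>The negative squared distance written as a sum of products of affine functions,
    the form to which the closure lemmas apply.\<close>
  have "(\<Sum>i\<in>UNIV. (- x $ i + y \<bullet> axis i 1) * (x $ i + y \<bullet> axis i (-1))) = - ((x - y) \<bullet> (x - y))" for y
    unfolding inner_vec_def[of "x - y"] sum_negf[symmetric]
    by (rule sum.cong) (auto simp: inner_axis algebra_simps)
  then have "(\<lambda>y. c - (x - y) \<bullet> (x - y)) = (\<lambda>y. c + (\<Sum>i\<in>UNIV. (- x $ i + y \<bullet> axis i 1) * (x $ i + y \<bullet> axis i (-1))))"
    by simp
  then show ?thesis
    by (simp only:) (intro k_smooth_add k_smooth_const k_smooth_sum k_smooth_mult k_smooth_linear finite)
qed

section \<open>Mollifiers\<close>

definition bump_mass :: "real^'d \<Rightarrow> real \<Rightarrow> real" where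
  "bump_mass _ e = (LINT y|(lborel :: (real^'d) measure). flat 0 (e\<^sup>2 - y \<bullet> y))"

text \<open>The standard mollifier supported in the closed ball of radius \<open>e\<close>. The
  inner function is a polynomial in \<open>y\<close> rather than a function of the norm, so that
  smoothness at the origin is automatic. The argument handed to \<open>bump_mass\<close> fixes the
  dimension in which the mass is computed.\<close>

definition bump :: "real \<Rightarrow> real^'d \<Rightarrow> real" where
  "bump e y = flat 0 (e\<^sup>2 - y \<bullet> y) / bump_mass y e"

lemma flat_ball_eq_0: "0 < e \<Longrightarrow> e \<le> norm y \<Longrightarrow> flat j (e\<^sup>2 - y \<bullet> y) = 0"
  by (rule flat_zero) (simp add: power_mono flip: power2_norm_eq_inner)

lemma continuous_on_flat_ball: "continuous_on UNIV (\<lambda>y :: real^'d. flat 0 (e\<^sup>2 - y \<bullet> y))"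
  by (rule continuous_on_compose2[OF continuous_on_flat]) (auto intro!: continuous_intros)

lemma integrable_continuous_compact_support:
  fixes f :: "'a::euclidean_space \<Rightarrow> 'b::{banach, second_countable_topology}"
  assumes "continuous_on UNIV f" "compact K" "\<And>x. x \<notin> K \<Longrightarrow> f x = 0"
  shows "integrable lborel f"
proof -
  have "integrable lborel (\<lambda>x. indicator K x *\<^sub>R f x)"
    using assms by (intro borel_integrable_compact) (auto intro: continuous_on_subset)
  moreover have "(\<lambda>x. indicator K x *\<^sub>R f x) = f"
    using assms(3) by (auto simp: fun_eq_iff indicator_def)
  ultimately show ?thesis by simp
qed

lemma bump_mass_pos:
  fixes y :: "real^'d"
  assumes "0 < e" shows "0 < bump_mass y e"
proof -
  have int: "integrable lborel (\<lambda>y :: real^'d. flat 0 (e\<^sup>2 - y \<bullet> y))"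
    by (rule integrable_continuous_compact_support[OF continuous_on_flat_ball compact_cball[of 0 e]])
       (use assms in \<open>auto intro!: flat_ball_eq_0\<close>)
  have "bump_mass y e \<noteq> 0"
  proof
    assume "bump_mass y e = 0"
    then have "AE y in lborel. flat 0 (e\<^sup>2 - (y :: real^'d) \<bullet> y) = 0"
      using integral_nonneg_eq_0_iff_AE[OF int] by (simp add: bump_mass_def flat_nonneg)
    moreover have "flat 0 (e\<^sup>2 - y \<bullet> y) \<noteq> 0" if "y \<in> ball 0 e" for y :: "real^'d"
      using flat_pos[of "e\<^sup>2 - y \<bullet> y"] that assms
      by (simp add: power_strict_mono flip: power2_norm_eq_inner)
    ultimately have "AE y in lborel. (y :: real^'d) \<notin> ball 0 e" by (auto elim: eventually_mono)
    then have "ball (0 :: real^'d) e \<in> null_sets lborel"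
      by (subst (asm) AE_iff_null_sets[symmetric]) auto
    then have "negligible (ball (0 :: real^'d) e)"
      by (simp add: negligible_iff_null_sets null_sets_completionI)
    then show False using assms open_not_negligible[of "ball (0 :: real^'d) e"] by auto
  qed
  moreover have "0 \<le> bump_mass y e" unfolding bump_mass_def by (simp add: flat_nonneg)
  ultimately show ?thesis by linarith
qed

lemma k_smooth_bump: "k_smooth k (\<lambda>y. bump e (x - y))"
proof -
  have "k_smooth k (\<lambda>y. (1 / bump_mass x e) * flat 0 (e\<^sup>2 - (x - y) \<bullet> (x - y)))"
    by (intro k_smooth_mult k_smooth_const k_smooth_flat_compose k_smooth_dist_square)
  moreover have "bump_mass (x - y) e = bump_mass x e" for y by (simp add: bump_mass_def)
  ultimately show ?thesis by (simp add: bump_def)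
qed

lemma bump_uminus: "bump e (- y) = bump e y"
  by (simp add: bump_def bump_mass_def)

lemma k_smooth_bump_self: "k_smooth k (bump e)"
  using k_smooth_bump[of k e 0] by (simp add: bump_uminus)

lemma bump_nonneg: "0 \<le> bump e y"
  by (auto simp: bump_def bump_mass_def flat_nonneg intro!: divide_nonneg_nonneg)

lemma bump_eq_0: "0 < e \<Longrightarrow> e \<le> norm y \<Longrightarrow> bump e y = 0"
  by (simp add: bump_def flat_ball_eq_0)

lemma continuous_on_bump: "continuous_on UNIV (bump e)"
  using k_smooth_bump_self[of 0] by simp

lemma integrable_bump: "0 < e \<Longrightarrow> integrable lborel (bump e)"
  by (rule integrable_continuous_compact_support[OF continuous_on_bump compact_cball[of 0 e]])
     (auto intro!: bump_eq_0)

lemma integral_bump: "0 < e \<Longrightarrow> (LINT y|lborel. bump e (y :: real^'d)) = 1"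
proof -
  assume e: "0 < e"
  have "(LINT y|lborel. bump e (y :: real^'d)) = (LINT y|lborel. flat 0 (e\<^sup>2 - (y :: real^'d) \<bullet> y) / bump_mass (0 :: real^'d) e)"
    by (simp add: bump_def bump_mass_def)
  also have "\<dots> = bump_mass (0 :: real^'d) e / bump_mass (0 :: real^'d) e"
    by (subst (2) bump_mass_def) simp
  finally show ?thesis using bump_mass_pos[OF e, of "0 :: real^'d"] by simp
qed

text \<open>Testing a weak gradient against this function produces the gradient of the mollification
  at \<open>x\<close>.\<close>

lemma bump_test_function:
  assumes "0 < e" "cball x e \<subseteq> \<Omega>"
  shows "(\<lambda>y. bump e (x - y)) \<in> test_functions \<Omega>"
proof -
  have "{y. bump e (x - y) \<noteq> 0} \<subseteq> cball x e"
    using bump_eq_0[OF assms(1)] by (force simp: dist_norm)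
  then have "closure {y. bump e (x - y) \<noteq> 0} \<subseteq> cball x e"
    by (rule closure_minimal) simp
  then show ?thesis
    using assms(2) k_smooth_bump
    by (auto simp: test_functions_def intro: bounded_subset[OF bounded_cball] simp: compact_eq_bounded_closed)
qed

definition grad_bump :: "real \<Rightarrow> real^'d \<Rightarrow> real^'d" where
  "grad_bump e y = (\<chi> i. partial_deriv i (bump e) y)"

lemma bump_has_derivative: "(bump e has_derivative (\<lambda>v. v \<bullet> grad_bump e y)) (at y)"
proof -
  have "bump e differentiable (at y)" using k_smooth_bump_self[of 1 e] by auto
  then have d: "(bump e has_derivative frechet_derivative (bump e) (at y)) (at y)"
    by (simp add: frechet_derivative_works[symmetric])
  then interpret bounded_linear "frechet_derivative (bump e) (at y)" by (rule has_derivative_bounded_linear)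
  have "frechet_derivative (bump e) (at y) v = v \<bullet> grad_bump e y" for v
  proof -
    have "frechet_derivative (bump e) (at y) v = frechet_derivative (bump e) (at y) (\<Sum>i\<in>UNIV. (v $ i) *\<^sub>R axis i 1)"
      using basis_expansion[of v] by (simp add: scalar_mult_eq_scaleR)
    also have "\<dots> = (\<Sum>i\<in>UNIV. v $ i * partial_deriv i (bump e) y)"
      by (simp add: sum scaleR partial_deriv_def)
    finally show ?thesis by (simp add: grad_bump_def inner_vec_def)
  qed
  then have "frechet_derivative (bump e) (at y) = (\<lambda>v. v \<bullet> grad_bump e y)" by (simp add: fun_eq_iff)
  then show ?thesis using d by simp
qed

lemma continuous_on_grad_bump: "continuous_on UNIV (grad_bump e)"
  unfolding grad_bump_def
  using k_smooth_bump_self[of 1 e] by (intro continuous_on_vec_lambda) auto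

lemma grad_bump_eq_0: "0 < e \<Longrightarrow> e < norm y \<Longrightarrow> grad_bump e y = 0"
proof -
  assume e: "0 < e" "e < norm y"
  have "((\<lambda>_. 0) has_derivative (\<lambda>_. 0)) (at y)" by simp
  then have "(bump e has_derivative (\<lambda>_. 0)) (at y)"
    by (rule has_derivative_transform_within_open[of _ _ _ _ "- cball 0 e"])
       (use e in \<open>auto simp: bump_eq_0 less_imp_le\<close>)
  from has_derivative_unique[OF bump_has_derivative this]
  have "v \<bullet> grad_bump e y = 0" for v by (simp add: fun_eq_iff)
  then show ?thesis using inner_eq_zero_iff by blast
qed

lemma partial_deriv_bump_shift: "partial_deriv i (\<lambda>y. bump e (x - y)) y = - grad_bump e (x - y) $ i"
proof -
  have "((\<lambda>y. bump e (x - y)) has_derivative (\<lambda>v. (- v) \<bullet> grad_bump e (x - y))) (at y)"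
    by (rule has_derivative_compose[OF _ bump_has_derivative]) (auto intro!: derivative_eq_intros)
  from partial_deriv_eq[OF this, of i] show ?thesis by (simp add: inner_axis' inner_commute)
qed

section \<open>A Poincare inequality for log-concave weights\<close>

lemma has_derivative_mvt_segment:
  fixes F :: "'a::euclidean_space \<Rightarrow> real"
  assumes "convex K" and "\<And>x. x \<in> K \<Longrightarrow> (F has_derivative (\<lambda>v. v \<bullet> G x)) (at x)"
    and "x \<in> K" "y \<in> K"
  obtains z where "z \<in> closed_segment x y" "F x - F y = (x - y) \<bullet> G z"
proof -
  have seg: "closed_segment y x \<subseteq> K"
    using assms by (simp add: closed_segment_subset)
  have pt: "y + t *\<^sub>R (x - y) \<in> closed_segment y x" if "0 \<le> t" "t \<le> 1" for t
    using that by (auto simp: closed_segment_def algebra_simps intro!: exI[of _ t])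
  have "((\<lambda>t. F (y + t *\<^sub>R (x - y))) has_derivative (\<lambda>s. (s *\<^sub>R (x - y)) \<bullet> G (y + t *\<^sub>R (x - y)))) (at t)"
    if "0 \<le> t" "t \<le> 1" for t
    by (rule has_derivative_compose[where f="\<lambda>t. y + t *\<^sub>R (x - y)" and f'="\<lambda>s. s *\<^sub>R (x - y)"])
       (use assms(2) seg pt that in \<open>auto intro!: derivative_eq_intros\<close>)
  then have "\<exists>t\<in>{0<..<1}. F (y + 1 *\<^sub>R (x - y)) - F (y + 0 *\<^sub>R (x - y)) = ((1 - 0) *\<^sub>R (x - y)) \<bullet> G (y + t *\<^sub>R (x - y))"
    by (intro mvt_simple) (auto intro: has_derivative_at_withinI)
  then obtain t where "t \<in> {0<..<1}" "F x - F y = (x - y) \<bullet> G (y + t *\<^sub>R (x - y))"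
    by auto
  then show ?thesis
    using that[of "y + t *\<^sub>R (x - y)"] pt[of t] by (simp add: closed_segment_commute)
qed

text \<open>The Poincare inequality compares coefficients of e^2. This bound serves the factors
  exp(\<plusminus> e F) on the smaller side, with an error of order e^3;
  \<open>exp_le_quadratic\<close> serves the larger side, whose exponent is already of order
  e^2.\<close>

lemma exp_ge_cubic:
  fixes s :: real assumes "\<bar>s\<bar> \<le> 1" shows "1 + s + s\<^sup>2 / 2 - \<bar>s\<bar> ^ 3 \<le> exp s"
proof -
  obtain t where t: "\<bar>t\<bar> \<le> \<bar>s\<bar>" "exp s = (\<Sum>m<3. s ^ m / fact m) + exp t / fact 3 * s ^ 3"
    using Maclaurin_exp_le[of s 3] by auto
  have "exp t \<le> 3"
    using t assms exp_le by (intro order_trans[OF _ exp_le]) auto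
  then have "\<bar>exp t / fact 3 * s ^ 3\<bar> \<le> 1 * \<bar>s\<bar> ^ 3"
    unfolding abs_mult power_abs by (intro mult_right_mono) (auto simp: fact_numeral)
  then show ?thesis using t(2) by (simp add: eval_nat_numeral)
qed

lemma exp_le_quadratic:
  fixes s :: real assumes "0 \<le> s" "s \<le> 1" shows "exp s \<le> 1 + s + s\<^sup>2"
  using exp_bound[of s] assms by simp

text \<open>Prekopa-Leindler for the weights perturbed by \<open>exp (\<plusminus> e F)\<close>: the gain
  \<open>exp (\<bar>x - y\<bar>\<^sup>2 / 4)\<close> absorbs the increment \<open>e (F x - F y)\<close> up to \<open>e\<^sup>2 \<bar>G\<bar>\<^sup>2\<close>. Comparing the
  coefficients of \<open>e\<^sup>2\<close> gives the Poincare inequality.\<close>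

lemma Poincare_centered_perturbation:
  fixes w F :: "'a::euclidean_space \<Rightarrow> real" and G :: "'a \<Rightarrow> 'a"
  assumes K: "compact K" "convex K"
    and w: "w \<in> borel_measurable borel" "\<And>x. x \<in> K \<Longrightarrow> 0 \<le> w x"
      "\<And>x y. x \<in> K \<Longrightarrow> y \<in> K \<Longrightarrow> w x * w y * exp ((norm (x - y))\<^sup>2 / 4) \<le> (w ((1/2) *\<^sub>R (x + y)))\<^sup>2"
    and F: "\<And>x. x \<in> K \<Longrightarrow> (F has_derivative (\<lambda>v. v \<bullet> G x)) (at x)"
    and [measurable]: "F \<in> borel_measurable borel"
    and G: "continuous_on UNIV G"
    and M: "\<And>x. x \<in> K \<Longrightarrow> \<bar>F x\<bar> \<le> M" and \<eta>: "0 < \<eta>"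
  shows "\<exists>e0>0. \<forall>e. 0 < e \<and> e \<le> e0 \<longrightarrow>
    (\<integral>\<^sup>+x. ennreal (indicator K x * w x * exp (e * F x)) \<partial>lborel) *
    (\<integral>\<^sup>+x. ennreal (indicator K x * w x * exp (- e * F x)) \<partial>lborel)
     \<le> (\<integral>\<^sup>+x. ennreal (indicator K x * w x * exp (e\<^sup>2 * ((norm (G x))\<^sup>2 + \<eta>) / 2)) \<partial>lborel)\<^sup>2"
proof -
  have [measurable]: "w \<in> borel_measurable borel" "G \<in> borel_measurable borel" "K \<in> sets borel"
    using w G K by (auto simp: borel_measurable_continuous_onI borel_closed compact_imp_closed)
  have "uniformly_continuous_on K (\<lambda>x. (norm (G x))\<^sup>2)"
    using K G by (intro compact_uniformly_continuous continuous_intros) (auto intro: continuous_on_subset)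
  then obtain d where d: "0 < d" "\<And>x y. x \<in> K \<Longrightarrow> y \<in> K \<Longrightarrow> dist y x < d \<Longrightarrow> dist ((norm (G y))\<^sup>2) ((norm (G x))\<^sup>2) < \<eta>"
    using \<eta> unfolding uniformly_continuous_on_def by metis
  \<comment> \<open>Chosen so that for points at distance at least d the increment e (F x - F y) is
    at most 2 e0 (|M| + 1) = (d/2)^2, hence at most (norm u)^2.\<close>
  define e0 where "e0 = d\<^sup>2 / (8 * (\<bar>M\<bar> + 1))"
  have "0 < e0" using d by (simp add: e0_def)
  moreover have "(\<integral>\<^sup>+x. ennreal (indicator K x * w x * exp (e * F x)) \<partial>lborel) *
    (\<integral>\<^sup>+x. ennreal (indicator K x * w x * exp (- e * F x)) \<partial>lborel)
     \<le> (\<integral>\<^sup>+x. ennreal (indicator K x * w x * exp (e\<^sup>2 * ((norm (G x))\<^sup>2 + \<eta>) / 2)) \<partial>lborel)\<^sup>2"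
    if e: "0 < e" "e \<le> e0" for e
  proof (rule Prekopa_Leindler_midpoint)
    fix x y :: 'a
    show "ennreal (indicator K x * w x * exp (e * F x)) * ennreal (indicator K y * w y * exp (- e * F y))
      \<le> (ennreal (indicator K ((1/2) *\<^sub>R (x + y)) * w ((1/2) *\<^sub>R (x + y)) * exp (e\<^sup>2 * ((norm (G ((1/2) *\<^sub>R (x + y))))\<^sup>2 + \<eta>) / 2)))\<^sup>2"
    proof (cases "x \<in> K \<and> y \<in> K")
      case True
      define z where "z = (1/2) *\<^sub>R (x + y)"
      have z: "z \<in> K"
        using convexD[OF K(2), of x y "1/2" "1/2"] True by (simp only: z_def scaleR_add_right)
      obtain p where p: "p \<in> closed_segment x y" "F x - F y = (x - y) \<bullet> G p"
        by (rule has_derivative_mvt_segment[OF K(2), of F G x y]) (use F True in auto)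
      have pK: "p \<in> K" using p True K closed_segment_subset by blast
      define u where "u = (x - y) /\<^sub>R 2"
      have nu: "(norm (x - y))\<^sup>2 / 4 = (norm u)\<^sup>2" by (simp add: u_def power_divide)
      \<comment> \<open>For close points F x - F y equals 2 (u \<bullet> G p) with \<open>p\<close>
        within distance d of the midpoint \<open>z\<close>; completing the square in u - e G p
        leaves e^2 |G p|^2, and uniform continuity replaces \<open>p\<close> by \<open>z\<close> at
        the cost of \<eta>. For distant points the choice of \<open>e0\<close> makes the left side
        nonpositive.\<close>
      have "e * (F x - F y) - (norm u)\<^sup>2 \<le> e\<^sup>2 * ((norm (G z))\<^sup>2 + \<eta>)"
      proof (cases "2 * norm u < d")
        case True
        have "dist p z < d"
        proof -
          obtain t where t: "0 \<le> t" "t \<le> 1" "p = (1 - t) *\<^sub>R x + t *\<^sub>R y"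
            using p(1) by (auto simp: closed_segment_def)
          have "p - z = (1/2 - t) *\<^sub>R (x - y)"
            by (simp add: t(3) z_def algebra_simps) (simp flip: scaleR_add_left)
          then have "dist p z = \<bar>1/2 - t\<bar> * norm (x - y)" by (simp add: dist_norm)
          also have "\<dots> \<le> 1 * norm (x - y)" using t by (intro mult_right_mono) (auto simp: abs_le_iff)
          finally have "dist p z \<le> norm (x - y)" by simp
          with True show ?thesis by (simp add: u_def)
        qed
        then have g: "(norm (G p))\<^sup>2 \<le> (norm (G z))\<^sup>2 + \<eta>"
          using d(2)[OF z pK] by (simp add: dist_real_def)
        have "0 \<le> (norm (u - e *\<^sub>R G p))\<^sup>2" by simp
        also have "\<dots> = (norm u)\<^sup>2 - 2 * e * (u \<bullet> G p) + e\<^sup>2 * (norm (G p))\<^sup>2"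
          by (simp only: power2_norm_eq_inner) (simp add: inner_diff inner_commute algebra_simps power2_eq_square)
        finally have "e * (F x - F y) - (norm u)\<^sup>2 \<le> e\<^sup>2 * (norm (G p))\<^sup>2"
          unfolding p(2) u_def by simp
        also have "\<dots> \<le> e\<^sup>2 * ((norm (G z))\<^sup>2 + \<eta>)" using g by (intro mult_left_mono) auto
        finally show ?thesis .
      next
        case False
        have "\<bar>F x\<bar> \<le> M" "\<bar>F y\<bar> \<le> M" using M True by auto
        then have "F x - F y \<le> 2 * (\<bar>M\<bar> + 1)" by (simp add: abs_if split: if_splits)
        then have "e * (F x - F y) \<le> e0 * (2 * (\<bar>M\<bar> + 1))"
          using e \<open>0 < e0\<close> by (smt (verit) mult_left_mono mult_right_mono)
        also have "\<dots> = (d / 2)\<^sup>2"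
          by (simp add: e0_def field_simps power2_eq_square)
        also have "\<dots> \<le> (norm u)\<^sup>2" using False d by (intro power_mono) auto
        finally have "e * (F x - F y) - (norm u)\<^sup>2 \<le> 0" by simp
        also have "0 \<le> e\<^sup>2 * ((norm (G z))\<^sup>2 + \<eta>)" using \<eta> by (intro mult_nonneg_nonneg add_nonneg_nonneg) auto
        finally show ?thesis .
      qed
      then have ex: "exp (e * F x) * exp (- e * F y) \<le> exp ((norm u)\<^sup>2) * exp (e\<^sup>2 * ((norm (G z))\<^sup>2 + \<eta>))"
        by (simp add: exp_add[symmetric] algebra_simps)
      have "w x * exp (e * F x) * (w y * exp (- e * F y)) = w x * w y * (exp (e * F x) * exp (- e * F y))"
        by (simp only: mult_ac)
      also have "\<dots> \<le> w x * w y * (exp ((norm u)\<^sup>2) * exp (e\<^sup>2 * ((norm (G z))\<^sup>2 + \<eta>)))"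
        using True w(2) by (intro mult_left_mono ex) auto
      also have "\<dots> = w x * w y * exp ((norm (x - y))\<^sup>2 / 4) * exp (e\<^sup>2 * ((norm (G z))\<^sup>2 + \<eta>))"
        unfolding nu by (simp only: mult_ac)
      also have "\<dots> \<le> (w z)\<^sup>2 * exp (e\<^sup>2 * ((norm (G z))\<^sup>2 + \<eta>))"
        using True w(3) by (intro mult_right_mono) (auto simp: z_def)
      also have "\<dots> = (w z * exp (e\<^sup>2 * ((norm (G z))\<^sup>2 + \<eta>) / 2))\<^sup>2"
        by (simp add: power_mult_distrib exp_double[symmetric])
      finally have "w x * exp (e * F x) * (w y * exp (- e * F y)) \<le> (w z * exp (e\<^sup>2 * ((norm (G z))\<^sup>2 + \<eta>) / 2))\<^sup>2" .
      then show ?thesis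
        using True z w(2) unfolding z_def[symmetric]
        by (simp add: ennreal_mult[symmetric] ennreal_power ennreal_leI)
    qed auto
  qed measurable
  ultimately show ?thesis by blast
qed

lemma nn_integral_le_cmult_real:
  fixes f g h :: "'a \<Rightarrow> real"
  assumes int: "integrable M f" "integrable M g" "integrable M h"
    and nn: "\<And>x. 0 \<le> f x" "\<And>x. 0 \<le> g x" "\<And>x. 0 \<le> h x"
    and le: "(\<integral>\<^sup>+x. ennreal (f x) \<partial>M) * (\<integral>\<^sup>+x. ennreal (g x) \<partial>M) \<le> (\<integral>\<^sup>+x. ennreal (h x) \<partial>M)\<^sup>2"
  shows "(LINT x|M. f x) * (LINT x|M. g x) \<le> (LINT x|M. h x)\<^sup>2"
  using le int nn
  by (simp add: nn_integral_eq_integral ennreal_mult[symmetric] ennreal_power ennreal_le_iff)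

lemma integrable_compact_weight:
  fixes w u :: "'a::euclidean_space \<Rightarrow> real"
  assumes K: "compact K" and w[measurable]: "w \<in> borel_measurable borel" and
    wb: "\<And>x. x \<in> K \<Longrightarrow> 0 \<le> w x" "\<And>x. x \<in> K \<Longrightarrow> w x \<le> Cw" and u: "continuous_on UNIV u"
  shows "integrable lborel (\<lambda>x. indicator K x * w x * u x)"
proof -
  have [measurable]: "K \<in> sets borel" using K by (simp add: borel_closed compact_imp_closed)
  have [measurable]: "u \<in> borel_measurable borel" using u by (rule borel_measurable_continuous_onI)
  have "bounded (u ` K)"
    using K u by (meson compact_continuous_image compact_imp_bounded continuous_on_subset subset_UNIV)
  then obtain B where B: "\<And>x. x \<in> K \<Longrightarrow> \<bar>u x\<bar> \<le> B" by (auto simp: bounded_iff)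
  have "integrable lborel (\<lambda>x. indicator K x * (\<bar>Cw\<bar> * \<bar>B\<bar>))"
    using K by (intro integrable_mult_left integrable_real_indicator) (simp_all add: emeasure_compact_finite[unfolded infinity_ennreal_def])
  then show ?thesis
  proof (rule Bochner_Integration.integrable_bound)
    show "AE x in lborel. norm (indicator K x * w x * u x) \<le> norm (indicator K x * (\<bar>Cw\<bar> * \<bar>B\<bar>))"
    proof (intro AE_I2)
      fix x
      show "norm (indicator K x * w x * u x) \<le> norm (indicator K x * (\<bar>Cw\<bar> * \<bar>B\<bar>))"
      proof (cases "x \<in> K")
        case True
        then have "\<bar>w x\<bar> \<le> \<bar>Cw\<bar>" "\<bar>u x\<bar> \<le> \<bar>B\<bar>" using wb B by fastforce+
        then show ?thesis using True by (simp add: abs_mult mult_mono)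
      qed simp
    qed
  qed simp
qed

text \<open>Expand the perturbed Prekopa-Leindler inequality in e. As \<open>F\<close> has mean
  zero, both factors on the left are at least W + e^2 A / 2 - O(e^3), while the integral on the
  right is at most W + e^2 (D + \<eta> W) / 2 + O(e^4). Taking square roots, cancelling W, dividing
  by e^2 / 2 and letting e tend to 0 gives A \<le> D + \<eta> W.\<close>

lemma Poincare_compact_centered:
  fixes w F :: "'a::euclidean_space \<Rightarrow> real" and G :: "'a \<Rightarrow> 'a"
  assumes K: "compact K" "convex K"
    and w: "w \<in> borel_measurable borel" "\<And>x. x \<in> K \<Longrightarrow> 0 \<le> w x" "\<And>x. x \<in> K \<Longrightarrow> w x \<le> Cw"
      "\<And>x y. x \<in> K \<Longrightarrow> y \<in> K \<Longrightarrow> w x * w y * exp ((norm (x - y))\<^sup>2 / 4) \<le> (w ((1/2) *\<^sub>R (x + y)))\<^sup>2"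
    and F: "\<And>x. (F has_derivative (\<lambda>v. v \<bullet> G x)) (at x)" and G: "continuous_on UNIV G"
    and mean: "(LINT x|lborel. indicator K x * w x * F x) = 0"
  shows "(LINT x|lborel. indicator K x * w x * (F x)\<^sup>2) \<le> (LINT x|lborel. indicator K x * w x * (norm (G x))\<^sup>2)"
proof (rule field_le_epsilon)
  fix \<eta>' :: real assume \<eta>': "0 < \<eta>'"
  have Fc: "continuous_on UNIV F"
    by (rule has_derivative_continuous_on[OF has_derivative_at_withinI[OF F]])
  have [measurable]: "w \<in> borel_measurable borel" "G \<in> borel_measurable borel" "K \<in> sets borel" "F \<in> borel_measurable borel"
    using w G K Fc by (auto simp: borel_measurable_continuous_onI borel_closed compact_imp_closed)
  have int: "integrable lborel (\<lambda>x. indicator K x * w x * u x)" if "continuous_on UNIV u" for u :: "'a \<Rightarrow> real"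
    by (rule integrable_compact_weight[OF K(1)]) (use w that in auto)
  define W where "W = (LINT x|lborel. indicator K x * w x)"
  have Wi: "integrable lborel (\<lambda>x. indicator K x * w x)" using int[of "\<lambda>_. 1"] by simp
  have W0: "0 \<le> W" unfolding W_def using w by (intro integral_nonneg_AE AE_I2) (auto simp: indicator_def)
  \<comment> \<open>The denominator W + 1 instead of W allows a weight without mass.\<close>
  define \<eta> where "\<eta> = \<eta>' / (W + 1)"
  have \<eta>: "0 < \<eta>" "\<eta> * W \<le> \<eta>'"
    using \<eta>' W0 by (auto simp: \<eta>_def field_simps)
  have "bounded (F ` K)" "bounded (G ` K)"
    using K Fc G by (meson compact_continuous_image compact_imp_bounded continuous_on_subset subset_UNIV)+
  then obtain M N where M: "\<And>x. x \<in> K \<Longrightarrow> \<bar>F x\<bar> \<le> M" and N: "\<And>x. x \<in> K \<Longrightarrow> norm (G x) \<le> N"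
    unfolding bounded_iff by auto
  define M1 where "M1 = \<bar>M\<bar> + 1"
  define N1 where "N1 = (N\<^sup>2 + \<eta>) / 2 + 1"
  have M1: "\<bar>F x\<bar> \<le> M1" "0 < M1" if "x \<in> K" for x using M[OF that] by (auto simp: M1_def)
  have N1: "((norm (G x))\<^sup>2 + \<eta>) / 2 \<le> N1" if "x \<in> K" for x
    using power_mono[OF N[OF that], of 2] by (simp add: N1_def divide_right_mono add_increasing2)
  have N1pos: "1 \<le> N1" using \<eta> by (simp add: N1_def)
  have M1pos: "1 \<le> M1" by (simp add: M1_def)
  obtain e0 where e0: "e0 > 0" "\<And>e. 0 < e \<Longrightarrow> e \<le> e0 \<Longrightarrow>
    (\<integral>\<^sup>+x. ennreal (indicator K x * w x * exp (e * F x)) \<partial>lborel) *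
    (\<integral>\<^sup>+x. ennreal (indicator K x * w x * exp (- e * F x)) \<partial>lborel)
     \<le> (\<integral>\<^sup>+x. ennreal (indicator K x * w x * exp (e\<^sup>2 * ((norm (G x))\<^sup>2 + \<eta>) / 2)) \<partial>lborel)\<^sup>2"
    using Poincare_centered_perturbation[OF K w(1,2,4) F _ G M \<eta>(1)] by auto
  define A D where "A = (LINT x|lborel. indicator K x * w x * (F x)\<^sup>2)"
    and "D = (LINT x|lborel. indicator K x * w x * (norm (G x))\<^sup>2)"
  define e1 where "e1 = min e0 (min 1 (min (1 / M1) (1 / N1)))"
  have e1: "0 < e1" using e0 N1pos M1pos by (simp add: e1_def)
  \<comment> \<open>The third condition on e makes the common lower bound of the two left factors
    nonnegative. This is needed to multiply the lower bounds and to pass from squares back to the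
    bases.\<close>
  have main: "A \<le> D + \<eta> * W + e * (2 * M1^3 * W + 2 * N1\<^sup>2 * W)" if e: "0 < e" "e \<le> e1" "e * M1 ^ 3 * e\<^sup>2 * W \<le> W" for e
  proof -
    have eb: "e \<le> e0" "e \<le> 1" "e * M1 \<le> 1" "e * N1 \<le> 1"
      using e M1pos N1pos by (auto simp: e1_def field_simps)
    let ?E = "\<lambda>e. (LINT x|lborel. indicator K x * w x * exp (e * F x))"
    let ?R = "(LINT x|lborel. indicator K x * w x * exp (e\<^sup>2 * ((norm (G x))\<^sup>2 + \<eta>) / 2))"
    have ce: "continuous_on UNIV (\<lambda>x. exp (c * F x))" for c by (intro continuous_intros Fc)
    have cG: "continuous_on UNIV (\<lambda>x. exp (e\<^sup>2 * ((norm (G x))\<^sup>2 + \<eta>) / 2))" by (intro continuous_intros G) auto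
    have PL: "?E e * ?E (- e) \<le> ?R\<^sup>2"
      using e0(2)[OF e(1) eb(1)]
      by (intro nn_integral_le_cmult_real int ce cG) (use w(2) in \<open>auto simp: indicator_def\<close>)
    have lower: "W + e\<^sup>2 / 2 * A - e ^ 3 * M1 ^ 3 * W \<le> ?E c" if c: "c = e \<or> c = - e" for c
    proof -
      have "W + e\<^sup>2 / 2 * A - e ^ 3 * M1 ^ 3 * W =
         (LINT x|lborel. indicator K x * w x * (1 + c * F x + e\<^sup>2 / 2 * (F x)\<^sup>2 - e ^ 3 * M1 ^ 3))"
      proof -
        have "(LINT x|lborel. indicator K x * w x * (1 + c * F x + e\<^sup>2 / 2 * (F x)\<^sup>2 - e ^ 3 * M1 ^ 3))
          = (LINT x|lborel. indicator K x * w x + c * (indicator K x * w x * F x)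
             + e\<^sup>2 / 2 * (indicator K x * w x * (F x)\<^sup>2) - e ^ 3 * M1 ^ 3 * (indicator K x * w x))"
          by (intro Bochner_Integration.integral_cong) (auto simp: algebra_simps)
        also have "\<dots> = W + c * 0 + e\<^sup>2 / 2 * A - e ^ 3 * M1 ^ 3 * W"
          unfolding W_def A_def mean[symmetric]
          using Wi int[OF Fc] int[of "\<lambda>x. (F x)\<^sup>2"] Fc by (simp add: continuous_on_power)
        finally show ?thesis by simp
      qed
      also have "\<dots> \<le> ?E c"
      proof (rule integral_mono)
        fix x
        show "indicator K x * w x * (1 + c * F x + e\<^sup>2 / 2 * (F x)\<^sup>2 - e ^ 3 * M1 ^ 3) \<le> indicator K x * w x * exp (c * F x)"
        proof (cases "x \<in> K")
          case True
          have cF: "\<bar>c * F x\<bar> \<le> e * M1" using c M1[OF True] e by (auto simp: abs_mult)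
          then have "1 + c * F x + (c * F x)\<^sup>2 / 2 - \<bar>c * F x\<bar> ^ 3 \<le> exp (c * F x)"
            using eb by (intro exp_ge_cubic) auto
          moreover have "\<bar>c * F x\<bar> ^ 3 \<le> (e * M1) ^ 3" using cF by (intro power_mono) auto
          moreover have "(c * F x)\<^sup>2 / 2 = e\<^sup>2 / 2 * (F x)\<^sup>2" using c by (auto simp: power_mult_distrib)
          ultimately have "1 + c * F x + e\<^sup>2 / 2 * (F x)\<^sup>2 - e ^ 3 * M1 ^ 3 \<le> exp (c * F x)"
            unfolding power_mult_distrib[of e M1] by linarith
          then show ?thesis using True w(2) by (simp add: mult_left_mono)
        qed simp
      qed (intro int continuous_intros Fc)+
      finally show ?thesis .
    qed
    have upper: "?R \<le> W + e\<^sup>2 / 2 * D + e\<^sup>2 / 2 * \<eta> * W + e ^ 4 * N1\<^sup>2 * W"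
    proof -
      have "?R \<le> (LINT x|lborel. indicator K x * w x * (1 + e\<^sup>2 / 2 * (norm (G x))\<^sup>2 + e\<^sup>2 / 2 * \<eta> + e ^ 4 * N1\<^sup>2))"
      proof (rule integral_mono)
        fix x
        show "indicator K x * w x * exp (e\<^sup>2 * ((norm (G x))\<^sup>2 + \<eta>) / 2) \<le>
          indicator K x * w x * (1 + e\<^sup>2 / 2 * (norm (G x))\<^sup>2 + e\<^sup>2 / 2 * \<eta> + e ^ 4 * N1\<^sup>2)"
        proof (cases "x \<in> K")
          case True
          define q where "q = ((norm (G x))\<^sup>2 + \<eta>) / 2"
          have q: "0 \<le> q" "q \<le> N1" using N1[OF True] \<eta> by (auto simp: q_def)
          have "e\<^sup>2 * q \<le> e * (e * N1)" using q e by (simp add: power2_eq_square mult_left_mono)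
          also have "\<dots> \<le> 1 * 1" using eb e N1pos by (intro mult_mono) auto
          finally have "exp (e\<^sup>2 * q) \<le> 1 + e\<^sup>2 * q + (e\<^sup>2 * q)\<^sup>2"
            using q by (intro exp_le_quadratic) auto
          also have "(e\<^sup>2 * q)\<^sup>2 \<le> e ^ 4 * N1\<^sup>2"
            using q by (simp add: power_mult_distrib mult_left_mono power_mono flip: power_mult)
          finally have "exp (e\<^sup>2 * q) \<le> 1 + e\<^sup>2 / 2 * (norm (G x))\<^sup>2 + e\<^sup>2 / 2 * \<eta> + e ^ 4 * N1\<^sup>2"
            by (simp add: q_def algebra_simps add_divide_distrib)
          then show ?thesis using True w(2) by (simp add: mult_left_mono q_def)
        qed simp
      qed (intro int continuous_intros G cG | simp)+
      also have "\<dots> = (LINT x|lborel. indicator K x * w x + e\<^sup>2 / 2 * (indicator K x * w x * (norm (G x))\<^sup>2)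
             + e\<^sup>2 / 2 * \<eta> * (indicator K x * w x) + e ^ 4 * N1\<^sup>2 * (indicator K x * w x))"
          by (intro Bochner_Integration.integral_cong) (auto simp: algebra_simps)
      also have "\<dots> = W + e\<^sup>2 / 2 * D + e\<^sup>2 / 2 * \<eta> * W + e ^ 4 * N1\<^sup>2 * W"
          unfolding W_def D_def
          using Wi int[of "\<lambda>x. (norm (G x))\<^sup>2"] G by (simp add: continuous_on_power continuous_on_norm)
      finally show ?thesis .
    qed
    have A0: "0 \<le> A" unfolding A_def using w by (intro integral_nonneg_AE AE_I2) (auto simp: indicator_def)
    have R0: "0 \<le> ?R" using w by (intro integral_nonneg_AE AE_I2) (auto simp: indicator_def)
    have L0: "0 \<le> W + e\<^sup>2 / 2 * A - e ^ 3 * M1 ^ 3 * W"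
      using e(3) A0 by (simp add: power3_eq_cube power2_eq_square mult_ac add_increasing2)
    have "(W + e\<^sup>2 / 2 * A - e ^ 3 * M1 ^ 3 * W)\<^sup>2 \<le> ?E e * ?E (- e)"
      unfolding power2_eq_square[of "W + e\<^sup>2 / 2 * A - e ^ 3 * M1 ^ 3 * W"]
      using L0 lower[of e] lower[of "- e"] by (intro mult_mono) auto
    then have "(W + e\<^sup>2 / 2 * A - e ^ 3 * M1 ^ 3 * W)\<^sup>2 \<le> ?R\<^sup>2" using PL by linarith
    then have "W + e\<^sup>2 / 2 * A - e ^ 3 * M1 ^ 3 * W \<le> ?R" using R0 power2_le_imp_le by blast
    then have "e\<^sup>2 / 2 * A \<le> e\<^sup>2 / 2 * D + e\<^sup>2 / 2 * \<eta> * W + e ^ 4 * N1\<^sup>2 * W + e ^ 3 * M1 ^ 3 * W"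
      using upper by linarith
    also have "e ^ 4 * N1\<^sup>2 * W \<le> e ^ 3 * N1\<^sup>2 * W"
      using eb e W0 by (intro mult_right_mono power_decreasing) auto
    also have "e\<^sup>2 / 2 * D + e\<^sup>2 / 2 * \<eta> * W + e ^ 3 * N1\<^sup>2 * W + e ^ 3 * M1 ^ 3 * W
      = e\<^sup>2 / 2 * (D + \<eta> * W + e * (2 * M1^3 * W + 2 * N1\<^sup>2 * W))"
      by (simp add: algebra_simps power2_eq_square power3_eq_cube)
    finally show ?thesis using e by simp
  qed
  have "((\<lambda>e. D + \<eta> * W + e * (2 * M1^3 * W + 2 * N1\<^sup>2 * W)) \<longlongrightarrow> D + \<eta> * W + 0 * (2 * M1^3 * W + 2 * N1\<^sup>2 * W)) (at_right 0)"
    by (intro tendsto_intros)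
  moreover have "\<forall>\<^sub>F e in at_right 0. A \<le> D + \<eta> * W + e * (2 * M1^3 * W + 2 * N1\<^sup>2 * W)"
  proof -
    define e2 where "e2 = min e1 (1 / M1 ^ 3)"
    have "0 < e2" using e1 M1pos by (simp add: e2_def)
    then have "\<forall>\<^sub>F e in at_right 0. 0 < e \<and> e < e2"
      by (auto simp: eventually_at_right)
    then show ?thesis
    proof eventually_elim
      case (elim e)
      have "e * M1 ^ 3 \<le> 1" using elim M1pos by (simp add: e2_def field_simps)
      moreover have "e\<^sup>2 \<le> 1"
        using elim by (simp add: e2_def e1_def power_le_one)
      ultimately have "e * M1 ^ 3 * e\<^sup>2 \<le> 1 * 1" using elim M1pos by (intro mult_mono) auto
      then have "e * M1 ^ 3 * e\<^sup>2 * W \<le> 1 * W" using W0 by (intro mult_right_mono) auto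
      then show ?case using elim by (intro main) (auto simp: e2_def)
    qed
  qed
  ultimately have "A \<le> D + \<eta> * W"
    by (auto dest!: tendsto_lowerbound)
  then show "A \<le> D + \<eta>'" using \<eta> by linarith
qed

text \<open>The variance inequality multiplied through by the total mass of the weight. In this form
  it also holds when the mass is zero, and it contains no quotient whose limit would have to be
  justified later. Subtracting the mean m / W reduces it to the centered case.\<close>

theorem Poincare_compact:
  fixes w F :: "'a::euclidean_space \<Rightarrow> real" and G :: "'a \<Rightarrow> 'a"
  assumes K: "compact K" "convex K"
    and w: "w \<in> borel_measurable borel" "\<And>x. x \<in> K \<Longrightarrow> 0 \<le> w x" "\<And>x. x \<in> K \<Longrightarrow> w x \<le> Cw"
      "\<And>x y. x \<in> K \<Longrightarrow> y \<in> K \<Longrightarrow> w x * w y * exp ((norm (x - y))\<^sup>2 / 4) \<le> (w ((1/2) *\<^sub>R (x + y)))\<^sup>2"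
    and F: "\<And>x. (F has_derivative (\<lambda>v. v \<bullet> G x)) (at x)" and G: "continuous_on UNIV G"
  shows "(LINT x|lborel. indicator K x * w x) * (LINT x|lborel. indicator K x * w x * (F x)\<^sup>2)
       - (LINT x|lborel. indicator K x * w x * F x)\<^sup>2
      \<le> (LINT x|lborel. indicator K x * w x) * (LINT x|lborel. indicator K x * w x * (norm (G x))\<^sup>2)"
proof -
  define W m where "W = (LINT x|lborel. indicator K x * w x)" and "m = (LINT x|lborel. indicator K x * w x * F x)"
  have Fc: "continuous_on UNIV F"
    by (rule has_derivative_continuous_on[OF has_derivative_at_withinI[OF F]])
  have [measurable]: "w \<in> borel_measurable borel" "K \<in> sets borel" "F \<in> borel_measurable borel"
    using w K Fc by (auto simp: borel_measurable_continuous_onI borel_closed compact_imp_closed)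
  have int: "integrable lborel (\<lambda>x. indicator K x * w x * u x)" if "continuous_on UNIV u" for u :: "'a \<Rightarrow> real"
    by (rule integrable_compact_weight[OF K(1)]) (use w that in auto)
  have Wi: "integrable lborel (\<lambda>x. indicator K x * w x)" using int[of "\<lambda>_. 1"] by simp
  have W0: "0 \<le> W" unfolding W_def using w by (intro integral_nonneg_AE AE_I2) (auto simp: indicator_def)
  show ?thesis
  proof (cases "W = 0")
    case True
    then show ?thesis by (simp flip: W_def)
  next
    case False
    define c where "c = m / W"
    have mean: "(LINT x|lborel. indicator K x * w x * (F x - c)) = 0"
    proof -
      have "(LINT x|lborel. indicator K x * w x * (F x - c)) = (LINT x|lborel. indicator K x * w x * F x - c * (indicator K x * w x))"
        by (intro Bochner_Integration.integral_cong) (auto simp: algebra_simps)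
      also have "\<dots> = m - c * W" using int[OF Fc] Wi by (simp add: m_def W_def)
      finally show ?thesis using False by (simp add: c_def)
    qed
    have "(LINT x|lborel. indicator K x * w x * (F x - c)\<^sup>2) \<le> (LINT x|lborel. indicator K x * w x * (norm (G x))\<^sup>2)"
      by (rule Poincare_compact_centered[OF K w _ G mean]) (auto intro!: derivative_eq_intros F)
    moreover have "(LINT x|lborel. indicator K x * w x * (F x - c)\<^sup>2) = (LINT x|lborel. indicator K x * w x * (F x)\<^sup>2) - m\<^sup>2 / W"
    proof -
      have "(LINT x|lborel. indicator K x * w x * (F x - c)\<^sup>2) =
        (LINT x|lborel. indicator K x * w x * (F x)\<^sup>2 - 2 * c * (indicator K x * w x * F x) + c\<^sup>2 * (indicator K x * w x))"
        by (intro Bochner_Integration.integral_cong) (auto simp: algebra_simps power2_eq_square)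
      also have "\<dots> = (LINT x|lborel. indicator K x * w x * (F x)\<^sup>2) - 2 * c * m + c\<^sup>2 * W"
        using int[OF Fc] Wi int[of "\<lambda>x. (F x)\<^sup>2"] Fc by (simp add: m_def W_def continuous_on_power)
      also have "2 * c * m - c\<^sup>2 * W = m\<^sup>2 / W"
        using False by (simp add: c_def power2_eq_square field_simps)
      then have "(LINT x|lborel. indicator K x * w x * (F x)\<^sup>2) - 2 * c * m + c\<^sup>2 * W = (LINT x|lborel. indicator K x * w x * (F x)\<^sup>2) - m\<^sup>2 / W"
        by linarith
      finally show ?thesis .
    qed
    ultimately have "(LINT x|lborel. indicator K x * w x * (F x)\<^sup>2) - m\<^sup>2 / W \<le> (LINT x|lborel. indicator K x * w x * (norm (G x))\<^sup>2)"
      by simp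
    then have "W * ((LINT x|lborel. indicator K x * w x * (F x)\<^sup>2) - m\<^sup>2 / W) \<le> W * (LINT x|lborel. indicator K x * w x * (norm (G x))\<^sup>2)"
      using W0 by (rule mult_left_mono)
    then show ?thesis using False by (simp add: W_def[symmetric] m_def[symmetric] right_diff_distrib)
  qed
qed

section \<open>Smooth approximation of weak gradients\<close>

lemma integrable_lborel_shift:
  fixes f :: "'a::euclidean_space \<Rightarrow> 'b::{banach, second_countable_topology}"
  assumes "integrable lborel f"
  shows "integrable lborel (\<lambda>x. f (x - z))" and "(LINT x|lborel. f (x - z)) = (LINT x|lborel. f x)"
proof -
  have eq: "lborel = distr lborel borel (\<lambda>x. - z + x)"
    by (rule lborel_distr_plus[symmetric])
  have [measurable]: "f \<in> borel_measurable borel" using borel_measurable_integrable[OF assms] by simp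
  show "integrable lborel (\<lambda>x. f (x - z))"
    using assms by (subst (asm) eq, subst (asm) integrable_distr_eq) auto
  show "(LINT x|lborel. f (x - z)) = (LINT x|lborel. f x)"
    by (subst (2) eq, subst integral_distr) auto
qed

text \<open>Induction over integrable functions. For an indicator, the set is enclosed in an open
  set \<open>U\<close> of nearly the same measure. The shifted indicators of \<open>U\<close>
  converge at the points of \<open>U\<close>, though perhaps not on its boundary; this suffices
  because the L1 distance between \<open>U\<close> and its translate is twice the measure of
  \<open>U\<close> minus twice the measure of the overlap. Sums and dominated limits follow from the
  triangle inequality.\<close>

lemma translation_continuous_L1:
  fixes f :: "'a::euclidean_space \<Rightarrow> real"
  assumes "integrable lborel f" and z: "z \<longlonglongrightarrow> 0"
  shows "(\<lambda>n. LINT x|lborel. \<bar>f (x - z n) - f x\<bar>) \<longlonglongrightarrow> 0"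
  using assms(1)
proof induction
  case (base A c)
  then have [measurable]: "A \<in> sets borel" and A: "emeasure lborel A < \<infinity>" by auto
  have iA: "integrable lborel (indicat_real A)" using base by simp
  show ?case
  proof (rule LIMSEQ_I)
    fix r :: real assume r: "0 < r"
    define e where "e = r / (4 * (\<bar>c\<bar> + 1))"
    have e: "0 < e" using r by (simp add: e_def)
    obtain U where U: "A \<subseteq> U" "open U" "emeasure lborel (U - A) < ennreal e"
      by (rule outer_regular_lborel[of A e]) (use e in auto)
    have [measurable]: "U \<in> sets borel" using U by auto
    have "emeasure lborel U \<le> emeasure lborel A + emeasure lborel (U - A)"
      using emeasure_subadditive[of A lborel "U - A"] U by (simp add: Un_absorb1)
    also have "\<dots> < \<infinity>" using A order_less_trans[OF U(3) ennreal_less_top] by simp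
    finally have iU: "integrable lborel (indicat_real U)" by simp
    have "(\<lambda>n. LINT x|lborel. indicat_real U x * indicator U (x - z n)) \<longlonglongrightarrow> (LINT x|lborel. indicat_real U x)"
    proof (rule integral_dominated_convergence[where w="indicat_real U"])
      show "AE x in lborel. (\<lambda>n. indicat_real U x * indicator U (x - z n)) \<longlonglongrightarrow> indicator U x"
      proof (intro AE_I2)
        fix x show "(\<lambda>n. indicat_real U x * indicator U (x - z n)) \<longlonglongrightarrow> indicator U x"
        proof (cases "x \<in> U")
          case True
          have "(\<lambda>n. x - z n) \<longlonglongrightarrow> x - 0" by (intro tendsto_intros z)
          then have "\<forall>\<^sub>F n in sequentially. x - z n \<in> U"
            using True U(2) by (intro topological_tendstoD[of _ "x - 0"]) simp_all
          then show ?thesis using True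
            by (intro tendsto_eventually) (simp add: eventually_mono indicator_def)
        qed simp
      qed
    qed (use iU in \<open>auto simp: indicator_def\<close>)
    then obtain N where N: "\<And>n. n \<ge> N \<Longrightarrow> \<bar>(LINT x|lborel. indicat_real U x * indicator U (x - z n)) - (LINT x|lborel. indicat_real U x)\<bar> < e"
      by (drule_tac LIMSEQ_D[OF _ e]) auto
    show "\<exists>no. \<forall>n\<ge>no. norm ((LINT x|lborel. \<bar>indicator A (x - z n) *\<^sub>R c - indicator A x *\<^sub>R c\<bar>) - 0) < r"
    proof (intro exI allI impI)
      fix n assume n: "n \<ge> N"
      note sh = integrable_lborel_shift[OF iU, of "z n"] integrable_lborel_shift[OF iA, of "z n"]
      have iUU: "integrable lborel (\<lambda>x. indicat_real U x * indicator U (x - z n))"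
        by (rule Bochner_Integration.integrable_bound[OF iU]) (auto simp: indicator_def)
      have UA: "(LINT x|lborel. indicat_real U x) - (LINT x|lborel. indicat_real A x) < e"
      proof -
        have "indicat_real (U - A) = (\<lambda>x. indicat_real U x - indicat_real A x)"
          using U(1) by (auto simp: fun_eq_iff split: split_indicator)
        then have "(LINT x|lborel. indicat_real U x) - (LINT x|lborel. indicat_real A x) = (LINT x|lborel. indicat_real (U - A) x)"
          using Bochner_Integration.integral_diff[OF iU iA] by simp
        also have "\<dots> = measure lborel (U - A)" by simp
        also have "\<dots> < e"
        proof -
          have "emeasure lborel (U - A) \<noteq> \<infinity>" using U(3) by auto
          then have "emeasure lborel (U - A) = ennreal (measure lborel (U - A))"
            by (simp add: emeasure_eq_ennreal_measure)
          then show ?thesis using U(3) by (simp add: ennreal_less_iff)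
        qed
        finally show ?thesis .
      qed
      \<comment> \<open>The triangle inequality through \<open>U\<close> and its translate; the
        product of indicators is the overlap. The four errors, two from U - A and two from the loss
        of overlap, are each below \<open>e\<close>.\<close>
      have "(LINT x|lborel. \<bar>indicator A (x - z n) - indicator A x\<bar>) \<le>
          (LINT x|lborel. (indicat_real U (x - z n) - indicat_real A (x - z n)) + (indicat_real U x - indicat_real A x)
            + (indicat_real U (x - z n) + indicat_real U x - 2 * (indicat_real U x * indicator U (x - z n))))"
      proof (rule integral_mono)
        fix x
        show "\<bar>indicator A (x - z n) - indicator A x\<bar> \<le> (indicat_real U (x - z n) - indicat_real A (x - z n)) + (indicat_real U x - indicat_real A x)
            + (indicat_real U (x - z n) + indicat_real U x - 2 * (indicat_real U x * indicator U (x - z n)))"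
          using U(1) by (auto split: split_indicator)
      qed (use sh iU iA iUU in auto)
      also have "\<dots> = 2 * ((LINT x|lborel. indicat_real U x) - (LINT x|lborel. indicat_real A x))
         + 2 * ((LINT x|lborel. indicat_real U x) - (LINT x|lborel. indicat_real U x * indicator U (x - z n)))"
        using sh iU iA iUU by simp
      also have "\<dots> < 4 * e"
      proof -
        have "2 * (a - b) + 2 * (a - c) < 4 * e" if "a - b < e" "\<bar>c - a\<bar> < e" for a b c :: real
          using that by (auto simp: abs_less_iff)
        then show ?thesis using UA N[OF n] by blast
      qed
      finally have "(LINT x|lborel. \<bar>indicator A (x - z n) - indicator A x\<bar>) < 4 * e" .
      then have "\<bar>c\<bar> * (LINT x|lborel. \<bar>indicator A (x - z n) - indicator A x\<bar>) \<le> \<bar>c\<bar> * (4 * e)"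
        by (intro mult_left_mono) auto
      also have "\<dots> < r" using r by (simp add: e_def field_simps)
      also have "\<bar>c\<bar> * (LINT x|lborel. \<bar>indicator A (x - z n) - indicator A x\<bar>) = (LINT x|lborel. \<bar>indicator A (x - z n) *\<^sub>R c - indicator A x *\<^sub>R c\<bar>)"
        by (subst integral_mult_right_zero[symmetric]) (auto intro!: Bochner_Integration.integral_cong simp: abs_mult[symmetric] algebra_simps)
      finally show "norm ((LINT x|lborel. \<bar>indicator A (x - z n) *\<^sub>R c - indicator A x *\<^sub>R c\<bar>) - 0) < r"
        by simp
    qed
  qed
next
  case (add f g)
  note sh = integrable_lborel_shift(1)[OF add(1)] integrable_lborel_shift(1)[OF add(2)]
  show ?case
  proof (rule tendsto_sandwich[OF _ _ tendsto_const])
    show "\<forall>\<^sub>F n in sequentially. (LINT x|lborel. \<bar>f (x - z n) + g (x - z n) - (f x + g x)\<bar>)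
       \<le> (LINT x|lborel. \<bar>f (x - z n) - f x\<bar>) + (LINT x|lborel. \<bar>g (x - z n) - g x\<bar>)"
    proof (intro always_eventually allI)
      fix n
      have i: "integrable lborel (\<lambda>x. \<bar>f (x - z n) - f x\<bar>)" "integrable lborel (\<lambda>x. \<bar>g (x - z n) - g x\<bar>)"
        using sh add(1,2) by auto
      show "(LINT x|lborel. \<bar>f (x - z n) + g (x - z n) - (f x + g x)\<bar>)
       \<le> (LINT x|lborel. \<bar>f (x - z n) - f x\<bar>) + (LINT x|lborel. \<bar>g (x - z n) - g x\<bar>)"
        unfolding Bochner_Integration.integral_add[OF i, symmetric]
        by (rule integral_mono) (use sh add(1,2) in auto)
    qed
    show "(\<lambda>n. (LINT x|lborel. \<bar>f (x - z n) - f x\<bar>) + (LINT x|lborel. \<bar>g (x - z n) - g x\<bar>)) \<longlonglongrightarrow> 0"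
      using tendsto_add[OF add(3,4)] by simp
  qed simp
next
  case (lim f s)
  show ?case
  proof (rule LIMSEQ_I)
    fix r :: real assume r: "0 < r"
    have "(\<lambda>i. LINT x|lborel. \<bar>s i x - f x\<bar>) \<longlonglongrightarrow> (LINT x|(lborel :: 'a measure). (0::real))"
    proof (rule integral_dominated_convergence[where w="\<lambda>x. 3 * \<bar>f x\<bar>"])
      show "AE x in lborel. (\<lambda>i. \<bar>s i x - f x\<bar>) \<longlonglongrightarrow> 0"
      proof (rule AE_I2)
        fix x show "(\<lambda>i. \<bar>s i x - f x\<bar>) \<longlonglongrightarrow> 0"
          by (rule tendsto_rabs_zero, rule LIM_zero, rule lim(2)) simp
      qed
      show "AE x in lborel. norm \<bar>s i x - f x\<bar> \<le> 3 * \<bar>f x\<bar>" for i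
      proof (intro AE_I2)
        fix x show "norm \<bar>s i x - f x\<bar> \<le> 3 * \<bar>f x\<bar>" using lim(3)[of x i] by simp
      qed
    qed (use lim in auto)
    from LIMSEQ_D[OF this, of "r/3"] obtain i where i: "(LINT x|lborel. \<bar>s i x - f x\<bar>) < r / 3"
      using r by auto
    from LIMSEQ_D[OF lim(5)[of i], of "r/3"] obtain N where N: "\<And>n. n \<ge> N \<Longrightarrow> (LINT x|lborel. \<bar>s i (x - z n) - s i x\<bar>) < r / 3"
      using r by auto
    show "\<exists>no. \<forall>n\<ge>no. norm ((LINT x|lborel. \<bar>f (x - z n) - f x\<bar>) - 0) < r"
    proof (intro exI allI impI)
      fix n assume n: "n \<ge> N"
      have d: "integrable lborel (\<lambda>x. \<bar>s i x - f x\<bar>)" using lim by auto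
      note sh = integrable_lborel_shift[OF d, of "z n"] integrable_lborel_shift(1)[OF lim(1)[of i], of "z n"] integrable_lborel_shift(1)[OF lim(4), of "z n"]
      have "(LINT x|lborel. \<bar>f (x - z n) - f x\<bar>) \<le> (LINT x|lborel. \<bar>s i (x - z n) - f (x - z n)\<bar> + \<bar>s i x - f x\<bar> + \<bar>s i (x - z n) - s i x\<bar>)"
        by (intro integral_mono) (use sh d lim in auto)
      also have "\<dots> = 2 * (LINT x|lborel. \<bar>s i x - f x\<bar>) + (LINT x|lborel. \<bar>s i (x - z n) - s i x\<bar>)"
        using sh d lim by simp
      also have "\<dots> < r" using i N[OF n] by linarith
      finally show "norm ((LINT x|lborel. \<bar>f (x - z n) - f x\<bar>) - 0) < r" by simp
    qed
  qed
qed

text \<open>Reduction to L1: (a - b)^2 \<le> |a^2 - b^2| for nonnegative a and b, so the squares of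
  the positive and negative parts, which are integrable, control the difference.\<close>

lemma translation_continuous_L2:
  fixes u :: "'a::euclidean_space \<Rightarrow> real"
  assumes [measurable]: "u \<in> borel_measurable borel" and int: "integrable lborel (\<lambda>x. (u x)\<^sup>2)" and z: "z \<longlonglongrightarrow> 0"
  shows "(\<lambda>n. LINT x|lborel. (u (x - z n) - u x)\<^sup>2) \<longlonglongrightarrow> 0"
proof -
  define p q where "p x = (max (u x) 0)\<^sup>2" and "q x = (max (- u x) 0)\<^sup>2" for x
  have [measurable]: "p \<in> borel_measurable borel" "q \<in> borel_measurable borel"
    unfolding p_def q_def by measurable
  have ip: "integrable lborel p" "integrable lborel q"
    by (rule Bochner_Integration.integrable_bound[OF int]; auto simp: p_def q_def max_def)+
  have sq: "(a - b)\<^sup>2 \<le> \<bar>a\<^sup>2 - b\<^sup>2\<bar>" if "0 \<le> a" "0 \<le> b" for a b :: real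
  proof -
    have "(a - b)\<^sup>2 = \<bar>a - b\<bar> * \<bar>a - b\<bar>" by (simp add: power2_eq_square)
    also have "\<dots> \<le> \<bar>a - b\<bar> * \<bar>a + b\<bar>" using that by (intro mult_left_mono) auto
    also have "\<dots> = \<bar>a\<^sup>2 - b\<^sup>2\<bar>" by (simp add: abs_mult[symmetric] power2_eq_square algebra_simps)
    finally show ?thesis .
  qed
  have b: "(u y - u x)\<^sup>2 \<le> 2 * \<bar>p y - p x\<bar> + 2 * \<bar>q y - q x\<bar>" for x y
  proof -
    have "u y - u x = (max (u y) 0 - max (u x) 0) - (max (- u y) 0 - max (- u x) 0)" by auto
    moreover have "(s - t)\<^sup>2 \<le> 2 * s\<^sup>2 + 2 * t\<^sup>2" for s t :: real
      using zero_le_power2[of "s + t"] by (simp add: power2_eq_square algebra_simps)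
    ultimately have "(u y - u x)\<^sup>2 \<le> 2 * (max (u y) 0 - max (u x) 0)\<^sup>2 + 2 * (max (- u y) 0 - max (- u x) 0)\<^sup>2"
      by metis
    also have "\<dots> \<le> 2 * \<bar>p y - p x\<bar> + 2 * \<bar>q y - q x\<bar>"
      unfolding p_def q_def by (intro add_mono mult_left_mono sq) auto
    finally show ?thesis .
  qed
  note sh = integrable_lborel_shift(1)[OF ip(1)] integrable_lborel_shift(1)[OF ip(2)]
  show ?thesis
  proof (rule tendsto_sandwich[OF _ _ tendsto_const])
    show "\<forall>\<^sub>F n in sequentially. (LINT x|lborel. (u (x - z n) - u x)\<^sup>2)
       \<le> 2 * (LINT x|lborel. \<bar>p (x - z n) - p x\<bar>) + 2 * (LINT x|lborel. \<bar>q (x - z n) - q x\<bar>)"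
    proof (intro always_eventually allI)
      fix n
      have i: "integrable lborel (\<lambda>x. 2 * \<bar>p (x - z n) - p x\<bar> + 2 * \<bar>q (x - z n) - q x\<bar>)"
        using sh ip by auto
      have "(LINT x|lborel. (u (x - z n) - u x)\<^sup>2) \<le> (LINT x|lborel. 2 * \<bar>p (x - z n) - p x\<bar> + 2 * \<bar>q (x - z n) - q x\<bar>)"
        using b by (intro integral_mono Bochner_Integration.integrable_bound[OF i] i) auto
      then show "(LINT x|lborel. (u (x - z n) - u x)\<^sup>2)
       \<le> 2 * (LINT x|lborel. \<bar>p (x - z n) - p x\<bar>) + 2 * (LINT x|lborel. \<bar>q (x - z n) - q x\<bar>)"
        using sh ip by simp
    qed
    show "(\<lambda>n. 2 * (LINT x|lborel. \<bar>p (x - z n) - p x\<bar>) + 2 * (LINT x|lborel. \<bar>q (x - z n) - q x\<bar>)) \<longlonglongrightarrow> 0"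
      using tendsto_add[OF tendsto_mult_left[OF translation_continuous_L1[OF ip(1) z], of 2]
        tendsto_mult_left[OF translation_continuous_L1[OF ip(2) z], of 2]] by simp
  qed simp
qed

definition smooth_approx :: "real \<Rightarrow> (real^'d \<Rightarrow> real) \<Rightarrow> real^'d \<Rightarrow> real" where
  "smooth_approx e u x = (LINT y|lborel. u y * bump e (x - y))"

definition smooth_approx_grad :: "real \<Rightarrow> (real^'d \<Rightarrow> real) \<Rightarrow> real^'d \<Rightarrow> real^'d" where
  "smooth_approx_grad e u x = (LINT y|lborel. u y *\<^sub>R grad_bump e (x - y))"

lemma bump_bounded:
  assumes e: "0 < e" obtains C where "\<And>y :: real^'d. norm (bump e y) \<le> C"
proof -
  have "bounded (bump e ` cball (0 :: real^'d) e)"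
    by (intro compact_imp_bounded compact_continuous_image compact_cball continuous_on_subset[OF continuous_on_bump]) auto
  then obtain C where C: "\<And>y :: real^'d. y \<in> cball 0 e \<Longrightarrow> norm (bump e y) \<le> C" unfolding bounded_iff by blast
  have "0 \<le> C" using C[of 0] e by (auto intro: order_trans[OF abs_ge_zero])
  then have "norm (bump e y) \<le> C" for y :: "real^'d"
    using bump_eq_0[OF e, of y] C[of y] by (cases "norm y \<le> e") auto
  then show ?thesis by (rule that)
qed

lemma grad_bump_uniformly_continuous:
  assumes "0 < e" shows "uniformly_continuous_on UNIV (grad_bump e :: real^'d \<Rightarrow> real^'d)"
  unfolding uniformly_continuous_on_def
proof (intro allI impI)
  fix r :: real assume r: "0 < r"
  have "uniformly_continuous_on (cball 0 (e + 2)) (grad_bump e :: real^'d \<Rightarrow> real^'d)"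
    by (intro compact_uniformly_continuous compact_cball continuous_on_subset[OF continuous_on_grad_bump]) auto
  then obtain d where d: "0 < d" "\<And>x y :: real^'d. x \<in> cball 0 (e + 2) \<Longrightarrow> y \<in> cball 0 (e + 2) \<Longrightarrow> dist y x < d \<Longrightarrow> dist (grad_bump e y) (grad_bump e x) < r"
    using r unfolding uniformly_continuous_on_def by metis
  show "\<exists>d>0. \<forall>x\<in>UNIV. \<forall>y\<in>UNIV. dist y x < d \<longrightarrow> dist (grad_bump e y) (grad_bump e (x :: real^'d)) < r"
  proof (intro exI[of _ "min d 1"] conjI ballI impI)
    show "0 < min d 1" using d by simp
    fix x y :: "real^'d" assume xy: "dist y x < min d 1"
    show "dist (grad_bump e y) (grad_bump e x) < r"
    proof (cases "norm x \<le> e + 1")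
      case True
      then have "norm y \<le> e + 2" using xy norm_triangle_sub[of y x] by (simp add: dist_norm)
      then show ?thesis using True d(2) xy by simp
    next
      case False
      then have "e < norm y" "e < norm x" using xy norm_triangle_sub[of x y] by (auto simp: dist_norm norm_minus_commute)
      then show ?thesis using grad_bump_eq_0[OF assms, of x] grad_bump_eq_0[OF assms, of y] r by simp
    qed
  qed
qed

lemma integrable_mult_bounded_continuous:
  fixes u :: "'a::euclidean_space \<Rightarrow> real" and f :: "'a \<Rightarrow> 'b::{banach, second_countable_topology}"
  assumes u: "integrable lborel u" and f: "continuous_on UNIV f" "\<And>x. norm (f x) \<le> C"
  shows "integrable lborel (\<lambda>x. u x *\<^sub>R f x)"
proof (rule Bochner_Integration.integrable_bound[of _ "\<lambda>x. C * u x"])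
  have [measurable]: "f \<in> borel_measurable borel" using f(1) by (rule borel_measurable_continuous_onI)
  have [measurable]: "u \<in> borel_measurable borel" using borel_measurable_integrable[OF u] by simp
  show "(\<lambda>x. u x *\<^sub>R f x) \<in> borel_measurable lborel" by measurable
  have "\<bar>u x\<bar> * norm (f x) \<le> \<bar>C\<bar> * \<bar>u x\<bar>" for x
    using mult_left_mono[OF order_trans[OF f(2)[of x] abs_ge_self], of "\<bar>u x\<bar>"] by (simp add: mult.commute)
  then show "AE x in lborel. norm (u x *\<^sub>R f x) \<le> norm (C * u x)" by (simp add: abs_mult)
qed (use u in auto)

lemma grad_bump_bounded:
  assumes e: "0 < e" obtains C where "\<And>y :: real^'d. norm (grad_bump e y) \<le> C"
proof -
  have "bounded (grad_bump e ` cball (0 :: real^'d) e)"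
    by (intro compact_imp_bounded compact_continuous_image compact_cball continuous_on_subset[OF continuous_on_grad_bump]) auto
  then obtain C where C: "\<And>y :: real^'d. y \<in> cball 0 e \<Longrightarrow> norm (grad_bump e y) \<le> C" unfolding bounded_iff by blast
  have "0 \<le> C" using C[of 0] e by (auto intro: order_trans[OF norm_ge_zero])
  then have "norm (grad_bump e y) \<le> C" for y :: "real^'d"
    using grad_bump_eq_0[OF e, of y] C[of y] by (cases "norm y \<le> e") auto
  then show ?thesis by (rule that)
qed

lemma smooth_approx_integrable:
  fixes u :: "real^'d \<Rightarrow> real"
  assumes u: "integrable lborel u" and e: "0 < e"
  shows "integrable lborel (\<lambda>y. u y * bump e (x - y))" "integrable lborel (\<lambda>y. u y *\<^sub>R grad_bump e (x - y))"
proof -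
  obtain C where C: "\<And>y :: real^'d. norm (bump e y) \<le> C" using bump_bounded[OF e] by blast
  have "continuous_on UNIV (\<lambda>y :: real^'d. bump e (x - y))"
    by (rule continuous_on_compose2[OF continuous_on_bump]) (auto intro!: continuous_intros)
  from integrable_mult_bounded_continuous[OF u this C]
  show "integrable lborel (\<lambda>y. u y * bump e (x - y))" by simp
  obtain C where C: "\<And>y :: real^'d. norm (grad_bump e y) \<le> C" using grad_bump_bounded[OF e] by blast
  have "continuous_on UNIV (\<lambda>y :: real^'d. grad_bump e (x - y))"
    by (rule continuous_on_compose2[OF continuous_on_grad_bump]) (auto intro!: continuous_intros)
  from integrable_mult_bounded_continuous[OF u this C]
  show "integrable lborel (\<lambda>y. u y *\<^sub>R grad_bump e (x - y))" by simp
qed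

text \<open>Uniform continuity of \<open>grad_bump\<close> makes the first-order expansion of the
  mollifier uniform in its argument. The derivative can therefore be taken under the integral with
  nothing but integrability of \<open>u\<close>. The added 1 in \<open>N\<close> keeps the divisor
  positive.\<close>

lemma smooth_approx_has_derivative:
  fixes u :: "real^'d \<Rightarrow> real"
  assumes u: "integrable lborel u" and e: "0 < e"
  shows "(smooth_approx e u has_derivative (\<lambda>v. v \<bullet> smooth_approx_grad e u x)) (at x)"
  unfolding has_derivative_at_alt
proof (intro conjI allI impI)
  show "bounded_linear (\<lambda>v. v \<bullet> smooth_approx_grad e u x)" by (rule bounded_linear_inner_left)
  fix r :: real assume r: "0 < r"
  define N where "N = (LINT y|lborel. \<bar>u y\<bar>) + 1"
  have N: "0 < N" unfolding N_def by (intro add_nonneg_pos integral_nonneg_AE) auto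
  note int = smooth_approx_integrable[OF u e]
  have iu: "integrable lborel (\<lambda>y. \<bar>u y\<bar>)" using u by simp
  obtain d where d: "0 < d" "\<And>x y :: real^'d. dist y x < d \<Longrightarrow> dist (grad_bump e y) (grad_bump e x) < r / N"
    using grad_bump_uniformly_continuous[OF e] r N unfolding uniformly_continuous_on_def by (metis UNIV_I divide_pos_pos)
  have est: "\<bar>bump e (q + h) - bump e q - h \<bullet> grad_bump e q\<bar> \<le> r / N * norm h" if h: "norm h < d" for q h :: "real^'d"
  proof -
    obtain z where z: "z \<in> closed_segment (q + h) q" "bump e (q + h) - bump e q = (q + h - q) \<bullet> grad_bump e z"
      using has_derivative_mvt_segment[OF convex_UNIV bump_has_derivative, of "q + h" q] by auto
    have "dist z q \<le> norm h"
      using dist_in_closed_segment[of z "q + h" q] z(1) by (simp add: dist_norm)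
    then have "dist (grad_bump e z) (grad_bump e q) < r / N" using h d(2) by simp
    then have "\<bar>h \<bullet> (grad_bump e z - grad_bump e q)\<bar> \<le> norm h * (r / N)"
      by (intro order_trans[OF Cauchy_Schwarz_ineq2] mult_left_mono) (auto simp: dist_norm)
    then show ?thesis using z(2) by (simp add: inner_diff_right mult.commute)
  qed
  show "\<exists>d>0. \<forall>y. norm (y - x) < d \<longrightarrow> norm (smooth_approx e u y - smooth_approx e u x - (y - x) \<bullet> smooth_approx_grad e u x) \<le> r * norm (y - x)"
  proof (intro exI[of _ d] conjI allI impI)
    fix x' assume h: "norm (x' - x) < d"
    have i3: "integrable lborel (\<lambda>y. u y * ((x' - x) \<bullet> grad_bump e (x - y)))"
      using integrable_inner_right[OF int(2)[of x], of "x' - x"] by simp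
    have "(x' - x) \<bullet> smooth_approx_grad e u x = (LINT y|lborel. u y * ((x' - x) \<bullet> grad_bump e (x - y)))"
      unfolding smooth_approx_grad_def using int(2)[of x] by (subst integral_inner_right[symmetric]) auto
    then have eq: "smooth_approx e u x' - smooth_approx e u x - (x' - x) \<bullet> smooth_approx_grad e u x
      = (LINT y|lborel. u y * bump e (x' - y) - u y * bump e (x - y) - u y * ((x' - x) \<bullet> grad_bump e (x - y)))"
      using int i3 by (simp add: smooth_approx_def)
    have "norm (smooth_approx e u x' - smooth_approx e u x - (x' - x) \<bullet> smooth_approx_grad e u x)
      \<le> (LINT y|lborel. norm (u y * bump e (x' - y) - u y * bump e (x - y) - u y * ((x' - x) \<bullet> grad_bump e (x - y))))"
      unfolding eq by (rule integral_norm_bound)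
    also have "\<dots> \<le> (LINT y|lborel. \<bar>u y\<bar> * (r / N * norm (x' - x)))"
    proof (rule integral_mono)
      fix y
      have "norm (u y * bump e (x' - y) - u y * bump e (x - y) - u y * ((x' - x) \<bullet> grad_bump e (x - y)))
        = \<bar>u y\<bar> * \<bar>bump e ((x - y) + (x' - x)) - bump e (x - y) - (x' - x) \<bullet> grad_bump e (x - y)\<bar>"
        unfolding right_diff_distrib[symmetric] by (simp add: abs_mult)
      also have "\<dots> \<le> \<bar>u y\<bar> * (r / N * norm (x' - x))" by (intro mult_left_mono est h) auto
      finally show "norm (u y * bump e (x' - y) - u y * bump e (x - y) - u y * ((x' - x) \<bullet> grad_bump e (x - y))) \<le> \<bar>u y\<bar> * (r / N * norm (x' - x))" .
    next
      show "integrable lborel (\<lambda>y. norm (u y * bump e (x' - y) - u y * bump e (x - y) - u y * ((x' - x) \<bullet> grad_bump e (x - y))))"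
        by (intro integrable_norm Bochner_Integration.integrable_diff int(1) i3)
      show "integrable lborel (\<lambda>y. \<bar>u y\<bar> * (r / N * norm (x' - x)))" by (intro integrable_mult_left iu)
    qed
    also have "\<dots> = (N - 1) * (r / N * norm (x' - x))" unfolding integral_mult_left_zero by (simp add: N_def)
    also have "\<dots> \<le> N * (r / N * norm (x' - x))" using N r by (intro mult_right_mono) auto
    also have "\<dots> = r * norm (x' - x)" using N by simp
    finally show "norm (smooth_approx e u x' - smooth_approx e u x - (x' - x) \<bullet> smooth_approx_grad e u x) \<le> r * norm (x' - x)" .
  qed (use d in auto)
qed

lemma continuous_on_smooth_approx_grad:
  fixes u :: "real^'d \<Rightarrow> real"
  assumes u: "integrable lborel u" and e: "0 < e"
  shows "continuous_on UNIV (smooth_approx_grad e u)"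
  unfolding continuous_on_iff
proof (intro ballI allI impI)
  fix x :: "real^'d" and r :: real assume r: "0 < r"
  define N where "N = (LINT y|lborel. \<bar>u y\<bar>) + 1"
  have N: "0 < N" unfolding N_def by (intro add_nonneg_pos integral_nonneg_AE) auto
  note int = smooth_approx_integrable(2)[OF u e]
  have iu: "integrable lborel (\<lambda>y. \<bar>u y\<bar>)" using u by simp
  obtain d where d: "0 < d" "\<And>x y :: real^'d. dist y x < d \<Longrightarrow> dist (grad_bump e y) (grad_bump e x) < r / N"
    using grad_bump_uniformly_continuous[OF e] r N unfolding uniformly_continuous_on_def by (metis UNIV_I divide_pos_pos)
  show "\<exists>d>0. \<forall>x'\<in>UNIV. dist x' x < d \<longrightarrow> dist (smooth_approx_grad e u x') (smooth_approx_grad e u x) < r"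
  proof (intro exI[of _ d] conjI ballI impI)
    fix x' assume x': "dist x' x < d"
    have "dist (smooth_approx_grad e u x') (smooth_approx_grad e u x) = norm (LINT y|lborel. u y *\<^sub>R grad_bump e (x' - y) - u y *\<^sub>R grad_bump e (x - y))"
      using int by (simp add: dist_norm smooth_approx_grad_def)
    also have "\<dots> \<le> (LINT y|lborel. norm (u y *\<^sub>R grad_bump e (x' - y) - u y *\<^sub>R grad_bump e (x - y)))"
      by (rule integral_norm_bound)
    also have "\<dots> \<le> (LINT y|lborel. \<bar>u y\<bar> * (r / N))"
    proof (rule integral_mono)
      fix y
      have "dist (x' - y) (x - y) < d" using x' by (simp add: dist_norm)
      then have "norm (grad_bump e (x' - y) - grad_bump e (x - y)) \<le> r / N" using d(2) by (simp add: dist_norm less_imp_le)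
      then show "norm (u y *\<^sub>R grad_bump e (x' - y) - u y *\<^sub>R grad_bump e (x - y)) \<le> \<bar>u y\<bar> * (r / N)"
        unfolding scaleR_diff_right[symmetric] norm_scaleR by (intro mult_left_mono) auto
    next
      show "integrable lborel (\<lambda>y. norm (u y *\<^sub>R grad_bump e (x' - y) - u y *\<^sub>R grad_bump e (x - y)))"
        by (intro integrable_norm Bochner_Integration.integrable_diff int)
      show "integrable lborel (\<lambda>y. \<bar>u y\<bar> * (r / N))" by (intro integrable_mult_left iu)
    qed
    also have "\<dots> = (N - 1) * (r / N)" unfolding integral_mult_left_zero by (simp add: N_def)
    also have "\<dots> < N * (r / N)" using N r by (intro mult_strict_right_mono) auto
    also have "\<dots> = r" using N by simp
    finally show "dist (smooth_approx_grad e u x') (smooth_approx_grad e u x) < r" .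
  qed (use d in auto)
qed

text \<open>The error at \<open>x\<close> is the average of u (x - z) - u x against the probability
  density \<open>bump e\<close>. Cauchy-Schwarz bounds its square by the average of the squares, and
  exchanging the integrals leaves an average of translation errors over |z| \<le> e.\<close>

lemma smooth_approx_L2_bound:
  fixes u :: "real^'d \<Rightarrow> real"
  assumes u: "integrable lborel u" and u2: "integrable lborel (\<lambda>x. (u x)\<^sup>2)" and e: "0 < e"
    and r: "\<And>z. norm z \<le> e \<Longrightarrow> (LINT x|lborel. (u (x - z) - u x)\<^sup>2) \<le> r"
  shows "(\<integral>\<^sup>+x. ennreal ((smooth_approx e u x - u x)\<^sup>2) \<partial>lborel) \<le> ennreal r"
proof -
  have [measurable]: "u \<in> borel_measurable borel" using borel_measurable_integrable[OF u] by simp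
  have [measurable]: "bump e \<in> borel_measurable borel"
    by (rule borel_measurable_continuous_onI[OF continuous_on_bump])
  have flip: "(\<integral>\<^sup>+y. f (x - y) \<partial>lborel) = (\<integral>\<^sup>+z. f z \<partial>lborel)" if [measurable]: "f \<in> borel_measurable borel"
    for f :: "real^'d \<Rightarrow> ennreal" and x
  proof -
    have "(\<integral>\<^sup>+z. f z \<partial>lborel) = (\<integral>\<^sup>+z. f z \<partial>density (distr lborel borel (\<lambda>y. x + (-1) *\<^sub>R y)) (\<lambda>_. ennreal (\<bar>-1\<bar> ^ DIM(real^'d))))"
      by (subst lborel_affine[of "-1" x]) simp_all
    then show ?thesis by (simp add: nn_integral_density nn_integral_distr)
  qed
  have one: "(\<integral>\<^sup>+z. ennreal (bump e (z :: real^'d)) \<partial>lborel) = 1"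
    using integral_bump[OF e, where 'd='d] by (subst nn_integral_eq_integral) (auto simp: integrable_bump[OF e] bump_nonneg)
  have pt: "ennreal ((smooth_approx e u x - u x)\<^sup>2) \<le> (\<integral>\<^sup>+z. ennreal ((u (x - z) - u x)\<^sup>2) * ennreal (bump e z) \<partial>lborel)" for x
  proof -
    have i: "integrable lborel (\<lambda>y. u y * bump e (x - y))" by (rule smooth_approx_integrable[OF u e])
    have flip1: "(\<lambda>y. bump e (x - y)) = (\<lambda>y. bump e (y - x))"
    proof
      fix y show "bump e (x - y) = bump e (y - x)" using bump_uminus[of e "y - x"] by (simp only: minus_diff_eq)
    qed
    have i1: "integrable lborel (\<lambda>y. bump e (x - y))"
      unfolding flip1 by (rule integrable_lborel_shift(1)[OF integrable_bump[OF e]])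
    have "(LINT y|lborel. bump e (x - y)) = 1"
      unfolding flip1 integrable_lborel_shift(2)[OF integrable_bump[OF e]] by (rule integral_bump[OF e])
    then have "smooth_approx e u x - u x = (LINT y|lborel. u y * bump e (x - y) - u x * bump e (x - y))"
      using i i1 by (simp add: smooth_approx_def)
    then have "\<bar>smooth_approx e u x - u x\<bar> \<le> (LINT y|lborel. norm (u y * bump e (x - y) - u x * bump e (x - y)))"
      using integral_norm_bound[of lborel "\<lambda>y. u y * bump e (x - y) - u x * bump e (x - y)"] by simp
    also have "(LINT y|lborel. norm (u y * bump e (x - y) - u x * bump e (x - y))) = (LINT y|lborel. \<bar>u y - u x\<bar> * bump e (x - y))"
      by (intro Bochner_Integration.integral_cong) (auto simp: left_diff_distrib[symmetric] abs_mult bump_nonneg)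
    finally have "ennreal \<bar>smooth_approx e u x - u x\<bar> \<le> ennreal (LINT y|lborel. \<bar>u y - u x\<bar> * bump e (x - y))"
      by (rule ennreal_leI)
    also have "\<dots> = (\<integral>\<^sup>+y. ennreal (\<bar>u y - u x\<bar> * bump e (x - y)) \<partial>lborel)"
    proof (rule nn_integral_eq_integral[symmetric])
      have "integrable lborel (\<lambda>y. \<bar>u y * bump e (x - y) - u x * bump e (x - y)\<bar>)" using i i1 by auto
      then show "integrable lborel (\<lambda>y. \<bar>u y - u x\<bar> * bump e (x - y))"
        by (simp add: left_diff_distrib[symmetric] abs_mult bump_nonneg)
    qed (simp add: bump_nonneg)
    also have "\<dots> = (\<integral>\<^sup>+y. (\<lambda>z. ennreal (\<bar>u (x - z) - u x\<bar> * bump e z)) (x - y) \<partial>lborel)" by simp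
    also have "\<dots> = (\<integral>\<^sup>+z. ennreal (\<bar>u (x - z) - u x\<bar> * bump e z) \<partial>lborel)"
      by (rule flip) measurable
    \<comment> \<open>The density is split into two square roots, so that the second factor in
      Cauchy-Schwarz has integral 1.\<close>
    also have "\<dots> = (\<integral>\<^sup>+z. ennreal (\<bar>u (x - z) - u x\<bar> * sqrt (bump e z)) * ennreal (sqrt (bump e z)) \<partial>lborel)"
      by (intro nn_integral_cong) (simp add: ennreal_mult[symmetric] bump_nonneg mult.assoc)
    finally have "(ennreal \<bar>smooth_approx e u x - u x\<bar>)\<^sup>2 \<le> (\<integral>\<^sup>+z. ennreal (\<bar>u (x - z) - u x\<bar> * sqrt (bump e z)) * ennreal (sqrt (bump e z)) \<partial>lborel)\<^sup>2"
      by (rule power_mono) simp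
    also have "\<dots> \<le> (\<integral>\<^sup>+z. (ennreal (\<bar>u (x - z) - u x\<bar> * sqrt (bump e z)))\<^sup>2 \<partial>lborel) * (\<integral>\<^sup>+z. (ennreal (sqrt (bump e (z :: real^'d))))\<^sup>2 \<partial>lborel)"
      by (rule Cauchy_Schwarz_nn_integral[of "\<lambda>z. ennreal (\<bar>u (x - z) - u x\<bar> * sqrt (bump e z))" lborel "\<lambda>z. ennreal (sqrt (bump e z))"])
        measurable
    also have "(\<integral>\<^sup>+z. (ennreal (sqrt (bump e (z :: real^'d))))\<^sup>2 \<partial>lborel) = 1"
      using one by (simp add: ennreal_power bump_nonneg)
    also have "(\<integral>\<^sup>+z. (ennreal (\<bar>u (x - z) - u x\<bar> * sqrt (bump e z)))\<^sup>2 \<partial>lborel) = (\<integral>\<^sup>+z. ennreal ((u (x - z) - u x)\<^sup>2) * ennreal (bump e z) \<partial>lborel)"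
      by (intro nn_integral_cong) (simp add: ennreal_power ennreal_mult[symmetric] bump_nonneg power_mult_distrib)
    finally show ?thesis by (simp add: ennreal_power)
  qed
  have "(\<integral>\<^sup>+x. ennreal ((smooth_approx e u x - u x)\<^sup>2) \<partial>lborel) \<le> (\<integral>\<^sup>+x. \<integral>\<^sup>+z. ennreal ((u (x - z) - u x)\<^sup>2) * ennreal (bump e z) \<partial>lborel \<partial>lborel)"
    by (intro nn_integral_mono pt)
  also have "\<dots> = (\<integral>\<^sup>+z. \<integral>\<^sup>+x. ennreal ((u (x - z) - u x)\<^sup>2) * ennreal (bump e z) \<partial>lborel \<partial>lborel)"
    by (rule lborel_pair.Fubini') measurable
  also have "\<dots> \<le> (\<integral>\<^sup>+z. ennreal r * ennreal (bump e (z :: real^'d)) \<partial>lborel)"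
  proof (rule nn_integral_mono)
    fix z :: "real^'d"
    show "(\<integral>\<^sup>+x. ennreal ((u (x - z) - u x)\<^sup>2) * ennreal (bump e z) \<partial>lborel) \<le> ennreal r * ennreal (bump e z)"
    proof (cases "norm z \<le> e")
      case True
      have i: "integrable lborel (\<lambda>x. (u (x - z) - u x)\<^sup>2)"
      proof (rule Bochner_Integration.integrable_bound)
        show "integrable lborel (\<lambda>x. 2 * (u (x - z))\<^sup>2 + 2 * (u x)\<^sup>2)"
          using integrable_lborel_shift(1)[OF u2, of z] u2 by simp
        have "(s - t)\<^sup>2 \<le> 2 * s\<^sup>2 + 2 * t\<^sup>2" for s t :: real
          using zero_le_power2[of "s + t"] by (simp add: power2_eq_square algebra_simps)
        then show "AE x in lborel. norm ((u (x - z) - u x)\<^sup>2) \<le> norm (2 * (u (x - z))\<^sup>2 + 2 * (u x)\<^sup>2)" by simp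
      qed measurable
      have "(\<integral>\<^sup>+x. ennreal ((u (x - z) - u x)\<^sup>2) \<partial>lborel) \<le> ennreal r"
        using r[OF True] i by (simp add: nn_integral_eq_integral ennreal_leI)
      then show ?thesis by (simp add: nn_integral_multc mult_right_mono)
    next
      case False
      then show ?thesis using bump_eq_0[OF e, of z] by simp
    qed
  qed
  also have "\<dots> = ennreal r" using one by (simp add: nn_integral_cmult)
  finally show ?thesis .
qed

lemma smooth_approx_tendsto_L2:
  fixes u :: "real^'d \<Rightarrow> real"
  assumes u: "integrable lborel u" and u2: "integrable lborel (\<lambda>x. (u x)\<^sup>2)" and r: "0 < r"
  shows "\<exists>e0>0. \<forall>e. 0 < e \<and> e \<le> e0 \<longrightarrow> (\<integral>\<^sup>+x. ennreal ((smooth_approx e u x - u x)\<^sup>2) \<partial>lborel) \<le> ennreal r"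
proof -
  have [measurable]: "u \<in> borel_measurable borel" using borel_measurable_integrable[OF u] by simp
  \<comment> \<open>Continuity of translation is available along sequences; a failure of uniformity
    would produce a null sequence of shifts contradicting it.\<close>
  have "\<exists>e0>0. \<forall>z. norm z \<le> e0 \<longrightarrow> (LINT x|lborel. (u (x - z) - u x)\<^sup>2) \<le> r"
  proof (rule ccontr)
    assume "\<not> ?thesis"
    then have "\<forall>n. \<exists>z. norm z \<le> 1 / real (Suc n) \<and> r < (LINT x|lborel. (u (x - z) - u x)\<^sup>2)"
      by (metis not_le zero_less_divide_1_iff of_nat_0_less_iff zero_less_Suc)
    then obtain z where z: "\<And>n. norm (z n) \<le> 1 / real (Suc n)" "\<And>n. r < (LINT x|lborel. (u (x - z n) - u x)\<^sup>2)"
      by metis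
    have "z \<longlonglongrightarrow> 0"
      by (rule Lim_null_comparison[OF _ LIMSEQ_inverse_real_of_nat])
         (rule always_eventually, use z(1) in \<open>simp add: inverse_eq_divide\<close>)
    from translation_continuous_L2[OF _ u2 this]
    have "(\<lambda>n. LINT x|lborel. (u (x - z n) - u x)\<^sup>2) \<longlonglongrightarrow> 0" by simp
    then have "r \<le> 0" by (rule LIMSEQ_le_const) (use z(2) less_imp_le in blast)
    then show False using r by simp
  qed
  then obtain e0 where e0: "0 < e0" "\<And>z. norm z \<le> e0 \<Longrightarrow> (LINT x|lborel. (u (x - z) - u x)\<^sup>2) \<le> r" by blast
  show ?thesis
  proof (intro exI[of _ e0] conjI allI impI)
    fix e assume "0 < e \<and> e \<le> e0"
    then show "(\<integral>\<^sup>+x. ennreal ((smooth_approx e u x - u x)\<^sup>2) \<partial>lborel) \<le> ennreal r"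
      by (intro smooth_approx_L2_bound u u2 e0(2)) auto
  qed (rule e0)
qed

text \<open>The mollifier centred at \<open>x\<close> is supported in the ball of radius
  \<open>e\<close>, inside \<Omega>, so it is an admissible test function and moves the derivative
  onto \<open>F\<close>. The two minus signs, from the weak gradient and from the inner reflection y
  \<mapsto> x - y, cancel. Cutting off to \<open>K\<close> makes the functions globally integrable
  and changes nothing on that ball.\<close>

lemma smooth_approx_grad_weak:
  fixes F :: "real^'d \<Rightarrow> real" and G :: "real^'d \<Rightarrow> real^'d"
  assumes wk: "weak_gradient_on \<Omega> F G" and e: "0 < e" and cb: "cball x e \<subseteq> K" "K \<subseteq> \<Omega>"
    and K: "compact K"
  shows "smooth_approx_grad e (\<lambda>y. indicator K y * F y) x $ i = smooth_approx e (\<lambda>y. indicator K y * G y $ i) x"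
proof -
  have iF: "integrable lborel (\<lambda>y. indicator K y * F y)"
    using wk cb(2) K by (simp add: weak_gradient_on_def set_integrable_def)
  have z: "grad_bump e (x - y) = 0 \<and> bump e (x - y) = 0" if "y \<notin> K" for y
  proof -
    have "y \<notin> cball x e" using that cb by auto
    then show ?thesis using e by (simp add: dist_norm grad_bump_eq_0 bump_eq_0)
  qed
  have "smooth_approx_grad e (\<lambda>y. indicator K y * F y) x $ i = (LINT y|lborel. (indicator K y * F y) *\<^sub>R grad_bump e (x - y)) \<bullet> axis i 1"
    by (simp add: smooth_approx_grad_def inner_axis)
  also have "\<dots> = (LINT y|lborel. (indicator K y * F y) *\<^sub>R grad_bump e (x - y) \<bullet> axis i 1)"
    by (rule integral_inner_left[symmetric]) (use smooth_approx_integrable(2)[OF iF e] in simp)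
  also have "\<dots> = (LINT y|lborel. - (F y * partial_deriv i (\<lambda>y. bump e (x - y)) y))"
    by (rule Bochner_Integration.integral_cong) (use z in \<open>auto simp: partial_deriv_bump_shift inner_axis indicator_def\<close>)
  also have "\<dots> = (LINT y|lborel. G y $ i * bump e (x - y))"
    using wk bump_test_function[OF e, of x \<Omega>] cb unfolding weak_gradient_on_def by auto
  also have "\<dots> = smooth_approx e (\<lambda>y. indicator K y * G y $ i) x"
    unfolding smooth_approx_def
    by (rule Bochner_Integration.integral_cong) (use z in \<open>auto simp: indicator_def\<close>)
  finally show ?thesis .
qed

text \<open>The functions are cut off on a closed neighbourhood \<open>K'\<close> of
  \<open>K\<close> inside \<Omega>. For radii up to \<open>e1\<close> the mollified gradient equals
  the mollification of the gradient on \<open>K\<close> itself, where the jump caused by the cutoff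
  is not felt.\<close>

theorem weak_gradient_smooth_approx:
  fixes F :: "real^'d \<Rightarrow> real" and G :: "real^'d \<Rightarrow> real^'d"
  assumes op: "open \<Omega>" and wk: "weak_gradient_on \<Omega> F G"
    and [measurable]: "F \<in> borel_measurable borel" "G \<in> borel_measurable borel"
    and L2: "\<And>K. compact K \<Longrightarrow> K \<subseteq> \<Omega> \<Longrightarrow> integrable lborel (\<lambda>x. indicator K x * (F x)\<^sup>2)"
      "\<And>K. compact K \<Longrightarrow> K \<subseteq> \<Omega> \<Longrightarrow> integrable lborel (\<lambda>x. indicator K x * (norm (G x))\<^sup>2)"
    and K: "compact K" "K \<subseteq> \<Omega>" and r: "0 < r"
  obtains F' G' where "\<And>x. (F' has_derivative (\<lambda>v. v \<bullet> G' x)) (at x)" "continuous_on UNIV G'"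
    "(\<integral>\<^sup>+x. ennreal (indicator K x * (F' x - F x)\<^sup>2) \<partial>lborel) \<le> ennreal r"
    "(\<integral>\<^sup>+x. ennreal (indicator K x * (norm (G' x - G x))\<^sup>2) \<partial>lborel) \<le> ennreal r"
proof -
  obtain e1 where e1: "0 < e1" "(\<Union>x\<in>K. cball x e1) \<subseteq> \<Omega>"
    using compact_subset_open_imp_cball_epsilon_subset[OF K(1) op K(2)] by blast
  define K' where "K' = (\<Union>x\<in>K. cball x e1)"
  have K': "compact K'" "K' \<subseteq> \<Omega>" "K \<subseteq> K'"
    using compact_minkowski_sum_cball[OF K(1), of e1] e1 by (auto simp: K'_def)
  have [measurable]: "K' \<in> sets borel" "K \<in> sets borel" using K' K by (auto simp: borel_closed compact_imp_closed)
  define u where "u y = indicator K' y * F y" for y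
  define g where "g i y = indicator K' y * G y $ i" for i y
  have [measurable]: "(\<lambda>x. G x $ i) \<in> borel_measurable borel" for i
    by (simp add: cart_eq_inner_axis)
  have [measurable]: "u \<in> borel_measurable borel" "g i \<in> borel_measurable borel" for i
    unfolding u_def[abs_def] g_def[abs_def] by measurable
  have iu: "integrable lborel u" and iG: "integrable lborel (\<lambda>y. indicator K' y *\<^sub>R G y)"
    using wk K' by (auto simp: weak_gradient_on_def set_integrable_def u_def[abs_def])
  have ig: "integrable lborel (g i)" for i
    using integrable_inner_left[OF iG, of "axis i 1"] by (simp add: g_def[abs_def] inner_axis)
  have iu2: "integrable lborel (\<lambda>x. (u x)\<^sup>2)"
  proof -
    have "(u x)\<^sup>2 = indicator K' x * (F x)\<^sup>2" for x by (simp add: u_def indicator_def)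
    then show ?thesis using L2(1)[OF K'(1,2)] by simp
  qed
  have ig2: "integrable lborel (\<lambda>x. (g i x)\<^sup>2)" for i
  proof (rule Bochner_Integration.integrable_bound[OF L2(2)[OF K'(1,2)]])
    show "AE x in lborel. norm ((g i x)\<^sup>2) \<le> norm (indicator K' x * (norm (G x))\<^sup>2)"
    proof (intro AE_I2)
      fix x show "norm ((g i x)\<^sup>2) \<le> norm (indicator K' x * (norm (G x))\<^sup>2)"
        using component_le_norm_cart[of "G x" i]
        by (auto simp: g_def indicator_def abs_le_square_iff[symmetric])
    qed
  qed measurable
  \<comment> \<open>The squared norm of the gradient error is a sum over the coordinates; each gets
    an equal share of \<open>r\<close>.\<close>
  define r' where "r' = r / real CARD('d)"
  have r': "0 < r'" "r' \<le> r" using r by (auto simp: r'_def field_simps)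
  obtain e2 where e2: "0 < e2" "\<And>e. 0 < e \<Longrightarrow> e \<le> e2 \<Longrightarrow> (\<integral>\<^sup>+x. ennreal ((smooth_approx e u x - u x)\<^sup>2) \<partial>lborel) \<le> ennreal r"
    using smooth_approx_tendsto_L2[OF iu iu2 r] by blast
  have "\<forall>i. \<exists>e0>0. \<forall>e. 0 < e \<and> e \<le> e0 \<longrightarrow> (\<integral>\<^sup>+x. ennreal ((smooth_approx e (g i) x - g i x)\<^sup>2) \<partial>lborel) \<le> ennreal r'"
    using smooth_approx_tendsto_L2[OF ig ig2 r'(1)] by blast
  then obtain e3 where e3: "\<And>i. 0 < e3 i" "\<And>i e. 0 < e \<Longrightarrow> e \<le> e3 i \<Longrightarrow> (\<integral>\<^sup>+x. ennreal ((smooth_approx e (g i) x - g i x)\<^sup>2) \<partial>lborel) \<le> ennreal r'"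
    by metis
  define e where "e = min e1 (min e2 (Min (range e3)))"
  have e: "0 < e" "e \<le> e1" "e \<le> e2" "e \<le> e3 i" for i
    using e1 e2 e3 by (auto simp: e_def min_le_iff_disj)
  have [measurable]: "smooth_approx e v \<in> borel_measurable borel" if "integrable lborel v" for v :: "real^'d \<Rightarrow> real"
    by (rule borel_measurable_continuous_onI, rule has_derivative_continuous_on[OF has_derivative_at_withinI[OF smooth_approx_has_derivative[OF that e(1)]]])
  show ?thesis
  proof (rule that[of "smooth_approx e u" "smooth_approx_grad e u"])
    show "(smooth_approx e u has_derivative (\<lambda>v. v \<bullet> smooth_approx_grad e u x)) (at x)" for x
      by (rule smooth_approx_has_derivative[OF iu e(1)])
    show "continuous_on UNIV (smooth_approx_grad e u)"
      by (rule continuous_on_smooth_approx_grad[OF iu e(1)])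
    have "(\<integral>\<^sup>+x. ennreal (indicator K x * (smooth_approx e u x - F x)\<^sup>2) \<partial>lborel) \<le> (\<integral>\<^sup>+x. ennreal ((smooth_approx e u x - u x)\<^sup>2) \<partial>lborel)"
      using K'(3) by (intro nn_integral_mono ennreal_leI) (auto simp: indicator_def u_def)
    also have "\<dots> \<le> ennreal r" by (rule e2(2)[OF e(1,3)])
    finally show "(\<integral>\<^sup>+x. ennreal (indicator K x * (smooth_approx e u x - F x)\<^sup>2) \<partial>lborel) \<le> ennreal r" .
    have "(\<integral>\<^sup>+x. ennreal (indicator K x * (norm (smooth_approx_grad e u x - G x))\<^sup>2) \<partial>lborel)
      \<le> (\<integral>\<^sup>+x. (\<Sum>i\<in>UNIV. ennreal ((smooth_approx e (g i) x - g i x)\<^sup>2)) \<partial>lborel)"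
    proof (rule nn_integral_mono)
      fix x
      show "ennreal (indicator K x * (norm (smooth_approx_grad e u x - G x))\<^sup>2) \<le> (\<Sum>i\<in>UNIV. ennreal ((smooth_approx e (g i) x - g i x)\<^sup>2))"
      proof (cases "x \<in> K")
        case True
        have cb: "cball x e \<subseteq> K'" using True e(2) by (force simp: K'_def)
        have "smooth_approx_grad e u x $ i = smooth_approx e (g i) x" for i
          unfolding u_def[abs_def] g_def[abs_def]
          by (rule smooth_approx_grad_weak[OF wk e(1) cb K'(2,1)])
        then have "(norm (smooth_approx_grad e u x - G x))\<^sup>2 = (\<Sum>i\<in>UNIV. (smooth_approx e (g i) x - g i x)\<^sup>2)"
          using subsetD[OF K'(3) True] unfolding power2_norm_eq_inner inner_vec_def
          by (simp add: power2_eq_square g_def)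
        then show ?thesis using True by (simp add: sum_ennreal)
      qed simp
    qed
    also have "\<dots> = (\<Sum>i\<in>UNIV. (\<integral>\<^sup>+x. ennreal ((smooth_approx e (g i) x - g i x)\<^sup>2) \<partial>lborel))"
      using ig by (intro nn_integral_sum) simp
    also have "\<dots> \<le> (\<Sum>i\<in>(UNIV :: 'd set). ennreal r')"
      by (intro sum_mono e3(2) e)
    also have "\<dots> = ennreal r"
      using r' by (simp add: r'_def ennreal_of_nat_eq_real_of_nat ennreal_mult[symmetric])
    finally show "(\<integral>\<^sup>+x. ennreal (indicator K x * (norm (smooth_approx_grad e u x - G x))\<^sup>2) \<partial>lborel) \<le> ennreal r" .
  qed
qed

section \<open>Polar coordinates\<close>

text \<open>At the origin the value is 0, which is not a point of the sphere. This is why the origin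
  is removed, or split off, in the measurability and integration lemmas.\<close>

definition direction :: "real^'d \<Rightarrow> real^'d" where
  "direction x = x /\<^sub>R norm x"

lemma norm_direction: "x \<noteq> 0 \<Longrightarrow> norm (direction x) = 1"
  by (simp add: direction_def)

lemma direction_scaleR: "0 < r \<Longrightarrow> direction (r *\<^sub>R x) = direction x"
  by (simp add: direction_def)

lemma measurable_surface:
  fixes \<phi> :: "real^'d \<Rightarrow> 'b::topological_space"
  assumes "\<phi> \<in> borel_measurable borel"
  shows "\<phi> \<in> borel_measurable surface_measure"
  using measurable_restrict_space1[OF assms] measurable_cong_sets[OF sets_surface_measure refl] by blast

lemma measurable_surface_id: "(\<lambda>\<xi>. \<xi>) \<in> borel_measurable (surface_measure :: (real^'d) measure)"
  by (rule measurable_surface) simp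

lemma measurable_direction[measurable]: "direction \<in> borel_measurable borel"
  unfolding direction_def[abs_def] by measurable

text \<open>Measurability of \<open>w\<close> is known only on the sphere, and the origin is mapped
  outside it, so measurability is checked separately on the origin and on its complement.\<close>

lemma measurable_compose_direction:
  fixes w :: "real^'d \<Rightarrow> 'b::topological_space"
  assumes "w \<in> borel_measurable surface_measure"
  shows "(\<lambda>x. w (direction x)) \<in> borel_measurable borel"
proof (rule measurable_piecewise_restrict[of "{{0}, - {0}}"])
  fix \<Omega> :: "(real^'d) set" assume "\<Omega> \<in> {{0}, - {0}}"
  then show "(\<lambda>x. w (direction x)) \<in> restrict_space borel \<Omega> \<rightarrow>\<^sub>M borel"
  proof
    assume "\<Omega> = {0}"
    then have "(\<lambda>x. w (direction x)) \<in> restrict_space borel \<Omega> \<rightarrow>\<^sub>M borel \<longleftrightarrow> (\<lambda>x. w (direction 0)) \<in> restrict_space borel \<Omega> \<rightarrow>\<^sub>M (borel :: 'b measure)"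
      by (intro measurable_cong) (auto simp: space_restrict_space)
    then show ?thesis by simp
  next
    assume "\<Omega> \<in> {- {0}}"
    then have [simp]: "\<Omega> = - {0}" by simp
    have "direction \<in> restrict_space borel \<Omega> \<rightarrow>\<^sub>M restrict_space borel (sphere 0 1)"
      by (intro measurable_restrict_space2 measurable_restrict_space1 measurable_direction)
         (auto simp: space_restrict_space norm_direction)
    moreover have "w \<in> restrict_space borel (sphere 0 1) \<rightarrow>\<^sub>M borel"
      using assms measurable_cong_sets[OF sets_surface_measure refl] by blast
    ultimately show ?thesis by (rule measurable_compose)
  qed
qed auto

lemma emeasure_cone_scale:
  fixes B :: "(real^'d) set"
  assumes [measurable]: "B \<in> sets borel" and a: "0 < a"
  shows "emeasure lborel {x. x \<noteq> 0 \<and> norm x < a \<and> direction x \<in> B}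
    = ennreal (a ^ CARD('d)) * emeasure lborel {x. x \<noteq> 0 \<and> norm x < 1 \<and> direction x \<in> B}"
proof -
  have [measurable]: "{x :: real^'d. x \<noteq> 0 \<and> norm x < a \<and> direction x \<in> B} \<in> sets borel" for a
    by measurable
  have "emeasure lborel {x. x \<noteq> 0 \<and> norm x < a \<and> direction x \<in> B}
    = emeasure (density (distr lborel borel (\<lambda>x. 0 + a *\<^sub>R x)) (\<lambda>_. ennreal (\<bar>a\<bar> ^ DIM(real^'d)))) {x. x \<noteq> 0 \<and> norm x < a \<and> direction x \<in> B}"
    using lborel_affine[of a "0 :: real^'d"] a by simp
  also have "\<dots> = ennreal (\<bar>a\<bar> ^ CARD('d)) * emeasure lborel ((\<lambda>x. 0 + a *\<^sub>R x) -` {x. x \<noteq> 0 \<and> norm x < a \<and> direction x \<in> B})"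
    by (subst emeasure_density_const) (simp_all add: emeasure_distr)
  also have "(\<lambda>x. 0 + a *\<^sub>R x) -` {x. x \<noteq> 0 \<and> norm x < a \<and> direction x \<in> B} = {x. x \<noteq> 0 \<and> norm x < 1 \<and> direction x \<in> B}"
    using a by (auto simp: direction_scaleR)
  finally show ?thesis using a by simp
qed

lemma emeasure_surface_cone:
  assumes "B \<in> sets borel" "B \<subseteq> sphere 0 1"
  shows "emeasure surface_measure B = of_nat CARD('d) * emeasure lborel {x :: real^'d. x \<noteq> 0 \<and> norm x < 1 \<and> direction x \<in> B}"
proof -
  have "{x \<in> ball 0 1 - {0}. x /\<^sub>R norm x \<in> B} = {x :: real^'d. x \<noteq> 0 \<and> norm x < 1 \<and> direction x \<in> B}"
    by (auto simp: direction_def)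
  then show ?thesis using emeasure_surface_measure[OF assms] by simp
qed

lemma finite_measure_surface: "finite_measure (surface_measure :: (real^'d) measure)"
proof
  have "emeasure lborel {x :: real^'d. x \<noteq> 0 \<and> norm x < 1 \<and> direction x \<in> sphere 0 1} \<le> emeasure lborel (ball (0 :: real^'d) 1)"
    by (rule emeasure_mono) auto
  also have "\<dots> < \<infinity>" using emeasure_lborel_ball_finite by simp
  finally have "emeasure (surface_measure :: (real^'d) measure) (sphere 0 1) < \<infinity>"
    by (subst emeasure_surface_cone) (auto simp: ennreal_mult_less_top ennreal_of_nat_eq_real_of_nat)
  then show "emeasure (surface_measure :: (real^'d) measure) (space surface_measure) \<noteq> \<infinity>"
    by (simp add: space_surface_measure)
qed

definition radial_measure :: "nat \<Rightarrow> real measure" where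
  "radial_measure n = density lborel (\<lambda>r. ennreal (indicator {0<..} r * r ^ (n - 1)))"

lemma emeasure_radial_measure:
  assumes n: "1 \<le> n" shows "emeasure (radial_measure n) {..<a} = ennreal ((max a 0) ^ n) / of_nat n"
proof -
  define b where "b = max a 0"
  have "emeasure (radial_measure n) {..<a} = (\<integral>\<^sup>+r. ennreal (indicator {0<..} r * r ^ (n - 1)) * indicator {..<a} r \<partial>lborel)"
    by (simp add: radial_measure_def emeasure_density)
  also have "\<dots> = (\<integral>\<^sup>+r. ennreal (r ^ (n - 1)) * indicator {0..b} r \<partial>lborel)"
    by (rule nn_integral_cong_AE)
       (use AE_lborel_singleton[of 0] AE_lborel_singleton[of a] in eventually_elim, auto simp: indicator_def b_def)
  also have "\<dots> = ennreal (b ^ n / n - 0 ^ n / n)"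
    by (rule nn_integral_FTC_Icc) (use n in \<open>auto simp: b_def intro!: derivative_eq_intros\<close>)
  also have "\<dots> = ennreal (b ^ n) / of_nat n"
    using n by (simp add: b_def divide_ennreal ennreal_of_nat_eq_real_of_nat power_0_left)
  finally show ?thesis by (simp add: b_def)
qed

lemma sigma_finite_radial_measure: "sigma_finite_measure (radial_measure n)"
  unfolding radial_measure_def
  by (subst sigma_finite_measure.sigma_finite_iff_density_finite[OF sigma_finite_lborel]) auto

text \<open>For fixed \<open>B\<close> both sides are measures in \<open>A\<close>. They agree on
  the half-lines {..<a}: a cone cut at radius a scales like a^d, and the factor d in the surface
  measure cancels the 1/d from integrating r^(d - 1). The half-lines form an intersection-stable
  generator on which the measures are finite.\<close>

lemma emeasure_polar:
  fixes B :: "(real^'d) set"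
  assumes A: "A \<in> sets borel" and B[measurable]: "B \<in> sets borel" "B \<subseteq> sphere 0 1"
  shows "emeasure (radial_measure CARD('d)) A * emeasure surface_measure B
    = emeasure lborel {x. x \<noteq> 0 \<and> norm x \<in> A \<and> direction x \<in> B}"
proof -
  define S where "S = {x :: real^'d. x \<noteq> 0 \<and> direction x \<in> B}"
  have [measurable]: "S \<in> sets borel" unfolding S_def by measurable
  define M where "M = distr (restrict_space lborel S) borel norm"
  define N where "N = scale_measure (emeasure surface_measure B) (radial_measure CARD('d))"
  have setsN: "sets N = sets borel" by (simp add: N_def radial_measure_def)
  have eM: "emeasure M X = emeasure lborel {x. x \<noteq> 0 \<and> norm x \<in> X \<and> direction x \<in> B}" if [measurable]: "X \<in> sets borel" for X
  proof -
    have "emeasure M X = emeasure (restrict_space lborel S) (norm -` X \<inter> S)"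
      unfolding M_def by (subst emeasure_distr) (auto simp: space_restrict_space intro!: measurable_restrict_space1)
    also have "\<dots> = emeasure lborel (norm -` X \<inter> S)"
      by (rule emeasure_restrict_space) auto
    also have "norm -` X \<inter> S = {x. x \<noteq> 0 \<and> norm x \<in> X \<and> direction x \<in> B}" by (auto simp: S_def)
    finally show ?thesis .
  qed
  have fin: "emeasure surface_measure B < \<infinity>"
    using finite_measure.emeasure_finite[OF finite_measure_surface, of B] by (simp add: less_top)
  have eq: "emeasure M {..<a} = emeasure N {..<a}" for a
  proof -
    have M: "emeasure M {..<a} = emeasure lborel {x. x \<noteq> 0 \<and> norm x < a \<and> direction x \<in> B}"
      by (subst eM) auto
    have N: "emeasure N {..<a} = emeasure surface_measure B * (ennreal ((max a 0) ^ CARD('d)) / of_nat CARD('d))"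
      by (simp add: N_def emeasure_radial_measure)
    show ?thesis
    proof (cases "0 < a")
      case True
      define L where "L = emeasure lborel {x. x \<noteq> 0 \<and> norm x < 1 \<and> direction x \<in> B}"
      have "emeasure N {..<a} = of_nat CARD('d) * L * (ennreal (a ^ CARD('d)) / of_nat CARD('d))"
        unfolding N emeasure_surface_cone[OF B] L_def using True by simp
      also have "\<dots> = ennreal (a ^ CARD('d)) * L * of_nat CARD('d) / of_nat CARD('d)"
        by (simp only: ennreal_times_divide mult_ac)
      also have "\<dots> = ennreal (a ^ CARD('d)) * L"
        by (rule ennreal_mult_divide_eq) (auto simp: ennreal_of_nat_eq_real_of_nat)
      also have "\<dots> = emeasure M {..<a}"
        unfolding M L_def by (rule emeasure_cone_scale[OF B(1) True, symmetric])
      finally show ?thesis by simp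
    next
      case False
      then have "{x. x \<noteq> 0 \<and> norm x < a \<and> direction x \<in> B} = {}"
      proof -
        have "\<not> norm x < a" for x :: "real^'d" using False norm_ge_zero[of x] by linarith
        then show ?thesis by simp
      qed
      then show ?thesis unfolding M N using False by (simp only:) (simp add: power_0_left)
    qed
  qed
  have "M = N"
  proof (rule measure_eqI_generator_eq_countable[of "range lessThan" UNIV])
    show "Int_stable (range (lessThan :: real \<Rightarrow> real set))"
    proof -
      have "{..<a} \<inter> {..<b} = {..<min a b}" for a b :: real by auto
      then show ?thesis by (auto simp: Int_stable_def)
    qed
    show "sets M = sigma_sets UNIV (range lessThan)" "sets N = sigma_sets UNIV (range lessThan)"
      unfolding setsN by (simp_all add: M_def borel_Iio)
    show "(\<lambda>n. {..<real n}) ` UNIV \<subseteq> range lessThan" by auto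
    show "\<Union> ((\<lambda>n. {..<real n}) ` UNIV) = UNIV" using reals_Archimedean2 by auto
    fix X assume "X \<in> (\<lambda>n. {..<real n}) ` UNIV"
    then obtain n where "X = {..<real n}" by auto
    then show "emeasure M X \<noteq> \<infinity>"
      using fin by (simp add: eq) (simp add: N_def emeasure_radial_measure ennreal_mult_eq_top_iff ennreal_divide_eq_top_iff less_top[symmetric])
  qed (auto simp: eq)
  then have "emeasure M A = emeasure N A" by simp
  then show ?thesis using eM[OF A] by (simp add: N_def mult.commute)
qed

lemma polar_measure:
  "distr (restrict_space lborel (- {0})) (borel \<Otimes>\<^sub>M restrict_space borel (sphere 0 1)) (\<lambda>x :: real^'d. (norm x, direction x))
    = radial_measure CARD('d) \<Otimes>\<^sub>M surface_measure"
proof (rule pair_measure_eqI[symmetric])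
  show "sigma_finite_measure (radial_measure CARD('d))" by (rule sigma_finite_radial_measure)
  show "sigma_finite_measure (surface_measure :: (real^'d) measure)"
    by (rule finite_measure.axioms(1)[OF finite_measure_surface])
  show "sets (radial_measure CARD('d) \<Otimes>\<^sub>M surface_measure) = sets (distr (restrict_space lborel (- {0})) (borel \<Otimes>\<^sub>M restrict_space borel (sphere 0 1)) (\<lambda>x :: real^'d. (norm x, direction x)))"
    by (simp, rule sets_pair_measure_cong) (simp_all add: radial_measure_def sets_surface_measure)
  fix A and B :: "(real^'d) set" assume A: "A \<in> sets (radial_measure CARD('d))" and B: "B \<in> sets surface_measure"
  then have A': "A \<in> sets borel" by (simp add: radial_measure_def)
  have B': "B \<in> sets borel" "B \<subseteq> sphere 0 1"
    using B by (auto simp: sets_surface_measure sets_restrict_space_iff)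
  have m: "(\<lambda>x :: real^'d. (norm x, direction x)) \<in> restrict_space lborel (- {0}) \<rightarrow>\<^sub>M borel \<Otimes>\<^sub>M restrict_space borel (sphere 0 1)"
    by (intro measurable_Pair measurable_restrict_space2 measurable_restrict_space1)
       (auto simp: space_restrict_space norm_direction)
  have "emeasure (distr (restrict_space lborel (- {0})) (borel \<Otimes>\<^sub>M restrict_space borel (sphere 0 1)) (\<lambda>x :: real^'d. (norm x, direction x))) (A \<times> B)
    = emeasure (restrict_space lborel (- {0})) ((\<lambda>x. (norm x, direction x)) -` (A \<times> B) \<inter> space (restrict_space lborel (- {0})))"
    by (rule emeasure_distr[OF m]) (use A' B B' in \<open>auto simp: sets_surface_measure\<close>)
  also have "(\<lambda>x. (norm x, direction x)) -` (A \<times> B) \<inter> space (restrict_space lborel (- {0})) = {x. x \<noteq> 0 \<and> norm x \<in> A \<and> direction x \<in> B}"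
    by (auto simp: space_restrict_space)
  also have "emeasure (restrict_space lborel (- {0})) \<dots> = emeasure lborel \<dots>"
    by (rule emeasure_restrict_space) auto
  also have "\<dots> = emeasure (radial_measure CARD('d)) A * emeasure surface_measure B"
    by (rule emeasure_polar[OF A' B', symmetric])
  finally show "emeasure (radial_measure CARD('d)) A * emeasure surface_measure B =
    emeasure (distr (restrict_space lborel (- {0})) (borel \<Otimes>\<^sub>M restrict_space borel (sphere 0 1)) (\<lambda>x :: real^'d. (norm x, direction x))) (A \<times> B)"
    by simp
qed

text \<open>The cone over a null set of the sphere is a Lebesgue null set. This carries almost
  everywhere statements, such as the invariance of \<open>f\<close>, from the sphere to its
  homogeneous extension.\<close>

lemma AE_direction:
  assumes "AE \<xi> in (surface_measure :: (real^'d) measure). P \<xi>"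
  shows "AE x in lborel. P (direction (x :: real^'d))"
proof -
  obtain N where N: "{\<xi> \<in> space surface_measure. \<not> P \<xi>} \<subseteq> N" "N \<in> sets surface_measure" "emeasure surface_measure N = 0"
    using assms by (auto elim: AE_E)
  then have N': "N \<in> sets borel" "N \<subseteq> sphere 0 1"
    by (auto simp: sets_surface_measure sets_restrict_space_iff)
  have "emeasure lborel {x. x \<noteq> 0 \<and> norm x \<in> UNIV \<and> direction x \<in> N} = 0"
    using emeasure_polar[of UNIV N] N' N(3) by simp
  then have "{x. x \<noteq> 0 \<and> norm x \<in> UNIV \<and> direction x \<in> N} \<in> null_sets lborel"
    using N'(1) by (auto simp: null_sets_def)
  then have "AE x in lborel. x \<notin> {x. x \<noteq> 0 \<and> norm x \<in> UNIV \<and> direction x \<in> N}"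
    by (rule AE_not_in)
  then show ?thesis
    using AE_lborel_singleton[of 0]
  proof eventually_elim
    case (elim x)
    then have "direction x \<notin> N" "direction x \<in> space surface_measure"
      by (auto simp: space_surface_measure norm_direction)
    then show ?case using N(1) by auto
  qed
qed

lemma polar_integral:
  fixes \<phi> :: "real \<Rightarrow> real" and w :: "real^'d \<Rightarrow> real"
  assumes [measurable]: "\<phi> \<in> borel_measurable borel" and w: "integrable surface_measure w"
    and \<phi>: "integrable lborel (\<lambda>r. indicator {0<..} r * r ^ (CARD('d) - 1) * \<phi> r)"
  shows "integrable lborel (\<lambda>x. \<phi> (norm x) * w (direction x))"
    and "(LINT x|lborel. \<phi> (norm x) * w (direction x))
      = (LINT r|lborel. indicator {0<..} r * r ^ (CARD('d) - 1) * \<phi> r) * (LINT \<xi>|surface_measure. w \<xi>)"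
proof -
  interpret R: sigma_finite_measure "radial_measure CARD('d)" by (rule sigma_finite_radial_measure)
  interpret S: finite_measure "surface_measure :: (real^'d) measure" by (rule finite_measure_surface)
  interpret P: pair_sigma_finite "radial_measure CARD('d)" "surface_measure :: (real^'d) measure" ..
  let ?P = "radial_measure CARD('d) \<Otimes>\<^sub>M (surface_measure :: (real^'d) measure)"
  let ?Q = "borel \<Otimes>\<^sub>M restrict_space borel (sphere (0 :: real^'d) 1)"
  let ?T = "\<lambda>x :: real^'d. (norm x, direction x)"
  have [measurable]: "w \<in> borel_measurable surface_measure" by (rule borel_measurable_integrable[OF w])
  have [measurable]: "\<phi> \<in> borel_measurable (radial_measure CARD('d))" by (simp add: radial_measure_def)
  have sets: "sets ?P = sets ?Q"
    by (rule sets_pair_measure_cong) (simp_all add: radial_measure_def sets_surface_measure)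
  have m: "?T \<in> restrict_space lborel (- {0}) \<rightarrow>\<^sub>M ?Q"
    by (intro measurable_Pair measurable_restrict_space2 measurable_restrict_space1)
       (auto simp: space_restrict_space norm_direction)
  have \<phi>R: "integrable (radial_measure CARD('d)) \<phi>"
    and \<phi>I: "(LINT r|radial_measure CARD('d). \<phi> r) = (LINT r|lborel. indicator {0<..} r * r ^ (CARD('d) - 1) * \<phi> r)"
    unfolding radial_measure_def using \<phi>
    by (auto simp: integrable_density integral_density indicator_def)
  have iP: "integrable ?P (\<lambda>(r, \<xi>). \<phi> r * w \<xi>)"
    by (rule P.Fubini_integrable) (use \<phi>R w in \<open>auto simp: abs_mult\<close>)
  have IP: "integral\<^sup>L ?P (\<lambda>(r, \<xi>). \<phi> r * w \<xi>) = (LINT r|lborel. indicator {0<..} r * r ^ (CARD('d) - 1) * \<phi> r) * (LINT \<xi>|surface_measure. w \<xi>)"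
    using P.integral_fst'[OF iP] by (simp add: \<phi>I)
  have meas: "(\<lambda>(r, \<xi>). \<phi> r * w \<xi>) \<in> borel_measurable ?Q"
    using borel_measurable_integrable[OF iP] measurable_cong_sets[OF sets refl] by blast
  have i1: "integrable (restrict_space lborel (- {0})) (\<lambda>x :: real^'d. \<phi> (norm x) * w (direction x))"
    using iP unfolding polar_measure[symmetric] by (subst (asm) integrable_distr_eq[OF m meas]) simp
  have I1: "(LINT x|restrict_space lborel (- {0}). \<phi> (norm x) * w (direction x)) = integral\<^sup>L ?P (\<lambda>(r, \<xi>). \<phi> r * w \<xi>)"
    unfolding polar_measure[symmetric] by (subst integral_distr[OF m meas]) simp
  have [measurable]: "(\<lambda>x. w (direction x)) \<in> borel_measurable borel"
    by (rule measurable_compose_direction) measurable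
  have ae: "AE x in lborel. indicator (- {0}) x *\<^sub>R (\<phi> (norm x) * w (direction x)) = \<phi> (norm (x :: real^'d)) * w (direction x)"
    using AE_lborel_singleton[of 0] by eventually_elim simp
  have "integrable lborel (\<lambda>x :: real^'d. indicator (- {0}) x *\<^sub>R (\<phi> (norm x) * w (direction x)))"
    using i1 by (simp add: integrable_restrict_space)
  then show "integrable lborel (\<lambda>x. \<phi> (norm x) * w (direction x))"
    by (rule integrable_cong_AE_imp) (use ae in \<open>auto elim: eventually_mono\<close>)
  have "(LINT x|lborel. \<phi> (norm x) * w (direction x)) = (LINT x|lborel. indicator (- {0}) x *\<^sub>R (\<phi> (norm x) * w (direction x)))"
    by (rule integral_cong_AE) (use ae in \<open>auto elim: eventually_mono\<close>)
  also have "\<dots> = (LINT x|restrict_space lborel (- {0}). \<phi> (norm x) * w (direction x))"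
    by (subst integral_restrict_space) auto
  finally show "(LINT x|lborel. \<phi> (norm x) * w (direction x))
      = (LINT r|lborel. indicator {0<..} r * r ^ (CARD('d) - 1) * \<phi> r) * (LINT \<xi>|surface_measure. w \<xi>)"
    by (simp add: I1 IP)
qed

section \<open>Gaussian moments and isometries of Lebesgue measure\<close>

lemma integrable_powr_exp_neg_square:
  fixes a :: real
  assumes "0 \<le> a"
  shows "integrable lborel (\<lambda>r. indicator {0<..} r * (r powr a * exp (- (r\<^sup>2) / 2)))"
proof -
  have "\<exists>C. \<forall>r>0. r powr a * exp (- (r\<^sup>2) / 2) \<le> C * exp (- r)"
  proof -
    have "((\<lambda>r. r powr a * exp (- (r\<^sup>2) / 2) / exp (- r)) \<longlongrightarrow> 0) at_top" by real_asymp
    then have "\<forall>\<^sub>F r in at_top. r powr a * exp (- (r\<^sup>2) / 2) / exp (- r) < 1"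
      by (rule order_tendstoD) simp
    then obtain R where R: "\<And>r. r \<ge> R \<Longrightarrow> r powr a * exp (- (r\<^sup>2) / 2) / exp (- r) < 1"
      by (auto simp: eventually_at_top_linorder)
    define C where "C = max 1 (\<bar>R\<bar> powr a * exp \<bar>R\<bar>)"
    have "r powr a * exp (- (r\<^sup>2) / 2) \<le> C * exp (- r)" if "0 < r" for r
    proof (cases "r \<ge> R")
      case True
      then have "r powr a * exp (- (r\<^sup>2) / 2) \<le> 1 * exp (- r)" using R[of r] by (simp add: field_simps)
      also have "\<dots> \<le> C * exp (- r)" by (intro mult_right_mono) (auto simp: C_def)
      finally show ?thesis .
    next
      case False
      have "r powr a * exp (- (r\<^sup>2) / 2) \<le> \<bar>R\<bar> powr a * 1"
        using False that assms by (intro mult_mono powr_mono2) auto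
      also have "\<dots> \<le> \<bar>R\<bar> powr a * (exp \<bar>R\<bar> * exp (- r))"
        using False that by (intro mult_left_mono) (auto simp: exp_add[symmetric])
      also have "\<dots> = (\<bar>R\<bar> powr a * exp \<bar>R\<bar>) * exp (- r)" by simp
      also have "\<dots> \<le> C * exp (- r)" by (intro mult_right_mono) (auto simp: C_def)
      finally show ?thesis .
    qed
    then show ?thesis by blast
  qed
  then obtain C where C: "\<And>r. 0 < r \<Longrightarrow> r powr a * exp (- (r\<^sup>2) / 2) \<le> C * exp (- r)" by blast
  have "integrable lborel (\<lambda>r. C * (indicator {0..} r * exp (- r)))"
  proof -
    have "(\<lambda>r. exp (- r) :: real) absolutely_integrable_on {0..}"
      using integrable_on_exp_minus_to_infinity[of 1 0] by (intro nonnegative_absolutely_integrable_1) auto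
    then have "integrable lborel (\<lambda>r. indicator {0..} r *\<^sub>R (exp (- r) :: real))"
      unfolding set_integrable_def by (subst (asm) integrable_completion) auto
    then show ?thesis by simp
  qed
  then show ?thesis
  proof (rule Bochner_Integration.integrable_bound)
    show "AE r in lborel. norm (indicator {0<..} r * (r powr a * exp (- (r\<^sup>2) / 2))) \<le> norm (C * (indicator {0..} r * exp (- r)))"
    proof (intro AE_I2)
      fix r :: real
      have "r powr a * exp (- (r\<^sup>2) / 2) \<le> \<bar>C\<bar> * exp (- r)" if "0 < r"
        by (rule order_trans[OF C[OF that] mult_right_mono[OF abs_ge_self]]) simp
      then show "norm (indicator {0<..} r * (r powr a * exp (- (r\<^sup>2) / 2))) \<le> norm (C * (indicator {0..} r * exp (- r)))"
        by (auto simp: indicator_def abs_mult)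
    qed
  qed measurable
qed

text \<open>The difference of the two integrands is the derivative of - r^a exp(- r^2 / 2), which
  vanishes at both ends of the half-line.\<close>

lemma gaussian_moment_step:
  fixes a :: real
  assumes a: "1 \<le> a"
  shows "(LINT r|lborel. indicator {0<..} r * (r powr (a + 1) * exp (- (r\<^sup>2) / 2)))
    = a * (LINT r|lborel. indicator {0<..} r * (r powr (a - 1) * exp (- (r\<^sup>2) / 2)))"
proof -
  let ?F = "\<lambda>r::real. - (r powr a * exp (- (r\<^sup>2) / 2))"
  let ?f = "\<lambda>r::real. r powr (a + 1) * exp (- (r\<^sup>2) / 2) - a * (r powr (a - 1) * exp (- (r\<^sup>2) / 2))"
  note int = integrable_powr_exp_neg_square[of "a + 1"] integrable_powr_exp_neg_square[of "a - 1"]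
  have i: "integrable lborel (\<lambda>r. indicator {0<..} r * ?f r)"
    using int a by (simp add: right_diff_distrib mult.left_commute[of _ a])
  have "(LBINT r=0..\<infinity>. ?f r) = 0 - 0"
  proof (rule interval_integral_FTC_integrable[where F="?F"])
    fix r :: real assume "0 < ereal r"
    then have r: "0 < r" by (simp add: zero_ereal_def)
    have e: "r powr (a + 1) = r powr a * r" using r by (simp add: powr_add)
    have "(?F has_real_derivative ?f r) (at r)"
      using r unfolding e by (auto intro!: derivative_eq_intros simp: algebra_simps)
    then show "(?F has_vector_derivative ?f r) (at r)"
      by (simp add: has_real_derivative_iff_has_vector_derivative)
    show "isCont ?f r" using r by (auto intro!: continuous_intros)
  next
    have "einterval 0 \<infinity> = {0::real<..}" by (auto simp: einterval_def zero_ereal_def)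
    then show "set_integrable lborel (einterval 0 \<infinity>) ?f" using i by (simp add: set_integrable_def)
    have "(?F \<longlongrightarrow> 0) (at_right 0)" using a by real_asymp
    then show "((?F \<circ> real_of_ereal) \<longlongrightarrow> 0) (at_right 0)"
      by (simp add: zero_ereal_def ereal_tendsto_simps)
    have "(?F \<longlongrightarrow> 0) at_top" by real_asymp
    then show "((?F \<circ> real_of_ereal) \<longlongrightarrow> 0) (at_left \<infinity>)"
      by (simp add: ereal_tendsto_simps)
  qed simp
  then have "(LINT r|lborel. indicator {0<..} r * ?f r) = 0"
    by (simp add: interval_lebesgue_integral_0_infty set_lebesgue_integral_def)
  moreover have "(\<lambda>r. indicator {0<..} r * ?f r) = (\<lambda>r. indicator {0<..} r * (r powr (a + 1) * exp (- (r\<^sup>2) / 2))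
     - a * (indicator {0<..} r * (r powr (a - 1) * exp (- (r\<^sup>2) / 2))))"
    by (simp add: fun_eq_iff algebra_simps)
  ultimately show ?thesis using int a by simp
qed

text \<open>Uniqueness of translation invariant measures. The image measure is translation invariant
  by linearity. Integrating 1_A(x) 1_B(y - x) in both orders, with \<open>B\<close> the unit ball,
  gives image(A) |B| = |A| image(B), and image(B) = |B| because the map preserves the ball. The
  symmetry of \<open>B\<close> absorbs the sign that appears after translating.\<close>

lemma lborel_distr_linear_isometric_involution:
  fixes T :: "'a::euclidean_space \<Rightarrow> 'a"
  assumes lin: "linear T" and nrm: "\<And>x. norm (T x) = norm x" and inv: "\<And>x. T (T x) = x"
  shows "distr lborel borel T = lborel"
proof (rule measure_eqI)
  have [measurable]: "T \<in> borel_measurable borel"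
    by (intro borel_measurable_continuous_onI linear_continuous_on linear_linear[THEN iffD2] lin)
  let ?\<mu> = "distr lborel borel T :: 'a measure"
  interpret \<mu>: sigma_finite_measure ?\<mu>
  proof
    have "ball 0 (real n) = T -` ball 0 (real n)" for n using nrm by auto
    then have "emeasure ?\<mu> (ball 0 (real n)) \<noteq> \<infinity>" for n
      using emeasure_lborel_ball_finite[of "0 :: 'a" "real n"] by (simp add: emeasure_distr flip: less_top)
    moreover have "(\<Union>n. ball (0::'a) (real n)) = UNIV"
      using reals_Archimedean2 by auto
    ultimately show "\<exists>A. countable A \<and> A \<subseteq> sets ?\<mu> \<and> \<Union> A = space ?\<mu> \<and> (\<forall>a\<in>A. emeasure ?\<mu> a \<noteq> \<infinity>)"
      by (intro exI[of _ "range (\<lambda>n. ball 0 (real n))"]) auto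
  qed
  interpret P: pair_sigma_finite ?\<mu> "lborel :: 'a measure" ..
  have tr: "(\<integral>\<^sup>+y. f (y + t) \<partial>lborel) = (\<integral>\<^sup>+y. f y \<partial>lborel)" if [measurable]: "f \<in> borel_measurable borel" for f :: "'a \<Rightarrow> ennreal" and t
    by (subst lborel_distr_plus[of t, symmetric], subst nn_integral_distr) (auto simp: add.commute)
  have tr': "(\<integral>\<^sup>+x. f (x + t) \<partial>?\<mu>) = (\<integral>\<^sup>+x. f x \<partial>?\<mu>)" if [measurable]: "f \<in> borel_measurable borel" for f :: "'a \<Rightarrow> ennreal" and t
  proof -
    have "(\<integral>\<^sup>+x. f (x + t) \<partial>?\<mu>) = (\<integral>\<^sup>+x. (\<lambda>z. f (T z)) (x + T t) \<partial>lborel)"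
      by (subst nn_integral_distr) (auto simp: linear_add[OF lin] inv)
    also have "\<dots> = (\<integral>\<^sup>+x. f x \<partial>?\<mu>)" by (subst tr) (auto simp: nn_integral_distr)
    finally show ?thesis .
  qed
  fix A assume "A \<in> sets ?\<mu>"
  then have [measurable]: "A \<in> sets borel" by simp
  define B where "B = ball (0::'a) 1"
  have [measurable]: "B \<in> sets borel" by (simp add: B_def)
  have B: "emeasure ?\<mu> B = emeasure lborel B"
  proof -
    have "T -` B = B" using nrm by (auto simp: B_def)
    then show ?thesis by (simp add: emeasure_distr)
  qed
  have "emeasure ?\<mu> A * emeasure lborel B = (\<integral>\<^sup>+x. \<integral>\<^sup>+y. indicator A x * indicator B (y + - x) \<partial>lborel \<partial>?\<mu>)"
  proof -
    have "(\<integral>\<^sup>+y. indicator B (y + - x) \<partial>lborel) = emeasure lborel B" for x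
      by (subst tr) simp_all
    then show ?thesis by (simp add: nn_integral_cmult nn_integral_multc del: add_uminus_conv_diff)
  qed
  also have "\<dots> = (\<integral>\<^sup>+y. \<integral>\<^sup>+x. indicator A x * indicator B (y + - x) \<partial>?\<mu> \<partial>lborel)"
    by (rule P.Fubini'[symmetric]) measurable
  also have "\<dots> = (\<integral>\<^sup>+y. \<integral>\<^sup>+x. indicator A (x + y) * indicator B (- x) \<partial>?\<mu> \<partial>lborel)"
  proof (rule nn_integral_cong)
    fix y :: 'a
    show "(\<integral>\<^sup>+x. indicator A x * indicator B (y + - x) \<partial>?\<mu>) = (\<integral>\<^sup>+x. indicator A (x + y) * indicator B (- x) \<partial>?\<mu>)"
      using tr'[of "\<lambda>x. indicator A x * indicator B (y + - x)" y] by simp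
  qed
  also have "\<dots> = (\<integral>\<^sup>+x. \<integral>\<^sup>+y. indicator A (x + y) * indicator B (- x) \<partial>lborel \<partial>?\<mu>)"
    by (rule P.Fubini') measurable
  also have "\<dots> = (\<integral>\<^sup>+x. emeasure lborel A * indicator B (- x) \<partial>?\<mu>)"
  proof (rule nn_integral_cong)
    fix x
    have "(\<integral>\<^sup>+y. indicator A (x + y) \<partial>lborel) = emeasure lborel A"
      using tr[of "indicator A" x] by (simp add: add.commute[of x])
    then show "(\<integral>\<^sup>+y. indicator A (x + y) * indicator B (- x) \<partial>lborel) = emeasure lborel A * indicator B (- x)"
      by (simp add: nn_integral_multc)
  qed
  also have "\<dots> = (\<integral>\<^sup>+x. emeasure lborel A * indicator B x \<partial>?\<mu>)"
    by (intro nn_integral_cong) (simp add: B_def indicator_def)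
  also have "\<dots> = emeasure lborel A * emeasure lborel B"
    by (subst nn_integral_cmult) (simp_all add: B)
  finally have "emeasure ?\<mu> A * emeasure lborel B = emeasure lborel A * emeasure lborel B" .
  moreover have "emeasure lborel B \<noteq> 0" "emeasure lborel B \<noteq> top"
    using emeasure_lborel_ball_finite[of "0 :: 'a" 1] open_not_negligible[of B]
    by (auto simp: B_def negligible_iff_null_sets null_sets_def null_sets_completionI)
  ultimately show "emeasure ?\<mu> A = emeasure lborel A"
    by (metis ennreal_mult_divide_eq)
qed simp

section \<open>Root systems and chambers\<close>

lemma linear_reflect: "linear (reflect v)"
  by (rule linearI) (simp_all add: reflect_def inner_add_left algebra_simps add_divide_distrib scaleR_add_left)

lemma inner_reflect:
  assumes "v \<noteq> 0" shows "reflect v x \<bullet> reflect v y = x \<bullet> y"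
proof -
  have "(norm v)\<^sup>2 \<noteq> 0" "v \<bullet> v = (norm v)\<^sup>2" using assms by (auto simp: power2_norm_eq_inner)
  then show ?thesis
    by (simp add: reflect_def inner_diff inner_commute field_simps power2_eq_square)
qed

lemma inner_reflect_self: "reflect v x \<bullet> y = x \<bullet> reflect v y"
  by (simp add: reflect_def inner_diff inner_commute mult.commute)

lemma norm_reflect: "v \<noteq> 0 \<Longrightarrow> norm (reflect v x) = norm x"
  by (simp add: norm_eq_sqrt_inner inner_reflect)

lemma reflect_reflect: "v \<noteq> 0 \<Longrightarrow> reflect v (reflect v x) = x"
  by (simp add: reflect_def inner_diff power2_norm_eq_inner)

lemma reflect_self: "v \<noteq> 0 \<Longrightarrow> reflect v v = - v"
  by (simp add: reflect_def power2_norm_eq_inner scaleR_2[symmetric] del: scaleR_2) (simp add: scaleR_2)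

lemma reflect_minus: "reflect (- v) = reflect v"
  by (simp add: reflect_def fun_eq_iff)

text \<open>Identifies the reflection along an image of \<open>v\<close> as a conjugate of the
  reflection along \<open>v\<close>; the conjugation invariance of \<kappa> is applied through this
  identity.\<close>

lemma reflect_conjugate:
  assumes "u \<noteq> 0" shows "reflect (reflect u v) = reflect u \<circ> reflect v \<circ> inv (reflect u)"
proof -
  have inv: "inv (reflect u) = reflect u"
    using reflect_reflect[OF assms] by (intro inv_unique_comp) (auto simp: fun_eq_iff)
  show ?thesis
  proof
    fix y
    have "(reflect u \<circ> reflect v \<circ> inv (reflect u)) y = reflect u (reflect u y - (2 * (reflect u y \<bullet> v) / (norm v)\<^sup>2) *\<^sub>R v)"
      by (simp add: inv reflect_def[of v])
    also have "\<dots> = y - (2 * (y \<bullet> reflect u v) / (norm v)\<^sup>2) *\<^sub>R reflect u v"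
      by (simp add: linear_diff[OF linear_reflect] linear_scale[OF linear_reflect] reflect_reflect[OF assms] inner_reflect_self)
    finally show "reflect (reflect u v) y = (reflect u \<circ> reflect v \<circ> inv (reflect u)) y"
      by (simp add: reflect_def[of "reflect u v"] norm_reflect[OF assms])
  qed
qed

lemma direction_reflect: "v \<noteq> 0 \<Longrightarrow> direction (reflect v x) = reflect v (direction x)"
  by (simp add: direction_def norm_reflect linear_scale[OF linear_reflect])

lemma distr_reflect: "v \<noteq> 0 \<Longrightarrow> distr lborel borel (reflect v) = lborel"
  by (rule lborel_distr_linear_isometric_involution[OF linear_reflect norm_reflect reflect_reflect])

lemma measurable_reflect[measurable]: "reflect v \<in> borel_measurable borel"
  unfolding reflect_def[abs_def] by measurable

lemma lborel_integral_reflect: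
  fixes f :: "real^'d \<Rightarrow> real"
  assumes "v \<noteq> 0" and [measurable]: "f \<in> borel_measurable borel"
  shows "(LINT x|lborel. f (reflect v x)) = (LINT x|lborel. f x)"
  by (subst (2) distr_reflect[OF assms(1), symmetric], subst integral_distr) simp_all

lemma AE_lborel_hyperplane:
  fixes v :: "real^'d"
  assumes "v \<noteq> 0" shows "AE x in lborel. x \<bullet> v \<noteq> 0"
proof -
  have "negligible {x. v \<bullet> x = 0}" using assms by (intro negligible_hyperplane) auto
  then have "{x. v \<bullet> x = 0} \<in> null_sets lebesgue" by (simp add: negligible_iff_null_sets)
  moreover have "closed {x. v \<bullet> x = 0}" by (rule closed_hyperplane)
  ultimately have "{x. v \<bullet> x = 0} \<in> null_sets lborel"
    by (auto simp: null_sets_def borel_closed)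
  then show ?thesis by (auto simp: inner_commute dest: AE_not_in)
qed

locale root_data =
  fixes Rp :: "(real^'d) set" and \<kappa> :: "real^'d \<Rightarrow> real"
  assumes Rp: "positive_root_system Rp" and \<kappa>: "multiplicity_function Rp \<kappa>"
begin

definition roots :: "(real^'d) set" where "roots = Rp \<union> uminus ` Rp"

text \<open>The root system hidden in \<open>positive_root_system\<close> is closed under negation,
  since reflecting a root along itself negates it. Hence it is recovered as \<open>roots\<close>,
  and closure under reflections and the positive functional can be stated without it.\<close>

lemma roots_properties:
  shows "finite Rp" and "0 \<notin> Rp"
    and reflect_roots: "\<And>u v. u \<in> roots \<Longrightarrow> v \<in> roots \<Longrightarrow> reflect v u \<in> roots"
    and positive_functional: "\<exists>w. \<forall>v\<in>Rp. v \<bullet> w > 0"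
    and uminus_notin_Rp: "\<And>v. v \<in> Rp \<Longrightarrow> - v \<notin> Rp"
proof -
  obtain R w where R: "root_system R" "\<forall>v\<in>R. v \<bullet> w \<noteq> 0" and Rp_eq: "Rp = {v \<in> R. v \<bullet> w > 0}"
    using Rp unfolding positive_root_system_def by blast
  have fin: "finite R" and nz: "0 \<notin> R" and cl: "\<And>u v. u \<in> R \<Longrightarrow> v \<in> R \<Longrightarrow> reflect v u \<in> R"
    using R(1) by (auto simp: root_system_def)
  have um: "- v \<in> R" if "v \<in> R" for v
  proof -
    have "v \<noteq> 0" using that nz by blast
    then show ?thesis using cl[OF that that] reflect_self by metis
  qed
  have "roots = R"
  proof
    show "roots \<subseteq> R" unfolding roots_def using um by (auto simp: Rp_eq)
    show "R \<subseteq> roots"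
    proof
      fix v assume v: "v \<in> R"
      show "v \<in> roots"
      proof (cases "v \<bullet> w > 0")
        case False
        then have "- v \<in> Rp" using v um R(2) by (auto simp: Rp_eq not_less less_le)
        then have "- (- v) \<in> uminus ` Rp" by (rule imageI)
        then show ?thesis unfolding roots_def by simp
      next
        case True
        then have "v \<in> Rp" using v by (simp add: Rp_eq)
        then show ?thesis unfolding roots_def by simp
      qed
    qed
  qed
  then show "\<And>u v. u \<in> roots \<Longrightarrow> v \<in> roots \<Longrightarrow> reflect v u \<in> roots" using cl by simp
  show "finite Rp" "0 \<notin> Rp" "\<exists>w. \<forall>v\<in>Rp. v \<bullet> w > 0" using fin nz by (auto simp: Rp_eq)
  show "\<And>v. v \<in> Rp \<Longrightarrow> - v \<notin> Rp" by (auto simp: Rp_eq)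
qed

lemmas finite_Rp = roots_properties(1) and zero_notin_Rp = roots_properties(2)

lemma root_nonzero: "v \<in> Rp \<Longrightarrow> v \<noteq> 0" "v \<in> roots \<Longrightarrow> v \<noteq> 0"
  using zero_notin_Rp by (auto simp: roots_def)

lemma finite_roots: "finite roots" using finite_Rp by (simp add: roots_def)

lemma Rp_roots: "v \<in> Rp \<Longrightarrow> v \<in> roots" by (simp add: roots_def)

lemma uminus_roots: "v \<in> roots \<Longrightarrow> - v \<in> roots" by (auto simp: roots_def)

lemma \<kappa>_nonneg: "v \<in> Rp \<Longrightarrow> 0 \<le> \<kappa> v"
  using \<kappa> by (simp add: multiplicity_function_def)

text \<open>A reflection along a root permutes the roots up to sign: \<pi> sends a positive root to
  whichever of \<plusminus> its image is positive, and is an involution. The absolute values hide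
  the sign, and \<kappa> is unchanged because the two reflections are conjugate, so the factors of
  the product are only permuted.\<close>

lemma h_weight_reflect:
  assumes u: "u \<in> Rp" shows "h_weight Rp \<kappa> (reflect u x) = h_weight Rp \<kappa> x"
proof -
  have u0: "u \<noteq> 0" using u root_nonzero by auto
  define \<pi> where "\<pi> v = (if reflect u v \<in> Rp then reflect u v else - reflect u v)" for v
  have \<pi>: "\<pi> v \<in> Rp" if "v \<in> Rp" for v
  proof -
    have "reflect u v \<in> roots" using reflect_roots that u by (simp add: Rp_roots)
    then show ?thesis by (auto simp: \<pi>_def roots_def)
  qed
  have \<pi>\<pi>: "\<pi> (\<pi> v) = v" if "v \<in> Rp" for v
    using that uminus_notin_Rp[of v]
    by (auto simp: \<pi>_def reflect_reflect[OF u0] linear_neg[OF linear_reflect])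
  have bij: "bij_betw \<pi> Rp Rp"
    by (rule bij_betwI[of _ _ _ \<pi>]) (use \<pi> \<pi>\<pi> in auto)
  have \<kappa>\<pi>: "\<kappa> (\<pi> v) = \<kappa> v" if v: "v \<in> Rp" for v
  proof -
    have "reflect (\<pi> v) = reflect (reflect u v)" by (simp add: \<pi>_def reflect_minus)
    also have "\<dots> = reflect u \<circ> reflect v \<circ> inv (reflect u)" by (rule reflect_conjugate[OF u0])
    finally have eq: "reflect (\<pi> v) = reflect u \<circ> reflect v \<circ> inv (reflect u)" .
    have "reflect u \<circ> id \<in> reflection_group Rp" by (intro reflection_group.intros u)
    then show ?thesis
      using \<kappa> \<pi>[OF v] v eq unfolding multiplicity_function_def by (metis comp_id)
  qed
  have "h_weight Rp \<kappa> (reflect u x) = (\<Prod>v\<in>Rp. \<bar>x \<bullet> \<pi> v\<bar> powr \<kappa> (\<pi> v))"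
    unfolding h_weight_def
    by (rule prod.cong) (auto simp: \<kappa>\<pi> inner_reflect_self, auto simp: \<pi>_def)
  also have "\<dots> = h_weight Rp \<kappa> x"
    unfolding h_weight_def by (rule prod.reindex_bij_betw[OF bij])
  finally show ?thesis .
qed

lemma measurable_h_weight[measurable]: "h_weight Rp \<kappa> \<in> borel_measurable borel"
  unfolding h_weight_def[abs_def] by measurable

lemma measurable_h_surface: "h_weight Rp \<kappa> \<in> borel_measurable surface_measure"
  by (rule measurable_surface) (rule measurable_h_weight)

lemma h_weight_nonneg: "0 \<le> h_weight Rp \<kappa> x"
  unfolding h_weight_def by (intro prod_nonneg) auto

lemma h_weight_scale:
  assumes r: "0 < r" shows "h_weight Rp \<kappa> (r *\<^sub>R x) = r powr gamma_k Rp \<kappa> * h_weight Rp \<kappa> x"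
proof -
  have "h_weight Rp \<kappa> (r *\<^sub>R x) = (\<Prod>v\<in>Rp. r powr \<kappa> v * \<bar>x \<bullet> v\<bar> powr \<kappa> v)"
    unfolding h_weight_def using r by (intro prod.cong) (auto simp: abs_mult powr_mult)
  also have "\<dots> = r powr gamma_k Rp \<kappa> * h_weight Rp \<kappa> x"
    using r finite_Rp by (simp add: prod.distrib h_weight_def gamma_k_def powr_sum)
  finally show ?thesis .
qed

lemma h_weight_direction: "x \<noteq> 0 \<Longrightarrow> h_weight Rp \<kappa> x = norm x powr gamma_k Rp \<kappa> * h_weight Rp \<kappa> (direction x)"
  using h_weight_scale[of "norm x" "direction x"] by (simp add: direction_def)

lemma h_weight_bounded: obtains C where "\<And>x. norm x \<le> r \<Longrightarrow> h_weight Rp \<kappa> x \<le> C"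
proof -
  have "h_weight Rp \<kappa> x \<le> (\<Prod>v\<in>Rp. (\<bar>r\<bar> * norm v) powr \<kappa> v)" if "norm x \<le> r" for x
    unfolding h_weight_def
  proof (rule prod_mono)
    fix v assume v: "v \<in> Rp"
    have "\<bar>x \<bullet> v\<bar> \<le> norm x * norm v" by (rule Cauchy_Schwarz_ineq2)
    also have "\<dots> \<le> \<bar>r\<bar> * norm v" using that by (intro mult_right_mono) auto
    finally show "0 \<le> \<bar>x \<bullet> v\<bar> powr \<kappa> v \<and> \<bar>x \<bullet> v\<bar> powr \<kappa> v \<le> (\<bar>r\<bar> * norm v) powr \<kappa> v"
      using \<kappa>_nonneg[OF v] by (auto intro: powr_mono2)
  qed
  then show ?thesis using that by blast
qed

lemma continuous_on_h_weight: "continuous_on {x. \<forall>v\<in>Rp. x \<bullet> v \<noteq> 0} (h_weight Rp \<kappa>)"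
  unfolding h_weight_def[abs_def] by (intro continuous_intros) auto

lemma h_weight_pos: "(\<And>v. v \<in> Rp \<Longrightarrow> x \<bullet> v \<noteq> 0) \<Longrightarrow> 0 < h_weight Rp \<kappa> x"
  unfolding h_weight_def by (intro prod_pos) auto

lemma h_weight_lower_bound:
  assumes "compact K" "K \<subseteq> off_hyperplanes Rp"
  obtains c where "0 < c" "\<And>x. x \<in> K \<Longrightarrow> c \<le> h_weight Rp \<kappa> x"
proof (cases "K = {}")
  case False
  have "continuous_on K (h_weight Rp \<kappa>)"
    by (rule continuous_on_subset[OF continuous_on_h_weight]) (use assms(2) in \<open>auto simp: off_hyperplanes_def\<close>)
  from continuous_attains_inf[OF assms(1) False this]
  obtain y where "y \<in> K" "\<And>x. x \<in> K \<Longrightarrow> h_weight Rp \<kappa> y \<le> h_weight Rp \<kappa> x" by blast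
  then show ?thesis
    using that[of "h_weight Rp \<kappa> y"] h_weight_pos assms(2) by (auto simp: off_hyperplanes_def)
qed (use that[of 1] in auto)

lemma open_off_hyperplanes: "open (off_hyperplanes Rp)"
proof -
  have "off_hyperplanes Rp = - {0} \<inter> (\<Inter>v\<in>Rp. {x. x \<bullet> v \<noteq> 0})"
    by (auto simp: off_hyperplanes_def)
  moreover have "open {x. x \<bullet> v \<noteq> 0}" for v :: "real^'d"
    by (intro open_Collect_neq continuous_intros)
  ultimately show ?thesis using finite_Rp by (auto intro!: open_INT)
qed

lemma AE_off_hyperplanes: "AE x in lborel. \<forall>v\<in>roots. (x :: real^'d) \<bullet> v \<noteq> 0"
  using AE_lborel_hyperplane[OF root_nonzero(2)] finite_roots by (simp add: AE_finite_all)

text \<open>The open Weyl chamber of \<open>x\<close> if \<open>x\<close> lies on no reflecting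
  hyperplane, and the empty set otherwise. Indexing chambers by points avoids fixing a base chamber
  and group elements.\<close>

definition chamber :: "real^'d \<Rightarrow> (real^'d) set" where
  "chamber x = {y. \<forall>v\<in>roots. 0 < (x \<bullet> v) * (y \<bullet> v)}"

lemma chamber_reflect:
  assumes u: "u \<in> Rp" shows "y \<in> chamber (reflect u x) \<longleftrightarrow> reflect u y \<in> chamber x"
proof -
  have u0: "u \<noteq> 0" and ur: "u \<in> roots" using u root_nonzero Rp_roots by auto
  have inv: "reflect u ` roots = roots"
  proof
    show "reflect u ` roots \<subseteq> roots" using reflect_roots ur by auto
    show "roots \<subseteq> reflect u ` roots"
      using reflect_roots[OF _ ur] reflect_reflect[OF u0] by (metis image_eqI subsetI)
  qed
  have "y \<in> chamber (reflect u x) \<longleftrightarrow> (\<forall>v\<in>roots. 0 < (reflect u x \<bullet> v) * (y \<bullet> v))"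
    by (simp add: chamber_def)
  also have "\<dots> \<longleftrightarrow> (\<forall>v\<in>reflect u ` roots. 0 < (x \<bullet> v) * (reflect u y \<bullet> v))"
    by (simp add: inner_reflect_self reflect_reflect[OF u0])
  also have "\<dots> \<longleftrightarrow> reflect u y \<in> chamber x" by (simp add: inv chamber_def)
  finally show ?thesis .
qed

lemma chamber_eq:
  assumes "y \<in> chamber x" shows "chamber y = chamber x"
proof -
  have "0 < (y \<bullet> v) * t \<longleftrightarrow> 0 < (x \<bullet> v) * t" if "v \<in> roots" for v t
    using assms that by (auto simp: chamber_def zero_less_mult_iff)
  then show ?thesis by (auto simp: chamber_def)
qed

text \<open>A chamber depends only on the sign pattern of its point on the finitely many
  roots.\<close>

lemma finite_chambers: "finite (range chamber)"
proof -
  have "chamber x = (\<lambda>(P, N). {y. (\<forall>v\<in>roots. (v \<in> P \<and> 0 < y \<bullet> v) \<or> (v \<in> N \<and> y \<bullet> v < 0))}) ({v\<in>roots. 0 < x \<bullet> v}, {v\<in>roots. x \<bullet> v < 0})" for x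
    by (auto simp: chamber_def zero_less_mult_iff)
  then have "range chamber \<subseteq> (\<lambda>(P, N). {y. (\<forall>v\<in>roots. (v \<in> P \<and> 0 < y \<bullet> v) \<or> (v \<in> N \<and> y \<bullet> v < 0))}) ` (Pow roots \<times> Pow roots)"
    by blast
  then show ?thesis by (rule finite_subset) (simp add: finite_roots)
qed

lemma measurable_chamber[measurable]: "chamber x \<in> sets borel"
proof -
  have "chamber x = (\<Inter>v\<in>roots. {y. 0 < (x \<bullet> v) * (y \<bullet> v)})" by (auto simp: chamber_def)
  moreover have "open {y. 0 < (x \<bullet> v) * (y \<bullet> v)}" for v
    by (intro open_Collect_less continuous_intros)
  ultimately have "open (chamber x)" using finite_roots by (auto intro!: open_INT)
  then show ?thesis by simp
qed

text \<open>The orbit of a point is finite because the roots are permuted and the part orthogonal to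
  them is fixed. Among the points of the orbit with the given chamber functional, one that maximizes
  \<open>x \<mapsto> x \<bullet> w\<close> lies in the chamber of \<open>w\<close>, since a reflection in a
  positive root that is negative at \<open>x\<close> would increase this value.\<close>

lemma chambers_conjugate:
  fixes \<Phi> :: "(real^'d) set \<Rightarrow> real"
  assumes \<Phi>: "\<And>u x. u \<in> Rp \<Longrightarrow> \<Phi> (chamber (reflect u x)) = \<Phi> (chamber x)"
    and x: "\<And>v. v \<in> roots \<Longrightarrow> x \<bullet> v \<noteq> 0" and y: "\<And>v. v \<in> roots \<Longrightarrow> y \<bullet> v \<noteq> 0"
  shows "\<Phi> (chamber x) = \<Phi> (chamber y)"
proof -
  obtain w where w: "\<And>v. v \<in> Rp \<Longrightarrow> v \<bullet> w > 0" using positive_functional by blast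
  have "\<Phi> (chamber z) = \<Phi> (chamber w)" if z: "\<And>v. v \<in> roots \<Longrightarrow> z \<bullet> v \<noteq> 0" for z
  proof -
    obtain a b where ab: "a \<in> span roots" "\<And>q. q \<in> span roots \<Longrightarrow> orthogonal b q" "z = a + b"
      using orthogonal_subspace_decomp_exists[of roots z] by blast
    obtain c where c: "a = (\<Sum>u\<in>roots. c u *\<^sub>R u)"
      using ab(1) finite_roots by (auto simp: span_finite)
    \<comment> \<open>A finite set that contains z and is closed under the reflections: every root
      in the expansion of \<open>a\<close> is replaced by an arbitrary root, while \<open>b\<close>,
      being orthogonal to the roots, stays fixed.\<close>
    define Q where "Q = (\<lambda>\<phi>. (\<Sum>u\<in>roots. c u *\<^sub>R \<phi> u) + b) ` (roots \<rightarrow>\<^sub>E roots)"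
    have "finite Q" unfolding Q_def by (intro finite_imageI finite_PiE finite_roots)
    have step: "reflect v p \<in> Q" if v: "v \<in> Rp" and p: "p \<in> Q" for v p
    proof -
      obtain \<phi> where \<phi>: "\<phi> \<in> roots \<rightarrow>\<^sub>E roots" "p = (\<Sum>u\<in>roots. c u *\<^sub>R \<phi> u) + b"
        using p by (auto simp: Q_def)
      have "b \<bullet> v = 0" using ab(2)[of v] v by (auto simp: orthogonal_def Rp_roots span_base)
      then have "reflect v b = b" by (simp add: reflect_def)
      then have "reflect v p = (\<Sum>u\<in>roots. c u *\<^sub>R (\<lambda>u\<in>roots. reflect v (\<phi> u)) u) + b"
        by (simp add: \<phi>(2) linear_add[OF linear_reflect] linear_sum[OF linear_reflect] linear_scale[OF linear_reflect])
      moreover have "(\<lambda>u\<in>roots. reflect v (\<phi> u)) \<in> roots \<rightarrow>\<^sub>E roots"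
        using \<phi>(1) reflect_roots[OF _ Rp_roots[OF v]] by auto
      ultimately show ?thesis unfolding Q_def by blast
    qed
    define Q' where "Q' = {p \<in> Q. \<Phi> (chamber p) = \<Phi> (chamber z) \<and> (\<forall>v\<in>roots. p \<bullet> v \<noteq> 0)}"
    have "z \<in> Q" unfolding Q_def
      by (rule image_eqI[of _ _ "\<lambda>u\<in>roots. u"]) (auto simp: ab(3) c)
    then have "z \<in> Q'" using z by (simp add: Q'_def)
    have finQ': "finite Q'" using \<open>finite Q\<close> by (simp add: Q'_def)
    define m where "m = Max ((\<lambda>p. p \<bullet> w) ` Q')"
    have "m \<in> (\<lambda>p. p \<bullet> w) ` Q'" unfolding m_def using finQ' \<open>z \<in> Q'\<close> by (intro Max_in) auto
    then obtain p where p: "p \<in> Q'" "m = p \<bullet> w" by auto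
    have max: "q \<bullet> w \<le> p \<bullet> w" if "q \<in> Q'" for q
      unfolding p(2)[symmetric] m_def using finQ' that by (intro Max_ge) auto
    have pos: "0 < p \<bullet> v" if v: "v \<in> Rp" for v
    proof (rule ccontr)
      assume "\<not> 0 < p \<bullet> v"
      moreover have "p \<bullet> v \<noteq> 0" using p(1) v by (auto simp: Q'_def Rp_roots)
      ultimately have neg: "p \<bullet> v < 0" by simp
      have v0: "v \<noteq> 0" using v root_nonzero by auto
      have "reflect v p \<in> Q'"
        using p(1) step[OF v] \<Phi>[OF v] v reflect_roots[OF _ Rp_roots[OF v]]
        by (auto simp: Q'_def inner_reflect_self)
      from max[OF this] have "- (2 * (p \<bullet> v) / (norm v)\<^sup>2) * (v \<bullet> w) \<le> 0"
        by (simp add: reflect_def inner_diff_left)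
      moreover have "0 < - (2 * (p \<bullet> v) / (norm v)\<^sup>2) * (v \<bullet> w)"
        using neg v0 w[OF v] by (intro mult_pos_pos) (auto simp: divide_neg_pos)
      ultimately show False by simp
    qed
    have "p \<in> chamber w"
      using pos w by (auto simp: chamber_def roots_def inner_commute[of w])
    then show ?thesis using chamber_eq[of p w] p(1) by (simp add: Q'_def)
  qed
  then show ?thesis using x y by metis
qed

end

section \<open>Integration by parts along affine flows\<close>

lemma Cauchy_Schwarz_integral:
  fixes f g :: "'a \<Rightarrow> real"
  assumes [measurable]: "f \<in> borel_measurable M" "g \<in> borel_measurable M"
    and f: "integrable M (\<lambda>x. (f x)\<^sup>2)" and g: "integrable M (\<lambda>x. (g x)\<^sup>2)"
  shows "integrable M (\<lambda>x. f x * g x)"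
    and "(LINT x|M. \<bar>f x * g x\<bar>)\<^sup>2 \<le> (LINT x|M. (f x)\<^sup>2) * (LINT x|M. (g x)\<^sup>2)"
    and "(LINT x|M. f x * g x)\<^sup>2 \<le> (LINT x|M. (f x)\<^sup>2) * (LINT x|M. (g x)\<^sup>2)"
proof -
  show i: "integrable M (\<lambda>x. f x * g x)"
  proof (rule Bochner_Integration.integrable_bound)
    show "integrable M (\<lambda>x. (f x)\<^sup>2 + (g x)\<^sup>2)" using f g by simp
    have "\<bar>a * b\<bar> \<le> a\<^sup>2 + b\<^sup>2" for a b :: real
    proof -
      have "2 * (\<bar>a\<bar> * \<bar>b\<bar>) \<le> a\<^sup>2 + b\<^sup>2"
        using zero_le_power2[of "\<bar>a\<bar> - \<bar>b\<bar>"] by (simp add: power2_diff)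
      moreover have "0 \<le> \<bar>a\<bar> * \<bar>b\<bar>" by simp
      ultimately show ?thesis unfolding abs_mult by linarith
    qed
    then show "AE x in M. norm (f x * g x) \<le> norm ((f x)\<^sup>2 + (g x)\<^sup>2)" by simp
  qed measurable
  have "(\<integral>\<^sup>+x. ennreal \<bar>f x\<bar> * ennreal \<bar>g x\<bar> \<partial>M)\<^sup>2 \<le> (\<integral>\<^sup>+x. (ennreal \<bar>f x\<bar>)\<^sup>2 \<partial>M) * (\<integral>\<^sup>+x. (ennreal \<bar>g x\<bar>)\<^sup>2 \<partial>M)"
    by (rule Cauchy_Schwarz_nn_integral[of "\<lambda>x. ennreal \<bar>f x\<bar>" M "\<lambda>x. ennreal \<bar>g x\<bar>"]) measurable
  then have "(ennreal (LINT x|M. \<bar>f x * g x\<bar>))\<^sup>2 \<le> ennreal (LINT x|M. (f x)\<^sup>2) * ennreal (LINT x|M. (g x)\<^sup>2)"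
    using f g i by (simp add: ennreal_power ennreal_mult[symmetric] abs_mult[symmetric] nn_integral_eq_integral)
  then show abs: "(LINT x|M. \<bar>f x * g x\<bar>)\<^sup>2 \<le> (LINT x|M. (f x)\<^sup>2) * (LINT x|M. (g x)\<^sup>2)"
    by (simp add: ennreal_power ennreal_mult[symmetric] ennreal_le_iff)
  have "\<bar>LINT x|M. f x * g x\<bar> \<le> (LINT x|M. \<bar>f x * g x\<bar>)" by (rule integral_abs_bound)
  then have "\<bar>LINT x|M. f x * g x\<bar>\<^sup>2 \<le> (LINT x|M. \<bar>f x * g x\<bar>)\<^sup>2" by (intro power_mono) auto
  then show "(LINT x|M. f x * g x)\<^sup>2 \<le> (LINT x|M. (f x)\<^sup>2) * (LINT x|M. (g x)\<^sup>2)"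
    using abs by simp
qed

text \<open>The product is expanded around the limits; Cauchy-Schwarz disposes of the three products
  that contain an error. Only the errors and the limits are assumed square integrable, which is what
  the approximation supplies.\<close>

lemma L2_pairing_tendsto:
  fixes u v :: "'a \<Rightarrow> real"
  assumes [measurable]: "\<And>n. un n \<in> borel_measurable M" "\<And>n. vn n \<in> borel_measurable M"
      "u \<in> borel_measurable M" "v \<in> borel_measurable M"
    and i: "\<And>n. integrable M (\<lambda>x. (un n x - u x)\<^sup>2)" "\<And>n. integrable M (\<lambda>x. (vn n x - v x)\<^sup>2)"
      "integrable M (\<lambda>x. (u x)\<^sup>2)" "integrable M (\<lambda>x. (v x)\<^sup>2)"
    and l: "(\<lambda>n. LINT x|M. (un n x - u x)\<^sup>2) \<longlonglongrightarrow> 0" "(\<lambda>n. LINT x|M. (vn n x - v x)\<^sup>2) \<longlonglongrightarrow> 0"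
  shows "(\<lambda>n. LINT x|M. un n x * vn n x) \<longlonglongrightarrow> (LINT x|M. u x * v x)"
    and "\<And>n. integrable M (\<lambda>x. un n x * vn n x)"
proof -
  have ints: "integrable M (\<lambda>x. (un n x - u x) * (vn n x - v x))" "integrable M (\<lambda>x. (un n x - u x) * v x)"
      "integrable M (\<lambda>x. u x * (vn n x - v x))" "integrable M (\<lambda>x. u x * v x)" for n
    by (rule Cauchy_Schwarz_integral(1); use i in auto)+
  have eq: "un n x * vn n x = (un n x - u x) * (vn n x - v x) + (un n x - u x) * v x + u x * (vn n x - v x) + u x * v x" for n x
    by (simp add: algebra_simps)
  show "integrable M (\<lambda>x. un n x * vn n x)" for n
    unfolding eq using ints by simp
  have z: "(\<lambda>n. LINT x|M. p n x * q n x) \<longlonglongrightarrow> 0"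
    if "\<And>n. (LINT x|M. p n x * q n x)\<^sup>2 \<le> A n * B n" "(\<lambda>n. A n * B n) \<longlonglongrightarrow> 0" for p q :: "nat \<Rightarrow> 'a \<Rightarrow> real" and A B
  proof -
    have "(\<lambda>n. (LINT x|M. p n x * q n x)\<^sup>2) \<longlonglongrightarrow> 0"
      by (rule tendsto_sandwich[OF _ _ tendsto_const that(2)]) (use that(1) in auto)
    then have "(\<lambda>n. sqrt ((LINT x|M. p n x * q n x)\<^sup>2)) \<longlonglongrightarrow> sqrt 0" by (rule tendsto_real_sqrt)
    then show ?thesis by (simp add: tendsto_rabs_zero_iff)
  qed
  have "(\<lambda>n. (LINT x|M. (un n x - u x) * (vn n x - v x)) + (LINT x|M. (un n x - u x) * v x) + (LINT x|M. u x * (vn n x - v x)) + (LINT x|M. u x * v x))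
     \<longlonglongrightarrow> 0 + 0 + 0 + (LINT x|M. u x * v x)"
  proof (intro tendsto_add tendsto_const)
    show "(\<lambda>n. LINT x|M. (un n x - u x) * (vn n x - v x)) \<longlonglongrightarrow> 0"
      by (rule z, rule Cauchy_Schwarz_integral(3)) (use i tendsto_mult[OF l] in auto)
    show "(\<lambda>n. LINT x|M. (un n x - u x) * v x) \<longlonglongrightarrow> 0"
      by (rule z, rule Cauchy_Schwarz_integral(3)) (use i tendsto_mult[OF l(1) tendsto_const] in auto)
    show "(\<lambda>n. LINT x|M. u x * (vn n x - v x)) \<longlonglongrightarrow> 0"
      by (rule z, rule Cauchy_Schwarz_integral(3)) (use i tendsto_mult[OF tendsto_const l(2)] in auto)
  qed
  moreover have "(LINT x|M. (un n x - u x) * (vn n x - v x)) + (LINT x|M. (un n x - u x) * v x) + (LINT x|M. u x * (vn n x - v x)) + (LINT x|M. u x * v x)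
     = (LINT x|M. un n x * vn n x)" for n
    unfolding eq using ints by simp
  ultimately show "(\<lambda>n. LINT x|M. un n x * vn n x) \<longlonglongrightarrow> (LINT x|M. u x * v x)" by simp
qed

lemma lborel_integral_dilation_translation:
  fixes f :: "'a::euclidean_space \<Rightarrow> real"
  assumes [measurable]: "f \<in> borel_measurable borel" and c: "0 < c"
  shows "(LINT x|lborel. f (t + c *\<^sub>R x) * c ^ DIM('a)) = (LINT x|lborel. f x)"
proof -
  have "(LINT x|lborel. f x) = (LINT x|density (distr lborel borel (\<lambda>x. t + c *\<^sub>R x)) (\<lambda>_. ennreal (\<bar>c\<bar> ^ DIM('a))). f x)"
    using lborel_affine[of c t] c by simp
  also have "\<dots> = (LINT x|lborel. f (t + c *\<^sub>R x) * c ^ DIM('a))"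
    using c by (subst integral_density) (auto simp: integral_distr mult.commute)
  finally show ?thesis by simp
qed

text \<open>Infinitesimal form of the change of variables along \<open>x \<mapsto> x + s (\<alpha> x + p)\<close>: the
  factor \<open>c\<close> is invariant along the flow, hence need not be differentiable.\<close>

lemma affine_flow_divergence:
  fixes c u :: "'a::euclidean_space \<Rightarrow> real" and U :: "'a \<Rightarrow> 'a"
  assumes [measurable]: "c \<in> borel_measurable borel" and cb: "\<And>x. \<bar>c x\<bar> \<le> B x" and B: "\<And>x. norm x \<le> R + norm p \<Longrightarrow> B x \<le> C"
    and cinv: "\<And>x s. 0 \<le> s \<Longrightarrow> c (x + s *\<^sub>R (\<alpha> *\<^sub>R x + p)) = c x"
    and u: "\<And>x. (u has_derivative (\<lambda>v. v \<bullet> U x)) (at x)" and U: "continuous_on UNIV U"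
    and supp: "\<And>x. R \<le> norm x \<Longrightarrow> u x = 0" and \<alpha>: "0 \<le> \<alpha>"
  shows "(LINT x|lborel. c x * ((\<alpha> *\<^sub>R x + p) \<bullet> U x + real DIM('a) * \<alpha> * u x)) = 0"
proof -
  define X where "X x = \<alpha> *\<^sub>R x + p" for x
  define d where "d = DIM('a)"
  \<comment> \<open>The pullback of \<open>u\<close> along the flow times its Jacobian. Since
    \<open>c\<close> is constant along the flow, the integral of c \<psi>(s) does not depend on s,
    and the claim is that its derivative at s = 0 vanishes.\<close>
  define \<psi> where "\<psi> s x = u (x + s *\<^sub>R X x) * (1 + s * \<alpha>) ^ d" for s x
  define \<psi>' where "\<psi>' s x = (X x \<bullet> U (x + s *\<^sub>R X x)) * (1 + s * \<alpha>) ^ d + u (x + s *\<^sub>R X x) * (real d * (1 + s * \<alpha>) ^ (d - 1) * \<alpha>)" for s x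
  have uc: "continuous_on UNIV u"
    by (rule has_derivative_continuous_on[OF has_derivative_at_withinI[OF u]])
  have [measurable]: "u \<in> borel_measurable borel" "U \<in> borel_measurable borel"
    using uc U by (auto intro: borel_measurable_continuous_onI)
  have der: "((\<lambda>s. \<psi> s x) has_real_derivative \<psi>' s x) (at s)" for s x
  proof -
    have "((\<lambda>s. x + s *\<^sub>R X x) has_derivative (\<lambda>t. t *\<^sub>R X x)) (at s)"
      by (auto intro!: derivative_eq_intros)
    from has_derivative_compose[OF this u]
    have "((\<lambda>s. u (x + s *\<^sub>R X x)) has_real_derivative (X x \<bullet> U (x + s *\<^sub>R X x))) (at s)"
      by (simp add: has_field_derivative_def mult_commute_abs)
    moreover have "((\<lambda>s. (1 + s * \<alpha>) ^ d) has_real_derivative (real d * (1 + s * \<alpha>) ^ (d - 1) * \<alpha>)) (at s)"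
      by (auto intro!: derivative_eq_intros)
    ultimately show ?thesis
      unfolding \<psi>_def \<psi>'_def by (auto intro!: derivative_eq_intros simp: algebra_simps)
  qed
  \<comment> \<open>For 0 \<le> s \<le> 1 the linear part of the flow does not shrink norms and the
    shift is at most \<open>norm p\<close>, so R + norm p is one radius that works for all these
    s.\<close>
  have zero: "\<psi> s x = 0" if x: "R + norm p < norm x" and s: "0 \<le> s" "s \<le> 1" for s x
  proof -
    have "norm x \<le> norm ((1 + s * \<alpha>) *\<^sub>R x)"
      using s \<alpha> unfolding norm_scaleR by (simp add: mult_le_cancel_right1)
    also have "(1 + s * \<alpha>) *\<^sub>R x = (x + s *\<^sub>R X x) - s *\<^sub>R p"
      by (simp add: X_def algebra_simps)
    also have "norm \<dots> \<le> norm (x + s *\<^sub>R X x) + norm (s *\<^sub>R p)" by (rule norm_triangle_ineq4)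
    also have "norm (s *\<^sub>R p) \<le> norm p" using s by (simp add: mult_left_le_one_le)
    finally have "R \<le> norm (x + s *\<^sub>R X x)" using x by simp
    then show ?thesis by (simp add: \<psi>_def supp)
  qed
  have "continuous_on ({0..1} \<times> cball 0 (R + norm p)) (\<lambda>(s, x). \<psi>' s x)"
    unfolding \<psi>'_def X_def split_beta'
    by (intro continuous_intros continuous_on_compose2[OF U] continuous_on_compose2[OF uc]) auto
  then have "bounded ((\<lambda>(s, x). \<psi>' s x) ` ({0..1} \<times> cball 0 (R + norm p)))"
    by (intro compact_imp_bounded compact_continuous_image compact_Times compact_cball compact_Icc)
  then obtain L where L: "\<And>s x. 0 \<le> s \<Longrightarrow> s \<le> 1 \<Longrightarrow> norm x \<le> R + norm p \<Longrightarrow> \<bar>\<psi>' s x\<bar> \<le> L"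
    unfolding bounded_iff by fastforce
  define s where "s n = 1 / real (Suc n)" for n
  have s: "0 < s n" "s n \<le> 1" for n by (auto simp: s_def)
  have slim: "s \<longlonglongrightarrow> 0" unfolding s_def using LIMSEQ_inverse_real_of_nat by (simp add: inverse_eq_divide)
  have quot: "\<bar>(\<psi> (s n) x - \<psi> 0 x) / s n\<bar> \<le> indicator (cball 0 (R + norm p)) x * \<bar>L\<bar>" for n x
  proof (cases "norm x \<le> R + norm p")
    case True
    obtain t where t: "0 < t" "t < s n" "\<psi> (s n) x - \<psi> 0 x = (s n - 0) * \<psi>' t x"
      using MVT2[of 0 "s n" "\<lambda>s. \<psi> s x" "\<lambda>s. \<psi>' s x"] der s by blast
    then have "(\<psi> (s n) x - \<psi> 0 x) / s n = \<psi>' t x" using s[of n] by simp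
    then show ?thesis using L[of t x] t s[of n] True by (auto simp: indicator_def)
  next
    case False
    then show ?thesis using zero[of x 0] zero[of x "s n"] s[of n] by simp
  qed
  have icontr: "integrable lborel (\<lambda>x. \<bar>C\<bar> * (indicator (cball 0 (R + norm p)) x * \<bar>L\<bar>))"
    by (intro integrable_mult_right integrable_mult_left integrable_real_indicator) (simp_all add: emeasure_compact_finite[unfolded infinity_ennreal_def])
  have dom: "\<bar>c x * ((\<psi> (s n) x - \<psi> 0 x) / s n)\<bar> \<le> \<bar>C\<bar> * (indicator (cball 0 (R + norm p)) x * \<bar>L\<bar>)" for n x
  proof (cases "norm x \<le> R + norm p")
    case True
    have "\<bar>c x\<bar> \<le> \<bar>C\<bar>" using cb[of x] B[OF True] by linarith
    then show ?thesis unfolding abs_mult using quot[of n x] by (intro mult_mono) auto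
  next
    case False
    then show ?thesis using quot[of n x] by (simp add: indicator_def)
  qed
  have [measurable]: "(\<lambda>x. \<psi> t x) \<in> borel_measurable borel" for t
    unfolding \<psi>_def X_def by measurable
  have Xm: "(\<lambda>x. X x) \<in> borel_measurable borel" unfolding X_def by measurable
  have [measurable]: "(\<lambda>x. \<psi>' 0 x) \<in> borel_measurable borel"
    unfolding \<psi>'_def using Xm by measurable
  have "(\<lambda>n. LINT x|lborel. c x * ((\<psi> (s n) x - \<psi> 0 x) / s n)) \<longlonglongrightarrow> (LINT x|lborel. c x * \<psi>' 0 x)"
  proof (rule integral_dominated_convergence[OF _ _ icontr])
    show "AE x in lborel. (\<lambda>n. c x * ((\<psi> (s n) x - \<psi> 0 x) / s n)) \<longlonglongrightarrow> c x * \<psi>' 0 x"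
    proof (intro AE_I2 tendsto_mult tendsto_const)
      fix x
      have "((\<lambda>h. (\<psi> (0 + h) x - \<psi> 0 x) / h) \<longlongrightarrow> \<psi>' 0 x) (at 0)"
        using der[of x 0] by (simp add: DERIV_def)
      then show "(\<lambda>n. (\<psi> (s n) x - \<psi> 0 x) / s n) \<longlonglongrightarrow> \<psi>' 0 x"
        using s(1) slim by (simp add: tendsto_at_iff_sequentially comp_def less_imp_neq[THEN not_sym])
    qed
    show "AE x in lborel. norm (c x * ((\<psi> (s n) x - \<psi> 0 x) / s n)) \<le> \<bar>C\<bar> * (indicator (cball 0 (R + norm p)) x * \<bar>L\<bar>)" for n
      using dom[of _ n] by simp
  qed measurable
  \<comment> \<open>The change of variables y = (1 + s \<alpha>) x + s p, combined with c y = c x,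
    turns the integral of c \<psi>(s) into that of c u.\<close>
  moreover have "(LINT x|lborel. c x * ((\<psi> (s n) x - \<psi> 0 x) / s n)) = 0" for n
  proof -
    have ic: "integrable lborel (\<lambda>x. c x * u x)"
    proof (rule Bochner_Integration.integrable_bound)
      have "integrable lborel u"
        by (rule integrable_continuous_compact_support[OF uc compact_cball[of 0 R]]) (auto intro: supp)
      then show "integrable lborel (\<lambda>x. \<bar>C\<bar> * u x)" by simp
      show "AE x in lborel. norm (c x * u x) \<le> norm (\<bar>C\<bar> * u x)"
      proof (intro AE_I2)
        fix x show "norm (c x * u x) \<le> norm (\<bar>C\<bar> * u x)"
        proof (cases "norm x \<le> R")
          case True
          then have "norm x \<le> R + norm p" by (simp add: add_increasing2)
          then have "\<bar>c x\<bar> \<le> \<bar>C\<bar>" using cb[of x] B[of x] by linarith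
          then show ?thesis by (simp add: abs_mult mult_right_mono)
        qed (simp add: supp)
      qed
    qed measurable
    have eq: "c x * \<psi> (s n) x = (\<lambda>y. c y * u y) (s n *\<^sub>R p + (1 + s n * \<alpha>) *\<^sub>R x) * (1 + s n * \<alpha>) ^ DIM('a)" for x
      using cinv[of "s n" x] s(1)[of n] by (simp add: \<psi>_def d_def X_def algebra_simps)
    have pos: "0 < 1 + s n * \<alpha>" using s(1)[of n] \<alpha> by (simp add: add_pos_nonneg)
    have I: "(LINT x|lborel. c x * \<psi> (s n) x) = (LINT x|lborel. c x * u x)"
      unfolding eq by (rule lborel_integral_dilation_translation[OF _ pos]) measurable
    have i: "integrable lborel (\<lambda>x. c x * \<psi> (s n) x)"
    proof -
      have "integrable lborel (\<lambda>x. c x * ((\<psi> (s n) x - \<psi> 0 x) / s n))"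
        by (rule Bochner_Integration.integrable_bound[OF icontr]) (use dom[of _ n] in \<open>auto intro: order_trans[OF _ abs_ge_self]\<close>)
      then have "integrable lborel (\<lambda>x. s n * (c x * ((\<psi> (s n) x - \<psi> 0 x) / s n)) + c x * u x)"
        by (intro Bochner_Integration.integrable_add ic integrable_mult_right)
      moreover have "s n * (c x * ((\<psi> (s n) x - \<psi> 0 x) / s n)) + c x * u x = c x * \<psi> (s n) x" for x
      proof -
        have *: "s n * (c x * (A / s n)) = c x * A" for A using s(1)[of n] by simp
        have **: "\<psi> 0 x = u x" by (simp add: \<psi>_def)
        show ?thesis unfolding * ** by (simp add: right_diff_distrib)
      qed
      ultimately show ?thesis by simp
    qed
    have \<psi>0: "\<psi> 0 x = u x" for x by (simp add: \<psi>_def)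
    have "(\<lambda>x. c x * ((\<psi> (s n) x - \<psi> 0 x) / s n)) = (\<lambda>x. (c x * \<psi> (s n) x - c x * u x) / s n)"
      unfolding \<psi>0 by (simp add: right_diff_distrib)
    then show ?thesis
      using Bochner_Integration.integral_diff[OF i ic] I by (simp only: integral_divide_zero) simp
  qed
  ultimately have "(\<lambda>n :: nat. 0) \<longlonglongrightarrow> (LINT x|lborel. c x * \<psi>' 0 x)" by (simp only:)
  then have "(LINT x|lborel. c x * \<psi>' 0 x) = 0"
    by (rule LIMSEQ_unique) (rule tendsto_const)
  moreover have "c x * \<psi>' 0 x = c x * ((\<alpha> *\<^sub>R x + p) \<bullet> U x + real DIM('a) * \<alpha> * u x)" for x
    by (simp add: \<psi>'_def X_def d_def algebra_simps)
  ultimately show ?thesis by simp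
qed

section \<open>Radial cutoff on the annulus 1 < |x| < 2\<close>

definition annulus_bump :: "real \<Rightarrow> real" where
  "annulus_bump r = flat 0 ((r\<^sup>2 - 1) * (4 - r\<^sup>2))"

text \<open>The derivative of \<open>annulus_bump\<close> divided by r, so that the gradient of the
  radial cutoff is this factor times \<open>x\<close>, with no division by the norm. The cutoff
  keeps away from the origin, where the homogeneous extension of \<open>f\<close> is
  singular.\<close>

definition annulus_bump_slope :: "real \<Rightarrow> real" where
  "annulus_bump_slope r = flat 1 ((r\<^sup>2 - 1) * (4 - r\<^sup>2)) * (10 - 4 * r\<^sup>2)"

lemma annulus_outside:
  assumes "0 \<le> r" "r \<le> 1 \<or> 2 \<le> r" shows "annulus_bump r = 0" "annulus_bump_slope r = 0"
proof -
  have "(r\<^sup>2 - 1) * (4 - r\<^sup>2) \<le> 0"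
  proof (cases "r \<le> 1")
    case True
    then have "r\<^sup>2 \<le> 1" using assms by (simp add: power_le_one)
    then show ?thesis by (intro mult_nonpos_nonneg) auto
  next
    case False
    then have "2\<^sup>2 \<le> r\<^sup>2" using assms by (intro power_mono) auto
    then show ?thesis by (intro mult_nonneg_nonpos) auto
  qed
  then show "annulus_bump r = 0" "annulus_bump_slope r = 0"
    by (simp_all add: annulus_bump_def annulus_bump_slope_def flat_zero)
qed

lemma annulus_bump_pos: "1 < r \<Longrightarrow> r < 2 \<Longrightarrow> 0 < annulus_bump r"
proof -
  assume r: "1 < r" "r < 2"
  have "1 < r\<^sup>2" using r by (simp add: one_less_power)
  moreover have "r\<^sup>2 < 2\<^sup>2" using r by (intro power_strict_mono) auto
  ultimately show ?thesis by (simp add: annulus_bump_def flat_pos)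
qed

lemma annulus_bump_nonneg: "0 \<le> annulus_bump r"
  by (simp add: annulus_bump_def flat_nonneg)

lemma annulus_bump_has_derivative: "(annulus_bump has_real_derivative r * annulus_bump_slope r) (at r)"
proof -
  have "((\<lambda>r. (r\<^sup>2 - 1) * (4 - r\<^sup>2)) has_real_derivative r * (10 - 4 * r\<^sup>2)) (at r)"
    by (auto intro!: derivative_eq_intros simp: power2_eq_square algebra_simps)
  from DERIV_chain2[OF flat_has_derivative this, of 0]
  show ?thesis
    unfolding annulus_bump_def[abs_def] annulus_bump_slope_def by (simp add: mult_ac)
qed

lemma continuous_on_annulus:
  "continuous_on S annulus_bump" "continuous_on S annulus_bump_slope"
  unfolding annulus_bump_def[abs_def] annulus_bump_slope_def[abs_def]
  by (auto intro!: continuous_intros continuous_on_compose2[OF continuous_on_flat])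

lemma measurable_annulus[measurable]:
  "annulus_bump \<in> borel_measurable borel" "annulus_bump_slope \<in> borel_measurable borel"
  by (intro borel_measurable_continuous_onI continuous_on_annulus)+

lemma annulus_bump_norm_has_derivative:
  fixes x :: "'a::euclidean_space"
  shows "((\<lambda>x. annulus_bump (norm x)) has_derivative (\<lambda>v. v \<bullet> (annulus_bump_slope (norm x) *\<^sub>R x))) (at x)"
proof -
  have eq: "(\<lambda>x :: 'a. annulus_bump (norm x)) = (\<lambda>x. flat 0 ((x \<bullet> x - 1) * (4 - x \<bullet> x)))"
    by (simp add: annulus_bump_def power2_norm_eq_inner)
  have "((\<lambda>x. (x \<bullet> x - 1) * (4 - x \<bullet> x)) has_derivative (\<lambda>v. (10 - 4 * (x \<bullet> x)) * (v \<bullet> x))) (at x)"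
    by (auto intro!: derivative_eq_intros simp: inner_commute algebra_simps)
  moreover have "(flat 0 has_derivative (\<lambda>t. flat 1 ((x \<bullet> x - 1) * (4 - x \<bullet> x)) * t)) (at ((x \<bullet> x - 1) * (4 - x \<bullet> x)))"
    using flat_has_derivative[of 0 "(x \<bullet> x - 1) * (4 - x \<bullet> x)"] by (simp add: has_field_derivative_def)
  ultimately have "((\<lambda>x. flat 0 ((x \<bullet> x - 1) * (4 - x \<bullet> x))) has_derivative
      (\<lambda>v. flat 1 ((x \<bullet> x - 1) * (4 - x \<bullet> x)) * ((10 - 4 * (x \<bullet> x)) * (v \<bullet> x)))) (at x)"
    by (rule has_derivative_compose)
  then show ?thesis unfolding eq
    by (simp add: annulus_bump_slope_def power2_norm_eq_inner mult.assoc)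
qed

lemma integral_annulus_FTC:
  fixes \<phi> \<phi>' :: "real \<Rightarrow> real"
  assumes [measurable]: "\<phi> \<in> borel_measurable borel"
    and \<phi>: "\<And>r. 0 < r \<Longrightarrow> (\<phi> has_real_derivative \<phi>' r) (at r)" "continuous_on {1..2} \<phi>'"
    and out: "\<And>r. 0 < r \<Longrightarrow> r \<notin> {1..2} \<Longrightarrow> \<phi>' r = 0" and ends: "\<phi> 1 = \<phi> 2"
  shows "integrable lborel (\<lambda>r. indicator {0<..} r * \<phi>' r)" "(LINT r|lborel. indicator {0<..} r * \<phi>' r) = 0"
proof -
  have eq: "(\<lambda>r. indicator {0<..} r * \<phi>' r) = (\<lambda>r. indicator {1..2} r *\<^sub>R \<phi>' r)"
    using out by (auto simp: fun_eq_iff indicator_def)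
  have i: "set_integrable lborel {1..2} \<phi>'" by (rule borel_integrable_atLeastAtMost'[OF \<phi>(2)])
  then show "integrable lborel (\<lambda>r. indicator {0<..} r * \<phi>' r)" unfolding eq set_integrable_def .
  have "(LINT r|lborel. indicator {1..2} r *\<^sub>R \<phi>' r) = \<phi> 2 - \<phi> 1"
    by (rule integral_FTC_Icc)
       (use \<phi> in \<open>auto simp: has_real_derivative_iff_has_vector_derivative[symmetric] intro: has_field_derivative_at_within\<close>)
  then show "(LINT r|lborel. indicator {0<..} r * \<phi>' r) = 0"
    unfolding eq using ends by simp
qed

lemma integrable_annulus:
  fixes \<phi> :: "real \<Rightarrow> real"
  assumes c: "continuous_on {1..2} \<phi>" and out: "\<And>r. 0 < r \<Longrightarrow> r \<notin> {1..2} \<Longrightarrow> \<phi> r = (0::real)"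
  shows "integrable lborel (\<lambda>r. indicator {0<..} r * \<phi> r)"
proof -
  have eq: "(\<lambda>r. indicator {0<..} r * \<phi> r) = (\<lambda>r. indicator {1..2} r *\<^sub>R \<phi> r)"
    using out by (auto simp: fun_eq_iff indicator_def)
  show ?thesis unfolding eq using borel_integrable_atLeastAtMost'[OF c] by (simp add: set_integrable_def)
qed

lemma integral_annulus_pos:
  fixes \<phi> :: "real \<Rightarrow> real"
  assumes c: "continuous_on {1..2} \<phi>" and out: "\<And>r. 0 < r \<Longrightarrow> r \<notin> {1..2} \<Longrightarrow> \<phi> r = (0::real)"
    and nn: "\<And>r. 0 < r \<Longrightarrow> 0 \<le> \<phi> r" and pos: "\<And>r. 1 < r \<Longrightarrow> r < 2 \<Longrightarrow> 0 < \<phi> r"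
  shows "0 < (LINT r|lborel. indicator {0<..} r * \<phi> r)"
proof -
  have i: "integrable lborel (\<lambda>r. indicator {0<..} r * \<phi> r)" by (rule integrable_annulus[OF c out])
  have "(LINT r|lborel. indicator {0<..} r * \<phi> r) \<noteq> 0"
  proof
    assume "(LINT r|lborel. indicator {0<..} r * \<phi> r) = 0"
    then have "AE r in lborel. indicator {0<..} r * \<phi> r = 0"
      using integral_nonneg_eq_0_iff_AE[OF i] nn by (simp add: indicator_def)
    then have "AE r in lborel. r \<notin> {1<..<2::real}"
      by eventually_elim (use pos in \<open>force simp: indicator_def\<close>)
    then have "{1<..<2::real} \<in> null_sets lborel" by (subst AE_iff_null_sets) auto
    then show False by (auto simp: null_sets_def)
  qed
  moreover have "0 \<le> (LINT r|lborel. indicator {0<..} r * \<phi> r)"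
    using nn by (intro integral_nonneg_AE AE_I2) (auto simp: indicator_def)
  ultimately show ?thesis by linarith
qed

lemma nn_integral_le_imp_LINT:
  fixes f :: "'a \<Rightarrow> real"
  assumes "f \<in> borel_measurable M" "\<And>x. 0 \<le> f x" "(\<integral>\<^sup>+x. ennreal (f x) \<partial>M) \<le> ennreal r" "0 \<le> r"
  shows "integrable M f" "(LINT x|M. f x) \<le> r"
proof -
  show i: "integrable M f"
    using assms by (intro integrableI_nonneg) (auto intro: le_less_trans)
  show "(LINT x|M. f x) \<le> r"
    using assms(2-4) nn_integral_eq_integral[OF i] by (simp add: ennreal_le_iff)
qed

context root_data
begin

text \<open>The exponent of the radial density: the squared weight is homogeneous of degree 2
  \<gamma> and polar coordinates contribute d - 1.\<close>

lemma lam_exponent: "2 * lambda_k Rp \<kappa> + 1 = 2 * gamma_k Rp \<kappa> + real (CARD('d) - 1)"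
proof -
  have "1 \<le> CARD('d)" by (simp add: Suc_leI)
  then show ?thesis by (simp add: lambda_k_def of_nat_diff field_simps)
qed

lemma weighted_polar_integral:
  fixes u :: "real^'d \<Rightarrow> real"
  assumes [measurable]: "\<phi> \<in> borel_measurable borel"
    and u: "integrable surface_measure (\<lambda>\<xi>. u \<xi> * (h_weight Rp \<kappa> \<xi>)\<^sup>2)"
    and um: "u \<in> borel_measurable surface_measure"
    and \<phi>: "integrable lborel (\<lambda>r. indicator {0<..} r * (r powr (2 * lambda_k Rp \<kappa> + 1) * \<phi> r))"
  shows "integrable lborel (\<lambda>x. \<phi> (norm x) * u (direction x) * (h_weight Rp \<kappa> x)\<^sup>2)"
    and "(LINT x|lborel. \<phi> (norm x) * u (direction x) * (h_weight Rp \<kappa> x)\<^sup>2)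
      = (LINT r|lborel. indicator {0<..} r * (r powr (2 * lambda_k Rp \<kappa> + 1) * \<phi> r)) * (LINT \<xi>|surface_measure. u \<xi> * (h_weight Rp \<kappa> \<xi>)\<^sup>2)"
proof -
  define \<gamma> where "\<gamma> = gamma_k Rp \<kappa>"
  have rad: "indicator {0<..} r * r ^ (CARD('d) - 1) * (r powr (2 * \<gamma>) * \<phi> r) = indicator {0<..} r * (r powr (2 * lambda_k Rp \<kappa> + 1) * \<phi> r)" for r :: real
  proof (cases "0 < r")
    case True
    have "r powr (2 * lambda_k Rp \<kappa> + 1) = r powr (2 * \<gamma>) * r ^ (CARD('d) - 1)"
      unfolding lam_exponent \<gamma>_def powr_add by (simp only: powr_realpow[OF True])
    then show ?thesis by (simp add: mult_ac)
  qed simp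
  have m: "(\<lambda>r. r powr (2 * \<gamma>) * \<phi> r) \<in> borel_measurable borel" by measurable
  have \<phi>': "integrable lborel (\<lambda>r. indicator {0<..} r * r ^ (CARD('d) - 1) * (r powr (2 * \<gamma>) * \<phi> r))"
    unfolding rad by (rule \<phi>)
  have [measurable]: "(\<lambda>x. u (direction x)) \<in> borel_measurable borel" by (rule measurable_compose_direction[OF um])
  note P = polar_integral[OF m u \<phi>', unfolded rad]
  have ae: "AE x in lborel. norm x powr (2 * \<gamma>) * \<phi> (norm x) * (u (direction x) * (h_weight Rp \<kappa> (direction x))\<^sup>2)
     = \<phi> (norm x) * u (direction x) * (h_weight Rp \<kappa> x)\<^sup>2"
    using AE_lborel_singleton[of 0]
  proof eventually_elim
    case (elim x)
    have "(h_weight Rp \<kappa> x)\<^sup>2 = norm x powr (2 * \<gamma>) * (h_weight Rp \<kappa> (direction x))\<^sup>2"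
      unfolding h_weight_direction[OF elim] power_mult_distrib \<gamma>_def
      by (simp add: power2_eq_square powr_add[symmetric])
    then show ?case by simp
  qed
  show "integrable lborel (\<lambda>x. \<phi> (norm x) * u (direction x) * (h_weight Rp \<kappa> x)\<^sup>2)"
    by (rule integrable_cong_AE_imp[OF P(1)]) (use ae in \<open>auto elim: eventually_mono\<close>)
  have "(LINT x|lborel. \<phi> (norm x) * u (direction x) * (h_weight Rp \<kappa> x)\<^sup>2) = (LINT x|lborel. norm x powr (2 * \<gamma>) * \<phi> (norm x) * (u (direction x) * (h_weight Rp \<kappa> (direction x))\<^sup>2))"
    by (rule integral_cong_AE) (use ae in \<open>auto elim: eventually_mono\<close>)
  then show "(LINT x|lborel. \<phi> (norm x) * u (direction x) * (h_weight Rp \<kappa> x)\<^sup>2)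
      = (LINT r|lborel. indicator {0<..} r * (r powr (2 * lambda_k Rp \<kappa> + 1) * \<phi> r)) * (LINT \<xi>|surface_measure. u \<xi> * (h_weight Rp \<kappa> \<xi>)\<^sup>2)"
    using P(2) by simp
qed

text \<open>Compact subsets of the annulus that avoid the hyperplanes and exhaust it up to a null
  set as \<delta> tends to 0.\<close>

definition annulus_core :: "real \<Rightarrow> (real^'d) set" where
  "annulus_core \<delta> = {x. 1 \<le> norm x \<and> norm x \<le> 2 \<and> (\<forall>v\<in>Rp. \<delta> \<le> \<bar>x \<bullet> v\<bar>)}"

lemma annulus_core: "compact (annulus_core \<delta>)" "0 < \<delta> \<Longrightarrow> annulus_core \<delta> \<subseteq> off_hyperplanes Rp"
proof -
  have "annulus_core \<delta> = {x. 1 \<le> norm x} \<inter> cball 0 2 \<inter> (\<Inter>v\<in>Rp. {x. \<delta> \<le> \<bar>x \<bullet> v\<bar>})"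
    by (auto simp: annulus_core_def)
  moreover have "closed {x :: real^'d. 1 \<le> norm x}" "\<And>v :: real^'d. closed {x. \<delta> \<le> \<bar>x \<bullet> v\<bar>}"
    by (intro closed_Collect_le continuous_intros)+
  ultimately have "closed (annulus_core \<delta>)" by (auto intro!: closed_INT closed_Int)
  moreover have "bounded (annulus_core \<delta>)"
    by (rule bounded_subset[OF bounded_cball[of 0 2]]) (auto simp: annulus_core_def)
  ultimately show "compact (annulus_core \<delta>)" by (simp add: compact_eq_bounded_closed)
qed (force simp: annulus_core_def off_hyperplanes_def)

end

section \<open>Weak gradients of homogeneous extensions\<close>

locale invariant_function = root_data Rp \<kappa> for Rp :: "(real^'d) set" and \<kappa> +
  fixes f :: "real^'d \<Rightarrow> real" and g :: "real^'d \<Rightarrow> real^'d"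
  assumes f_meas: "f \<in> borel_measurable surface_measure"
    and grad: "has_weak_sph_gradient Rp f g"
    and inv: "G_invariant Rp f"
    and f2: "integrable surface_measure (\<lambda>\<xi>. (f \<xi>)\<^sup>2 * (h_weight Rp \<kappa> \<xi>)\<^sup>2)"
    and g2: "integrable surface_measure (\<lambda>\<xi>. (norm (g \<xi>))\<^sup>2 * (h_weight Rp \<kappa> \<xi>)\<^sup>2)"
begin

definition F :: "real^'d \<Rightarrow> real" where "F x = f (direction x)"
definition G :: "real^'d \<Rightarrow> real^'d" where "G x = g (direction x) /\<^sub>R norm x"

lemma g_meas: "g \<in> borel_measurable surface_measure"
  using grad by (simp add: has_weak_sph_gradient_def)

lemma measurable_FG[measurable]: "F \<in> borel_measurable borel" "G \<in> borel_measurable borel"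
proof -
  show "F \<in> borel_measurable borel" unfolding F_def[abs_def] by (rule measurable_compose_direction[OF f_meas])
  have [measurable]: "(\<lambda>x. g (direction x)) \<in> borel_measurable borel" by (rule measurable_compose_direction[OF g_meas])
  show "G \<in> borel_measurable borel" unfolding G_def[abs_def] by measurable
qed

lemma weak_FG: "weak_gradient_on (off_hyperplanes Rp) F G"
  using grad by (simp add: has_weak_sph_gradient_def F_def[abs_def] G_def[abs_def] direction_def)

lemma compact_radii:
  assumes K: "compact K" "K \<subseteq> off_hyperplanes Rp"
  obtains r1 r2 where "0 < r1" "r1 \<le> r2" "\<And>x. x \<in> K \<Longrightarrow> r1 \<le> norm x \<and> norm x \<le> r2"
proof (cases "K = {}")
  case False
  have c: "continuous_on K norm" by (intro continuous_intros)
  obtain x y where "x \<in> K" "\<And>z. z \<in> K \<Longrightarrow> norm x \<le> norm z" "y \<in> K" "\<And>z. z \<in> K \<Longrightarrow> norm z \<le> norm y"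
    using continuous_attains_inf[OF K(1) False c] continuous_attains_sup[OF K(1) False c] by blast
  then show ?thesis using that[of "norm x" "norm y"] K(2) by (auto simp: off_hyperplanes_def)
qed (use that[of 1 1] in auto)

lemma integrable_radial_Icc:
  fixes a :: real
  assumes "0 < r1" "continuous_on {r1..r2} \<phi>"
  shows "integrable lborel (\<lambda>r. indicator {0<..} r * (r powr a * (indicator {r1..r2} r * \<phi> r)))"
proof -
  have eq: "(\<lambda>r. indicator {0<..} r * (r powr a * (indicator {r1..r2} r * \<phi> r))) = (\<lambda>r. indicator {r1..r2} r *\<^sub>R (r powr a * \<phi> r))"
    using assms(1) by (auto simp: fun_eq_iff indicator_def)
  have "continuous_on {r1..r2} (\<lambda>r. r powr a * \<phi> r)" using assms by (intro continuous_intros) auto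
  then show ?thesis unfolding eq by (rule borel_integrable_atLeastAtMost'[unfolded set_integrable_def])
qed

text \<open>On a compact set off the hyperplanes the weight is bounded below and the radius is
  bounded away from 0 and from infinity. Weighted square integrability on the sphere therefore gives
  unweighted local square integrability, as mollification requires.\<close>

lemma local_L2:
  assumes K: "compact K" "K \<subseteq> off_hyperplanes Rp"
  shows "integrable lborel (\<lambda>x. indicator K x * (F x)\<^sup>2)" "integrable lborel (\<lambda>x. indicator K x * (norm (G x))\<^sup>2)"
proof -
  have [measurable]: "K \<in> sets borel" using K by (simp add: borel_closed compact_imp_closed)
  obtain r1 r2 where r: "0 < r1" "r1 \<le> r2" "\<And>x. x \<in> K \<Longrightarrow> r1 \<le> norm x \<and> norm x \<le> r2"
    using compact_radii[OF K] by blast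
  obtain c where c: "0 < c" "\<And>x. x \<in> K \<Longrightarrow> c \<le> h_weight Rp \<kappa> x"
    using h_weight_lower_bound[OF K] by blast
  have dom: "integrable lborel (\<lambda>x. indicator K x * U x)"
    if U: "integrable lborel (\<lambda>x. (indicator {r1..r2} (norm x) * \<phi> (norm x)) * u (direction x) * (h_weight Rp \<kappa> x)\<^sup>2)"
      and Um: "U \<in> borel_measurable borel" and eq: "\<And>x. x \<in> K \<Longrightarrow> U x = \<phi> (norm x) * u (direction x)" and nn: "\<And>x. 0 \<le> U x" for U u \<phi>
  proof (rule Bochner_Integration.integrable_bound)
    show "integrable lborel (\<lambda>x. (1 / c\<^sup>2) * ((indicator {r1..r2} (norm x) * \<phi> (norm x)) * u (direction x) * (h_weight Rp \<kappa> x)\<^sup>2))"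
      using U by (rule integrable_mult_right)
    show "AE x in lborel. norm (indicator K x * U x) \<le> norm ((1 / c\<^sup>2) * ((indicator {r1..r2} (norm x) * \<phi> (norm x)) * u (direction x) * (h_weight Rp \<kappa> x)\<^sup>2))"
    proof (intro AE_I2)
      fix x
      show "norm (indicator K x * U x) \<le> norm ((1 / c\<^sup>2) * ((indicator {r1..r2} (norm x) * \<phi> (norm x)) * u (direction x) * (h_weight Rp \<kappa> x)\<^sup>2))"
      proof (cases "x \<in> K")
        case True
        have "c\<^sup>2 \<le> (h_weight Rp \<kappa> x)\<^sup>2" using c True by (intro power_mono) auto
        then have "U x * c\<^sup>2 \<le> U x * (h_weight Rp \<kappa> x)\<^sup>2" using nn by (intro mult_left_mono) auto
        then have "U x \<le> (1 / c\<^sup>2) * (U x * (h_weight Rp \<kappa> x)\<^sup>2)" using c by (simp add: field_simps)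
        also have "\<dots> = (1 / c\<^sup>2) * ((indicator {r1..r2} (norm x) * \<phi> (norm x)) * u (direction x) * (h_weight Rp \<kappa> x)\<^sup>2)"
          using r(3)[OF True] eq[OF True] by simp
        also have "\<dots> \<le> norm \<dots>" unfolding real_norm_def by (rule abs_ge_self)
        finally show ?thesis using True nn[of x] by simp
      qed simp
    qed
  qed (use Um in measurable)
  have "integrable lborel (\<lambda>x. (indicator {r1..r2} (norm x) * 1) * (f (direction x))\<^sup>2 * (h_weight Rp \<kappa> x)\<^sup>2)"
    using r(1) by (intro weighted_polar_integral(1)[OF _ f2] integrable_radial_Icc) (use f_meas in \<open>auto intro!: continuous_intros\<close>)
  then show "integrable lborel (\<lambda>x. indicator K x * (F x)\<^sup>2)"
    by (rule dom) (measurable, simp_all add: F_def)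
  have c2: "continuous_on {r1..r2} (\<lambda>r. 1 / r\<^sup>2)" using r(1) by (intro continuous_intros) auto
  have "integrable lborel (\<lambda>x. (indicator {r1..r2} (norm x) * (1 / (norm x)\<^sup>2)) * (norm (g (direction x)))\<^sup>2 * (h_weight Rp \<kappa> x)\<^sup>2)"
    by (rule weighted_polar_integral(1)[OF _ g2 _ integrable_radial_Icc[OF r(1) c2]]) (use g_meas in auto)
  then show "integrable lborel (\<lambda>x. indicator K x * (norm (G x))\<^sup>2)"
    by (rule dom) (measurable, simp_all add: G_def power_divide divide_simps power_mult_distrib)
qed

lemma smooth_sequence:
  assumes K: "compact K" "K \<subseteq> off_hyperplanes Rp"
  obtains Fn Gn where "\<And>n x. (Fn n has_derivative (\<lambda>v. v \<bullet> Gn n x)) (at x)" "\<And>n. continuous_on UNIV (Gn n)"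
    "\<And>n. integrable lborel (\<lambda>x. indicator K x * (Fn n x - F x)\<^sup>2)" "(\<lambda>n. LINT x|lborel. indicator K x * (Fn n x - F x)\<^sup>2) \<longlonglongrightarrow> 0"
    "\<And>n. integrable lborel (\<lambda>x. indicator K x * (norm (Gn n x - G x))\<^sup>2)" "(\<lambda>n. LINT x|lborel. indicator K x * (norm (Gn n x - G x))\<^sup>2) \<longlonglongrightarrow> 0"
proof -
  have [measurable]: "K \<in> sets borel" using K by (simp add: borel_closed compact_imp_closed)
  have "\<forall>n. \<exists>F' G'. (\<forall>x. (F' has_derivative (\<lambda>v. v \<bullet> G' x)) (at x)) \<and> continuous_on UNIV G' \<and>
    (\<integral>\<^sup>+x. ennreal (indicator K x * (F' x - F x)\<^sup>2) \<partial>lborel) \<le> ennreal (inverse (real (Suc n))) \<and>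
    (\<integral>\<^sup>+x. ennreal (indicator K x * (norm (G' x - G x))\<^sup>2) \<partial>lborel) \<le> ennreal (inverse (real (Suc n)))"
  proof
    fix n
    have pos: "0 < inverse (real (Suc n))" by simp
    obtain F' G' where "\<And>x. (F' has_derivative (\<lambda>v. v \<bullet> G' x)) (at x)" "continuous_on UNIV G'"
      "(\<integral>\<^sup>+x. ennreal (indicator K x * (F' x - F x)\<^sup>2) \<partial>lborel) \<le> ennreal (inverse (real (Suc n)))"
      "(\<integral>\<^sup>+x. ennreal (indicator K x * (norm (G' x - G x))\<^sup>2) \<partial>lborel) \<le> ennreal (inverse (real (Suc n)))"
      using weak_gradient_smooth_approx[OF open_off_hyperplanes weak_FG measurable_FG local_L2 K pos]
      by blast
    then show "\<exists>F' G'. (\<forall>x. (F' has_derivative (\<lambda>v. v \<bullet> G' x)) (at x)) \<and> continuous_on UNIV G' \<and>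
    (\<integral>\<^sup>+x. ennreal (indicator K x * (F' x - F x)\<^sup>2) \<partial>lborel) \<le> ennreal (inverse (real (Suc n))) \<and>
    (\<integral>\<^sup>+x. ennreal (indicator K x * (norm (G' x - G x))\<^sup>2) \<partial>lborel) \<le> ennreal (inverse (real (Suc n)))"
      by blast
  qed
  from choice[OF this] obtain Fn where "\<forall>n. \<exists>G'. (\<forall>x. (Fn n has_derivative (\<lambda>v. v \<bullet> G' x)) (at x)) \<and> continuous_on UNIV G' \<and>
    (\<integral>\<^sup>+x. ennreal (indicator K x * (Fn n x - F x)\<^sup>2) \<partial>lborel) \<le> ennreal (inverse (real (Suc n))) \<and>
    (\<integral>\<^sup>+x. ennreal (indicator K x * (norm (G' x - G x))\<^sup>2) \<partial>lborel) \<le> ennreal (inverse (real (Suc n)))" ..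
  from choice[OF this] obtain Gn where FG': "\<forall>n. (\<forall>x. (Fn n has_derivative (\<lambda>v. v \<bullet> Gn n x)) (at x)) \<and> continuous_on UNIV (Gn n) \<and>
    (\<integral>\<^sup>+x. ennreal (indicator K x * (Fn n x - F x)\<^sup>2) \<partial>lborel) \<le> ennreal (inverse (real (Suc n))) \<and>
    (\<integral>\<^sup>+x. ennreal (indicator K x * (norm (Gn n x - G x))\<^sup>2) \<partial>lborel) \<le> ennreal (inverse (real (Suc n)))" ..
  then have FG: "\<And>n x. (Fn n has_derivative (\<lambda>v. v \<bullet> Gn n x)) (at x)" "\<And>n. continuous_on UNIV (Gn n)"
    "\<And>n. (\<integral>\<^sup>+x. ennreal (indicator K x * (Fn n x - F x)\<^sup>2) \<partial>lborel) \<le> ennreal (inverse (real (Suc n)))"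
    "\<And>n. (\<integral>\<^sup>+x. ennreal (indicator K x * (norm (Gn n x - G x))\<^sup>2) \<partial>lborel) \<le> ennreal (inverse (real (Suc n)))"
    by blast+
  have [measurable]: "Fn n \<in> borel_measurable borel" "Gn n \<in> borel_measurable borel" for n
    using FG(2) has_derivative_continuous_on[OF has_derivative_at_withinI[OF FG(1)]]
    by (auto intro: borel_measurable_continuous_onI)
  have a: "integrable lborel (\<lambda>x. indicator K x * (Fn n x - F x)\<^sup>2)" "(LINT x|lborel. indicator K x * (Fn n x - F x)\<^sup>2) \<le> inverse (real (Suc n))" for n
    by (rule nn_integral_le_imp_LINT[OF _ _ FG(3)]; (measurable | simp add: zero_le_mult_iff))+
  have b: "integrable lborel (\<lambda>x. indicator K x * (norm (Gn n x - G x))\<^sup>2)" "(LINT x|lborel. indicator K x * (norm (Gn n x - G x))\<^sup>2) \<le> inverse (real (Suc n))" for n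
    by (rule nn_integral_le_imp_LINT[OF _ _ FG(4)]; (measurable | simp add: zero_le_mult_iff))+
  show ?thesis
  proof (rule that[of Fn Gn])
    show "(\<lambda>n. LINT x|lborel. indicator K x * (Fn n x - F x)\<^sup>2) \<longlonglongrightarrow> 0"
      by (rule tendsto_sandwich[OF _ _ tendsto_const LIMSEQ_inverse_real_of_nat]) (use a(2) in auto)
    show "(\<lambda>n. LINT x|lborel. indicator K x * (norm (Gn n x - G x))\<^sup>2) \<longlonglongrightarrow> 0"
      by (rule tendsto_sandwich[OF _ _ tendsto_const LIMSEQ_inverse_real_of_nat]) (use b(2) in auto)
  qed (use FG a b in auto)
qed

text \<open>The divergence identity for u = F^2 times the radial cutoff. It holds for the
  mollifications of \<open>F\<close>, and since \<open>c\<close> vanishes on the part of the annulus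
  outside \<open>annulus_core\<close>, only a compact set off the hyperplanes matters; there the
  mollifications and their gradients converge in L2. Writing the integrand as a product of
  \<open>F\<close> and an expression linear in \<open>F\<close> and \<open>G\<close> makes L2
  convergence of the two factors sufficient.\<close>

lemma weak_flow_identity:
  assumes [measurable]: "c \<in> borel_measurable borel" and cb: "\<And>x. \<bar>c x\<bar> \<le> B x" and B: "\<And>x. norm x \<le> 2 + norm p \<Longrightarrow> B x \<le> C"
    and cinv: "\<And>x s. 0 \<le> s \<Longrightarrow> c (x + s *\<^sub>R (\<alpha> *\<^sub>R x + p)) = c x"
    and \<alpha>: "0 \<le> \<alpha>" and \<delta>: "0 < \<delta>"
    and core: "\<And>x. 1 \<le> norm x \<Longrightarrow> norm x \<le> 2 \<Longrightarrow> x \<notin> annulus_core \<delta> \<Longrightarrow> c x = 0"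
  shows "(LINT x|lborel. c x * (2 * F x * (G x \<bullet> (\<alpha> *\<^sub>R x + p)) * annulus_bump (norm x)
      + (F x)\<^sup>2 * (annulus_bump_slope (norm x) * (x \<bullet> (\<alpha> *\<^sub>R x + p)) + real CARD('d) * \<alpha> * annulus_bump (norm x)))) = 0"
proof -
  define K where "K = annulus_core \<delta>"
  have K: "compact K" "K \<subseteq> off_hyperplanes Rp" using annulus_core \<delta> by (auto simp: K_def)
  have [measurable]: "K \<in> sets borel" using K by (simp add: borel_closed compact_imp_closed)
  define X where "X x = \<alpha> *\<^sub>R x + p" for x :: "real^'d"
  have [measurable]: "X \<in> borel_measurable borel" unfolding X_def[abs_def] by measurable
  define A S where "A x = annulus_bump (norm x)" and "S x = annulus_bump_slope (norm x) * (x \<bullet> X x) + real CARD('d) * \<alpha> * A x" for x :: "real^'d"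
  have [measurable]: "A \<in> borel_measurable borel" "S \<in> borel_measurable borel"
    unfolding A_def[abs_def] S_def[abs_def] by measurable
  have contA: "continuous_on UNIV A" "continuous_on UNIV S" "continuous_on UNIV X"
    unfolding A_def[abs_def] S_def[abs_def] X_def[abs_def]
    by (intro continuous_intros continuous_on_compose2[OF continuous_on_annulus(1)[of UNIV]] continuous_on_compose2[OF continuous_on_annulus(2)[of UNIV]]; simp)+
  obtain L where L: "\<And>x. x \<in> K \<Longrightarrow> \<bar>A x\<bar> \<le> L \<and> \<bar>S x\<bar> \<le> L \<and> norm (X x) \<le> L"
  proof -
    have "bounded (A ` K)" "bounded (S ` K)" "bounded (X ` K)"
      using K(1) contA by (auto intro!: compact_imp_bounded compact_continuous_image intro: continuous_on_subset)
    then obtain a b d where "\<And>x. x \<in> K \<Longrightarrow> norm (A x) \<le> a" "\<And>x. x \<in> K \<Longrightarrow> norm (S x) \<le> b" "\<And>x. x \<in> K \<Longrightarrow> norm (X x) \<le> d"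
      unfolding bounded_iff by (meson imageI)
    then show ?thesis using that[of "max a (max b d)"] by (force simp: le_max_iff_disj)
  qed
  have cC: "\<bar>c x\<bar> \<le> \<bar>C\<bar>" if "x \<in> K" for x
  proof -
    have "norm x \<le> 2 + norm p" using that by (simp add: K_def annulus_core_def add_increasing2)
    then show ?thesis using cb[of x] B[of x] by linarith
  qed
  obtain Fn Gn where FG: "\<And>n x. (Fn n has_derivative (\<lambda>v. v \<bullet> Gn n x)) (at x)" "\<And>n. continuous_on UNIV (Gn n)"
    and FGi: "\<And>n. integrable lborel (\<lambda>x. indicator K x * (Fn n x - F x)\<^sup>2)" "(\<lambda>n. LINT x|lborel. indicator K x * (Fn n x - F x)\<^sup>2) \<longlonglongrightarrow> 0"
      "\<And>n. integrable lborel (\<lambda>x. indicator K x * (norm (Gn n x - G x))\<^sup>2)" "(\<lambda>n. LINT x|lborel. indicator K x * (norm (Gn n x - G x))\<^sup>2) \<longlonglongrightarrow> 0"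
    using smooth_sequence[OF K] by blast
  have Fc: "continuous_on UNIV (Fn n)" for n
    by (rule has_derivative_continuous_on[OF has_derivative_at_withinI[OF FG(1)]])
  have [measurable]: "Fn n \<in> borel_measurable borel" "Gn n \<in> borel_measurable borel" for n
    using FG(2) Fc by (auto intro: borel_measurable_continuous_onI)
  define un u where "un n x = indicator K x * Fn n x" and "u x = indicator K x * F x" for n x
  \<comment> \<open>The second factor, linear in the function and its gradient. Linearity lets the
    bound \<open>vbound\<close> serve both the limit and the errors.\<close>
  define vn v where "vn n x = indicator K x * (c x * (2 * (Gn n x \<bullet> X x) * A x + Fn n x * S x))"
    and "v x = indicator K x * (c x * (2 * (G x \<bullet> X x) * A x + F x * S x))" for n x
  have [measurable]: "un n \<in> borel_measurable borel" "u \<in> borel_measurable borel" "vn n \<in> borel_measurable borel" "v \<in> borel_measurable borel" for n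
    unfolding un_def[abs_def] u_def[abs_def] vn_def[abs_def] v_def[abs_def] by measurable
  define Q where "Q = 2 * \<bar>C\<bar>\<^sup>2 * (4 * L ^ 4 + L\<^sup>2)"
  have vbound: "(vv)\<^sup>2 \<le> Q * (indicator K x * (norm y)\<^sup>2 + indicator K x * t\<^sup>2)"
    if "vv = indicator K x * (c x * (2 * (y \<bullet> X x) * A x + t * S x))" for vv x y t
  proof (cases "x \<in> K")
    case True
    have L': "\<bar>A x\<bar> \<le> L" "\<bar>S x\<bar> \<le> L" "norm (X x) \<le> L" using L[OF True] by auto
    then have L0: "0 \<le> L" by linarith
    have "\<bar>y \<bullet> X x\<bar> \<le> norm y * L"
      using Cauchy_Schwarz_ineq2[of y "X x"] mult_left_mono[OF L'(3) norm_ge_zero[of y]] by linarith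
    then have "\<bar>(y \<bullet> X x) * A x\<bar> \<le> (norm y * L) * L"
      unfolding abs_mult using L' L0 by (intro mult_mono) auto
    then have "\<bar>2 * (y \<bullet> X x) * A x\<bar> \<le> 2 * L\<^sup>2 * norm y" by (simp add: abs_mult power2_eq_square mult_ac)
    then have a: "(2 * (y \<bullet> X x) * A x)\<^sup>2 \<le> (2 * L\<^sup>2 * norm y)\<^sup>2"
      using L0 by (intro abs_le_square_iff[THEN iffD1]) simp
    have "\<bar>t * S x\<bar> \<le> \<bar>t\<bar> * L" unfolding abs_mult using L' by (intro mult_left_mono) auto
    then have b: "(t * S x)\<^sup>2 \<le> (\<bar>t\<bar> * L)\<^sup>2" using L0 by (intro abs_le_square_iff[THEN iffD1]) simp
    have sq: "(p + q)\<^sup>2 \<le> 2 * p\<^sup>2 + 2 * q\<^sup>2" for p q :: real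
      using zero_le_power2[of "p - q"] by (simp add: power2_eq_square algebra_simps)
    have "(2 * (y \<bullet> X x) * A x + t * S x)\<^sup>2 \<le> 2 * (2 * L\<^sup>2 * norm y)\<^sup>2 + 2 * (\<bar>t\<bar> * L)\<^sup>2"
      using sq[of "2 * (y \<bullet> X x) * A x" "t * S x"] a b by linarith
    also have "\<dots> = 2 * (4 * L ^ 4) * (norm y)\<^sup>2 + 2 * L\<^sup>2 * t\<^sup>2"
      by (simp add: power_mult_distrib flip: power_mult)
    also have "\<dots> \<le> 2 * (4 * L ^ 4 + L\<^sup>2) * (norm y)\<^sup>2 + 2 * (4 * L ^ 4 + L\<^sup>2) * t\<^sup>2"
      by (intro add_mono mult_right_mono) auto
    finally have d: "(2 * (y \<bullet> X x) * A x + t * S x)\<^sup>2 \<le> 2 * (4 * L ^ 4 + L\<^sup>2) * ((norm y)\<^sup>2 + t\<^sup>2)"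
      by (simp add: algebra_simps)
    have "(c x)\<^sup>2 \<le> \<bar>C\<bar>\<^sup>2" using cC[OF True] by (intro abs_le_square_iff[THEN iffD1]) simp
    then have "(c x)\<^sup>2 * (2 * (y \<bullet> X x) * A x + t * S x)\<^sup>2 \<le> \<bar>C\<bar>\<^sup>2 * (2 * (4 * L ^ 4 + L\<^sup>2) * ((norm y)\<^sup>2 + t\<^sup>2))"
      using d by (intro mult_mono) auto
    also have "\<dots> = Q * ((norm y)\<^sup>2 + t\<^sup>2)" by (simp only: Q_def mult_ac)
    finally have "(c x * (2 * (y \<bullet> X x) * A x + t * S x))\<^sup>2 \<le> Q * ((norm y)\<^sup>2 + t\<^sup>2)"
      by (simp only: power_mult_distrib)
    then show ?thesis using that True by simp
  qed (simp add: that)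
  note loc = local_L2[OF K]
  have lim: "(\<lambda>n. LINT x|lborel. un n x * vn n x) \<longlonglongrightarrow> (LINT x|lborel. u x * v x)"
  proof (rule L2_pairing_tendsto(1))
    have e1: "(un n x - u x)\<^sup>2 = indicator K x * (Fn n x - F x)\<^sup>2" for n x
      by (simp add: un_def u_def indicator_def)
    show "integrable lborel (\<lambda>x. (un n x - u x)\<^sup>2)" "(\<lambda>n. LINT x|lborel. (un n x - u x)\<^sup>2) \<longlonglongrightarrow> 0" for n
      unfolding e1 by (fact FGi)+
    have e2: "(u x)\<^sup>2 = indicator K x * (F x)\<^sup>2" for x by (simp add: u_def indicator_def)
    show "integrable lborel (\<lambda>x. (u x)\<^sup>2)" unfolding e2 by (fact loc)
    have q: "integrable lborel (\<lambda>x. Q * (indicator K x * (norm (G x))\<^sup>2 + indicator K x * (F x)\<^sup>2))"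
      using loc by (intro integrable_mult_right Bochner_Integration.integrable_add)
    show "integrable lborel (\<lambda>x. (v x)\<^sup>2)"
    proof (rule Bochner_Integration.integrable_bound[OF q])
      show "AE x in lborel. norm ((v x)\<^sup>2) \<le> norm (Q * (indicator K x * (norm (G x))\<^sup>2 + indicator K x * (F x)\<^sup>2))"
        using vbound[of "v _", OF v_def] by (intro AE_I2) (auto intro: order_trans[OF _ abs_ge_self])
    qed measurable
    have e3: "vn n x - v x = indicator K x * (c x * (2 * ((Gn n x - G x) \<bullet> X x) * A x + (Fn n x - F x) * S x))" for n x
      by (simp add: vn_def v_def algebra_simps inner_diff_left)
    have qn: "integrable lborel (\<lambda>x. Q * (indicator K x * (norm (Gn n x - G x))\<^sup>2 + indicator K x * (Fn n x - F x)\<^sup>2))" for n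
      using FGi by (intro integrable_mult_right Bochner_Integration.integrable_add)
    show vi: "integrable lborel (\<lambda>x. (vn n x - v x)\<^sup>2)" for n
    proof (rule Bochner_Integration.integrable_bound[OF qn[of n]])
      show "AE x in lborel. norm ((vn n x - v x)\<^sup>2) \<le> norm (Q * (indicator K x * (norm (Gn n x - G x))\<^sup>2 + indicator K x * (Fn n x - F x)\<^sup>2))"
        using vbound[OF e3] by (intro AE_I2) (auto intro: order_trans[OF _ abs_ge_self])
    qed measurable
    show "(\<lambda>n. LINT x|lborel. (vn n x - v x)\<^sup>2) \<longlonglongrightarrow> 0"
    proof (rule tendsto_sandwich[OF _ _ tendsto_const])
      show "\<forall>\<^sub>F n in sequentially. (LINT x|lborel. (vn n x - v x)\<^sup>2)
        \<le> Q * ((LINT x|lborel. indicator K x * (norm (Gn n x - G x))\<^sup>2) + (LINT x|lborel. indicator K x * (Fn n x - F x)\<^sup>2))"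
      proof (intro always_eventually allI)
        fix n
        have "(LINT x|lborel. (vn n x - v x)\<^sup>2) \<le> (LINT x|lborel. Q * (indicator K x * (norm (Gn n x - G x))\<^sup>2 + indicator K x * (Fn n x - F x)\<^sup>2))"
          by (rule integral_mono[OF vi qn vbound[OF e3]])
        then show "(LINT x|lborel. (vn n x - v x)\<^sup>2)
        \<le> Q * ((LINT x|lborel. indicator K x * (norm (Gn n x - G x))\<^sup>2) + (LINT x|lborel. indicator K x * (Fn n x - F x)\<^sup>2))"
          using FGi by simp
      qed
      show "(\<lambda>n. Q * ((LINT x|lborel. indicator K x * (norm (Gn n x - G x))\<^sup>2) + (LINT x|lborel. indicator K x * (Fn n x - F x)\<^sup>2))) \<longlonglongrightarrow> 0"
        using tendsto_mult_left[OF tendsto_add[OF FGi(4) FGi(2)], of Q] by simp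
    qed simp
  qed measurable
  \<comment> \<open>Off \<open>K\<close> the product vanishes for one of two reasons:
    \<open>c\<close> is zero inside the annulus, or the radial cutoff and its slope are zero outside
    it.\<close>
  have "(LINT x|lborel. un n x * vn n x) = 0" for n
  proof -
    have "(LINT x|lborel. c x * ((\<alpha> *\<^sub>R x + p) \<bullet> ((2 * Fn n x * A x) *\<^sub>R Gn n x + ((Fn n x)\<^sup>2 * annulus_bump_slope (norm x)) *\<^sub>R x)
        + real DIM(real^'d) * \<alpha> * ((Fn n x)\<^sup>2 * A x))) = 0"
    proof (rule affine_flow_divergence[OF _ cb B cinv _ _ _ \<alpha>])
      show "((\<lambda>x. (Fn n x)\<^sup>2 * A x) has_derivative
        (\<lambda>h. h \<bullet> ((2 * Fn n x * A x) *\<^sub>R Gn n x + ((Fn n x)\<^sup>2 * annulus_bump_slope (norm x)) *\<^sub>R x))) (at x)" for x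
        unfolding A_def
        by (rule has_derivative_eq_rhs, rule has_derivative_mult[OF has_derivative_power[OF FG(1)] annulus_bump_norm_has_derivative])
           (simp add: fun_eq_iff inner_add_right algebra_simps)
      show "continuous_on UNIV (\<lambda>x. (2 * Fn n x * A x) *\<^sub>R Gn n x + ((Fn n x)\<^sup>2 * annulus_bump_slope (norm x)) *\<^sub>R x)"
        by (intro continuous_intros Fc contA FG continuous_on_compose2[OF continuous_on_annulus(2)[of UNIV]]) auto
      show "(Fn n x)\<^sup>2 * A x = 0" if "2 \<le> norm x" for x
        using annulus_outside(1)[of "norm x"] that by (simp add: A_def)
    qed simp_all
    moreover have "c x * ((\<alpha> *\<^sub>R x + p) \<bullet> ((2 * Fn n x * A x) *\<^sub>R Gn n x + ((Fn n x)\<^sup>2 * annulus_bump_slope (norm x)) *\<^sub>R x)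
        + real DIM(real^'d) * \<alpha> * ((Fn n x)\<^sup>2 * A x)) = un n x * vn n x" for x
    proof (cases "x \<in> K")
      case True
      then show ?thesis
        by (simp add: un_def vn_def S_def X_def inner_add_right inner_commute algebra_simps power2_eq_square)
    next
      case False
      show ?thesis
      proof (cases "1 \<le> norm x \<and> norm x \<le> 2")
        case True
        then have "c x = 0" using core False by (simp add: K_def)
        then show ?thesis using False by (simp add: un_def)
      next
        case out: False
        then have "A x = 0" "annulus_bump_slope (norm x) = 0"
          using annulus_outside[of "norm x"] by (auto simp: A_def)
        then show ?thesis using False by (simp add: un_def)
      qed
    qed
    ultimately show ?thesis by simp
  qed
  then have "(\<lambda>n :: nat. 0) \<longlonglongrightarrow> (LINT x|lborel. u x * v x)" using lim by (simp only:)
  then have "(LINT x|lborel. u x * v x) = 0" by (rule LIMSEQ_unique) (rule tendsto_const)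
  moreover have "u x * v x = c x * (2 * F x * (G x \<bullet> (\<alpha> *\<^sub>R x + p)) * annulus_bump (norm x)
      + (F x)\<^sup>2 * (annulus_bump_slope (norm x) * (x \<bullet> (\<alpha> *\<^sub>R x + p)) + real CARD('d) * \<alpha> * annulus_bump (norm x)))" for x
  proof (cases "x \<in> K")
    case True
    then show ?thesis
      by (simp add: u_def v_def S_def X_def A_def algebra_simps power2_eq_square)
  next
    case False
    show ?thesis
    proof (cases "1 \<le> norm x \<and> norm x \<le> 2")
      case True
      then have "c x = 0" using core False by (simp add: K_def)
      then show ?thesis using False by (simp add: u_def)
    next
      case out: False
      then have "annulus_bump (norm x) = 0" "annulus_bump_slope (norm x) = 0"
        using annulus_outside[of "norm x"] by auto
      then show ?thesis using False by (simp add: u_def)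
    qed
  qed
  ultimately show ?thesis by simp
qed

lemma annulus_core_AE:
  "AE x in lborel. 1 \<le> norm x \<longrightarrow> norm x \<le> 2 \<longrightarrow> (\<forall>\<^sub>F n in sequentially. x \<in> annulus_core (inverse (real (Suc n))))"
  using AE_off_hyperplanes
proof eventually_elim
  case (elim x)
  show ?case
  proof (intro impI)
    assume x: "1 \<le> norm x" "norm x \<le> 2"
    have "\<forall>\<^sub>F n in sequentially. \<forall>v\<in>Rp. inverse (real (Suc n)) \<le> \<bar>x \<bullet> v\<bar>"
    proof (rule eventually_ball_finite[OF finite_Rp], rule ballI)
      fix v assume "v \<in> Rp"
      then have "0 < \<bar>x \<bullet> v\<bar>" using elim Rp_roots by auto
      then have "\<forall>\<^sub>F n in sequentially. inverse (real (Suc n)) < \<bar>x \<bullet> v\<bar>"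
        by (rule order_tendstoD(2)[OF LIMSEQ_inverse_real_of_nat])
      then show "\<forall>\<^sub>F n in sequentially. inverse (real (Suc n)) \<le> \<bar>x \<bullet> v\<bar>"
        by eventually_elim simp
    qed
    then show "\<forall>\<^sub>F n in sequentially. x \<in> annulus_core (inverse (real (Suc n)))"
      by eventually_elim (use x in \<open>auto simp: annulus_core_def\<close>)
  qed
qed

text \<open>Along the dilation flow the identity pairs the radial part of the gradient with an
  arbitrary bounded angular factor, so it can be tested against its own sign.\<close>

lemma radial_part_zero: "AE x in lborel. F x * (G x \<bullet> x) = 0"
proof -
  define w where "w \<xi> = f \<xi> * (g \<xi> \<bullet> \<xi>)" for \<xi>
  have [measurable]: "f \<in> borel_measurable surface_measure" "g \<in> borel_measurable surface_measure"
    by (fact f_meas, fact g_meas)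
  have wm[measurable]: "w \<in> borel_measurable surface_measure"
    unfolding w_def[abs_def] by (intro borel_measurable_times borel_measurable_inner f_meas g_meas measurable_surface_id)
  have core: "AE \<xi> in surface_measure. (\<forall>v\<in>Rp. \<delta> \<le> \<bar>\<xi> \<bullet> v\<bar>) \<longrightarrow> w \<xi> = 0" if \<delta>: "0 < \<delta>" for \<delta>
  proof -
    define Z where "Z = {\<xi> :: real^'d. \<forall>v\<in>Rp. \<delta> \<le> \<bar>\<xi> \<bullet> v\<bar>}"
    have "Z = (\<Inter>v\<in>Rp. {x. \<delta> \<le> \<bar>x \<bullet> v\<bar>})" by (auto simp: Z_def)
    moreover have "closed {x :: real^'d. \<delta> \<le> \<bar>x \<bullet> v\<bar>}" for v
      by (intro closed_Collect_le continuous_intros)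
    ultimately have clZ: "closed Z" by (auto intro!: closed_INT)
    then have [measurable]: "Z \<in> sets borel" by simp
    have ZS[measurable]: "indicator Z \<in> borel_measurable (surface_measure :: (real^'d) measure)"
      by (rule measurable_surface) measurable
    \<comment> \<open>Homogeneous of degree 0, hence constant along dilations. The sign turns f (g
      \<bullet> \<xi>) into its absolute value, and \<open>Z\<close> keeps the support off the
      hyperplanes.\<close>
    define c where "c x = indicator Z (direction x) * sgn (w (direction x))" for x
    have [measurable]: "(\<lambda>x. w (direction x)) \<in> borel_measurable borel" by (rule measurable_compose_direction[OF wm])
    have cm[measurable]: "c \<in> borel_measurable borel" unfolding c_def[abs_def] by measurable
    have id: "(LINT x|lborel. c x * (2 * F x * (G x \<bullet> (1 *\<^sub>R x + 0)) * annulus_bump (norm x)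
      + (F x)\<^sup>2 * (annulus_bump_slope (norm x) * (x \<bullet> (1 *\<^sub>R x + 0)) + real CARD('d) * 1 * annulus_bump (norm x)))) = 0"
    proof (rule weak_flow_identity[where B="\<lambda>_. 1" and C=1, OF cm _ _ _ _ \<delta>])
      show "\<bar>c x\<bar> \<le> 1" for x by (simp add: c_def indicator_def abs_sgn_eq)
      show "c (x + s *\<^sub>R (1 *\<^sub>R x + 0)) = c x" if "0 \<le> s" for x s
      proof -
        have "x + s *\<^sub>R (1 *\<^sub>R x + 0) = (1 + s) *\<^sub>R x" by (simp add: algebra_simps)
        then show ?thesis using direction_scaleR[of "1 + s" x] that by (simp add: c_def)
      qed
      fix x :: "real^'d" assume x: "1 \<le> norm x" "norm x \<le> 2" "x \<notin> annulus_core \<delta>"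
      then obtain v where v: "v \<in> Rp" "\<bar>x \<bullet> v\<bar> < \<delta>" by (auto simp: annulus_core_def not_le)
      have "\<bar>direction x \<bullet> v\<bar> = \<bar>x \<bullet> v\<bar> / norm x" by (simp add: direction_def abs_mult divide_inverse mult.commute)
      also have "\<dots> \<le> \<bar>x \<bullet> v\<bar> / 1" using x by (intro divide_left_mono) auto
      finally have "direction x \<notin> Z" using v unfolding Z_def by fastforce
      then show "c x = 0" by (simp add: c_def)
    qed simp_all
    \<comment> \<open>The total radial factor multiplying F^2. As r^(d - 1) B(r) is the derivative
      of r^d times the cutoff, its integral is zero, so only the gradient term survives.\<close>
    define B where "B r = annulus_bump_slope r * r\<^sup>2 + real CARD('d) * annulus_bump r" for r
    have [measurable]: "B \<in> borel_measurable borel" unfolding B_def[abs_def] by measurable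
    \<comment> \<open>On this compact part of the sphere the weight is bounded below by
      \<open>k\<close>, which makes f^2 and |g|^2 integrable there without the weight.\<close>
    have K1: "compact (Z \<inter> sphere 0 1)" "Z \<inter> sphere 0 1 \<subseteq> off_hyperplanes Rp"
      using clZ \<delta> by (auto simp: closed_Int_compact Z_def off_hyperplanes_def)
    obtain k where k: "0 < k" "\<And>x. x \<in> Z \<inter> sphere 0 1 \<Longrightarrow> k \<le> h_weight Rp \<kappa> x"
      using h_weight_lower_bound[OF K1] by blast
    have dom: "integrable surface_measure (\<lambda>\<xi>. (1 / k\<^sup>2) * ((f \<xi>)\<^sup>2 * (h_weight Rp \<kappa> \<xi>)\<^sup>2 + (norm (g \<xi>))\<^sup>2 * (h_weight Rp \<kappa> \<xi>)\<^sup>2))"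
      using f2 g2 by (intro integrable_mult_right Bochner_Integration.integrable_add)
    have bnd: "indicator Z \<xi> * a \<le> (1 / k\<^sup>2) * ((f \<xi>)\<^sup>2 * (h_weight Rp \<kappa> \<xi>)\<^sup>2 + (norm (g \<xi>))\<^sup>2 * (h_weight Rp \<kappa> \<xi>)\<^sup>2)"
      if \<xi>: "\<xi> \<in> space surface_measure" and a: "0 \<le> a" "a \<le> (f \<xi>)\<^sup>2 + (norm (g \<xi>))\<^sup>2" for \<xi> a
    proof (cases "\<xi> \<in> Z")
      case True
      then have "k\<^sup>2 \<le> (h_weight Rp \<kappa> \<xi>)\<^sup>2"
        using k \<xi> by (intro power_mono) (auto simp: space_surface_measure)
      then have "a * k\<^sup>2 \<le> ((f \<xi>)\<^sup>2 + (norm (g \<xi>))\<^sup>2) * (h_weight Rp \<kappa> \<xi>)\<^sup>2"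
        using a by (intro mult_mono) auto
      then show ?thesis using True k by (simp add: field_simps)
    qed (simp)
    have wle: "\<bar>w \<xi>\<bar> \<le> (f \<xi>)\<^sup>2 + (norm (g \<xi>))\<^sup>2" if "\<xi> \<in> space surface_measure" for \<xi>
    proof -
      have "norm \<xi> = 1" using that by (simp add: space_surface_measure)
      then have "\<bar>g \<xi> \<bullet> \<xi>\<bar> \<le> norm (g \<xi>)" using Cauchy_Schwarz_ineq2[of "g \<xi>" \<xi>] by simp
      then have "\<bar>w \<xi>\<bar> \<le> \<bar>f \<xi>\<bar> * norm (g \<xi>)" by (simp add: w_def abs_mult mult_left_mono)
      moreover have "2 * (\<bar>f \<xi>\<bar> * norm (g \<xi>)) \<le> (f \<xi>)\<^sup>2 + (norm (g \<xi>))\<^sup>2"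
        using zero_le_power2[of "\<bar>f \<xi>\<bar> - norm (g \<xi>)"] by (simp add: power2_diff)
      moreover have "0 \<le> \<bar>f \<xi>\<bar> * norm (g \<xi>)" by simp
      ultimately show ?thesis by linarith
    qed
    have iw: "integrable surface_measure (\<lambda>\<xi>. indicator Z \<xi> * \<bar>w \<xi>\<bar>)"
      by (rule Bochner_Integration.integrable_bound[OF dom])
         (use bnd wle in \<open>auto intro!: AE_I2 intro: order_trans[OF _ abs_ge_self] simp: abs_mult\<close>)
    have if2: "integrable surface_measure (\<lambda>\<xi>. indicator Z \<xi> * sgn (w \<xi>) * (f \<xi>)\<^sup>2)"
    proof (rule Bochner_Integration.integrable_bound[OF dom])
      show "AE \<xi> in surface_measure. norm (indicator Z \<xi> * sgn (w \<xi>) * (f \<xi>)\<^sup>2) \<le> norm ((1 / k\<^sup>2) * ((f \<xi>)\<^sup>2 * (h_weight Rp \<kappa> \<xi>)\<^sup>2 + (norm (g \<xi>))\<^sup>2 * (h_weight Rp \<kappa> \<xi>)\<^sup>2))"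
      proof (rule AE_I2)
        fix \<xi> :: "real^'d" assume \<xi>: "\<xi> \<in> space surface_measure"
        have "norm (indicator Z \<xi> * sgn (w \<xi>) * (f \<xi>)\<^sup>2) \<le> indicator Z \<xi> * (f \<xi>)\<^sup>2"
          by (simp add: abs_mult abs_sgn_eq indicator_def)
        also have "\<dots> \<le> (1 / k\<^sup>2) * ((f \<xi>)\<^sup>2 * (h_weight Rp \<kappa> \<xi>)\<^sup>2 + (norm (g \<xi>))\<^sup>2 * (h_weight Rp \<kappa> \<xi>)\<^sup>2)"
          by (rule bnd[OF \<xi>]) auto
        also have "\<dots> \<le> norm \<dots>" unfolding real_norm_def by (rule abs_ge_self)
        finally show "norm (indicator Z \<xi> * sgn (w \<xi>) * (f \<xi>)\<^sup>2) \<le> norm ((1 / k\<^sup>2) * ((f \<xi>)\<^sup>2 * (h_weight Rp \<kappa> \<xi>)\<^sup>2 + (norm (g \<xi>))\<^sup>2 * (h_weight Rp \<kappa> \<xi>)\<^sup>2))" .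
      qed
    qed measurable
    have rA: "integrable lborel (\<lambda>r. indicator {0<..} r * r ^ (CARD('d) - 1) * annulus_bump r)"
      and rA0: "0 < (LINT r|lborel. indicator {0<..} r * r ^ (CARD('d) - 1) * annulus_bump r)"
    proof -
      have c: "continuous_on {1..2} (\<lambda>r. r ^ (CARD('d) - 1) * annulus_bump r)"
        by (intro continuous_intros continuous_on_annulus)
      have o: "r ^ (CARD('d) - 1) * annulus_bump r = 0" if "0 < r" "r \<notin> {1..2}" for r
        using annulus_outside(1)[of r] that by auto
      show "integrable lborel (\<lambda>r. indicator {0<..} r * r ^ (CARD('d) - 1) * annulus_bump r)"
        unfolding mult.assoc by (rule integrable_annulus[OF c o])
      show "0 < (LINT r|lborel. indicator {0<..} r * r ^ (CARD('d) - 1) * annulus_bump r)"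
        unfolding mult.assoc
        by (rule integral_annulus_pos[OF c o]) (auto simp: annulus_bump_nonneg annulus_bump_pos)
    qed
    have rB: "integrable lborel (\<lambda>r. indicator {0<..} r * r ^ (CARD('d) - 1) * B r)"
      and rB0: "(LINT r|lborel. indicator {0<..} r * r ^ (CARD('d) - 1) * B r) = 0"
    proof -
      have d: "((\<lambda>r. r ^ CARD('d) * annulus_bump r) has_real_derivative r ^ (CARD('d) - 1) * B r) (at r)" if "0 < r" for r
      proof -
        have "r ^ CARD('d) = r ^ (CARD('d) - 1) * r"
          by (metis One_nat_def Suc_pred mult.commute power_Suc zero_less_card_finite)
        then show ?thesis
          by (auto intro!: derivative_eq_intros annulus_bump_has_derivative simp: B_def algebra_simps power2_eq_square)
      qed
      have c: "continuous_on {1..2} (\<lambda>r. r ^ (CARD('d) - 1) * B r)"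
        unfolding B_def by (intro continuous_intros continuous_on_annulus)
      have o: "r ^ (CARD('d) - 1) * B r = 0" if "0 < r" "r \<notin> {1..2}" for r
        using annulus_outside[of r] that by (auto simp: B_def)
      have e: "1 ^ CARD('d) * annulus_bump 1 = 2 ^ CARD('d) * annulus_bump 2"
        using annulus_outside(1)[of 1] annulus_outside(1)[of 2] by simp
      show "integrable lborel (\<lambda>r. indicator {0<..} r * r ^ (CARD('d) - 1) * B r)"
        unfolding mult.assoc by (rule integral_annulus_FTC(1)[OF _ d c o e]) measurable
      show "(LINT r|lborel. indicator {0<..} r * r ^ (CARD('d) - 1) * B r) = 0"
        unfolding mult.assoc by (rule integral_annulus_FTC(2)[OF _ d c o e]) measurable
    qed
    note P1 = polar_integral[OF measurable_annulus(1) iw rA] and P2 = polar_integral[OF _ if2 rB]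
    have ae: "AE x in lborel. c x * (2 * F x * (G x \<bullet> (1 *\<^sub>R x + 0)) * annulus_bump (norm x)
      + (F x)\<^sup>2 * (annulus_bump_slope (norm x) * (x \<bullet> (1 *\<^sub>R x + 0)) + real CARD('d) * 1 * annulus_bump (norm x)))
      = 2 * (annulus_bump (norm x) * (indicator Z (direction x) * \<bar>w (direction x)\<bar>)) + B (norm x) * (indicator Z (direction x) * sgn (w (direction x)) * (f (direction x))\<^sup>2)"
      using AE_lborel_singleton[of 0]
    proof eventually_elim
      case (elim x)
      have e1: "F x * (G x \<bullet> x) = w (direction x)"
        using elim by (simp add: F_def G_def w_def direction_def)
      have "c x * (2 * F x * (G x \<bullet> (1 *\<^sub>R x + 0)) * annulus_bump (norm x)
      + (F x)\<^sup>2 * (annulus_bump_slope (norm x) * (x \<bullet> (1 *\<^sub>R x + 0)) + real CARD('d) * 1 * annulus_bump (norm x)))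
       = 2 * c x * (F x * (G x \<bullet> x)) * annulus_bump (norm x) + c x * (F x)\<^sup>2 * B (norm x)"
        by (simp add: B_def power2_norm_eq_inner algebra_simps)
      also have "\<dots> = 2 * (annulus_bump (norm x) * (indicator Z (direction x) * (sgn (w (direction x)) * w (direction x)))) + B (norm x) * (indicator Z (direction x) * sgn (w (direction x)) * (f (direction x))\<^sup>2)"
        unfolding e1 by (simp add: c_def F_def)
      also have "sgn (w (direction x)) * w (direction x) = \<bar>w (direction x)\<bar>" by (simp add: sgn_if)
      finally show ?case .
    qed
    have "(LINT x|lborel. 2 * (annulus_bump (norm x) * (indicator Z (direction x) * \<bar>w (direction x)\<bar>)) + B (norm x) * (indicator Z (direction x) * sgn (w (direction x)) * (f (direction x))\<^sup>2)) = 0"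
      unfolding id[symmetric]
    proof (rule integral_cong_AE)
      show "(\<lambda>x. 2 * (annulus_bump (norm x) * (indicator Z (direction x) * \<bar>w (direction x)\<bar>)) + B (norm x) * (indicator Z (direction x) * sgn (w (direction x)) * (f (direction x))\<^sup>2)) \<in> borel_measurable lborel"
        using borel_measurable_integrable[OF P1(1)] borel_measurable_integrable[OF P2(1)] by simp
      show "AE x in lborel. 2 * (annulus_bump (norm x) * (indicator Z (direction x) * \<bar>w (direction x)\<bar>)) + B (norm x) * (indicator Z (direction x) * sgn (w (direction x)) * (f (direction x))\<^sup>2)
        = c x * (2 * F x * (G x \<bullet> (1 *\<^sub>R x + 0)) * annulus_bump (norm x)
      + (F x)\<^sup>2 * (annulus_bump_slope (norm x) * (x \<bullet> (1 *\<^sub>R x + 0)) + real CARD('d) * 1 * annulus_bump (norm x)))"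
        using ae by eventually_elim simp
    qed measurable
    then have "2 * ((LINT r|lborel. indicator {0<..} r * r ^ (CARD('d) - 1) * annulus_bump r) * (LINT \<xi>|surface_measure. indicator Z \<xi> * \<bar>w \<xi>\<bar>)) = 0"
      using P1 P2 rB0 by simp
    then have "(LINT \<xi>|surface_measure. indicator Z \<xi> * \<bar>w \<xi>\<bar>) = 0" using rA0 by simp
    then have "AE \<xi> in surface_measure. indicator Z \<xi> * \<bar>w \<xi>\<bar> = 0"
      using integral_nonneg_eq_0_iff_AE[OF iw] by simp
    then show ?thesis by eventually_elim (auto simp: Z_def indicator_def split: if_splits)
  qed
  \<comment> \<open>Countably many \<delta> reach every point off the hyperplanes.\<close>
  have "AE \<xi> in surface_measure. \<forall>n. (\<forall>v\<in>Rp. inverse (real (Suc n)) \<le> \<bar>\<xi> \<bullet> v\<bar>) \<longrightarrow> w \<xi> = 0"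
    unfolding AE_all_countable by (intro allI core) simp
  from AE_direction[OF this] show ?thesis
    using AE_off_hyperplanes AE_lborel_singleton[of 0]
  proof eventually_elim
    case (elim x)
    have "\<forall>\<^sub>F n in sequentially. \<forall>v\<in>Rp. inverse (real (Suc n)) \<le> \<bar>direction x \<bullet> v\<bar>"
    proof (rule eventually_ball_finite[OF finite_Rp], rule ballI)
      fix v assume "v \<in> Rp"
      then have "0 < \<bar>direction x \<bullet> v\<bar>" using elim(2,3) Rp_roots by (auto simp: direction_def)
      then have "\<forall>\<^sub>F n in sequentially. inverse (real (Suc n)) < \<bar>direction x \<bullet> v\<bar>"
        by (rule order_tendstoD(2)[OF LIMSEQ_inverse_real_of_nat])
      then show "\<forall>\<^sub>F n in sequentially. inverse (real (Suc n)) \<le> \<bar>direction x \<bullet> v\<bar>"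
        by eventually_elim simp
    qed
    then obtain n where "\<forall>v\<in>Rp. inverse (real (Suc n)) \<le> \<bar>direction x \<bullet> v\<bar>"
      by (auto simp: eventually_sequentially)
    then have "w (direction x) = 0" using elim(1) by blast
    then show ?case using elim(3) by (simp add: F_def G_def w_def direction_def)
  qed
qed

lemma weighted_product_integrable:
  assumes [measurable]: "u \<in> borel_measurable surface_measure"
    and bound: "\<And>\<xi>. \<xi> \<in> space surface_measure \<Longrightarrow> \<bar>u \<xi>\<bar> \<le> C * ((f \<xi>)\<^sup>2 + (norm (g \<xi>))\<^sup>2)"
  shows "integrable surface_measure (\<lambda>\<xi>. u \<xi> * (h_weight Rp \<kappa> \<xi>)\<^sup>2)"
proof (rule Bochner_Integration.integrable_bound)
  show "integrable surface_measure (\<lambda>\<xi>. C * ((f \<xi>)\<^sup>2 * (h_weight Rp \<kappa> \<xi>)\<^sup>2 + (norm (g \<xi>))\<^sup>2 * (h_weight Rp \<kappa> \<xi>)\<^sup>2))"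
    using f2 g2 by (intro integrable_mult_right Bochner_Integration.integrable_add)
  have "(\<lambda>\<xi>. h_weight Rp \<kappa> \<xi>) \<in> borel_measurable surface_measure"
    by (rule measurable_h_surface)
  then show "(\<lambda>\<xi>. u \<xi> * (h_weight Rp \<kappa> \<xi>)\<^sup>2) \<in> borel_measurable surface_measure" by measurable
  show "AE \<xi> in surface_measure. norm (u \<xi> * (h_weight Rp \<kappa> \<xi>)\<^sup>2) \<le> norm (C * ((f \<xi>)\<^sup>2 * (h_weight Rp \<kappa> \<xi>)\<^sup>2 + (norm (g \<xi>))\<^sup>2 * (h_weight Rp \<kappa> \<xi>)\<^sup>2))"
  proof (rule AE_I2)
    fix \<xi> :: "real^'d" assume "\<xi> \<in> space surface_measure"
    then have "\<bar>u \<xi>\<bar> * (h_weight Rp \<kappa> \<xi>)\<^sup>2 \<le> C * ((f \<xi>)\<^sup>2 + (norm (g \<xi>))\<^sup>2) * (h_weight Rp \<kappa> \<xi>)\<^sup>2"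
      using bound by (intro mult_right_mono) auto
    also have "\<dots> = C * ((f \<xi>)\<^sup>2 * (h_weight Rp \<kappa> \<xi>)\<^sup>2 + (norm (g \<xi>))\<^sup>2 * (h_weight Rp \<kappa> \<xi>)\<^sup>2)" by (simp add: algebra_simps)
    also have "\<dots> \<le> norm \<dots>" unfolding real_norm_def by (rule abs_ge_self)
    finally show "norm (u \<xi> * (h_weight Rp \<kappa> \<xi>)\<^sup>2) \<le> norm (C * ((f \<xi>)\<^sup>2 * (h_weight Rp \<kappa> \<xi>)\<^sup>2 + (norm (g \<xi>))\<^sup>2 * (h_weight Rp \<kappa> \<xi>)\<^sup>2))"
      by (simp add: abs_mult)
  qed
qed

lemma weighted_integrable_fg:
  "integrable surface_measure (\<lambda>\<xi>. (f \<xi> * (g \<xi> \<bullet> p)) * (h_weight Rp \<kappa> \<xi>)\<^sup>2)"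
  "integrable surface_measure (\<lambda>\<xi>. ((f \<xi>)\<^sup>2 * (\<xi> \<bullet> p)) * (h_weight Rp \<kappa> \<xi>)\<^sup>2)"
proof -
  have [measurable]: "f \<in> borel_measurable surface_measure" "g \<in> borel_measurable surface_measure"
    by (fact f_meas, fact g_meas)
  show "integrable surface_measure (\<lambda>\<xi>. (f \<xi> * (g \<xi> \<bullet> p)) * (h_weight Rp \<kappa> \<xi>)\<^sup>2)"
  proof (rule weighted_product_integrable[where C="norm p"])
    fix \<xi>
    have "2 * (\<bar>f \<xi>\<bar> * norm (g \<xi>)) \<le> (f \<xi>)\<^sup>2 + (norm (g \<xi>))\<^sup>2"
      using zero_le_power2[of "\<bar>f \<xi>\<bar> - norm (g \<xi>)"] by (simp add: power2_diff)
    moreover have "0 \<le> \<bar>f \<xi>\<bar> * norm (g \<xi>)" by simp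
    ultimately have "\<bar>f \<xi>\<bar> * norm (g \<xi>) \<le> (f \<xi>)\<^sup>2 + (norm (g \<xi>))\<^sup>2" by linarith
    then have "norm p * (\<bar>f \<xi>\<bar> * norm (g \<xi>)) \<le> norm p * ((f \<xi>)\<^sup>2 + (norm (g \<xi>))\<^sup>2)" by (rule mult_left_mono) simp
    moreover have "\<bar>f \<xi> * (g \<xi> \<bullet> p)\<bar> \<le> \<bar>f \<xi>\<bar> * (norm (g \<xi>) * norm p)"
      unfolding abs_mult by (intro mult_left_mono Cauchy_Schwarz_ineq2) auto
    ultimately show "\<bar>f \<xi> * (g \<xi> \<bullet> p)\<bar> \<le> norm p * ((f \<xi>)\<^sup>2 + (norm (g \<xi>))\<^sup>2)" by (simp add: mult_ac)
  qed measurable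
  show "integrable surface_measure (\<lambda>\<xi>. ((f \<xi>)\<^sup>2 * (\<xi> \<bullet> p)) * (h_weight Rp \<kappa> \<xi>)\<^sup>2)"
  proof (rule weighted_product_integrable[where C="norm p"])
    fix \<xi> :: "real^'d" assume "\<xi> \<in> space surface_measure"
    then have "\<bar>\<xi> \<bullet> p\<bar> \<le> norm p" using Cauchy_Schwarz_ineq2[of \<xi> p] by (simp add: space_surface_measure)
    then have "\<bar>(f \<xi>)\<^sup>2 * (\<xi> \<bullet> p)\<bar> \<le> (f \<xi>)\<^sup>2 * norm p" by (simp add: abs_mult mult_left_mono)
    also have "\<dots> \<le> ((f \<xi>)\<^sup>2 + (norm (g \<xi>))\<^sup>2) * norm p" by (intro mult_right_mono) auto
    finally show "\<bar>(f \<xi>)\<^sup>2 * (\<xi> \<bullet> p)\<bar> \<le> norm p * ((f \<xi>)\<^sup>2 + (norm (g \<xi>))\<^sup>2)" by (simp add: mult.commute)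
  qed (intro borel_measurable_times borel_measurable_power borel_measurable_inner f_meas measurable_surface_id borel_measurable_const)
qed

text \<open>The weight is constant along directions orthogonal to all roots, which is why no boundary
  terms arise on the reflecting hyperplanes.\<close>

lemma translation_identity:
  assumes p: "\<And>v. v \<in> Rp \<Longrightarrow> p \<bullet> v = 0"
  shows "2 * (LINT \<xi>|surface_measure. (f \<xi> * (g \<xi> \<bullet> p)) * (h_weight Rp \<kappa> \<xi>)\<^sup>2)
    = (2 * lambda_k Rp \<kappa> + 1) * (LINT \<xi>|surface_measure. ((f \<xi>)\<^sup>2 * (\<xi> \<bullet> p)) * (h_weight Rp \<kappa> \<xi>)\<^sup>2)"
proof -
  define l where "l = lambda_k Rp \<kappa>"
  have [measurable]: "f \<in> borel_measurable surface_measure" "g \<in> borel_measurable surface_measure"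
    by (fact f_meas, fact g_meas)
  \<comment> \<open>The squared weight cut off near the hyperplanes. It depends on \<open>x\<close>
    only through the products with the roots, so translation along \<open>p\<close> does not change
    it.\<close>
  define c where "c n x = indicator {x. \<forall>v\<in>Rp. inverse (real (Suc n)) \<le> \<bar>x \<bullet> v\<bar>} x * (h_weight Rp \<kappa> x)\<^sup>2" for n x
  define \<Psi> where "\<Psi> x = 2 * F x * (G x \<bullet> (0 *\<^sub>R x + p)) * annulus_bump (norm x)
      + (F x)\<^sup>2 * (annulus_bump_slope (norm x) * (x \<bullet> (0 *\<^sub>R x + p)) + real CARD('d) * 0 * annulus_bump (norm x))" for x
  have "closed {x :: real^'d. \<forall>v\<in>Rp. inverse (real (Suc n)) \<le> \<bar>x \<bullet> v\<bar>}" for n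
  proof -
    have "{x :: real^'d. \<forall>v\<in>Rp. inverse (real (Suc n)) \<le> \<bar>x \<bullet> v\<bar>} = (\<Inter>v\<in>Rp. {x. inverse (real (Suc n)) \<le> \<bar>x \<bullet> v\<bar>})" by auto
    moreover have "closed {x :: real^'d. inverse (real (Suc n)) \<le> \<bar>x \<bullet> v\<bar>}" for v
      by (intro closed_Collect_le continuous_intros)
    ultimately show ?thesis by (auto intro!: closed_INT)
  qed
  then have Zm: "{x :: real^'d. \<forall>v\<in>Rp. inverse (real (Suc n)) \<le> \<bar>x \<bullet> v\<bar>} \<in> sets borel" for n by simp
  have cm[measurable]: "c n \<in> borel_measurable borel" for n
    unfolding c_def[abs_def] using Zm by measurable
  have [measurable]: "\<Psi> \<in> borel_measurable borel" unfolding \<Psi>_def[abs_def] by measurable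
  obtain C where C: "\<And>x. norm x \<le> 2 + norm p \<Longrightarrow> h_weight Rp \<kappa> x \<le> C" using h_weight_bounded by blast
  have zero: "(LINT x|lborel. c n x * \<Psi> x) = 0" for n
    unfolding \<Psi>_def
  proof (rule weak_flow_identity[where B="\<lambda>x. (h_weight Rp \<kappa> x)\<^sup>2" and C="C\<^sup>2" and \<delta>="inverse (real (Suc n))", OF cm])
    show "\<bar>c n x\<bar> \<le> (h_weight Rp \<kappa> x)\<^sup>2" for x by (simp add: c_def indicator_def)
    show "(h_weight Rp \<kappa> x)\<^sup>2 \<le> C\<^sup>2" if "norm x \<le> 2 + norm p" for x
      using C[OF that] h_weight_nonneg by (intro power_mono)
    show "c n (x + s *\<^sub>R (0 *\<^sub>R x + p)) = c n x" for x s
    proof -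
      have "(x + s *\<^sub>R (0 *\<^sub>R x + p)) \<bullet> v = x \<bullet> v" if "v \<in> Rp" for v using p[OF that] by (simp add: inner_add_left)
      then show ?thesis by (simp add: c_def h_weight_def indicator_def cong: prod.cong)
    qed
    show "c n x = 0" if "1 \<le> norm x" "norm x \<le> 2" "x \<notin> annulus_core (inverse (real (Suc n)))" for x
      using that by (auto simp: c_def annulus_core_def indicator_def)
  qed simp_all
  \<comment> \<open>The radial factors of the two terms: \<open>G\<close> is homogeneous of degree
    -1, and x \<bullet> p contributes one power of the radius, as does the gradient of the radial
    cutoff through \<open>annulus_bump_slope\<close>, whose remaining factor is that same x
    \<bullet> p.\<close>
  define \<phi>1 \<phi>2 where "\<phi>1 r = annulus_bump r / r" and "\<phi>2 r = annulus_bump_slope r * r" for r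
  have [measurable]: "\<phi>1 \<in> borel_measurable borel" "\<phi>2 \<in> borel_measurable borel"
    unfolding \<phi>1_def[abs_def] \<phi>2_def[abs_def] by measurable
  have c1: "continuous_on {1..2} (\<lambda>r. r powr (2 * l + 1) * \<phi>1 r)" and c2: "continuous_on {1..2} (\<lambda>r. r powr (2 * l + 1) * \<phi>2 r)"
    unfolding \<phi>1_def \<phi>2_def by (intro continuous_intros continuous_on_annulus; simp)+
  have o1: "r powr (2 * l + 1) * \<phi>1 r = 0" and o2: "r powr (2 * l + 1) * \<phi>2 r = 0" if "0 < r" "r \<notin> {1..2}" for r
    using annulus_outside[of r] that by (auto simp: \<phi>1_def \<phi>2_def)
  note i1 = integrable_annulus[OF c1 o1] and i2 = integrable_annulus[OF c2 o2]
  define J1 J2 where "J1 = (LINT r|lborel. indicator {0<..} r * (r powr (2 * l + 1) * \<phi>1 r))"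
    and "J2 = (LINT r|lborel. indicator {0<..} r * (r powr (2 * l + 1) * \<phi>2 r))"
  have J1: "0 < J1" unfolding J1_def
    by (rule integral_annulus_pos[OF c1 o1]) (auto simp: \<phi>1_def annulus_bump_nonneg annulus_bump_pos)
  \<comment> \<open>Integration by parts in the radius, using that r^(2 l + 1) times the cutoff
    vanishes at 1 and 2. This is the origin of the factor 2 l + 1.\<close>
  have J2: "J2 = - (2 * l + 1) * J1"
  proof -
    have d: "((\<lambda>r. r powr (2 * l + 1) * annulus_bump r) has_real_derivative (2 * l + 1) * (r powr (2 * l + 1) * \<phi>1 r) + r powr (2 * l + 1) * \<phi>2 r) (at r)" if "0 < r" for r
    proof -
      have e: "r powr (2 * l + 1 - 1) = r powr (2 * l + 1) / r" using powr_diff[of r "2 * l + 1" 1] that by simp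
      have "((\<lambda>r. r powr (2 * l + 1)) has_real_derivative (2 * l + 1) * r powr (2 * l + 1 - 1)) (at r)"
        using that by (rule has_real_derivative_powr)
      from DERIV_mult[OF this annulus_bump_has_derivative]
      show ?thesis
        by (rule DERIV_cong) (simp only: e \<phi>1_def \<phi>2_def, simp add: algebra_simps add_divide_distrib)
    qed
    have c: "continuous_on {1..2} (\<lambda>r. (2 * l + 1) * (r powr (2 * l + 1) * \<phi>1 r) + r powr (2 * l + 1) * \<phi>2 r)"
      by (intro continuous_on_add continuous_on_mult_left c1 c2)
    have o: "(2 * l + 1) * (r powr (2 * l + 1) * \<phi>1 r) + r powr (2 * l + 1) * \<phi>2 r = 0" if "0 < r" "r \<notin> {1..2}" for r
      by (simp only: o1[OF that] o2[OF that])
    have m: "(\<lambda>r. r powr (2 * l + 1) * annulus_bump r) \<in> borel_measurable borel" by measurable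
    have e: "1 powr (2 * l + 1) * annulus_bump 1 = 2 powr (2 * l + 1) * annulus_bump 2"
      using annulus_outside(1)[of 1] annulus_outside(1)[of 2] by simp
    have "0 = (LINT r|lborel. indicator {0<..} r * ((2 * l + 1) * (r powr (2 * l + 1) * \<phi>1 r) + r powr (2 * l + 1) * \<phi>2 r))"
      by (rule integral_annulus_FTC(2)[OF m d c o e, symmetric])
    also have "\<dots> = (LINT r|lborel. (2 * l + 1) * (indicator {0<..} r * (r powr (2 * l + 1) * \<phi>1 r)) + indicator {0<..} r * (r powr (2 * l + 1) * \<phi>2 r))"
      by (intro Bochner_Integration.integral_cong) (auto simp: algebra_simps)
    also have "\<dots> = (2 * l + 1) * J1 + J2" using i1 i2 by (simp add: J1_def J2_def)
    finally show ?thesis by algebra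
  qed
  define u1 u2 where "u1 \<xi> = f \<xi> * (g \<xi> \<bullet> p)" and "u2 \<xi> = (f \<xi>)\<^sup>2 * (\<xi> \<bullet> p)" for \<xi>
  have m1: "u1 \<in> borel_measurable surface_measure" and m2: "u2 \<in> borel_measurable surface_measure"
    unfolding u1_def[abs_def] u2_def[abs_def]
    by (intro borel_measurable_times borel_measurable_power borel_measurable_inner f_meas g_meas measurable_surface_id borel_measurable_const)+
  note w = weighted_integrable_fg[of p, folded u1_def u2_def]
  note P1 = weighted_polar_integral[OF _ w(1) m1 i1[unfolded l_def]] and P2 = weighted_polar_integral[OF _ w(2) m2 i2[unfolded l_def]]
  have ae: "AE x in lborel. (h_weight Rp \<kappa> x)\<^sup>2 * \<Psi> x = 2 * (\<phi>1 (norm x) * u1 (direction x) * (h_weight Rp \<kappa> x)\<^sup>2) + \<phi>2 (norm x) * u2 (direction x) * (h_weight Rp \<kappa> x)\<^sup>2"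
    using AE_lborel_singleton[of 0]
  proof eventually_elim
    case (elim x)
    have "x \<bullet> p = norm x * (direction x \<bullet> p)" using elim by (simp add: direction_def)
    moreover have "G x \<bullet> p = (g (direction x) \<bullet> p) / norm x" by (simp add: G_def divide_inverse mult.commute)
    ultimately show ?case by (simp add: \<Psi>_def \<phi>1_def \<phi>2_def u1_def u2_def F_def algebra_simps)
  qed
  have iR: "integrable lborel (\<lambda>x. 2 * (\<phi>1 (norm x) * u1 (direction x) * (h_weight Rp \<kappa> x)\<^sup>2) + \<phi>2 (norm x) * u2 (direction x) * (h_weight Rp \<kappa> x)\<^sup>2)"
    using P1(1) P2(1) by (intro Bochner_Integration.integrable_add integrable_mult_right) simp_all
  have iW: "integrable lborel (\<lambda>x. (h_weight Rp \<kappa> x)\<^sup>2 * \<Psi> x)"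
    by (rule integrable_cong_AE_imp[OF iR]) (measurable, use ae in \<open>auto elim: eventually_mono\<close>)
  \<comment> \<open>The cutoff near the hyperplanes is removed. It only multiplies the integrand by
    an indicator, so the absolute value of the limit is itself a dominating function.\<close>
  have "(\<lambda>n. LINT x|lborel. c n x * \<Psi> x) \<longlonglongrightarrow> (LINT x|lborel. (h_weight Rp \<kappa> x)\<^sup>2 * \<Psi> x)"
  proof (rule integral_dominated_convergence[where w="\<lambda>x. norm ((h_weight Rp \<kappa> x)\<^sup>2 * \<Psi> x)"])
    show "AE x in lborel. (\<lambda>n. c n x * \<Psi> x) \<longlonglongrightarrow> (h_weight Rp \<kappa> x)\<^sup>2 * \<Psi> x"
      using annulus_core_AE
    proof eventually_elim
      case (elim x)
      show ?case
      proof (cases "1 \<le> norm x \<and> norm x \<le> 2")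
        case True
        then have "\<forall>\<^sub>F n in sequentially. x \<in> annulus_core (inverse (real (Suc n)))" using elim by blast
        then have "\<forall>\<^sub>F n in sequentially. c n x * \<Psi> x = (h_weight Rp \<kappa> x)\<^sup>2 * \<Psi> x"
          by eventually_elim (simp add: c_def annulus_core_def)
        then show ?thesis by (rule tendsto_eventually)
      next
        case False
        then have "annulus_bump (norm x) = 0" "annulus_bump_slope (norm x) = 0"
          using annulus_outside[of "norm x"] by auto
        then have "\<Psi> x = 0" by (simp add: \<Psi>_def)
        then show ?thesis by simp
      qed
    qed
    show "AE x in lborel. norm (c n x * \<Psi> x) \<le> norm ((h_weight Rp \<kappa> x)\<^sup>2 * \<Psi> x)" for n
      by (intro AE_I2) (auto simp: c_def indicator_def)
  qed (use iW in auto)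
  then have "(\<lambda>n :: nat. 0) \<longlonglongrightarrow> (LINT x|lborel. (h_weight Rp \<kappa> x)\<^sup>2 * \<Psi> x)" unfolding zero .
  then have "(LINT x|lborel. (h_weight Rp \<kappa> x)\<^sup>2 * \<Psi> x) = 0" by (rule LIMSEQ_unique) (rule tendsto_const)
  moreover have "(LINT x|lborel. (h_weight Rp \<kappa> x)\<^sup>2 * \<Psi> x) = (LINT x|lborel. 2 * (\<phi>1 (norm x) * u1 (direction x) * (h_weight Rp \<kappa> x)\<^sup>2) + \<phi>2 (norm x) * u2 (direction x) * (h_weight Rp \<kappa> x)\<^sup>2)"
    by (rule integral_cong_AE) (use ae iW iR in auto)
  ultimately have "2 * (J1 * (LINT \<xi>|surface_measure. u1 \<xi> * (h_weight Rp \<kappa> \<xi>)\<^sup>2)) + J2 * (LINT \<xi>|surface_measure. u2 \<xi> * (h_weight Rp \<kappa> \<xi>)\<^sup>2) = 0"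
    using P1 P2 by (simp add: J1_def J2_def l_def)
  then have "J1 * (2 * (LINT \<xi>|surface_measure. u1 \<xi> * (h_weight Rp \<kappa> \<xi>)\<^sup>2) - (2 * l + 1) * (LINT \<xi>|surface_measure. u2 \<xi> * (h_weight Rp \<kappa> \<xi>)\<^sup>2)) = 0"
    unfolding J2 by (simp add: algebra_simps)
  then show ?thesis using J1 by (simp add: u1_def u2_def l_def)
qed

end

section \<open>The spectral gap\<close>

text \<open>A differentiable approximation of \<open>s\<close> from below that vanishes for \<open>s \<le> \<delta>\<close>, as \<open>F\<close> has no
  gradient at the origin.\<close>

definition soft_square :: "real \<Rightarrow> real \<Rightarrow> real" where
  "soft_square \<delta> s = (max 0 (s - \<delta>))\<^sup>2 / s"

definition soft_square_slope :: "real \<Rightarrow> real \<Rightarrow> real" where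
  "soft_square_slope \<delta> s = (if s \<le> \<delta> then 0 else 1 - \<delta>\<^sup>2 / s\<^sup>2)"

lemma max_square_has_derivative: "((\<lambda>t. (max 0 t)\<^sup>2) has_real_derivative 2 * max 0 t) (at t)" for t :: real
proof -
  consider "t < 0" | "t > 0" | "t = 0" by linarith
  then show ?thesis
  proof cases
    case 1
    have "((\<lambda>t :: real. 0) has_real_derivative 0) (at t)" by simp
    then have "((\<lambda>t. (max 0 t)\<^sup>2) has_real_derivative 0) (at t)"
      by (rule has_field_derivative_transform_within_open[of _ _ _ "{..<0}"]) (use 1 in auto)
    then show ?thesis using 1 by simp
  next
    case 2
    have "((\<lambda>t :: real. t\<^sup>2) has_real_derivative 2 * t) (at t)" by (auto intro!: derivative_eq_intros)
    then have "((\<lambda>t. (max 0 t)\<^sup>2) has_real_derivative 2 * t) (at t)"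
      by (rule has_field_derivative_transform_within_open[of _ _ _ "{0<..}"]) (use 2 in auto)
    then show ?thesis using 2 by simp
  next
    case 3
    have "((\<lambda>h :: real. \<bar>h\<bar>) \<longlongrightarrow> 0) (at 0)" using tendsto_rabs[OF tendsto_ident_at, of "0::real" UNIV] by simp
    then have "((\<lambda>h :: real. (max 0 h)\<^sup>2 / h) \<longlongrightarrow> 0) (at 0)"
      by (rule Lim_null_comparison[rotated])
         (auto intro!: always_eventually simp: max_def power2_eq_square)
    then show ?thesis using 3 by (simp add: DERIV_def)
  qed
qed

lemma soft_square_has_derivative:
  assumes \<delta>: "0 < \<delta>"
  shows "(soft_square \<delta> has_real_derivative soft_square_slope \<delta> s) (at s)"
proof (cases "s < \<delta>")
  case True
  have "((\<lambda>t :: real. 0) has_real_derivative 0) (at s)" by simp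
  then have "(soft_square \<delta> has_real_derivative 0) (at s)"
    by (rule has_field_derivative_transform_within_open[of _ _ _ "{..<\<delta>}"]) (use True in \<open>auto simp: soft_square_def\<close>)
  then show ?thesis using True by (simp add: soft_square_slope_def)
next
  case False
  then have s: "0 < s" using \<delta> by simp
  have "((\<lambda>t. (max 0 (t - \<delta>))\<^sup>2) has_real_derivative 2 * max 0 (s - \<delta>)) (at s)"
  proof -
    have "((\<lambda>t. t - \<delta>) has_real_derivative 1) (at s)" by (auto intro!: derivative_eq_intros)
    from DERIV_chain2[where g="\<lambda>t. t - \<delta>" and x=s, OF max_square_has_derivative[of "s - \<delta>"] this]
    show ?thesis by simp
  qed
  from DERIV_divide[OF this DERIV_ident] s
  have "(soft_square \<delta> has_real_derivative (2 * max 0 (s - \<delta>) * s - (max 0 (s - \<delta>))\<^sup>2 * 1) / (s * s)) (at s)"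
    by (simp add: soft_square_def[abs_def])
  also have "(2 * max 0 (s - \<delta>) * s - (max 0 (s - \<delta>))\<^sup>2 * 1) / (s * s) = soft_square_slope \<delta> s"
    using False s by (auto simp: soft_square_slope_def field_simps power2_eq_square)
  finally show ?thesis .
qed

lemma soft_square_bounds:
  assumes "0 < \<delta>"
  shows "0 \<le> s \<Longrightarrow> 0 \<le> soft_square \<delta> s" "0 \<le> s \<Longrightarrow> soft_square \<delta> s \<le> s"
    "0 \<le> soft_square_slope \<delta> s" "soft_square_slope \<delta> s \<le> 1"
    "s \<le> \<delta> \<Longrightarrow> soft_square \<delta> s = 0" "s \<le> \<delta> \<Longrightarrow> soft_square_slope \<delta> s = 0"
proof -
  show "0 \<le> s \<Longrightarrow> 0 \<le> soft_square \<delta> s" by (simp add: soft_square_def)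
  show "soft_square \<delta> s \<le> s" if "0 \<le> s"
  proof (cases "s = 0")
    case False
    have "(max 0 (s - \<delta>))\<^sup>2 \<le> s\<^sup>2" using that assms by (intro power_mono) auto
    then show ?thesis using False that by (simp add: soft_square_def field_simps power2_eq_square)
  qed (simp add: soft_square_def)
  show "0 \<le> soft_square_slope \<delta> s"
  proof (cases "s \<le> \<delta>")
    case False
    then have "\<delta>\<^sup>2 \<le> s\<^sup>2" using assms by (intro power_mono) auto
    then show ?thesis using False assms by (simp add: soft_square_slope_def)
  qed (simp add: soft_square_slope_def)
  show "soft_square_slope \<delta> s \<le> 1" by (simp add: soft_square_slope_def)
  show "s \<le> \<delta> \<Longrightarrow> soft_square \<delta> s = 0" "s \<le> \<delta> \<Longrightarrow> soft_square_slope \<delta> s = 0"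
    by (simp_all add: soft_square_def soft_square_slope_def)
qed

lemma continuous_on_soft_square_slope:
  assumes "0 < \<delta>" shows "continuous_on UNIV (soft_square_slope \<delta>)"
proof -
  have "soft_square_slope \<delta> = (\<lambda>s. 1 - \<delta>\<^sup>2 / (max s \<delta>)\<^sup>2)"
    using assms by (auto simp: soft_square_slope_def fun_eq_iff max_def)
  moreover have "continuous_on UNIV (\<lambda>s. 1 - \<delta>\<^sup>2 / (max s \<delta>)\<^sup>2)"
  proof (intro continuous_intros ballI)
    fix s have "0 < max s \<delta>" using assms by simp
    then show "(max s \<delta>)\<^sup>2 \<noteq> 0" by simp
  qed
  ultimately show ?thesis by simp
qed

lemma continuous_on_soft_square: "0 < \<delta> \<Longrightarrow> continuous_on UNIV (soft_square \<delta>)"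
  by (rule DERIV_continuous_on, rule has_field_derivative_at_within, rule soft_square_has_derivative)

lemma soft_square_norm_has_derivative:
  fixes x :: "'a::euclidean_space"
  assumes "0 < \<delta>"
  shows "((\<lambda>x. soft_square \<delta> ((norm x)\<^sup>2)) has_derivative (\<lambda>v. v \<bullet> ((2 * soft_square_slope \<delta> ((norm x)\<^sup>2)) *\<^sub>R x))) (at x)"
proof -
  have "((\<lambda>x. x \<bullet> x) has_derivative (\<lambda>v. 2 * (v \<bullet> x))) (at x)"
    by (auto intro!: derivative_eq_intros simp: inner_commute)
  moreover have "(soft_square \<delta> has_derivative (\<lambda>t. soft_square_slope \<delta> (x \<bullet> x) * t)) (at (x \<bullet> x))"
    using soft_square_has_derivative[OF assms] by (simp add: has_field_derivative_def)
  ultimately have "((\<lambda>x. soft_square \<delta> (x \<bullet> x)) has_derivative (\<lambda>v. soft_square_slope \<delta> (x \<bullet> x) * (2 * (v \<bullet> x)))) (at x)"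
    by (rule has_derivative_compose)
  then show ?thesis by (simp add: power2_norm_eq_inner mult_ac)
qed

lemma soft_square_tendsto:
  assumes "0 \<le> s" shows "(\<lambda>n. soft_square (inverse (real (Suc n))) s) \<longlonglongrightarrow> s"
proof (cases "s = 0")
  case False
  then have s: "0 < s" using assms by simp
  have "(\<lambda>n. (max 0 (s - inverse (real (Suc n))))\<^sup>2 / s) \<longlonglongrightarrow> (max 0 (s - 0))\<^sup>2 / s"
    using s by (intro tendsto_intros LIMSEQ_inverse_real_of_nat) auto
  then show ?thesis using s by (simp add: soft_square_def[abs_def] power2_eq_square)
qed (simp add: soft_square_def)

context root_data
begin

section \<open>The Gaussian weight on a chamber\<close>

definition gauss_weight :: "real^'d \<Rightarrow> real" where
  "gauss_weight x = (h_weight Rp \<kappa> x)\<^sup>2 * exp (- ((norm x)\<^sup>2) / 2)"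

lemma measurable_gauss_weight[measurable]: "gauss_weight \<in> borel_measurable borel"
  unfolding gauss_weight_def[abs_def] by measurable

lemma gauss_weight_nonneg: "0 \<le> gauss_weight x" by (simp add: gauss_weight_def)

text \<open>Where each root keeps its sign, |x \<bullet> v| |y \<bullet> v| is at most the square at
  the midpoint by the inequality of arithmetic and geometric means, and nonnegative powers preserve
  this. For the Gaussian the parallelogram law gives equality with exactly the factor exp(|x - y|^2
  / 4), which is where the constant 1 of the Poincare inequality comes from.\<close>

lemma gauss_weight_midpoint:
  assumes same: "\<And>v. v \<in> Rp \<Longrightarrow> 0 \<le> (x \<bullet> v) * (y \<bullet> v)"
  shows "gauss_weight x * gauss_weight y * exp ((norm (x - y))\<^sup>2 / 4) \<le> (gauss_weight ((1/2) *\<^sub>R (x + y)))\<^sup>2"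
proof -
  define z where "z = (1/2) *\<^sub>R (x + y)"
  have "h_weight Rp \<kappa> x * h_weight Rp \<kappa> y \<le> (h_weight Rp \<kappa> z)\<^sup>2"
  proof -
    have pm: "(\<bar>a\<bar> * \<bar>b\<bar>) powr k = \<bar>a\<bar> powr k * \<bar>b\<bar> powr k" for a b k :: real
      by (simp add: powr_mult)
    have "(\<Prod>v\<in>Rp. \<bar>x \<bullet> v\<bar> powr \<kappa> v * \<bar>y \<bullet> v\<bar> powr \<kappa> v) \<le> (\<Prod>v\<in>Rp. (\<bar>z \<bullet> v\<bar> powr \<kappa> v)\<^sup>2)"
    proof (rule prod_mono)
      fix v assume v: "v \<in> Rp"
      have "\<bar>x \<bullet> v\<bar> * \<bar>y \<bullet> v\<bar> = (x \<bullet> v) * (y \<bullet> v)" using same[OF v] by (simp add: abs_mult[symmetric])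
      also have "\<dots> \<le> (z \<bullet> v)\<^sup>2"
        using zero_le_power2[of "x \<bullet> v - y \<bullet> v"] by (simp add: z_def inner_add_left power2_eq_square field_simps)
      also have "\<dots> = \<bar>z \<bullet> v\<bar> * \<bar>z \<bullet> v\<bar>" by (simp add: power2_eq_square abs_mult[symmetric])
      finally have "(\<bar>x \<bullet> v\<bar> * \<bar>y \<bullet> v\<bar>) powr \<kappa> v \<le> (\<bar>z \<bullet> v\<bar> * \<bar>z \<bullet> v\<bar>) powr \<kappa> v"
        using \<kappa>_nonneg[OF v] by (intro powr_mono2) auto
      then show "0 \<le> \<bar>x \<bullet> v\<bar> powr \<kappa> v * \<bar>y \<bullet> v\<bar> powr \<kappa> v \<and> \<bar>x \<bullet> v\<bar> powr \<kappa> v * \<bar>y \<bullet> v\<bar> powr \<kappa> v \<le> (\<bar>z \<bullet> v\<bar> powr \<kappa> v)\<^sup>2"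
        by (simp only: pm power2_eq_square) simp
    qed
    then show ?thesis by (simp add: h_weight_def prod.distrib prod_power_distrib)
  qed
  then have h: "(h_weight Rp \<kappa> x * h_weight Rp \<kappa> y)\<^sup>2 \<le> ((h_weight Rp \<kappa> z)\<^sup>2)\<^sup>2"
    by (intro power_mono) (auto simp: h_weight_nonneg)
  have e: "exp (- ((norm x)\<^sup>2) / 2) * exp (- ((norm y)\<^sup>2) / 2) * exp ((norm (x - y))\<^sup>2 / 4) = (exp (- ((norm z)\<^sup>2) / 2))\<^sup>2"
  proof -
    have "(norm z)\<^sup>2 = (norm (x + y))\<^sup>2 / 4" by (simp add: z_def power_mult_distrib power_divide)
    moreover have "(norm (x + y))\<^sup>2 + (norm (x - y))\<^sup>2 = 2 * (norm x)\<^sup>2 + 2 * (norm y)\<^sup>2"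
      by (simp add: power2_norm_eq_inner inner_simps inner_commute)
    ultimately have "- ((norm x)\<^sup>2) / 2 + - ((norm y)\<^sup>2) / 2 + (norm (x - y))\<^sup>2 / 4 = - ((norm z)\<^sup>2) / 2 + - ((norm z)\<^sup>2) / 2"
      by (simp add: field_simps)
    then show ?thesis by (simp add: exp_add[symmetric] power2_eq_square)
  qed
  have "gauss_weight x * gauss_weight y * exp ((norm (x - y))\<^sup>2 / 4)
    = (h_weight Rp \<kappa> x * h_weight Rp \<kappa> y)\<^sup>2 * (exp (- ((norm x)\<^sup>2) / 2) * exp (- ((norm y)\<^sup>2) / 2) * exp ((norm (x - y))\<^sup>2 / 4))"
    by (simp add: gauss_weight_def power_mult_distrib)
  also have "\<dots> \<le> ((h_weight Rp \<kappa> z)\<^sup>2)\<^sup>2 * (exp (- ((norm z)\<^sup>2) / 2))\<^sup>2"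
    unfolding e using h by (rule mult_right_mono) simp
  also have "\<dots> = (gauss_weight z)\<^sup>2" by (simp add: gauss_weight_def power_mult_distrib)
  finally show ?thesis by (simp add: z_def)
qed

text \<open>A compact convex exhaustion of the chamber of \<open>x\<close>. The conditions for the
  roots positive at \<open>x\<close> suffice, since the negatives of these are the remaining roots
  when \<open>x\<close> is off the hyperplanes.\<close>

definition chamber_core :: "real^'d \<Rightarrow> nat \<Rightarrow> (real^'d) set" where
  "chamber_core x n = {y. (\<forall>v\<in>roots. 0 < x \<bullet> v \<longrightarrow> inverse (real (Suc n)) \<le> y \<bullet> v) \<and> norm y \<le> real (Suc n)}"

lemma chamber_core_eq:
  "chamber_core x n = cball 0 (real (Suc n)) \<inter> (\<Inter>v\<in>{v\<in>roots. 0 < x \<bullet> v}. {y. inverse (real (Suc n)) \<le> v \<bullet> y})"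
  by (auto simp: chamber_core_def inner_commute)

lemma compact_chamber_core: "compact (chamber_core x n)"
  unfolding chamber_core_eq
  by (intro compact_Int_closed compact_cball closed_INT ballI closed_halfspace_ge)

lemma convex_chamber_core: "convex (chamber_core x n)"
  unfolding chamber_core_eq
  by (intro convex_Int convex_cball convex_INT convex_halfspace_ge)

lemma chamber_core_subset:
  assumes x: "\<And>v. v \<in> roots \<Longrightarrow> x \<bullet> v \<noteq> 0" shows "chamber_core x n \<subseteq> chamber x"
proof
  fix y assume y: "y \<in> chamber_core x n"
  have pos: "0 < y \<bullet> v" if "v \<in> roots" "0 < x \<bullet> v" for v
  proof -
    have "inverse (real (Suc n)) \<le> y \<bullet> v" using y that by (auto simp: chamber_core_def)
    then show ?thesis by (rule less_le_trans[rotated]) simp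
  qed
  show "y \<in> chamber x"
    unfolding chamber_def
  proof (intro CollectI ballI)
    fix v assume v: "v \<in> roots"
    show "0 < (x \<bullet> v) * (y \<bullet> v)"
    proof (cases "0 < x \<bullet> v")
      case True
      then show ?thesis using pos[OF v] by simp
    next
      case False
      then have "0 < x \<bullet> (- v)" using x[OF v] by simp
      from pos[OF uminus_roots[OF v] this] have "y \<bullet> v < 0" by simp
      moreover have "x \<bullet> v < 0" using False x[OF v] by simp
      ultimately show ?thesis by (rule mult_neg_neg[rotated])
    qed
  qed
qed

lemma chamber_core_exhausts:
  assumes y: "y \<in> chamber x" shows "\<forall>\<^sub>F n in sequentially. y \<in> chamber_core x n"
proof -
  have "\<forall>\<^sub>F n in sequentially. \<forall>v\<in>{v\<in>roots. 0 < x \<bullet> v}. inverse (real (Suc n)) \<le> y \<bullet> v"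
  proof (rule eventually_ball_finite, simp add: finite_roots, rule ballI)
    fix v assume "v \<in> {v\<in>roots. 0 < x \<bullet> v}"
    then have "0 < y \<bullet> v" using y by (auto simp: chamber_def zero_less_mult_iff)
    then have "\<forall>\<^sub>F n in sequentially. inverse (real (Suc n)) < y \<bullet> v"
      by (rule order_tendstoD(2)[OF LIMSEQ_inverse_real_of_nat])
    then show "\<forall>\<^sub>F n in sequentially. inverse (real (Suc n)) \<le> y \<bullet> v"
      by eventually_elim simp
  qed
  moreover have "\<forall>\<^sub>F n in sequentially. norm y \<le> real (Suc n)"
  proof -
    obtain N where "norm y \<le> real N" using real_arch_simple by blast
    then show ?thesis by (auto simp: eventually_sequentially intro!: exI[of _ N])
  qed
  ultimately show ?thesis by eventually_elim (auto simp: chamber_core_def)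
qed

definition gauss_moment :: "real \<Rightarrow> real" where
  "gauss_moment a = (LINT r|lborel. indicator {0<..} r * (r powr a * exp (- (r\<^sup>2) / 2)))"

text \<open>Keeps the exponent 2 l + 1 of the radial density nonnegative, so that the Gaussian
  moments below exist.\<close>

lemma lambda_k_ge: "- 1 / 2 \<le> lambda_k Rp \<kappa>"
proof -
  have "0 \<le> gamma_k Rp \<kappa>" unfolding gamma_k_def using \<kappa>_nonneg by (rule sum_nonneg)
  moreover have "1 \<le> real CARD('d)" by (simp add: Suc_leI)
  moreover have "- 1 / 2 \<le> a + (c - 2) / 2" if "0 \<le> a" "1 \<le> c" for a c :: real using that by (simp add: field_simps)
  ultimately show ?thesis unfolding lambda_k_def by blast
qed

lemma gauss_moment_pos: "0 \<le> a \<Longrightarrow> 0 < gauss_moment a"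
proof -
  assume a: "0 \<le> a"
  note i = integrable_powr_exp_neg_square[OF a]
  have "gauss_moment a \<noteq> 0"
  proof
    assume "gauss_moment a = 0"
    then have "AE r in lborel. indicator {0<..} r * (r powr a * exp (- (r\<^sup>2) / 2)) = 0"
      using integral_nonneg_eq_0_iff_AE[OF i] by (simp add: gauss_moment_def)
    then have "AE r in lborel. r \<notin> {1<..<2::real}"
      by eventually_elim (auto simp: indicator_def)
    then have "{1<..<2::real} \<in> null_sets lborel" by (subst AE_iff_null_sets) auto
    then show False by (auto simp: null_sets_def)
  qed
  moreover have "0 \<le> gauss_moment a" unfolding gauss_moment_def by (intro integral_nonneg_AE AE_I2) simp
  ultimately show ?thesis by linarith
qed

text \<open>The bridge between the sphere and Lebesgue measure: a factor |x|^k only shifts the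
  radial exponent by k. As the moments are positive, identities for sphere integrals can be proved
  in the whole space and divided by a moment.\<close>

lemma gaussian_polar_integral:
  fixes u :: "real^'d \<Rightarrow> real"
  assumes u: "integrable surface_measure (\<lambda>\<xi>. u \<xi> * (h_weight Rp \<kappa> \<xi>)\<^sup>2)"
    and um: "u \<in> borel_measurable surface_measure"
  shows "integrable lborel (\<lambda>x. gauss_weight x * (norm x ^ k * u (direction x)))"
    and "(LINT x|lborel. gauss_weight x * (norm x ^ k * u (direction x)))
      = gauss_moment (2 * lambda_k Rp \<kappa> + 1 + real k) * (LINT \<xi>|surface_measure. u \<xi> * (h_weight Rp \<kappa> \<xi>)\<^sup>2)"
proof -
  have m: "(\<lambda>r :: real. r ^ k * exp (- (r\<^sup>2) / 2)) \<in> borel_measurable borel" by measurable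
  have eq: "indicator {0<..} r * (r powr (2 * lambda_k Rp \<kappa> + 1) * (r ^ k * exp (- (r\<^sup>2) / 2)))
    = indicator {0<..} r * (r powr (2 * lambda_k Rp \<kappa> + 1 + real k) * exp (- (r\<^sup>2) / 2))" for r :: real
    by (cases "0 < r") (simp_all add: powr_add powr_realpow)
  have i: "integrable lborel (\<lambda>r. indicator {0<..} r * (r powr (2 * lambda_k Rp \<kappa> + 1) * (r ^ k * exp (- (r\<^sup>2) / 2))))"
    unfolding eq using lambda_k_ge by (intro integrable_powr_exp_neg_square) simp
  have e: "gauss_weight x * (norm x ^ k * u (direction x)) = norm x ^ k * exp (- ((norm x)\<^sup>2) / 2) * u (direction x) * (h_weight Rp \<kappa> x)\<^sup>2" for x
    by (simp add: gauss_weight_def)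
  show "integrable lborel (\<lambda>x. gauss_weight x * (norm x ^ k * u (direction x)))"
    unfolding e by (rule weighted_polar_integral(1)[OF m u um i])
  show "(LINT x|lborel. gauss_weight x * (norm x ^ k * u (direction x)))
      = gauss_moment (2 * lambda_k Rp \<kappa> + 1 + real k) * (LINT \<xi>|surface_measure. u \<xi> * (h_weight Rp \<kappa> \<xi>)\<^sup>2)"
    unfolding e weighted_polar_integral(2)[OF m u um i] gauss_moment_def eq ..
qed

text \<open>Relates the moment belonging to |x|^4 F^2 to the one belonging to |x|^2 F^2 and |x|^4
  |G|^2, so that all terms of the inequality share one factor.\<close>

lemma gauss_moment_recursion:
  "gauss_moment (2 * lambda_k Rp \<kappa> + 5) = (2 * lambda_k Rp \<kappa> + 4) * gauss_moment (2 * lambda_k Rp \<kappa> + 3)"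
proof -
  have "gauss_moment (2 * lambda_k Rp \<kappa> + 4 + 1) = (2 * lambda_k Rp \<kappa> + 4) * gauss_moment (2 * lambda_k Rp \<kappa> + 4 - 1)"
    unfolding gauss_moment_def using lambda_k_ge by (intro gaussian_moment_step) simp
  moreover have "2 * lambda_k Rp \<kappa> + 4 + 1 = 2 * lambda_k Rp \<kappa> + 5" "2 * lambda_k Rp \<kappa> + 4 - 1 = 2 * lambda_k Rp \<kappa> + 3" by simp_all
  ultimately show ?thesis by (simp only:)
qed

lemma gauss_weight_bounded: obtains C where "0 \<le> C" "\<And>x. norm x \<le> r \<Longrightarrow> gauss_weight x \<le> C\<^sup>2"
proof -
  obtain C where C: "\<And>x. norm x \<le> r \<Longrightarrow> h_weight Rp \<kappa> x \<le> C" using h_weight_bounded by blast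
  have "gauss_weight x \<le> \<bar>C\<bar>\<^sup>2" if "norm x \<le> r" for x
  proof -
    have "(h_weight Rp \<kappa> x)\<^sup>2 \<le> C\<^sup>2" using C[OF that] h_weight_nonneg by (intro power_mono)
    then have "gauss_weight x \<le> C\<^sup>2 * 1" unfolding gauss_weight_def by (intro mult_mono) auto
    then show ?thesis by simp
  qed
  then show ?thesis using that[of "\<bar>C\<bar>"] by simp
qed

lemma integrable_h_square: "integrable surface_measure (\<lambda>\<xi>. (h_weight Rp \<kappa> \<xi>)\<^sup>2)"
proof -
  interpret finite_measure "surface_measure :: (real^'d) measure" by (rule finite_measure_surface)
  obtain C where C: "\<And>x. norm x \<le> 1 \<Longrightarrow> h_weight Rp \<kappa> x \<le> C" using h_weight_bounded by blast
  have m: "h_weight Rp \<kappa> \<in> borel_measurable surface_measure"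
    by (rule measurable_h_surface)
  show ?thesis
  proof (rule integrable_const_bound[of _ "C\<^sup>2"])
    show "AE \<xi> in surface_measure. norm ((h_weight Rp \<kappa> \<xi>)\<^sup>2) \<le> C\<^sup>2"
      using C h_weight_nonneg by (intro AE_I2) (auto simp: space_surface_measure intro!: power_mono)
  qed (use m in measurable)
qed

end

context invariant_function
begin

section \<open>The Poincare inequality on a chamber\<close>

lemma gaussian_F2: "integrable lborel (\<lambda>x. gauss_weight x * (norm x ^ k * (F x)\<^sup>2))"
  "(LINT x|lborel. gauss_weight x * (norm x ^ k * (F x)\<^sup>2)) = gauss_moment (2 * lambda_k Rp \<kappa> + 1 + real k) * (LINT \<xi>|surface_measure. (f \<xi>)\<^sup>2 * (h_weight Rp \<kappa> \<xi>)\<^sup>2)"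
  using gaussian_polar_integral[OF f2 borel_measurable_power[OF f_meas], of k] by (simp_all add: F_def)

lemma gaussian_G2: "integrable lborel (\<lambda>x. gauss_weight x * (norm x ^ 4 * (norm (G x))\<^sup>2))"
  "(LINT x|lborel. gauss_weight x * (norm x ^ 4 * (norm (G x))\<^sup>2)) = gauss_moment (2 * lambda_k Rp \<kappa> + 3) * (LINT \<xi>|surface_measure. (norm (g \<xi>))\<^sup>2 * (h_weight Rp \<kappa> \<xi>)\<^sup>2)"
proof -
  have m: "(\<lambda>\<xi>. (norm (g \<xi>))\<^sup>2) \<in> borel_measurable surface_measure" using g_meas by measurable
  have eq: "gauss_weight x * (norm x ^ 4 * (norm (G x))\<^sup>2) = gauss_weight x * (norm x ^ 2 * (norm (g (direction x)))\<^sup>2)" for x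
  proof (cases "x = 0")
    case False
    then show ?thesis by (simp add: G_def power_mult_distrib power_inverse eval_nat_numeral field_simps)
  qed simp
  have e: "2 * lambda_k Rp \<kappa> + 1 + real 2 = 2 * lambda_k Rp \<kappa> + 3" by simp
  show "integrable lborel (\<lambda>x. gauss_weight x * (norm x ^ 4 * (norm (G x))\<^sup>2))"
    unfolding eq by (rule gaussian_polar_integral(1)[OF g2 m])
  show "(LINT x|lborel. gauss_weight x * (norm x ^ 4 * (norm (G x))\<^sup>2)) = gauss_moment (2 * lambda_k Rp \<kappa> + 3) * (LINT \<xi>|surface_measure. (norm (g \<xi>))\<^sup>2 * (h_weight Rp \<kappa> \<xi>)\<^sup>2)"
    unfolding eq gaussian_polar_integral(2)[OF g2 m] e ..
qed

lemma integrable_f_weight: "integrable surface_measure (\<lambda>\<xi>. f \<xi> * (h_weight Rp \<kappa> \<xi>)\<^sup>2)"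
proof (rule Bochner_Integration.integrable_bound)
  show "integrable surface_measure (\<lambda>\<xi>. (f \<xi>)\<^sup>2 * (h_weight Rp \<kappa> \<xi>)\<^sup>2 + (h_weight Rp \<kappa> \<xi>)\<^sup>2)"
    by (intro Bochner_Integration.integrable_add f2 integrable_h_square)
  have "h_weight Rp \<kappa> \<in> borel_measurable surface_measure"
    by (rule measurable_h_surface)
  then show "(\<lambda>\<xi>. f \<xi> * (h_weight Rp \<kappa> \<xi>)\<^sup>2) \<in> borel_measurable surface_measure" using f_meas by measurable
  show "AE \<xi> in surface_measure. norm (f \<xi> * (h_weight Rp \<kappa> \<xi>)\<^sup>2) \<le> norm ((f \<xi>)\<^sup>2 * (h_weight Rp \<kappa> \<xi>)\<^sup>2 + (h_weight Rp \<kappa> \<xi>)\<^sup>2)"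
  proof (rule AE_I2)
    fix \<xi>
    have "2 * \<bar>f \<xi>\<bar> \<le> (f \<xi>)\<^sup>2 + 1" using zero_le_power2[of "\<bar>f \<xi>\<bar> - 1"] by (simp add: power2_diff)
    moreover have "0 \<le> \<bar>f \<xi>\<bar>" by simp
    ultimately have "\<bar>f \<xi>\<bar> \<le> (f \<xi>)\<^sup>2 + 1" by linarith
    then have "\<bar>f \<xi>\<bar> * (h_weight Rp \<kappa> \<xi>)\<^sup>2 \<le> ((f \<xi>)\<^sup>2 + 1) * (h_weight Rp \<kappa> \<xi>)\<^sup>2" by (rule mult_right_mono) simp
    then show "norm (f \<xi> * (h_weight Rp \<kappa> \<xi>)\<^sup>2) \<le> norm ((f \<xi>)\<^sup>2 * (h_weight Rp \<kappa> \<xi>)\<^sup>2 + (h_weight Rp \<kappa> \<xi>)\<^sup>2)"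
      by (simp add: abs_mult algebra_simps)
  qed
qed

lemma gaussian_F1: "integrable lborel (\<lambda>x. gauss_weight x * (norm x ^ k * F x))"
  "(LINT x|lborel. gauss_weight x * (norm x ^ k * F x)) = gauss_moment (2 * lambda_k Rp \<kappa> + 1 + real k) * (LINT \<xi>|surface_measure. f \<xi> * (h_weight Rp \<kappa> \<xi>)\<^sup>2)"
  using gaussian_polar_integral[OF integrable_f_weight f_meas, of k] by (simp_all add: F_def)

lemma integrable_gauss_weight: "integrable lborel gauss_weight"
  using gaussian_polar_integral(1)[of "\<lambda>_. 1" 0] integrable_h_square by simp

text \<open>The weighted squared norm of |x|^2 G + 2 F x, the gradient of |x|^2 F, without its cross
  term 4 |x|^2 F (G \<bullet> x), which vanishes almost everywhere by
  \<open>radial_part_zero\<close>.\<close>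

definition energy :: "real^'d \<Rightarrow> real" where
  "energy x = gauss_weight x * (norm x ^ 4 * (norm (G x))\<^sup>2) + 4 * (gauss_weight x * (norm x ^ 2 * (F x)\<^sup>2))"

lemma integrable_energy: "integrable lborel energy"
  unfolding energy_def[abs_def] using gaussian_G2(1) gaussian_F2(1)[of 2] by simp

lemma energy_nonneg: "0 \<le> energy x" by (simp add: energy_def gauss_weight_nonneg)

lemma measurable_energy[measurable]: "energy \<in> borel_measurable borel"
  unfolding energy_def[abs_def] by measurable

text \<open>The smooth inequality is applied to \<open>b\<close> times mollifications of
  \<open>F\<close> and passed to the limit in L2. The factor \<open>b\<close> vanishes near the
  origin together with its slope, so convergence of the mollifications is only needed on a compact
  set off both the origin and the hyperplanes.\<close>

lemma chamber_core_Poincare: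
  fixes x0 :: "real^'d" and n :: nat
  assumes x0: "\<And>v. v \<in> roots \<Longrightarrow> x0 \<bullet> v \<noteq> 0"
  defines "K \<equiv> chamber_core x0 n" and "b \<equiv> (\<lambda>y :: real^'d. soft_square (inverse (real (Suc n))) ((norm y)\<^sup>2))"
  shows "(LINT y|lborel. indicator K y * gauss_weight y) * (LINT y|lborel. indicator K y * gauss_weight y * (b y * F y)\<^sup>2)
      - (LINT y|lborel. indicator K y * gauss_weight y * (b y * F y))\<^sup>2
     \<le> (LINT y|lborel. indicator K y * gauss_weight y) * (LINT y|lborel. indicator K y * energy y)"
proof -
  define \<delta> where "\<delta> = inverse (real (Suc n))"
  have \<delta>: "0 < \<delta>" by (simp add: \<delta>_def)
  define N where "N = real (Suc n)"
  have N: "0 \<le> N" by (simp add: N_def)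
  define s where "s y = soft_square_slope \<delta> ((norm y)\<^sup>2)" for y :: "real^'d"
  note sb = soft_square_bounds[OF \<delta>]
  have bs: "0 \<le> b y" "b y \<le> (norm y)\<^sup>2" "0 \<le> s y" "s y \<le> 1" "(norm y)\<^sup>2 \<le> \<delta> \<Longrightarrow> b y = 0 \<and> s y = 0" for y
    using sb by (auto simp: b_def s_def \<delta>_def)
  have bc: "continuous_on UNIV b" "continuous_on UNIV s"
    unfolding b_def s_def[abs_def] \<delta>_def[symmetric]
    by (intro continuous_on_compose2[OF continuous_on_soft_square[OF \<delta>]] continuous_on_compose2[OF continuous_on_soft_square_slope[OF \<delta>]] continuous_intros; simp)+
  have [measurable]: "b \<in> borel_measurable borel" "s \<in> borel_measurable borel"
    using bc by (auto intro: borel_measurable_continuous_onI)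
  have K: "compact K" "convex K" "K \<subseteq> chamber x0"
    using compact_chamber_core convex_chamber_core chamber_core_subset[OF x0] by (auto simp: K_def)
  have [measurable]: "K \<in> sets borel" using K by (simp add: borel_closed compact_imp_closed)
  have KN: "norm y \<le> N" if "y \<in> K" for y using that by (simp add: K_def chamber_core_def N_def)
  \<comment> \<open>The part of \<open>K\<close> where \<open>b\<close> or its slope can be nonzero.
    It stays away from the origin even if there are no roots to keep \<open>K\<close> away from
    it.\<close>
  define A where "A = K \<inter> {y. \<delta> \<le> (norm y)\<^sup>2}"
  have "closed {y :: real^'d. \<delta> \<le> (norm y)\<^sup>2}" by (intro closed_Collect_le continuous_intros)
  then have A: "compact A" using K by (simp add: A_def compact_Int_closed)
  have A': "A \<subseteq> off_hyperplanes Rp"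
    using K(3) \<delta> Rp_roots by (fastforce simp: A_def off_hyperplanes_def chamber_def)
  note A = A A'
  have [measurable]: "A \<in> sets borel" using A by (simp add: borel_closed compact_imp_closed)
  obtain C where C: "0 \<le> C" "\<And>y. norm y \<le> N \<Longrightarrow> gauss_weight y \<le> C\<^sup>2" using gauss_weight_bounded by blast
  obtain Fm Gm where FG: "\<And>m x. (Fm m has_derivative (\<lambda>v. v \<bullet> Gm m x)) (at x)" "\<And>m. continuous_on UNIV (Gm m)"
    and FGi: "\<And>m. integrable lborel (\<lambda>x. indicator A x * (Fm m x - F x)\<^sup>2)" "(\<lambda>m. LINT x|lborel. indicator A x * (Fm m x - F x)\<^sup>2) \<longlonglongrightarrow> 0"
      "\<And>m. integrable lborel (\<lambda>x. indicator A x * (norm (Gm m x - G x))\<^sup>2)" "(\<lambda>m. LINT x|lborel. indicator A x * (norm (Gm m x - G x))\<^sup>2) \<longlonglongrightarrow> 0"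
    using smooth_sequence[OF A] by blast
  have Fc: "continuous_on UNIV (Fm m)" for m
    by (rule has_derivative_continuous_on[OF has_derivative_at_withinI[OF FG(1)]])
  have [measurable]: "Fm m \<in> borel_measurable borel" "Gm m \<in> borel_measurable borel" for m
    using FG(2) Fc by (auto intro: borel_measurable_continuous_onI)
  define \<Gamma>m \<Gamma> where "\<Gamma>m m y = b y *\<^sub>R Gm m y + (Fm m y * (2 * s y)) *\<^sub>R y"
    and "\<Gamma> y = b y *\<^sub>R G y + (F y * (2 * s y)) *\<^sub>R y" for m y
  have [measurable]: "\<Gamma>m m \<in> borel_measurable borel" "\<Gamma> \<in> borel_measurable borel" for m
    unfolding \<Gamma>m_def[abs_def] \<Gamma>_def[abs_def] by measurable
  define W where "W = (LINT y|lborel. indicator K y * gauss_weight y)"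
  have W0: "0 \<le> W" unfolding W_def by (intro integral_nonneg_AE AE_I2) (simp add: gauss_weight_nonneg)
  have P: "W * (LINT y|lborel. indicator K y * gauss_weight y * (b y * Fm m y)\<^sup>2) - (LINT y|lborel. indicator K y * gauss_weight y * (b y * Fm m y))\<^sup>2
      \<le> W * (LINT y|lborel. indicator K y * gauss_weight y * (norm (\<Gamma>m m y))\<^sup>2)" for m
    unfolding W_def
  proof (rule Poincare_compact[OF K(1,2), where Cw="C\<^sup>2"])
    fix y z assume y: "y \<in> K" and z: "z \<in> K"
    show "gauss_weight y * gauss_weight z * exp ((norm (y - z))\<^sup>2 / 4) \<le> (gauss_weight ((1/2) *\<^sub>R (y + z)))\<^sup>2"
    proof (rule gauss_weight_midpoint)
      fix v assume "v \<in> Rp"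
      then have "0 < (x0 \<bullet> v) * (y \<bullet> v)" "0 < (x0 \<bullet> v) * (z \<bullet> v)"
        using y z K(3) by (auto simp: chamber_def Rp_roots)
      then show "0 \<le> (y \<bullet> v) * (z \<bullet> v)" by (auto simp: zero_less_mult_iff zero_le_mult_iff)
    qed
  next
    show "((\<lambda>y. b y * Fm m y) has_derivative (\<lambda>v. v \<bullet> \<Gamma>m m y)) (at y)" for y
      unfolding b_def \<Gamma>m_def s_def \<delta>_def[symmetric]
      by (rule has_derivative_eq_rhs, rule has_derivative_mult[OF soft_square_norm_has_derivative[OF \<delta>] FG(1)])
         (simp add: fun_eq_iff inner_add_right algebra_simps)
    show "continuous_on UNIV (\<Gamma>m m)"
      unfolding \<Gamma>m_def[abs_def] by (intro continuous_intros bc FG Fc)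
  qed (use C KN gauss_weight_nonneg in auto)
  \<comment> \<open>Attaching the square root of the weight to each factor turns the weighted
    integrals into plain L2 pairings. The mean is the pairing with \<open>rt\<close> itself.\<close>
  define rt where "rt y = indicator K y * sqrt (gauss_weight y)" for y
  have rt: "0 \<le> rt y" "rt y * rt y = indicator K y * gauss_weight y" "rt y \<le> C" for y
  proof -
    show "0 \<le> rt y" by (simp add: rt_def gauss_weight_nonneg)
    show "rt y * rt y = indicator K y * gauss_weight y" by (simp add: rt_def indicator_def gauss_weight_nonneg)
    show "rt y \<le> C"
    proof (cases "y \<in> K")
      case True
      then have "sqrt (gauss_weight y) \<le> sqrt (C\<^sup>2)" using C(2) KN by (intro real_sqrt_le_mono) auto
      then show ?thesis using True C(1) by (simp add: rt_def)
    qed (simp add: rt_def C)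
  qed
  have [measurable]: "rt \<in> borel_measurable borel" unfolding rt_def[abs_def] by measurable
  define um u vm v where "um m y = rt y * (b y * Fm m y)" and "u y = rt y * (b y * F y)"
    and "vm m y = rt y * norm (\<Gamma>m m y)" and "v y = rt y * norm (\<Gamma> y)" for m y
  have [measurable]: "um m \<in> borel_measurable borel" "u \<in> borel_measurable borel" "vm m \<in> borel_measurable borel" "v \<in> borel_measurable borel" for m
    unfolding um_def[abs_def] u_def[abs_def] vm_def[abs_def] v_def[abs_def] by measurable
  define Q where "Q = C\<^sup>2 * (2 * N ^ 4 + 8 * N\<^sup>2)"
  have bN: "b y \<le> N\<^sup>2" if "y \<in> K" for y
  proof -
    have "(norm y)\<^sup>2 \<le> N\<^sup>2" using KN[OF that] by (intro power_mono) auto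
    then show ?thesis using bs(2)[of y] by linarith
  qed
  \<comment> \<open>One pointwise bound for both the function and its gradient: p stands for the
    factor multiplied by \<open>b\<close>, q for the one multiplied by the slope. It is applied to
    the limits and to the approximation errors.\<close>
  have sq: "(rt y * (b y * p + 2 * s y * norm y * q))\<^sup>2 \<le> Q * (indicator A y * p\<^sup>2 + indicator A y * q\<^sup>2)" if pq: "0 \<le> p" "0 \<le> q" for y p q
  proof (cases "y \<in> A")
    case True
    then have yK: "y \<in> K" by (simp add: A_def)
    have "b y * p \<le> N\<^sup>2 * p" using bN[OF yK] pq by (intro mult_right_mono) auto
    moreover have "2 * s y * norm y * q \<le> 2 * 1 * N * q"
      using bs(3,4)[of y] KN[OF yK] pq N by (intro mult_mono) auto
    ultimately have "b y * p + 2 * s y * norm y * q \<le> N\<^sup>2 * p + 2 * N * q" by simp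
    then have "rt y * (b y * p + 2 * s y * norm y * q) \<le> C * (N\<^sup>2 * p + 2 * N * q)"
      using rt(1,3)[of y] C pq N bs(1,3)[of y] by (intro mult_mono) auto
    then have "(rt y * (b y * p + 2 * s y * norm y * q))\<^sup>2 \<le> (C * (N\<^sup>2 * p + 2 * N * q))\<^sup>2"
      using rt(1)[of y] bs(1,3)[of y] pq by (intro power_mono) auto
    also have "\<dots> = C\<^sup>2 * (N\<^sup>2 * p + 2 * N * q)\<^sup>2" by (simp add: power_mult_distrib)
    also have "(N\<^sup>2 * p + 2 * N * q)\<^sup>2 \<le> 2 * (N\<^sup>2 * p)\<^sup>2 + 2 * (2 * N * q)\<^sup>2"
      using zero_le_power2[of "N\<^sup>2 * p - 2 * N * q"] by (simp add: power2_eq_square algebra_simps)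
    also have "\<dots> = 2 * N ^ 4 * p\<^sup>2 + 8 * N\<^sup>2 * q\<^sup>2" by (simp add: power_mult_distrib flip: power_mult)
    also have "\<dots> \<le> (2 * N ^ 4 + 8 * N\<^sup>2) * p\<^sup>2 + (2 * N ^ 4 + 8 * N\<^sup>2) * q\<^sup>2"
      using N by (intro add_mono mult_right_mono) auto
    finally have "(rt y * (b y * p + 2 * s y * norm y * q))\<^sup>2 \<le> C\<^sup>2 * ((2 * N ^ 4 + 8 * N\<^sup>2) * p\<^sup>2 + (2 * N ^ 4 + 8 * N\<^sup>2) * q\<^sup>2)"
      by (simp add: mult_left_mono)
    also have "\<dots> = Q * (indicator A y * p\<^sup>2 + indicator A y * q\<^sup>2)" using True by (simp add: Q_def algebra_simps)
    finally show ?thesis .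
  next
    case False
    show ?thesis
    proof (cases "y \<in> K")
      case True
      then have "b y = 0 \<and> s y = 0" using False by (intro bs(5)) (auto simp: A_def)
      then show ?thesis using False by simp
    qed (use False in \<open>simp add: rt_def\<close>)
  qed
  note loc = local_L2[OF A]
  have Q0: "0 \<le> Q" using N by (simp add: Q_def)
  have diffu: "(um m y - u y)\<^sup>2 \<le> Q * (indicator A y * (norm (Gm m y - G y))\<^sup>2 + indicator A y * (Fm m y - F y)\<^sup>2)" for m y
  proof -
    have "(um m y - u y)\<^sup>2 = (rt y * (b y * \<bar>Fm m y - F y\<bar> + 2 * s y * norm y * 0))\<^sup>2"
      by (simp add: um_def u_def right_diff_distrib[symmetric] power_mult_distrib)
    also have "\<dots> \<le> Q * (indicator A y * \<bar>Fm m y - F y\<bar>\<^sup>2 + indicator A y * 0\<^sup>2)" by (rule sq) auto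
    also have "\<dots> \<le> Q * (indicator A y * (norm (Gm m y - G y))\<^sup>2 + indicator A y * (Fm m y - F y)\<^sup>2)"
      using Q0 by (intro mult_left_mono) auto
    finally show ?thesis .
  qed
  have nb: "norm (b y *\<^sub>R w + (t * (2 * s y)) *\<^sub>R y) \<le> b y * norm w + 2 * s y * norm y * \<bar>t\<bar>" for y w t
    by (rule order_trans[OF norm_triangle_ineq]) (use bs(1,3)[of y] in \<open>simp add: abs_mult mult_ac\<close>)
  have diffv: "(vm m y - v y)\<^sup>2 \<le> Q * (indicator A y * (norm (Gm m y - G y))\<^sup>2 + indicator A y * (Fm m y - F y)\<^sup>2)" for m y
  proof -
    have "\<bar>norm (\<Gamma>m m y) - norm (\<Gamma> y)\<bar> \<le> norm (\<Gamma>m m y - \<Gamma> y)" by (rule norm_triangle_ineq3)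
    also have "\<Gamma>m m y - \<Gamma> y = b y *\<^sub>R (Gm m y - G y) + ((Fm m y - F y) * (2 * s y)) *\<^sub>R y"
      by (simp add: \<Gamma>m_def \<Gamma>_def algebra_simps)
    also have "norm \<dots> \<le> b y * norm (Gm m y - G y) + 2 * s y * norm y * \<bar>Fm m y - F y\<bar>" by (rule nb)
    finally have "\<bar>vm m y - v y\<bar> \<le> rt y * (b y * norm (Gm m y - G y) + 2 * s y * norm y * \<bar>Fm m y - F y\<bar>)"
      unfolding vm_def v_def right_diff_distrib[symmetric] abs_mult using rt(1)[of y] by (simp add: mult_left_mono)
    then have "\<bar>vm m y - v y\<bar>\<^sup>2 \<le> (rt y * (b y * norm (Gm m y - G y) + 2 * s y * norm y * \<bar>Fm m y - F y\<bar>))\<^sup>2"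
      by (rule power_mono) simp
    also have "\<dots> \<le> Q * (indicator A y * (norm (Gm m y - G y))\<^sup>2 + indicator A y * \<bar>Fm m y - F y\<bar>\<^sup>2)" by (rule sq) auto
    finally show ?thesis by simp
  qed
  have u2: "(u y)\<^sup>2 \<le> Q * (indicator A y * (norm (G y))\<^sup>2 + indicator A y * (F y)\<^sup>2)" for y
  proof -
    have "(u y)\<^sup>2 = (rt y * (b y * \<bar>F y\<bar> + 2 * s y * norm y * 0))\<^sup>2"
      by (simp add: u_def power_mult_distrib)
    also have "\<dots> \<le> Q * (indicator A y * \<bar>F y\<bar>\<^sup>2 + indicator A y * 0\<^sup>2)" by (rule sq) auto
    also have "\<dots> \<le> Q * (indicator A y * (norm (G y))\<^sup>2 + indicator A y * (F y)\<^sup>2)"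
      using Q0 by (intro mult_left_mono) auto
    finally show ?thesis .
  qed
  have v2: "(v y)\<^sup>2 \<le> Q * (indicator A y * (norm (G y))\<^sup>2 + indicator A y * (F y)\<^sup>2)" for y
  proof -
    have "v y \<le> rt y * (b y * norm (G y) + 2 * s y * norm y * \<bar>F y\<bar>)"
      unfolding v_def \<Gamma>_def using rt(1)[of y] nb by (intro mult_left_mono) auto
    moreover have "0 \<le> v y" using rt(1)[of y] by (simp add: v_def)
    ultimately have "(v y)\<^sup>2 \<le> (rt y * (b y * norm (G y) + 2 * s y * norm y * \<bar>F y\<bar>))\<^sup>2" by (rule power_mono)
    also have "\<dots> \<le> Q * (indicator A y * (norm (G y))\<^sup>2 + indicator A y * \<bar>F y\<bar>\<^sup>2)" by (rule sq) auto
    finally show ?thesis by simp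
  qed
  have qm: "integrable lborel (\<lambda>y. Q * (indicator A y * (norm (Gm m y - G y))\<^sup>2 + indicator A y * (Fm m y - F y)\<^sup>2))" for m
    using FGi by (intro integrable_mult_right Bochner_Integration.integrable_add)
  have qq: "integrable lborel (\<lambda>y. Q * (indicator A y * (norm (G y))\<^sup>2 + indicator A y * (F y)\<^sup>2))"
    using loc by (intro integrable_mult_right Bochner_Integration.integrable_add)
  have ib: "integrable lborel (\<lambda>y. (k y)\<^sup>2)" if "k \<in> borel_measurable borel" "\<And>y. (k y)\<^sup>2 \<le> q y" "integrable lborel q" for k q :: "real^'d \<Rightarrow> real"
  proof (rule Bochner_Integration.integrable_bound[OF that(3)])
    show "AE y in lborel. norm ((k y)\<^sup>2) \<le> norm (q y)"
      using that(2) by (intro AE_I2) (auto intro: order_trans[OF _ abs_ge_self])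
  qed (use that(1) in measurable)
  have tq: "(\<lambda>m. LINT y|lborel. (k m y)\<^sup>2) \<longlonglongrightarrow> 0"
    if "\<And>m. k m \<in> borel_measurable borel" "\<And>m y. (k m y)\<^sup>2 \<le> Q * (indicator A y * (norm (Gm m y - G y))\<^sup>2 + indicator A y * (Fm m y - F y)\<^sup>2)" for k :: "nat \<Rightarrow> real^'d \<Rightarrow> real"
  proof (rule tendsto_sandwich[OF _ _ tendsto_const])
    show "\<forall>\<^sub>F m in sequentially. (LINT y|lborel. (k m y)\<^sup>2)
      \<le> Q * ((LINT x|lborel. indicator A x * (norm (Gm m x - G x))\<^sup>2) + (LINT x|lborel. indicator A x * (Fm m x - F x)\<^sup>2))"
    proof (intro always_eventually allI)
      fix m
      have "(LINT y|lborel. (k m y)\<^sup>2) \<le> (LINT y|lborel. Q * (indicator A y * (norm (Gm m y - G y))\<^sup>2 + indicator A y * (Fm m y - F y)\<^sup>2))"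
        by (rule integral_mono[OF ib[OF that qm] qm that(2)])
      then show "(LINT y|lborel. (k m y)\<^sup>2)
      \<le> Q * ((LINT x|lborel. indicator A x * (norm (Gm m x - G x))\<^sup>2) + (LINT x|lborel. indicator A x * (Fm m x - F x)\<^sup>2))"
        using FGi by simp
    qed
    show "(\<lambda>m. Q * ((LINT x|lborel. indicator A x * (norm (Gm m x - G x))\<^sup>2) + (LINT x|lborel. indicator A x * (Fm m x - F x)\<^sup>2))) \<longlonglongrightarrow> 0"
      using tendsto_mult_left[OF tendsto_add[OF FGi(4) FGi(2)], of Q] by simp
  qed simp
  have iu: "integrable lborel (\<lambda>y. (um m y - u y)\<^sup>2)" "integrable lborel (\<lambda>y. (vm m y - v y)\<^sup>2)"
    "integrable lborel (\<lambda>y. (u y)\<^sup>2)" "integrable lborel (\<lambda>y. (v y)\<^sup>2)" for m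
    by (rule ib[OF _ diffu qm], measurable) (rule ib[OF _ diffv qm], measurable, rule ib[OF _ u2 qq], measurable, rule ib[OF _ v2 qq], measurable)
  have lu: "(\<lambda>m. LINT y|lborel. (um m y - u y)\<^sup>2) \<longlonglongrightarrow> 0" "(\<lambda>m. LINT y|lborel. (vm m y - v y)\<^sup>2) \<longlonglongrightarrow> 0"
    by (rule tq[OF _ diffu], measurable) (rule tq[OF _ diffv], measurable)
  have irt: "integrable lborel (\<lambda>y. (rt y)\<^sup>2)"
  proof -
    have "integrable lborel (\<lambda>y. gauss_weight y * indicator K y)"
      by (rule integrable_real_mult_indicator) (simp_all add: integrable_gauss_weight)
    then show ?thesis by (simp add: power2_eq_square rt(2) mult.commute)
  qed
  have L1: "(\<lambda>m. LINT y|lborel. um m y * um m y) \<longlonglongrightarrow> (LINT y|lborel. u y * u y)"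
    by (rule L2_pairing_tendsto(1)) (use iu lu in simp_all)
  have L2: "(\<lambda>m. LINT y|lborel. vm m y * vm m y) \<longlonglongrightarrow> (LINT y|lborel. v y * v y)"
    by (rule L2_pairing_tendsto(1)) (use iu lu in simp_all)
  have L3: "(\<lambda>m. LINT y|lborel. rt y * um m y) \<longlonglongrightarrow> (LINT y|lborel. rt y * u y)"
    by (rule L2_pairing_tendsto(1)[where un="\<lambda>_. rt"]) (use iu lu irt in simp_all)
  have e: "um m y * um m y = indicator K y * gauss_weight y * (b y * Fm m y)\<^sup>2"
    "vm m y * vm m y = indicator K y * gauss_weight y * (norm (\<Gamma>m m y))\<^sup>2"
    "rt y * um m y = indicator K y * gauss_weight y * (b y * Fm m y)"
    "u y * u y = indicator K y * gauss_weight y * (b y * F y)\<^sup>2"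
    "v y * v y = indicator K y * gauss_weight y * (norm (\<Gamma> y))\<^sup>2"
    "rt y * u y = indicator K y * gauss_weight y * (b y * F y)" for m y
    unfolding rt(2)[symmetric] by (simp_all add: um_def vm_def u_def v_def power2_eq_square mult_ac)
  have main: "W * (LINT y|lborel. u y * u y) - (LINT y|lborel. rt y * u y)\<^sup>2 \<le> W * (LINT y|lborel. v y * v y)"
  proof (rule LIMSEQ_le)
    show "(\<lambda>m. W * (LINT y|lborel. um m y * um m y) - (LINT y|lborel. rt y * um m y)\<^sup>2) \<longlonglongrightarrow> W * (LINT y|lborel. u y * u y) - (LINT y|lborel. rt y * u y)\<^sup>2"
      by (intro tendsto_intros L1 L3)
    show "(\<lambda>m. W * (LINT y|lborel. vm m y * vm m y)) \<longlonglongrightarrow> W * (LINT y|lborel. v y * v y)"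
      by (intro tendsto_intros L2)
    show "\<exists>N. \<forall>m\<ge>N. W * (LINT y|lborel. um m y * um m y) - (LINT y|lborel. rt y * um m y)\<^sup>2 \<le> W * (LINT y|lborel. vm m y * vm m y)"
      using P unfolding e by blast
  qed
  \<comment> \<open>After the cross term has dropped out, the bounds 0 \<le> b \<le> |y|^2 and 0
    \<le> s \<le> 1 leave at most the energy. Thus the soft square costs nothing in the
    constant.\<close>
  have "(LINT y|lborel. v y * v y) \<le> (LINT y|lborel. indicator K y * energy y)"
  proof (rule integral_mono_AE)
    show "integrable lborel (\<lambda>y. v y * v y)" using iu(4) by (simp add: power2_eq_square)
    show "integrable lborel (\<lambda>y. indicator K y * energy y)"
      using integrable_real_mult_indicator[OF _ integrable_energy, of K] by (simp add: mult.commute)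
    show "AE y in lborel. v y * v y \<le> indicator K y * energy y"
      using radial_part_zero
    proof eventually_elim
      case (elim y)
      have "(norm (\<Gamma> y))\<^sup>2 = (b y)\<^sup>2 * (norm (G y))\<^sup>2 + 4 * b y * s y * (F y * (G y \<bullet> y)) + 4 * (s y)\<^sup>2 * (F y)\<^sup>2 * (norm y)\<^sup>2"
        unfolding \<Gamma>_def power2_norm_eq_inner by (simp add: inner_simps inner_commute algebra_simps power2_eq_square)
      also have "\<dots> = (b y)\<^sup>2 * (norm (G y))\<^sup>2 + 4 * (s y)\<^sup>2 * ((F y)\<^sup>2 * (norm y)\<^sup>2)" using elim by simp
      also have "\<dots> \<le> norm y ^ 4 * (norm (G y))\<^sup>2 + 4 * 1 * ((F y)\<^sup>2 * (norm y)\<^sup>2)"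
      proof (intro add_mono mult_right_mono mult_left_mono)
        have "(b y)\<^sup>2 \<le> ((norm y)\<^sup>2)\<^sup>2" using bs(1,2)[of y] by (intro power_mono)
        then show "(b y)\<^sup>2 \<le> norm y ^ 4" by (simp flip: power_mult)
        show "(s y)\<^sup>2 \<le> 1" using bs(3,4)[of y] by (simp add: power_le_one)
      qed auto
      finally have "(norm (\<Gamma> y))\<^sup>2 \<le> norm y ^ 4 * (norm (G y))\<^sup>2 + 4 * ((norm y)\<^sup>2 * (F y)\<^sup>2)" by (simp add: mult_ac)
      then have "indicator K y * gauss_weight y * (norm (\<Gamma> y))\<^sup>2 \<le> indicator K y * gauss_weight y * (norm y ^ 4 * (norm (G y))\<^sup>2 + 4 * ((norm y)\<^sup>2 * (F y)\<^sup>2))"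
        by (intro mult_left_mono) (simp_all add: gauss_weight_nonneg)
      then show ?case unfolding e energy_def by (simp add: algebra_simps)
    qed
  qed
  then have "W * (LINT y|lborel. v y * v y) \<le> W * (LINT y|lborel. indicator K y * energy y)"
    using W0 by (rule mult_left_mono)
  then show ?thesis using main unfolding e W_def by linarith
qed

text \<open>Both regularizations are removed at once: the cores exhaust the chamber and the soft
  squares increase to |y|^2 in the limit, dominated by the integrands without regularization. The
  mean zero hypothesis refers to the limit only, so the squared mean is carried along until
  then.\<close>

lemma chamber_Poincare:
  assumes x0: "\<And>v. v \<in> roots \<Longrightarrow> x0 \<bullet> v \<noteq> 0"
    and mean: "(LINT y|lborel. indicator (chamber x0) y * (gauss_weight y * (norm y ^ 2 * F y))) = 0"
  shows "(LINT y|lborel. indicator (chamber x0) y * (gauss_weight y * (norm y ^ 4 * (F y)\<^sup>2)))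
    \<le> (LINT y|lborel. indicator (chamber x0) y * energy y)"
proof -
  define C where "C = chamber x0"
  have [measurable]: "C \<in> sets borel" by (simp add: C_def)
  define K where "K n = chamber_core x0 n" for n
  have [measurable]: "K n \<in> sets borel" for n
    using compact_chamber_core[of x0 n] by (simp add: K_def borel_closed compact_imp_closed)
  have KC: "K n \<subseteq> C" for n using chamber_core_subset[OF x0] by (simp add: K_def C_def)
  have Kev: "\<forall>\<^sub>F n in sequentially. y \<in> K n" if "y \<in> C" for y
    using chamber_core_exhausts[of y x0] that by (simp add: K_def C_def)
  define b where "b n y = soft_square (inverse (real (Suc n))) ((norm y)\<^sup>2)" for n and y :: "real^'d"
  have b: "0 \<le> b n y" "b n y \<le> (norm y)\<^sup>2" "(\<lambda>n. b n y) \<longlonglongrightarrow> (norm y)\<^sup>2" for n y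
    using soft_square_bounds[of "inverse (real (Suc n))"] soft_square_tendsto[of "(norm y)\<^sup>2"] by (auto simp: b_def)
  have [measurable]: "b n \<in> borel_measurable borel" for n
    unfolding b_def by (intro borel_measurable_continuous_onI continuous_on_compose2[OF continuous_on_soft_square] continuous_intros) auto
  have lim: "(\<lambda>n. LINT y|lborel. indicator (K n) y * p n y) \<longlonglongrightarrow> (LINT y|lborel. indicator C y * q y)"
    if [measurable]: "\<And>n. p n \<in> borel_measurable borel" and q: "integrable lborel q" and pq: "\<And>n y. \<bar>p n y\<bar> \<le> \<bar>q y\<bar>" "\<And>y. (\<lambda>n. p n y) \<longlonglongrightarrow> q y"
    for p and q :: "real^'d \<Rightarrow> real"
  proof (rule integral_dominated_convergence[where w="\<lambda>y. \<bar>q y\<bar>"])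
    have [measurable]: "q \<in> borel_measurable borel" using borel_measurable_integrable[OF q] by simp
    show "(\<lambda>y. indicator C y * q y) \<in> borel_measurable lborel" by measurable
    show "AE y in lborel. (\<lambda>n. indicator (K n) y * p n y) \<longlonglongrightarrow> indicator C y * q y"
    proof (rule AE_I2)
      fix y
      show "(\<lambda>n. indicator (K n) y * p n y) \<longlonglongrightarrow> indicator C y * q y"
      proof (cases "y \<in> C")
        case True
        from Kev[OF this] have "\<forall>\<^sub>F n in sequentially. p n y = indicator (K n) y * p n y"
          by eventually_elim simp
        from Lim_transform_eventually[OF pq(2) this] show ?thesis using True by simp
      next
        case False
        then have "y \<notin> K n" for n using KC by auto
        then show ?thesis using False by simp
      qed
    qed
    show "AE y in lborel. norm (indicator (K n) y * p n y) \<le> \<bar>q y\<bar>" for n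
      using pq(1) by (intro AE_I2) (auto simp: indicator_def)
  qed (use q in auto)
  define W where "W n = (LINT y|lborel. indicator (K n) y * gauss_weight y)" for n
  define V where "V = (LINT y|lborel. indicator C y * gauss_weight y)"
  have l0: "W \<longlonglongrightarrow> V"
    unfolding W_def[abs_def] V_def by (rule lim) (simp_all add: integrable_gauss_weight)
  have "(\<lambda>n. LINT y|lborel. indicator (K n) y * (gauss_weight y * (b n y * F y)\<^sup>2)) \<longlonglongrightarrow> (LINT y|lborel. indicator C y * (gauss_weight y * (norm y ^ 4 * (F y)\<^sup>2)))"
  proof (rule lim[OF _ gaussian_F2(1)])
    fix n y
    have "(b n y)\<^sup>2 \<le> ((norm y)\<^sup>2)\<^sup>2" using b by (intro power_mono)
    then have "(b n y)\<^sup>2 \<le> norm y ^ 4" by (simp flip: power_mult)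
    then show "\<bar>gauss_weight y * (b n y * F y)\<^sup>2\<bar> \<le> \<bar>gauss_weight y * (norm y ^ 4 * (F y)\<^sup>2)\<bar>"
      by (simp add: abs_mult power_mult_distrib mult_left_mono mult_right_mono)
    have "(\<lambda>n. gauss_weight y * (b n y * F y)\<^sup>2) \<longlonglongrightarrow> gauss_weight y * ((norm y)\<^sup>2 * F y)\<^sup>2"
      by (intro tendsto_intros b)
    then show "(\<lambda>n. gauss_weight y * (b n y * F y)\<^sup>2) \<longlonglongrightarrow> gauss_weight y * (norm y ^ 4 * (F y)\<^sup>2)"
      by (simp add: power_mult_distrib flip: power_mult)
  qed measurable
  then have l1: "(\<lambda>n. LINT y|lborel. indicator (K n) y * gauss_weight y * (b n y * F y)\<^sup>2) \<longlonglongrightarrow> (LINT y|lborel. indicator C y * (gauss_weight y * (norm y ^ 4 * (F y)\<^sup>2)))"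
    by (simp add: mult.assoc)
  have "(\<lambda>n. LINT y|lborel. indicator (K n) y * (gauss_weight y * (b n y * F y))) \<longlonglongrightarrow> (LINT y|lborel. indicator C y * (gauss_weight y * (norm y ^ 2 * F y)))"
  proof (rule lim[OF _ gaussian_F1(1)])
    fix n y
    show "\<bar>gauss_weight y * (b n y * F y)\<bar> \<le> \<bar>gauss_weight y * ((norm y)\<^sup>2 * F y)\<bar>"
      using b(1,2)[of n y] by (simp add: abs_mult mult_left_mono mult_right_mono)
    show "(\<lambda>n. gauss_weight y * (b n y * F y)) \<longlonglongrightarrow> gauss_weight y * ((norm y)\<^sup>2 * F y)"
      by (intro tendsto_intros b)
  qed measurable
  then have l2: "(\<lambda>n. LINT y|lborel. indicator (K n) y * gauss_weight y * (b n y * F y)) \<longlonglongrightarrow> 0"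
    using mean by (simp add: mult.assoc C_def)
  have l3: "(\<lambda>n. LINT y|lborel. indicator (K n) y * energy y) \<longlonglongrightarrow> (LINT y|lborel. indicator C y * energy y)"
    by (rule lim[OF _ integrable_energy]) simp_all
  have "V * (LINT y|lborel. indicator C y * (gauss_weight y * (norm y ^ 4 * (F y)\<^sup>2))) - 0\<^sup>2 \<le> V * (LINT y|lborel. indicator C y * energy y)"
  proof (rule LIMSEQ_le)
    show "(\<lambda>n. W n * (LINT y|lborel. indicator (K n) y * gauss_weight y * (b n y * F y)\<^sup>2) - (LINT y|lborel. indicator (K n) y * gauss_weight y * (b n y * F y))\<^sup>2)
      \<longlonglongrightarrow> V * (LINT y|lborel. indicator C y * (gauss_weight y * (norm y ^ 4 * (F y)\<^sup>2))) - 0\<^sup>2"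
      by (intro tendsto_intros l0 l1 l2)
    show "(\<lambda>n. W n * (LINT y|lborel. indicator (K n) y * energy y)) \<longlonglongrightarrow> V * (LINT y|lborel. indicator C y * energy y)"
      by (intro tendsto_intros l0 l3)
    show "\<exists>N. \<forall>n\<ge>N. W n * (LINT y|lborel. indicator (K n) y * gauss_weight y * (b n y * F y)\<^sup>2) - (LINT y|lborel. indicator (K n) y * gauss_weight y * (b n y * F y))\<^sup>2
      \<le> W n * (LINT y|lborel. indicator (K n) y * energy y)"
      using chamber_core_Poincare[OF x0] unfolding W_def K_def b_def by blast
  qed
  then have VA: "V * (LINT y|lborel. indicator C y * (gauss_weight y * (norm y ^ 4 * (F y)\<^sup>2))) \<le> V * (LINT y|lborel. indicator C y * energy y)" by simp
  have iV: "integrable lborel (\<lambda>y. indicator C y * gauss_weight y)"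
    using integrable_real_mult_indicator[OF _ integrable_gauss_weight, of C] by (simp add: mult.commute)
  have V0: "0 \<le> V" unfolding V_def by (intro integral_nonneg_AE AE_I2) (simp add: gauss_weight_nonneg)
  have "(LINT y|lborel. indicator C y * (gauss_weight y * (norm y ^ 4 * (F y)\<^sup>2))) \<le> (LINT y|lborel. indicator C y * energy y)"
  proof (cases "V = 0")
    case False
    then show ?thesis using VA V0 by (simp add: mult_le_cancel_left)
  next
    case True
    \<comment> \<open>The multiplied inequality gives nothing for a chamber without mass, but then
      the left side is zero and the energy is nonnegative.\<close>
    then have "AE y in lborel. indicator C y * gauss_weight y = 0"
      using integral_nonneg_eq_0_iff_AE[OF iV] by (simp add: V_def gauss_weight_nonneg)
    then have "AE y in lborel. indicator C y * (gauss_weight y * (norm y ^ 4 * (F y)\<^sup>2)) = 0"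
      by eventually_elim (auto simp: indicator_def)
    then have "(LINT y|lborel. indicator C y * (gauss_weight y * (norm y ^ 4 * (F y)\<^sup>2))) = 0"
      by (rule integral_eq_zero_AE)
    moreover have "0 \<le> (LINT y|lborel. indicator C y * energy y)"
      by (intro integral_nonneg_AE AE_I2) (simp add: energy_nonneg)
    ultimately show ?thesis by simp
  qed
  then show ?thesis by (simp add: C_def)
qed

section \<open>Combining the chambers\<close>

lemma F_reflect: "u \<in> Rp \<Longrightarrow> AE x in lborel. F (reflect u x) = F x"
  using inv AE_direction[of "\<lambda>\<xi>. f (reflect u \<xi>) = f \<xi>"] root_nonzero(1)[of u]
  by (simp add: G_invariant_def F_def direction_reflect)

definition regular_chambers :: "(real^'d) set set" where
  "regular_chambers = chamber ` {x. \<forall>v\<in>roots. x \<bullet> v \<noteq> 0}"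

lemma finite_regular_chambers: "finite regular_chambers"
  using finite_chambers by (rule finite_subset[rotated]) (auto simp: regular_chambers_def)

lemma sum_regular_chambers:
  assumes "\<forall>v\<in>roots. x \<bullet> v \<noteq> 0"
  shows "(\<Sum>C\<in>regular_chambers. indicator C x) = (1 :: real)"
proof -
  have self: "x \<in> chamber x"
    unfolding chamber_def using assms by (simp flip: power2_eq_square)
  have ind: "indicator C x = (if C = chamber x then 1 else 0 :: real)" if C: "C \<in> regular_chambers" for C
  proof (cases "x \<in> C")
    case True
    obtain z where z: "C = chamber z" using C unfolding regular_chambers_def by blast
    have "x \<in> chamber z" using True unfolding z .
    from chamber_eq[OF this] have "C = chamber x" unfolding z by metis
    then show ?thesis using True by (simp add: indicator_def)
  next
    case False
    then have "C \<noteq> chamber x" using self by blast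
    then show ?thesis using False by (simp add: indicator_def)
  qed
  have "(\<Sum>C\<in>regular_chambers. indicator C x) = (\<Sum>C\<in>regular_chambers. if C = chamber x then 1 else 0 :: real)"
    by (rule sum.cong[OF refl ind])
  also have "\<dots> = 1" using assms unfolding sum.delta[OF finite_regular_chambers] by (simp add: regular_chambers_def)
  finally show ?thesis .
qed

lemma integral_regular_chambers:
  assumes q: "integrable lborel q"
  shows "(\<Sum>C\<in>regular_chambers. LINT y|lborel. indicator C y * q y) = (LINT y|lborel. (q y :: real))"
proof -
  have [measurable]: "q \<in> borel_measurable borel" using borel_measurable_integrable[OF q] by simp
  have m: "C \<in> sets borel" if "C \<in> regular_chambers" for C using that by (auto simp: regular_chambers_def)
  have i: "integrable lborel (\<lambda>y. indicator C y * q y)" if "C \<in> regular_chambers" for C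
    using integrable_real_mult_indicator[OF _ q, of C] m[OF that] by (simp add: mult.commute)
  have "(\<Sum>C\<in>regular_chambers. LINT y|lborel. indicator C y * q y) = (LINT y|lborel. (\<Sum>C\<in>regular_chambers. indicator C y * q y))"
    using i by (subst Bochner_Integration.integral_sum) auto
  also have "\<dots> = (LINT y|lborel. q y)"
  proof (rule integral_cong_AE)
    show "(\<lambda>y. \<Sum>C\<in>regular_chambers. indicator C y * q y) \<in> borel_measurable lborel"
      using i by (intro borel_measurable_sum borel_measurable_integrable)
    show "AE y in lborel. (\<Sum>C\<in>regular_chambers. indicator C y * q y) = q y"
      using AE_off_hyperplanes
    proof eventually_elim
      case (elim y)
      then show ?case using sum_regular_chambers[of y] by (simp add: sum_distrib_right[symmetric])
    qed
  qed simp
  finally show ?thesis .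
qed

lemma gauss_weight_reflect: "u \<in> Rp \<Longrightarrow> gauss_weight (reflect u x) = gauss_weight x"
  using root_nonzero(1)[of u] by (simp add: gauss_weight_def h_weight_reflect norm_reflect)

text \<open>The integral over a chamber is unchanged when the chamber is reflected, since weight,
  norm and \<open>F\<close> are invariant, so it is the same for all regular chambers. These
  partition the space up to a null set, and the total is a Gaussian moment times the mean of
  \<open>f\<close>, which is zero.\<close>

lemma chamber_mean_zero:
  assumes mean: "(LINT \<xi>|surface_measure. f \<xi> * (h_weight Rp \<kappa> \<xi>)\<^sup>2) = 0"
    and x0: "\<And>v. v \<in> roots \<Longrightarrow> x0 \<bullet> v \<noteq> 0"
  shows "(LINT y|lborel. indicator (chamber x0) y * (gauss_weight y * (norm y ^ 2 * F y))) = 0"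
proof -
  define q where "q y = gauss_weight y * (norm y ^ 2 * F y)" for y
  have [measurable]: "q \<in> borel_measurable borel" unfolding q_def[abs_def] by measurable
  have q: "integrable lborel q" unfolding q_def[abs_def] by (rule gaussian_F1(1))
  define \<Phi> where "\<Phi> C = (LINT y|lborel. indicator C y * q y)" for C
  have inv\<Phi>: "\<Phi> (chamber (reflect u x)) = \<Phi> (chamber x)" if u: "u \<in> Rp" for u x
  proof -
    have u0: "u \<noteq> 0" using root_nonzero(1)[OF u] .
    have "\<Phi> (chamber (reflect u x)) = (LINT y|lborel. indicator (chamber x) (reflect u y) * q (reflect u y))"
      unfolding \<Phi>_def
    proof (rule integral_cong_AE)
      show "AE y in lborel. indicator (chamber (reflect u x)) y * q y = indicator (chamber x) (reflect u y) * q (reflect u y)"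
        using F_reflect[OF u]
      proof eventually_elim
        case (elim y)
        have "q (reflect u y) = q y"
          unfolding q_def gauss_weight_reflect[OF u] norm_reflect[OF u0] elim ..
        moreover have "indicator (chamber (reflect u x)) y = (indicator (chamber x) (reflect u y) :: real)"
          unfolding indicator_def chamber_reflect[OF u] ..
        ultimately show ?case by simp
      qed
    qed measurable
    also have "\<dots> = \<Phi> (chamber x)"
      unfolding \<Phi>_def using lborel_integral_reflect[OF u0, of "\<lambda>y. indicator (chamber x) y * q y"] by simp
    finally show ?thesis .
  qed
  have all: "\<Phi> C = \<Phi> (chamber x0)" if C: "C \<in> regular_chambers" for C
  proof -
    obtain x where x: "C = chamber x" "\<forall>v\<in>roots. x \<bullet> v \<noteq> 0"
      using C unfolding regular_chambers_def by blast
    show ?thesis unfolding x(1)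
      by (rule chambers_conjugate[where \<Phi>=\<Phi>, OF inv\<Phi>]) (assumption | rule x0 | rule x(2)[rule_format])+
  qed
  have "(\<Sum>C\<in>regular_chambers. \<Phi> C) = (LINT y|lborel. q y)"
    unfolding \<Phi>_def by (rule integral_regular_chambers[OF q])
  also have "\<dots> = 0" unfolding q_def gaussian_F1(2) using mean by simp
  finally have "real (card regular_chambers) * \<Phi> (chamber x0) = 0"
    using all by simp
  moreover have "card regular_chambers \<noteq> 0"
    using finite_regular_chambers x0 by (auto simp: regular_chambers_def)
  ultimately show ?thesis by (simp add: \<Phi>_def q_def)
qed

text \<open>Applying the Poincare inequality of each chamber to \<open>x \<mapsto> \<bar>x\<bar>\<^sup>2 f (x / \<bar>x\<bar>)\<close>:
  the Gaussian moments turn the constant \<open>1\<close> into \<open>2 \<lambda>\<close>.\<close>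

theorem spectral_gap:
  assumes mean: "(LINT \<xi>|surface_measure. f \<xi> * (h_weight Rp \<kappa> \<xi>)\<^sup>2) = 0"
  shows "2 * lambda_k Rp \<kappa> * (LINT \<xi>|surface_measure. (f \<xi>)\<^sup>2 * (h_weight Rp \<kappa> \<xi>)\<^sup>2)
    \<le> (LINT \<xi>|surface_measure. (norm (g \<xi>))\<^sup>2 * (h_weight Rp \<kappa> \<xi>)\<^sup>2)"
proof -
  define l where "l = lambda_k Rp \<kappa>"
  define S1 S2 where "S1 = (LINT \<xi>|surface_measure. (f \<xi>)\<^sup>2 * (h_weight Rp \<kappa> \<xi>)\<^sup>2)"
    and "S2 = (LINT \<xi>|surface_measure. (norm (g \<xi>))\<^sup>2 * (h_weight Rp \<kappa> \<xi>)\<^sup>2)"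
  define M where "M = gauss_moment (2 * l + 3)"
  have M: "0 < M" unfolding M_def using lambda_k_ge by (intro gauss_moment_pos) (simp add: l_def)
  have "(LINT y|lborel. gauss_weight y * (norm y ^ 4 * (F y)\<^sup>2)) = (\<Sum>C\<in>regular_chambers. LINT y|lborel. indicator C y * (gauss_weight y * (norm y ^ 4 * (F y)\<^sup>2)))"
    by (rule integral_regular_chambers[OF gaussian_F2(1), symmetric])
  also have "\<dots> \<le> (\<Sum>C\<in>regular_chambers. LINT y|lborel. indicator C y * energy y)"
  proof (rule sum_mono)
    fix C assume "C \<in> regular_chambers"
    then obtain x where x: "C = chamber x" "\<And>v. v \<in> roots \<Longrightarrow> x \<bullet> v \<noteq> 0"
      unfolding regular_chambers_def by blast
    show "(LINT y|lborel. indicator C y * (gauss_weight y * (norm y ^ 4 * (F y)\<^sup>2))) \<le> (LINT y|lborel. indicator C y * energy y)"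
      unfolding x(1) by (rule chamber_Poincare[OF x(2) chamber_mean_zero[OF mean x(2)]])
  qed
  also have "\<dots> = (LINT y|lborel. energy y)"
    by (rule integral_regular_chambers[OF integrable_energy])
  also have "\<dots> = M * S2 + 4 * (M * S1)"
    unfolding energy_def using gaussian_G2 gaussian_F2[of 2] by (simp add: M_def S1_def S2_def l_def add.assoc)
  also have "(LINT y|lborel. gauss_weight y * (norm y ^ 4 * (F y)\<^sup>2)) = ((2 * l + 4) * M) * S1"
  proof -
    have "2 * l + 1 + real 4 = 2 * l + 5" by simp
    then show ?thesis
      using gaussian_F2(2)[of 4] gauss_moment_recursion by (simp add: M_def S1_def l_def add.assoc)
  qed
  finally have "M * (2 * l * S1) \<le> M * S2" by (simp add: algebra_simps)
  then show ?thesis using M by (simp add: S1_def S2_def l_def)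
qed

section \<open>The uncertainty inequality\<close>

text \<open>Taken in an arbitrary direction rather than along a coordinate axis, so that an axis can
  be split into a part in the span of the roots and an orthogonal part.\<close>

definition first_moment :: "real^'d \<Rightarrow> real" where
  "first_moment p = (LINT \<xi>|surface_measure. ((f \<xi>)\<^sup>2 * (\<xi> \<bullet> p)) * (h_weight Rp \<kappa> \<xi>)\<^sup>2)"

lemma linear_first_moment: "linear first_moment"
proof (rule linearI)
  fix p q :: "real^'d" and c :: real
  have "first_moment (p + q) = (LINT \<xi>|surface_measure. ((f \<xi>)\<^sup>2 * (\<xi> \<bullet> p)) * (h_weight Rp \<kappa> \<xi>)\<^sup>2 + ((f \<xi>)\<^sup>2 * (\<xi> \<bullet> q)) * (h_weight Rp \<kappa> \<xi>)\<^sup>2)"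
    unfolding first_moment_def by (intro Bochner_Integration.integral_cong) (auto simp: inner_add_right algebra_simps)
  also have "\<dots> = first_moment p + first_moment q"
    unfolding first_moment_def by (rule Bochner_Integration.integral_add) (rule weighted_integrable_fg)+
  finally show "first_moment (p + q) = first_moment p + first_moment q" .
  have "first_moment (c *\<^sub>R p) = (LINT \<xi>|surface_measure. c * (((f \<xi>)\<^sup>2 * (\<xi> \<bullet> p)) * (h_weight Rp \<kappa> \<xi>)\<^sup>2))"
    unfolding first_moment_def by (intro Bochner_Integration.integral_cong) auto
  then show "first_moment (c *\<^sub>R p) = c *\<^sub>R first_moment p" by (simp add: first_moment_def)
qed

lemma measurable_f2_inner: "(\<lambda>\<xi>. (f \<xi>)\<^sup>2 * (\<xi> \<bullet> p)) \<in> borel_measurable surface_measure"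
  by (intro borel_measurable_times borel_measurable_power borel_measurable_inner f_meas measurable_surface_id borel_measurable_const)

text \<open>Reflection along \<open>v\<close> preserves f^2 and the weight and reverses the sign of
  \<xi> \<bullet> v. The substitution is made in the whole space with a Gaussian factor, where the
  reflection invariance of Lebesgue measure is at hand.\<close>

lemma first_moment_root:
  assumes v: "v \<in> Rp" shows "first_moment v = 0"
proof -
  have v0: "v \<noteq> 0" using root_nonzero(1)[OF v] .
  define q where "q x = gauss_weight x * (norm x ^ 0 * ((f (direction x))\<^sup>2 * (direction x \<bullet> v)))" for x
  have [measurable]: "q \<in> borel_measurable borel"
    unfolding q_def[abs_def] using measurable_compose_direction[OF measurable_f2_inner] by measurable
  have "(LINT x|lborel. q x) = (LINT x|lborel. q (reflect v x))"
    by (rule lborel_integral_reflect[OF v0, symmetric]) measurable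
  also have "\<dots> = (LINT x|lborel. - q x)"
  proof (rule integral_cong_AE)
    show "AE x in lborel. q (reflect v x) = - q x"
      using F_reflect[OF v]
    proof eventually_elim
      case (elim x)
      have "direction (reflect v x) \<bullet> v = - (direction x \<bullet> v)"
        by (simp add: direction_reflect[OF v0] inner_reflect_self reflect_self[OF v0])
      then show ?case using elim by (simp add: q_def F_def gauss_weight_reflect[OF v])
    qed
  qed measurable
  finally have "(LINT x|lborel. q x) = 0" by simp
  then have "gauss_moment (2 * lambda_k Rp \<kappa> + 1 + real 0) * first_moment v = 0"
    using gaussian_polar_integral(2)[OF weighted_integrable_fg(2)[of v] measurable_f2_inner[of v], of 0]
    by (simp add: q_def first_moment_def)
  moreover have "0 < gauss_moment (2 * lambda_k Rp \<kappa> + 1 + real 0)"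
    using lambda_k_ge by (intro gauss_moment_pos) simp
  ultimately show ?thesis by simp
qed

text \<open>Brings the vanishing of the radial part back to the sphere: the Gaussian extension of
  the integrand is zero almost everywhere, and its integral is the sphere integral times a positive
  moment.\<close>

lemma radial_term_zero:
  "(LINT \<xi>|surface_measure. (f \<xi> * (g \<xi> \<bullet> \<xi>) * (\<xi> \<bullet> p)) * (h_weight Rp \<kappa> \<xi>)\<^sup>2) = 0"
  "integrable surface_measure (\<lambda>\<xi>. (f \<xi> * (g \<xi> \<bullet> \<xi>) * (\<xi> \<bullet> p)) * (h_weight Rp \<kappa> \<xi>)\<^sup>2)"
proof -
  have m: "(\<lambda>\<xi>. f \<xi> * (g \<xi> \<bullet> \<xi>) * (\<xi> \<bullet> p)) \<in> borel_measurable surface_measure"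
    by (intro borel_measurable_times borel_measurable_inner f_meas g_meas measurable_surface_id borel_measurable_const)
  show i: "integrable surface_measure (\<lambda>\<xi>. (f \<xi> * (g \<xi> \<bullet> \<xi>) * (\<xi> \<bullet> p)) * (h_weight Rp \<kappa> \<xi>)\<^sup>2)"
  proof (rule weighted_product_integrable[where C="norm p", OF m])
    fix \<xi> :: "real^'d" assume "\<xi> \<in> space surface_measure"
    then have n: "norm \<xi> = 1" by (simp add: space_surface_measure)
    have "2 * (\<bar>f \<xi>\<bar> * norm (g \<xi>)) \<le> (f \<xi>)\<^sup>2 + (norm (g \<xi>))\<^sup>2"
      using zero_le_power2[of "\<bar>f \<xi>\<bar> - norm (g \<xi>)"] by (simp add: power2_diff)
    moreover have "0 \<le> \<bar>f \<xi>\<bar> * norm (g \<xi>)" by simp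
    ultimately have a: "\<bar>f \<xi>\<bar> * norm (g \<xi>) \<le> (f \<xi>)\<^sup>2 + (norm (g \<xi>))\<^sup>2" by linarith
    have "\<bar>g \<xi> \<bullet> \<xi>\<bar> \<le> norm (g \<xi>)" "\<bar>\<xi> \<bullet> p\<bar> \<le> norm p"
      using Cauchy_Schwarz_ineq2[of "g \<xi>" \<xi>] Cauchy_Schwarz_ineq2[of \<xi> p] n by simp_all
    then have "\<bar>f \<xi> * (g \<xi> \<bullet> \<xi>) * (\<xi> \<bullet> p)\<bar> \<le> (\<bar>f \<xi>\<bar> * norm (g \<xi>)) * norm p"
      unfolding abs_mult by (intro mult_mono) auto
    also have "\<dots> \<le> ((f \<xi>)\<^sup>2 + (norm (g \<xi>))\<^sup>2) * norm p" using a by (rule mult_right_mono) simp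
    finally show "\<bar>f \<xi> * (g \<xi> \<bullet> \<xi>) * (\<xi> \<bullet> p)\<bar> \<le> norm p * ((f \<xi>)\<^sup>2 + (norm (g \<xi>))\<^sup>2)" by (simp add: mult.commute)
  qed
  have "AE x in lborel. gauss_weight x * (norm x ^ 0 * (f (direction x) * (g (direction x) \<bullet> direction x) * (direction x \<bullet> p))) = 0"
    using radial_part_zero AE_lborel_singleton[of 0]
  proof eventually_elim
    case (elim x)
    have "F x * (G x \<bullet> x) = f (direction x) * (g (direction x) \<bullet> direction x)"
      using elim(2) by (simp add: F_def G_def direction_def)
    then show ?case using elim(1) by simp
  qed
  then have "(LINT x|lborel. gauss_weight x * (norm x ^ 0 * (f (direction x) * (g (direction x) \<bullet> direction x) * (direction x \<bullet> p)))) = 0"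
    by (rule integral_eq_zero_AE)
  then have "gauss_moment (2 * lambda_k Rp \<kappa> + 1 + real 0) * (LINT \<xi>|surface_measure. (f \<xi> * (g \<xi> \<bullet> \<xi>) * (\<xi> \<bullet> p)) * (h_weight Rp \<kappa> \<xi>)\<^sup>2) = 0"
    unfolding gaussian_polar_integral(2)[OF i m] .
  moreover have "0 < gauss_moment (2 * lambda_k Rp \<kappa> + 1 + real 0)"
    using lambda_k_ge by (intro gauss_moment_pos) simp
  ultimately show "(LINT \<xi>|surface_measure. (f \<xi> * (g \<xi> \<bullet> \<xi>) * (\<xi> \<bullet> p)) * (h_weight Rp \<kappa> \<xi>)\<^sup>2) = 0" by simp
qed

text \<open>Cauchy-Schwarz is used twice. Against the gradient it produces S2 (S1 - T), where
  \<open>T\<close> is the second moment of f^2 in direction \<open>p\<close>; against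
  \<open>f\<close> itself it gives first_moment^2 \<le> S1 T, which eliminates \<open>T\<close>. The
  factor (l + 1/2)^2 comes from \<open>translation_identity\<close> after division by 2.\<close>

lemma moment_gradient_inequality:
  fixes p :: "real^'d"
  assumes p: "\<And>v. v \<in> Rp \<Longrightarrow> p \<bullet> v = 0" and np: "norm p \<le> 1"
  defines "S1 \<equiv> (LINT \<xi>|surface_measure. (f \<xi>)\<^sup>2 * (h_weight Rp \<kappa> \<xi>)\<^sup>2)"
    and "S2 \<equiv> (LINT \<xi>|surface_measure. (norm (g \<xi>))\<^sup>2 * (h_weight Rp \<kappa> \<xi>)\<^sup>2)"
  assumes S1: "0 < S1"
  shows "(lambda_k Rp \<kappa> + 1 / 2)\<^sup>2 * (first_moment p)\<^sup>2 \<le> S2 * (S1 - (first_moment p)\<^sup>2 / S1)"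
    and "(first_moment p)\<^sup>2 \<le> S1\<^sup>2"
proof -
  let ?h = "h_weight Rp \<kappa>"
  have [measurable]: "f \<in> borel_measurable surface_measure" "g \<in> borel_measurable surface_measure" "?h \<in> borel_measurable surface_measure"
    by (fact f_meas, fact g_meas, fact measurable_h_surface)
  have tm: "(\<lambda>\<xi>. \<xi> \<bullet> p) \<in> borel_measurable surface_measure"
    by (intro borel_measurable_inner measurable_surface_id borel_measurable_const)
  have t1: "(\<xi> \<bullet> p)\<^sup>2 \<le> 1" if "\<xi> \<in> space surface_measure" for \<xi>
  proof -
    have "\<bar>\<xi> \<bullet> p\<bar> \<le> norm \<xi> * norm p" by (rule Cauchy_Schwarz_ineq2)
    also have "\<dots> \<le> 1" using that np by (simp add: space_surface_measure)
    finally have "\<bar>\<xi> \<bullet> p\<bar> \<le> 1" .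
    then show ?thesis by (rule abs_square_le_1[THEN iffD2])
  qed
  have iT: "integrable surface_measure (\<lambda>\<xi>. (f \<xi> * (\<xi> \<bullet> p) * ?h \<xi>)\<^sup>2)"
  proof (rule Bochner_Integration.integrable_bound[OF f2])
    show "(\<lambda>\<xi>. (f \<xi> * (\<xi> \<bullet> p) * ?h \<xi>)\<^sup>2) \<in> borel_measurable surface_measure" using tm by measurable
    show "AE \<xi> in surface_measure. norm ((f \<xi> * (\<xi> \<bullet> p) * ?h \<xi>)\<^sup>2) \<le> norm ((f \<xi>)\<^sup>2 * (?h \<xi>)\<^sup>2)"
    proof (rule AE_I2)
      fix \<xi> :: "real^'d" assume "\<xi> \<in> space surface_measure"
      from mult_left_mono[OF t1[OF this], of "(f \<xi>)\<^sup>2 * (?h \<xi>)\<^sup>2"]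
      show "norm ((f \<xi> * (\<xi> \<bullet> p) * ?h \<xi>)\<^sup>2) \<le> norm ((f \<xi>)\<^sup>2 * (?h \<xi>)\<^sup>2)"
        by (simp add: power_mult_distrib mult_ac)
    qed
  qed
  have iF: "integrable surface_measure (\<lambda>\<xi>. (f \<xi> * ?h \<xi>)\<^sup>2)" using f2 by (simp add: power_mult_distrib)
  have iG: "integrable surface_measure (\<lambda>\<xi>. (norm (g \<xi>) * ?h \<xi>)\<^sup>2)" using g2 by (simp add: power_mult_distrib)
  define T where "T = (LINT \<xi>|surface_measure. (f \<xi> * (\<xi> \<bullet> p) * ?h \<xi>)\<^sup>2)"
  have m1: "(\<lambda>\<xi>. f \<xi> * (\<xi> \<bullet> p) * ?h \<xi>) \<in> borel_measurable surface_measure" using tm by measurable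
  have "(LINT \<xi>|surface_measure. (f \<xi> * ?h \<xi>) * (f \<xi> * (\<xi> \<bullet> p) * ?h \<xi>))\<^sup>2 \<le> (LINT \<xi>|surface_measure. (f \<xi> * ?h \<xi>)\<^sup>2) * T"
    unfolding T_def by (rule Cauchy_Schwarz_integral(3)[OF _ m1 iF iT]) measurable
  then have mT: "(first_moment p)\<^sup>2 \<le> S1 * T"
    by (simp add: first_moment_def S1_def power_mult_distrib power2_eq_square mult_ac)
  have TS: "T \<le> S1"
    unfolding T_def S1_def
  proof (rule integral_mono_AE[OF iT f2], rule AE_I2)
    fix \<xi> :: "real^'d" assume "\<xi> \<in> space surface_measure"
    from mult_left_mono[OF t1[OF this], of "(f \<xi>)\<^sup>2 * (?h \<xi>)\<^sup>2"]
    show "(f \<xi> * (\<xi> \<bullet> p) * ?h \<xi>)\<^sup>2 \<le> (f \<xi>)\<^sup>2 * (?h \<xi>)\<^sup>2"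
      by (simp add: power_mult_distrib mult_ac)
  qed
  have "S1 * T \<le> S1 * S1" using TS S1 by (intro mult_left_mono) auto
  with mT show "(first_moment p)\<^sup>2 \<le> S1\<^sup>2" by (simp add: power2_eq_square)
  \<comment> \<open>The bound sqrt(1 - (\<xi> \<bullet> p)^2) for the tangential part of
    \<open>p\<close> is grouped with \<open>f\<close>, so that the integral of r^2 is S1 -
    T.\<close>
  define r where "r \<xi> = f \<xi> * sqrt (1 - (\<xi> \<bullet> p)\<^sup>2) * ?h \<xi>" for \<xi>
  have rm: "r \<in> borel_measurable surface_measure" unfolding r_def[abs_def] using tm by measurable
  have r2: "(r \<xi>)\<^sup>2 = (f \<xi>)\<^sup>2 * (?h \<xi>)\<^sup>2 - (f \<xi> * (\<xi> \<bullet> p) * ?h \<xi>)\<^sup>2" if "\<xi> \<in> space surface_measure" for \<xi>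
    using t1[OF that] by (simp add: r_def power_mult_distrib algebra_simps)
  have ir: "integrable surface_measure (\<lambda>\<xi>. (r \<xi>)\<^sup>2)"
    by (subst Bochner_Integration.integrable_cong[OF refl r2]) (auto intro: Bochner_Integration.integrable_diff f2 iT)
  have Ir: "(LINT \<xi>|surface_measure. (r \<xi>)\<^sup>2) = S1 - T"
    unfolding S1_def T_def Bochner_Integration.integral_diff[OF f2 iT, symmetric]
    by (rule Bochner_Integration.integral_cong[OF refl r2])
  \<comment> \<open>Subtracting the radial term, whose integral is zero, replaces \<open>p\<close>
    by its tangential component at each point without changing the integral.\<close>
  let ?I = "LINT \<xi>|surface_measure. (f \<xi> * (g \<xi> \<bullet> p)) * (?h \<xi>)\<^sup>2 - (f \<xi> * (g \<xi> \<bullet> \<xi>) * (\<xi> \<bullet> p)) * (?h \<xi>)\<^sup>2"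
  have "?I = (LINT \<xi>|surface_measure. (f \<xi> * (g \<xi> \<bullet> p)) * (?h \<xi>)\<^sup>2)"
    using radial_term_zero weighted_integrable_fg(1) by simp
  then have I: "2 * ?I = (2 * lambda_k Rp \<kappa> + 1) * first_moment p"
    using translation_identity[OF p] by (simp add: first_moment_def)
  have "\<bar>?I\<bar> \<le> (LINT \<xi>|surface_measure. \<bar>(norm (g \<xi>) * ?h \<xi>) * r \<xi>\<bar>)"
  proof (rule order_trans[OF integral_abs_bound integral_mono_AE])
    show "integrable surface_measure (\<lambda>\<xi>. \<bar>(f \<xi> * (g \<xi> \<bullet> p)) * (?h \<xi>)\<^sup>2 - (f \<xi> * (g \<xi> \<bullet> \<xi>) * (\<xi> \<bullet> p)) * (?h \<xi>)\<^sup>2\<bar>)"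
      by (intro integrable_abs Bochner_Integration.integrable_diff weighted_integrable_fg(1) radial_term_zero(2))
    show "integrable surface_measure (\<lambda>\<xi>. \<bar>(norm (g \<xi>) * ?h \<xi>) * r \<xi>\<bar>)"
      by (intro integrable_abs Cauchy_Schwarz_integral(1)[OF _ rm iG ir]) measurable
    show "AE \<xi> in surface_measure. \<bar>(f \<xi> * (g \<xi> \<bullet> p)) * (?h \<xi>)\<^sup>2 - (f \<xi> * (g \<xi> \<bullet> \<xi>) * (\<xi> \<bullet> p)) * (?h \<xi>)\<^sup>2\<bar> \<le> \<bar>(norm (g \<xi>) * ?h \<xi>) * r \<xi>\<bar>"
    proof (rule AE_I2)
      fix \<xi> :: "real^'d" assume sp: "\<xi> \<in> space surface_measure"
      then have n: "\<xi> \<bullet> \<xi> = 1" by (simp add: space_surface_measure norm_eq_1)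
      define q where "q = p - (\<xi> \<bullet> p) *\<^sub>R \<xi>"
      have "(norm q)\<^sup>2 = (norm p)\<^sup>2 - (\<xi> \<bullet> p)\<^sup>2"
        unfolding power2_norm_eq_inner q_def by (simp add: inner_simps n inner_commute power2_eq_square)
      also have "\<dots> \<le> 1 - (\<xi> \<bullet> p)\<^sup>2" using np by (simp add: power_le_one)
      finally have nq: "norm q \<le> sqrt (1 - (\<xi> \<bullet> p)\<^sup>2)" by (rule real_le_rsqrt)
      have "\<bar>g \<xi> \<bullet> q\<bar> \<le> norm (g \<xi>) * sqrt (1 - (\<xi> \<bullet> p)\<^sup>2)"
        using Cauchy_Schwarz_ineq2[of "g \<xi>" q] mult_left_mono[OF nq norm_ge_zero[of "g \<xi>"]] by linarith
      then have "\<bar>f \<xi>\<bar> * (?h \<xi>)\<^sup>2 * \<bar>g \<xi> \<bullet> q\<bar> \<le> \<bar>f \<xi>\<bar> * (?h \<xi>)\<^sup>2 * (norm (g \<xi>) * sqrt (1 - (\<xi> \<bullet> p)\<^sup>2))"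
        by (rule mult_left_mono) simp
      moreover have e1: "(f \<xi> * (g \<xi> \<bullet> p)) * (?h \<xi>)\<^sup>2 - (f \<xi> * (g \<xi> \<bullet> \<xi>) * (\<xi> \<bullet> p)) * (?h \<xi>)\<^sup>2 = f \<xi> * (?h \<xi>)\<^sup>2 * (g \<xi> \<bullet> q)"
        by (simp add: q_def inner_diff_right algebra_simps)
      moreover have e2: "\<bar>(norm (g \<xi>) * ?h \<xi>) * r \<xi>\<bar> = \<bar>f \<xi>\<bar> * (?h \<xi>)\<^sup>2 * (norm (g \<xi>) * sqrt (1 - (\<xi> \<bullet> p)\<^sup>2))"
        using t1[OF sp] by (simp add: r_def abs_mult power2_eq_square)
      ultimately show "\<bar>(f \<xi> * (g \<xi> \<bullet> p)) * (?h \<xi>)\<^sup>2 - (f \<xi> * (g \<xi> \<bullet> \<xi>) * (\<xi> \<bullet> p)) * (?h \<xi>)\<^sup>2\<bar> \<le> \<bar>(norm (g \<xi>) * ?h \<xi>) * r \<xi>\<bar>"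
        unfolding e1 e2 abs_mult[of "f \<xi> * (?h \<xi>)\<^sup>2"] by (simp add: abs_mult)
    qed
  qed
  then have "\<bar>?I\<bar>\<^sup>2 \<le> (LINT \<xi>|surface_measure. \<bar>(norm (g \<xi>) * ?h \<xi>) * r \<xi>\<bar>)\<^sup>2" by (rule power_mono) simp
  also have "\<dots> \<le> (LINT \<xi>|surface_measure. (norm (g \<xi>) * ?h \<xi>)\<^sup>2) * (LINT \<xi>|surface_measure. (r \<xi>)\<^sup>2)"
    by (rule Cauchy_Schwarz_integral(2)[OF _ rm iG ir]) measurable
  also have "\<dots> = S2 * (S1 - T)" by (simp only: Ir S2_def power_mult_distrib)
  finally have I2: "?I\<^sup>2 \<le> S2 * (S1 - T)" by simp
  have S2: "0 \<le> S2" unfolding S2_def by simp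
  have "(lambda_k Rp \<kappa> + 1 / 2) * first_moment p = ?I" using I by (simp add: algebra_simps)
  then have "(lambda_k Rp \<kappa> + 1 / 2)\<^sup>2 * (first_moment p)\<^sup>2 = ?I\<^sup>2" by (simp flip: power_mult_distrib)
  also note I2
  also have "S2 * (S1 - T) \<le> S2 * (S1 - (first_moment p)\<^sup>2 / S1)"
    using mT S1 S2 by (intro mult_left_mono diff_left_mono) (simp_all add: field_simps)
  finally show "(lambda_k Rp \<kappa> + 1 / 2)\<^sup>2 * (first_moment p)\<^sup>2 \<le> S2 * (S1 - (first_moment p)\<^sup>2 / S1)" .
qed

text \<open>The orthogonal projection off the span of the roots does not change the first moment, by
  linearity and \<open>first_moment_root\<close>, and does not increase the norm.\<close>

lemma first_moment_bounds:
  fixes p0 :: "real^'d"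
  assumes n: "norm p0 \<le> 1"
  defines "S1 \<equiv> (LINT \<xi>|surface_measure. (f \<xi>)\<^sup>2 * (h_weight Rp \<kappa> \<xi>)\<^sup>2)"
    and "S2 \<equiv> (LINT \<xi>|surface_measure. (norm (g \<xi>))\<^sup>2 * (h_weight Rp \<kappa> \<xi>)\<^sup>2)"
  assumes S1: "0 < S1"
  shows "(lambda_k Rp \<kappa> + 1 / 2)\<^sup>2 * (first_moment p0)\<^sup>2 \<le> S2 * (S1 - (first_moment p0)\<^sup>2 / S1)"
    and "(first_moment p0)\<^sup>2 \<le> S1\<^sup>2"
proof -
  obtain q p where qp: "q \<in> span Rp" "\<And>w. w \<in> span Rp \<Longrightarrow> orthogonal p w" "p0 = q + p"
    using orthogonal_subspace_decomp_exists[of Rp p0] by blast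
  have "first_moment q = 0"
    by (rule linear_eq_0_on_span[OF linear_first_moment _ qp(1)]) (rule first_moment_root)
  then have m: "first_moment p0 = first_moment p" by (simp add: qp(3) linear_add[OF linear_first_moment])
  have po: "p \<bullet> v = 0" if "v \<in> Rp" for v using qp(2)[of v] that by (simp add: span_base orthogonal_def)
  have "p \<bullet> q = 0" using qp(2)[OF qp(1)] by (simp add: orthogonal_def)
  then have "(norm p0)\<^sup>2 = (norm q)\<^sup>2 + (norm p)\<^sup>2"
    unfolding qp(3) power2_norm_eq_inner by (simp add: inner_simps inner_commute)
  moreover have "(norm p0)\<^sup>2 \<le> 1" using n by (simp add: power_le_one)
  ultimately have "(norm p)\<^sup>2 \<le> 1" using zero_le_power2[of "norm q"] by linarith
  then have np: "norm p \<le> 1" by (simp add: power2_le_imp_le)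
  note R = moment_gradient_inequality[OF po np, folded S1_def S2_def, OF _ S1]
  show "(lambda_k Rp \<kappa> + 1 / 2)\<^sup>2 * (first_moment p0)\<^sup>2 \<le> S2 * (S1 - (first_moment p0)\<^sup>2 / S1)"
    "(first_moment p0)\<^sup>2 \<le> S1\<^sup>2" unfolding m using R by auto
qed

end

text \<open>With A = (l + 1/2)^2, the hypotheses bound D below by 2 l and, for m^2 < 1, by A m^2 /
  (1 - m^2). Times 1 - m, the former decreases in m and the latter, A m^2 / (1 + m), increases for m
  > 0. The least value of their maximum is attained where they meet, and it is the stated
  constant.\<close>

lemma uncertainty_optimization:
  fixes l D m :: real
  assumes l: "0 \<le> l" and D: "2 * l \<le> D" and m1: "m\<^sup>2 \<le> 1" and mD: "(l + 1 / 2)\<^sup>2 * m\<^sup>2 \<le> D * (1 - m\<^sup>2)"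
  shows "2 * l * (1 - sqrt (2 * l) / sqrt ((l + 1 / 2)\<^sup>2 + 2 * l)) \<le> (1 - m) * D"
proof -
  define A where "A = (l + 1 / 2)\<^sup>2"
  have A: "0 < A" unfolding A_def using l by simp
  \<comment> \<open>The nonnegative value of m at which the two lower bounds for D agree, that is, A
    \<mu>^2 = 2 l (1 - \<mu>^2).\<close>
  define \<mu> where "\<mu> = sqrt (2 * l) / sqrt (A + 2 * l)"
  have \<mu>0: "0 \<le> \<mu>" using l A by (simp add: \<mu>_def)
  have "\<mu>\<^sup>2 = 2 * l / (A + 2 * l)" using l A by (simp add: \<mu>_def power_divide)
  then have \<mu>A: "A * \<mu>\<^sup>2 = 2 * l * (1 - \<mu>\<^sup>2)" using l A by (simp add: field_simps)
  have "\<mu>\<^sup>2 < 1" using \<open>\<mu>\<^sup>2 = 2 * l / (A + 2 * l)\<close> l A by simp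
  then have \<mu>1: "\<mu> < 1" using \<mu>0 by (simp add: power2_less_1_iff)
  have m: "\<bar>m\<bar> \<le> 1" using m1 by (simp add: abs_square_le_1)
  have D0: "0 \<le> D" using l D by simp
  have "2 * l * (1 - \<mu>) \<le> (1 - m) * D"
  proof (cases "m \<le> \<mu>")
    case True
    have "2 * l * (1 - \<mu>) \<le> D * (1 - m)" using True D D0 \<mu>1 by (intro mult_mono) auto
    then show ?thesis by (simp add: mult.commute)
  next
    case False
    then have mp: "0 < m" "\<mu> < m" using \<mu>0 by auto
    show ?thesis
    \<comment> \<open>The main case cancels \<mu>^2. If \<mu> = 0, then l = 0 and the claim is the
      nonnegativity of (1 - m) D.\<close>
    proof (cases "\<mu> = 0")
      case True
      then have "2 * l = 0" using \<mu>A by simp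
      then show ?thesis using m D0 by simp
    next
      case False
      then have \<mu>p: "0 < \<mu>" using \<mu>0 by simp
      \<comment> \<open>The product equals (1 + \<mu>) m^2 - (1 + m) \<mu>^2, so its sign expresses
        that m^2 / (1 + m) is increasing.\<close>
      have "0 \<le> (m - \<mu>) * (m + \<mu> + m * \<mu>)" using mp \<mu>0 by (intro mult_nonneg_nonneg) auto
      then have "(1 + m) * \<mu>\<^sup>2 \<le> (1 + \<mu>) * m\<^sup>2" by (simp add: power2_eq_square algebra_simps)
      then have "2 * l * (1 - \<mu>) * ((1 + m) * \<mu>\<^sup>2) \<le> 2 * l * (1 - \<mu>) * ((1 + \<mu>) * m\<^sup>2)"
        using l \<mu>1 by (intro mult_left_mono) auto
      also have "\<dots> = (2 * l * (1 - \<mu>\<^sup>2)) * m\<^sup>2" by (simp add: power2_eq_square algebra_simps)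
      also have "\<dots> = (A * m\<^sup>2) * \<mu>\<^sup>2" unfolding \<mu>A[symmetric] by simp
      also have "\<dots> \<le> (D * (1 - m\<^sup>2)) * \<mu>\<^sup>2" using mD by (intro mult_right_mono) (auto simp: A_def)
      also have "\<dots> = ((1 - m) * D) * ((1 + m) * \<mu>\<^sup>2)" by (simp add: power2_eq_square algebra_simps)
      finally have "(2 * l * (1 - \<mu>)) * ((1 + m) * \<mu>\<^sup>2) \<le> ((1 - m) * D) * ((1 + m) * \<mu>\<^sup>2)" .
      moreover have "0 < (1 + m) * \<mu>\<^sup>2" using mp \<mu>p by simp
      ultimately show ?thesis by (rule mult_right_le_imp_le)
    qed
  qed
  then show ?thesis by (simp add: \<mu>_def A_def)
qed

theorem theorem4p1:
  fixes Rp :: "(real^'d) set" and \<kappa> :: "real^'d \<Rightarrow> real" and f :: "real^'d \<Rightarrow> real"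
  assumes "CARD('d) \<ge> 2"
    and "positive_root_system Rp"
    and "multiplicity_function Rp \<kappa>"
    and "f \<in> sobolev_h Rp \<kappa>"
    and "G_invariant Rp f"
    and "(LINT \<xi>|surface_measure. f \<xi> * (h_weight Rp \<kappa> \<xi>)\<^sup>2) = 0"
    and "norm_h Rp \<kappa> f = 1"
  shows "(MIN i. 1 / omega_k Rp \<kappa> *
            (LINT \<xi>|surface_measure. (1 - \<xi> $ i) * \<bar>f \<xi>\<bar>\<^sup>2 * (h_weight Rp \<kappa> \<xi>)\<^sup>2))
         * (norm_h Rp \<kappa> (sph_gradient Rp f))\<^sup>2
         \<ge> C_const Rp \<kappa>"
proof -
  interpret root_data Rp \<kappa> by unfold_locales (fact assms)+
  let ?h = "h_weight Rp \<kappa>"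
  define g where "g = sph_gradient Rp f"
  obtain g' where "has_weak_sph_gradient Rp f g'" using assms(4) unfolding sobolev_h_def by blast
  then have grad: "has_weak_sph_gradient Rp f g" unfolding g_def sph_gradient_def by (rule someI[of "has_weak_sph_gradient Rp f"])
  have fm: "f \<in> borel_measurable surface_measure" and f2: "integrable surface_measure (\<lambda>\<xi>. (f \<xi>)\<^sup>2 * (?h \<xi>)\<^sup>2)"
    using assms(4) by (auto simp: sobolev_h_def L2_h_def)
  have gm: "g \<in> borel_measurable surface_measure" using grad by (simp add: has_weak_sph_gradient_def)
  have hm: "?h \<in> borel_measurable surface_measure"
    by (rule measurable_h_surface)
  \<comment> \<open>Invariance annihilates the difference terms almost everywhere, so the
    h-spherical gradient, whose integrability is assumed, agrees with \<open>g\<close>.\<close>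
  have g2: "integrable surface_measure (\<lambda>\<xi>. (norm (g \<xi>))\<^sup>2 * (?h \<xi>)\<^sup>2)"
  proof (rule integrable_cong_AE_imp)
    show "integrable surface_measure (\<lambda>\<xi>. (norm (h_sph_gradient Rp \<kappa> f \<xi>))\<^sup>2 * (?h \<xi>)\<^sup>2)"
      using assms(4) by (simp add: sobolev_h_def L2_h_def)
    show "(\<lambda>\<xi>. (norm (g \<xi>))\<^sup>2 * (?h \<xi>)\<^sup>2) \<in> borel_measurable surface_measure" using gm hm by measurable
    have "AE \<xi> in surface_measure. \<forall>v\<in>Rp. f (reflect v \<xi>) = f \<xi>"
      using assms(5) finite_Rp by (simp add: G_invariant_def AE_finite_all)
    then show "AE \<xi> in surface_measure. (norm (h_sph_gradient Rp \<kappa> f \<xi>))\<^sup>2 * (?h \<xi>)\<^sup>2 = (norm (g \<xi>))\<^sup>2 * (?h \<xi>)\<^sup>2"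
      by eventually_elim (simp add: h_sph_gradient_def g_def)
  qed
  interpret invariant_function Rp \<kappa> f g by unfold_locales (fact fm grad assms(5) f2 g2)+
  define \<omega> S2 where "\<omega> = omega_k Rp \<kappa>" and "S2 = (LINT \<xi>|surface_measure. (norm (g \<xi>))\<^sup>2 * (?h \<xi>)\<^sup>2)"
  define S1 where "S1 = (LINT \<xi>|surface_measure. (f \<xi>)\<^sup>2 * (?h \<xi>)\<^sup>2)"
  have \<omega>0: "0 \<le> \<omega>" unfolding \<omega>_def omega_k_def by simp
  have "sqrt (1 / \<omega> * S1) = 1" using assms(7) by (simp add: norm_h_def \<omega>_def S1_def)
  then have "1 / \<omega> * S1 = 1" by (simp add: real_sqrt_eq_1_iff)
  \<comment> \<open>If \<omega> were 0, the quotient 1 / \<omega> would be 0 and the norm could not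
    be 1.\<close>
  then have \<omega>: "0 < \<omega>" "S1 = \<omega>" using \<omega>0 by (cases "\<omega> = 0"; simp add: field_simps)+
  have S2: "0 \<le> S2" unfolding S2_def by simp
  have D: "(norm_h Rp \<kappa> (sph_gradient Rp f))\<^sup>2 = S2 / \<omega>"
    using S2 \<omega> by (simp add: norm_h_def g_def[symmetric] S2_def \<omega>_def)
  define l where "l = lambda_k Rp \<kappa>"
  have l0: "0 \<le> l"
  proof -
    have "0 \<le> gamma_k Rp \<kappa>" unfolding gamma_k_def using \<kappa>_nonneg by (rule sum_nonneg)
    then show ?thesis using assms(1) by (simp add: l_def lambda_k_def)
  qed
  have gap: "2 * l \<le> S2 / \<omega>"
    using spectral_gap[OF assms(6)] \<omega> by (simp add: l_def S1_def[symmetric] S2_def[symmetric] field_simps)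
  \<comment> \<open>The minimum over the finitely many coordinates is attained, so it suffices to
    treat a single coordinate direction, a unit vector.\<close>
  have "(MIN i. 1 / \<omega> * (LINT \<xi>|surface_measure. (1 - \<xi> $ i) * \<bar>f \<xi>\<bar>\<^sup>2 * (?h \<xi>)\<^sup>2))
    \<in> range (\<lambda>i. 1 / \<omega> * (LINT \<xi>|surface_measure. (1 - \<xi> $ i) * \<bar>f \<xi>\<bar>\<^sup>2 * (?h \<xi>)\<^sup>2))"
    by (rule Min_in) auto
  then obtain i where i: "(MIN i. 1 / \<omega> * (LINT \<xi>|surface_measure. (1 - \<xi> $ i) * \<bar>f \<xi>\<bar>\<^sup>2 * (?h \<xi>)\<^sup>2))
    = 1 / \<omega> * (LINT \<xi>|surface_measure. (1 - \<xi> $ i) * \<bar>f \<xi>\<bar>\<^sup>2 * (?h \<xi>)\<^sup>2)" by blast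
  define m where "m = first_moment (axis i 1) / \<omega>"
  have "(LINT \<xi>|surface_measure. (1 - \<xi> $ i) * \<bar>f \<xi>\<bar>\<^sup>2 * (?h \<xi>)\<^sup>2)
    = (LINT \<xi>|surface_measure. (f \<xi>)\<^sup>2 * (?h \<xi>)\<^sup>2 - ((f \<xi>)\<^sup>2 * (\<xi> \<bullet> axis i 1)) * (?h \<xi>)\<^sup>2)"
    by (intro Bochner_Integration.integral_cong) (auto simp: inner_axis algebra_simps)
  also have "\<dots> = \<omega> - \<omega> * m"
    using f2 weighted_integrable_fg(2)[of "axis i 1"] \<omega> by (simp add: S1_def first_moment_def m_def)
  finally have i': "1 / \<omega> * (LINT \<xi>|surface_measure. (1 - \<xi> $ i) * \<bar>f \<xi>\<bar>\<^sup>2 * (?h \<xi>)\<^sup>2) = 1 - m"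
    using \<omega> by (simp add: field_simps)
  have "0 < S1" using \<omega> by simp
  note B = first_moment_bounds[of "axis i 1", folded S1_def S2_def, OF _ this, folded l_def]
  have fm': "first_moment (axis i 1) = \<omega> * m" using \<omega> by (simp add: m_def)
  have m1: "m\<^sup>2 \<le> 1"
    using B(2) \<omega> unfolding fm' by (simp add: power_mult_distrib norm_axis_1)
  have "(l + 1 / 2)\<^sup>2 * m\<^sup>2 \<le> S2 / \<omega> * (1 - m\<^sup>2)"
  proof -
    have "\<omega>\<^sup>2 * ((l + 1 / 2)\<^sup>2 * m\<^sup>2) \<le> \<omega>\<^sup>2 * (S2 / \<omega> * (1 - m\<^sup>2))"
      using B(1) \<omega> unfolding fm' by (simp add: power_mult_distrib norm_axis_1 power2_eq_square algebra_simps)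
    then show ?thesis using \<omega> by (subst (asm) mult_le_cancel_left_pos) simp_all
  qed
  from uncertainty_optimization[OF l0 gap m1 this]
  show ?thesis
    unfolding D \<omega>_def[symmetric] i i' by (simp add: C_const_def l_def Let_def)
qed

end
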